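(* Let $\mathbb{K}$ be a field and $n,r\ge1$ integers. The ideal $\mathfrak{C}_n(\mathbb{K})\bar e\,\mathfrak{C}_n(\mathbb{K})$ of $\mathfrak{C}_n(\mathbb{K})$ is strong idempotent, and the set (of classes of) $$\mathbb{J}=\Bigl\{\prod_{i<j}e_{ij}^{(k_{ij})}\chi_\mu\;\Big|\;\lambda,\mu\in\Lambda(n,r),\ \lambda\trianglerighteq\mu,\ (k_{ij})_{i,j=1}^n\in T(\lambda,\mu)\Bigr\}$$ is a $\mathbb{K}$-basis of $\mathfrak{C}_n(\Lambda(n,r))=\mathfrak{C}_n(\mathbb{K})/\mathfrak{C}_n(\mathbb{K})\bar e\,\mathfrak{C}_n(\mathbb{K})$.
   Context: $\mathbb{N}$ contains $0$. $\Lambda(n,r)=\{\lambda\in\mathbb{N}^n:\sum\lambda_i=r\}\subset\mathbb{Z}^n$; $\lambda\trianglerighteq\mu$ means $\sum_{i\le j}\lambda_i\ge\sum_{i\le j}\mu_i$ for all $j$. $T(\lambda,\mu)$ is the set of upper triangular $n\times n$ matrices $(k_{\sigma\rho})$ over $\mathbb{N}$ with row sums $\sum_{\rho=\sigma}^n k_{\sigma\rho}=\lambda_\sigma$ and column sums $\sum_{\sigma=1}^\rho k_{\sigma\rho}=\mu_\rho$. $v_1,\dots,v_n$ is the standard basis of $\mathbb{Z}^n$ and $\Psi_n\subset\mathbb{Z}^n$ is the submonoid generated by $v_i-v_{i+1}$, $1\le i\le n-1$. Kostant form: $sl_n^+$ is the Lie algebra of strictly upper triangular $n\times n$ matrices over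 $\mathbb{C}$ with basis of matrix units $e_{ij}$, $i<j$; $\mathfrak{A}_n(\mathbb{C})$ is its universal enveloping algebra; $e_{ij}^{(k)}=e_{ij}^k/k!$. Products $\prod_{i<j}$ are taken with the factor for $e_{ij}$ to the left of the factor for $e_{i'j'}$ whenever $(j,i)>_{lex}(j',i')$ (e.g. $e_{23}$, $e_{13}$, $e_{12}$ from left to right when $n=3$). $\mathfrak{A}_n(\mathbb{Z})$ is the $\mathbb{Z}$-span of all $\prod_{i<j}e_{ij}^{(k_{ij})}$, $k_{ij}\in\mathbb{N}$; it is a subring, and $\mathfrak{A}_n(\mathbb{K})=\mathbb{K}\otimes_{\mathbb{Z}}\mathfrak{A}_n(\mathbb{Z})$. It is $\Psi_n$-graded by $\deg\prod e_{ij}^{(k_{ij})}=\sum k_{ij}(v_i-v_j)$. Skew product: $B_n$ is the algebra of all functions $\mathbb{Z}^n\to\mathbb{K}$, with $\Psi_n$ acting by $f^\gamma(z)=f(z+\gamma)$. $\mathfrak{C}_n(\mathbb{K})=\mathfrak{A}_n(\mathbb{K})\ltimes_{\Psi_n}B_n$ is the vector space $\mathfrak{A}_n(\mathbb{K})\otimes B_n$ with product $(a\otimes b)(a'\otimes b')=aa'\otimes b^{\gamma}b'$ for $a'$ homogeneous of degree $\gamma$. One writes $ab$ for $a\otimes b$, and $\chi_\mu$ for the indicator function of $\{\mu\}$. $\chi$ is the indicator function of $\Lambda(n,r)$, and $\bar e=1-1\otimes\chi$, an idempotent of $\mathfrak{C}_n(\mathbb{K})$. A two-sided ideal $I$ of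 an algebra $A$ is strong idempotent if for all $A/I$-modules $X,Y$ and all $i\ge1$ the canonical map $\operatorname{Ext}^i_{A/I}(X,Y)\to\operatorname{Ext}^i_A(X,Y)$ is an isomorphism. *)

theory Defs
  imports
    "HOL-Algebra.QuotRing"
    "HOL-Algebra.IntRing"
    "HOL-Algebra.Generated_Groups"
    "Jordan_Normal_Form.Matrix"
begin

section \<open>Modules over rings that need not be commutative\<close>

text \<open>
  A record of type \<open>('r, 'm) module\<close> also has the ring fields \<open>mult\<close> and \<open>one\<close>. For algebras they
  are meaningful, for plain modules they are ignored (and left \<open>undefined\<close> where we construct one).
  The locale \<open>module\<close> of the library demands a commutative ring of scalars.
\<close>

definition left_module :: "('r, 's) ring_scheme \<Rightarrow> ('r, 'm) module \<Rightarrow> bool" where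
  "left_module R M \<longleftrightarrow> ring R \<and> abelian_group M \<and>
     (\<forall>a\<in>carrier R. \<forall>x\<in>carrier M. a \<odot>\<^bsub>M\<^esub> x \<in> carrier M) \<and>
     (\<forall>a\<in>carrier R. \<forall>b\<in>carrier R. \<forall>x\<in>carrier M.
        (a \<oplus>\<^bsub>R\<^esub> b) \<odot>\<^bsub>M\<^esub> x = a \<odot>\<^bsub>M\<^esub> x \<oplus>\<^bsub>M\<^esub> b \<odot>\<^bsub>M\<^esub> x) \<and>
     (\<forall>a\<in>carrier R. \<forall>x\<in>carrier M. \<forall>y\<in>carrier M.
        a \<odot>\<^bsub>M\<^esub> (x \<oplus>\<^bsub>M\<^esub> y) = a \<odot>\<^bsub>M\<^esub> x \<oplus>\<^bsub>M\<^esub> a \<odot>\<^bsub>M\<^esub> y) \<and>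
     (\<forall>a\<in>carrier R. \<forall>b\<in>carrier R. \<forall>x\<in>carrier M.
        (a \<otimes>\<^bsub>R\<^esub> b) \<odot>\<^bsub>M\<^esub> x = a \<odot>\<^bsub>M\<^esub> (b \<odot>\<^bsub>M\<^esub> x)) \<and>
     (\<forall>x\<in>carrier M. \<one>\<^bsub>R\<^esub> \<odot>\<^bsub>M\<^esub> x = x)"

definition mod_hom :: "('r, 's) ring_scheme \<Rightarrow> ('r, 'm) module \<Rightarrow> ('r, 'n) module \<Rightarrow> ('m \<Rightarrow> 'n) set" where
  "mod_hom R M N = {h \<in> carrier M \<rightarrow>\<^sub>E carrier N.
     (\<forall>x\<in>carrier M. \<forall>y\<in>carrier M. h (x \<oplus>\<^bsub>M\<^esub> y) = h x \<oplus>\<^bsub>N\<^esub> h y) \<and>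
     (\<forall>a\<in>carrier R. \<forall>x\<in>carrier M. h (a \<odot>\<^bsub>M\<^esub> x) = a \<odot>\<^bsub>N\<^esub> h x)}"

definition hom_group ::
    "('r, 's) ring_scheme \<Rightarrow> ('r, 'm) module \<Rightarrow> ('r, 'n) module \<Rightarrow> ('m \<Rightarrow> 'n) monoid" where
  "hom_group R M N = \<lparr>carrier = mod_hom R M N,
     mult = (\<lambda>f g. \<lambda>x\<in>carrier M. f x \<oplus>\<^bsub>N\<^esub> g x), one = (\<lambda>x\<in>carrier M. \<zero>\<^bsub>N\<^esub>)\<rparr>"

definition free_module :: "('r, 's) ring_scheme \<Rightarrow> 'b set \<Rightarrow> ('r, 'b \<Rightarrow> 'r) module" where
  "free_module R S = \<lparr>
     carrier = {f. range f \<subseteq> carrier R \<and> finite {s. f s \<noteq> \<zero>\<^bsub>R\<^esub>} \<and> {s. f s \<noteq> \<zero>\<^bsub>R\<^esub>} \<subseteq> S},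
     mult = undefined, one = undefined,
     zero = (\<lambda>s. \<zero>\<^bsub>R\<^esub>), add = (\<lambda>f g s. f s \<oplus>\<^bsub>R\<^esub> g s),
     smult = (\<lambda>a f s. a \<otimes>\<^bsub>R\<^esub> f s)\<rparr>"

definition free_gen :: "('r, 's) ring_scheme \<Rightarrow> 'b \<Rightarrow> 'b \<Rightarrow> 'r" where
  "free_gen R s = (\<lambda>t. if t = s then \<one>\<^bsub>R\<^esub> else \<zero>\<^bsub>R\<^esub>)"

text \<open>Linear combination of the family \<open>f\<close> with finitely supported coefficients \<open>c\<close>.\<close>

definition lincomb :: "('r, 's) ring_scheme \<Rightarrow> ('r, 'm) module \<Rightarrow> ('b \<Rightarrow> 'm) \<Rightarrow> ('b \<Rightarrow> 'r) \<Rightarrow> 'm" where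
  "lincomb R M f c = (\<Oplus>\<^bsub>M\<^esub>b\<in>{b. c b \<noteq> \<zero>\<^bsub>R\<^esub>}. c b \<odot>\<^bsub>M\<^esub> f b)"

text \<open>
  \<open>P\<close> is projective if it is a direct summand of a free module; it suffices to consider the
  canonical epimorphism from the free module on the underlying set of \<open>P\<close>, which has to split.
\<close>

definition projective_module :: "('r, 's) ring_scheme \<Rightarrow> ('r, 'm) module \<Rightarrow> bool" where
  "projective_module R P \<longleftrightarrow> left_module R P \<and>
     (\<exists>s\<in>mod_hom R P (free_module R (carrier P)). \<forall>x\<in>carrier P. lincomb R P (\<lambda>p. p) (s x) = x)"

text \<open>The family \<open>(f b)\<^sub>b\<close>, \<open>b \<in> B\<close>, is a basis (in particular, \<open>f\<close> is injective on \<open>B\<close> if \<open>R\<close> is nontrivial).\<close>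

definition is_basis :: "('r, 's) ring_scheme \<Rightarrow> ('r, 'm) module \<Rightarrow> ('b \<Rightarrow> 'm) \<Rightarrow> 'b set \<Rightarrow> bool" where
  "is_basis R M f B \<longleftrightarrow> left_module R M \<and> f ` B \<subseteq> carrier M \<and>
     (\<forall>x\<in>carrier M. \<exists>!c. c \<in> carrier (free_module R B) \<and> lincomb R M f c = x)"

text \<open>
  Quotient of a module by a submodule, or of an algebra by an ideal. On the ring fields this is
  \<open>M Quot N\<close>.
\<close>

definition quot_module :: "('r, 'm) module \<Rightarrow> 'm set \<Rightarrow> ('r, 'm set) module" where
  "quot_module M N = \<lparr>carrier = a_rcosets\<^bsub>M\<^esub> N, mult = rcoset_mult M N, one = N +>\<^bsub>M\<^esub> \<one>\<^bsub>M\<^esub>,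
     zero = N, add = set_add M, smult = (\<lambda>a X. \<Union>x\<in>X. N +>\<^bsub>M\<^esub> (a \<odot>\<^bsub>M\<^esub> x))\<rparr>"

text \<open>The additive group of a ring as a module over the integers.\<close>

definition int_module :: "('a, 's) ring_scheme \<Rightarrow> (int, 'a) module" where
  "int_module G = \<lparr>carrier = carrier G, mult = mult G, one = \<one>\<^bsub>G\<^esub>, zero = \<zero>\<^bsub>G\<^esub>, add = add G,
     smult = (\<lambda>z x. [z] \<cdot>\<^bsub>G\<^esub> x)\<rparr>"

definition add_span :: "('a, 's) ring_scheme \<Rightarrow> 'a set \<Rightarrow> 'a set" where
  "add_span G S = generate (add_monoid G) S"


section \<open>Ext and strong idempotent ideals\<close>

definition proj_resolution ::
    "('r, 's) ring_scheme \<Rightarrow> ('r, 'x) module \<Rightarrow> (nat \<Rightarrow> ('r, 'p) module) \<Rightarrow> (nat \<Rightarrow> 'p \<Rightarrow> 'p)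
      \<Rightarrow> ('p \<Rightarrow> 'x) \<Rightarrow> bool" where
  "proj_resolution R X P d \<epsilon> \<longleftrightarrow> left_module R X \<and>
     (\<forall>i. projective_module R (P i)) \<and>
     (\<forall>i. d i \<in> mod_hom R (P (Suc i)) (P i)) \<and> \<epsilon> \<in> mod_hom R (P 0) X \<and>
     \<epsilon> ` carrier (P 0) = carrier X \<and>
     d 0 ` carrier (P 1) = {x \<in> carrier (P 0). \<epsilon> x = \<zero>\<^bsub>X\<^esub>} \<and>
     (\<forall>i. d (Suc i) ` carrier (P (Suc (Suc i))) = {x \<in> carrier (P (Suc i)). d i x = \<zero>\<^bsub>P i\<^esub>})"

definition ext_cocycles ::
    "('r, 's) ring_scheme \<Rightarrow> (nat \<Rightarrow> ('r, 'p) module) \<Rightarrow> (nat \<Rightarrow> 'p \<Rightarrow> 'p) \<Rightarrow> ('r, 'y) module \<Rightarrow> nat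
      \<Rightarrow> ('p \<Rightarrow> 'y) monoid" where
  "ext_cocycles R P d Y i = (hom_group R (P i) Y)
     \<lparr>carrier := {h \<in> mod_hom R (P i) Y. compose (carrier (P (Suc i))) h (d i) = (\<lambda>x\<in>carrier (P (Suc i)). \<zero>\<^bsub>Y\<^esub>)}\<rparr>"

definition ext_coboundaries ::
    "('r, 's) ring_scheme \<Rightarrow> (nat \<Rightarrow> ('r, 'p) module) \<Rightarrow> (nat \<Rightarrow> 'p \<Rightarrow> 'p) \<Rightarrow> ('r, 'y) module \<Rightarrow> nat
      \<Rightarrow> ('p \<Rightarrow> 'y) set" where
  "ext_coboundaries R P d Y i = (case i of
       0 \<Rightarrow> {\<lambda>x\<in>carrier (P 0). \<zero>\<^bsub>Y\<^esub>}
     | Suc j \<Rightarrow> (\<lambda>g. compose (carrier (P (Suc j))) g (d j)) ` mod_hom R (P j) Y)"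

text \<open>
  \<open>ext_group R P d Y i\<close> is the \<open>i\<close>-th cohomology group of \<open>Hom\<^sub>R(P, Y)\<close>, i.e. \<open>Ext\<^sup>i\<^sub>R(X, Y)\<close>
  computed with the projective resolution \<open>P\<close> of \<open>X\<close>.
\<close>

definition ext_group ::
    "('r, 's) ring_scheme \<Rightarrow> (nat \<Rightarrow> ('r, 'p) module) \<Rightarrow> (nat \<Rightarrow> 'p \<Rightarrow> 'p) \<Rightarrow> ('r, 'y) module \<Rightarrow> nat
      \<Rightarrow> ('p \<Rightarrow> 'y) set monoid" where
  "ext_group R P d Y i = ext_cocycles R P d Y i Mod ext_coboundaries R P d Y i"

definition restrict_scalars :: "('a, 's) ring_scheme \<Rightarrow> 'a set \<Rightarrow> ('a set, 'm) module \<Rightarrow> ('a, 'm) module" where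
  "restrict_scalars A I M = \<lparr>carrier = carrier M, mult = mult M, one = \<one>\<^bsub>M\<^esub>, zero = \<zero>\<^bsub>M\<^esub>, add = add M,
     smult = (\<lambda>a x. (I +>\<^bsub>A\<^esub> a) \<odot>\<^bsub>M\<^esub> x)\<rparr>"

definition lifts_identity ::
    "('a, 's) ring_scheme \<Rightarrow> (nat \<Rightarrow> ('a, 'q) module) \<Rightarrow> (nat \<Rightarrow> 'q \<Rightarrow> 'q) \<Rightarrow> ('q \<Rightarrow> 'x)
      \<Rightarrow> (nat \<Rightarrow> ('a, 'p) module) \<Rightarrow> (nat \<Rightarrow> 'p \<Rightarrow> 'p) \<Rightarrow> ('p \<Rightarrow> 'x) \<Rightarrow> (nat \<Rightarrow> 'q \<Rightarrow> 'p) \<Rightarrow> bool" where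
  "lifts_identity A Q dQ \<epsilon>Q P dP \<epsilon>P f \<longleftrightarrow>
     (\<forall>i. f i \<in> mod_hom A (Q i) (P i)) \<and>
     (\<forall>x\<in>carrier (Q 0). \<epsilon>P (f 0 x) = \<epsilon>Q x) \<and>
     (\<forall>i. \<forall>x\<in>carrier (Q (Suc i)). f i (dQ i x) = dP i (f (Suc i) x))"

text \<open>
  Map on cohomology induced by the chain map \<open>f : Q \<rightarrow> P\<close>: the class of \<open>h : P\<^sub>i \<rightarrow> Y\<close> is sent to the
  class of \<open>h \<circ> f\<^sub>i\<close>.
\<close>

definition ext_map ::
    "('a, 's) ring_scheme \<Rightarrow> (nat \<Rightarrow> ('a, 'q) module) \<Rightarrow> (nat \<Rightarrow> 'q \<Rightarrow> 'q) \<Rightarrow> ('a, 'y) module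
      \<Rightarrow> (nat \<Rightarrow> 'q \<Rightarrow> 'p) \<Rightarrow> nat \<Rightarrow> ('p \<Rightarrow> 'y) set \<Rightarrow> ('q \<Rightarrow> 'y) set" where
  "ext_map A Q dQ Y f i H =
     (\<Union>h\<in>H. ext_coboundaries A Q dQ Y i #>\<^bsub>ext_cocycles A Q dQ Y i\<^esub> compose (carrier (Q i)) h (f i))"

text \<open>
  The canonical map \<open>Ext\<^sup>i\<^bsub>A/I\<^esub>(X, Y) \<rightarrow> Ext\<^sup>i\<^bsub>A\<^esub>(X, Y)\<close> is computed with a projective resolution \<open>P\<close> of \<open>X\<close>
  over \<open>A/I\<close>, a projective resolution \<open>Q\<close> of \<open>X\<close> over \<open>A\<close>, and a lift \<open>Q \<rightarrow> P\<close> of the identity of \<open>X\<close>;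
  up to canonical isomorphism it does not depend on these choices, and we demand an isomorphism
  for all of them.

  HOL cannot quantify over types inside a formula, hence the types \<open>'x, 'y, 'p, 'q\<close> of the elements of
  \<open>X\<close>, \<open>Y\<close>, \<open>P\<^sub>i\<close>, \<open>Q\<^sub>i\<close> are a parameter of the predicate. To be strong idempotent means that it holds
  for all of them, so in a theorem they have to be type variables. (For fixed \<open>'p\<close> and \<open>'q\<close> that are too
  small to carry a resolution of \<open>X\<close> the condition is vacuous for that \<open>X\<close>.)
\<close>

definition strong_idempotent ::
    "('x \<times> 'y \<times> 'p \<times> 'q) itself \<Rightarrow> ('a, 's) ring_scheme \<Rightarrow> 'a set \<Rightarrow> bool" where
  "strong_idempotent _ A I \<longleftrightarrow> ideal I A \<and>
     (\<forall>(X :: ('a set, 'x) module) (Y :: ('a set, 'y) module)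
       (P :: nat \<Rightarrow> ('a set, 'p) module) dP \<epsilon>P (Q :: nat \<Rightarrow> ('a, 'q) module) dQ \<epsilon>Q f i.
        left_module (A Quot I) X \<longrightarrow> left_module (A Quot I) Y \<longrightarrow>
        proj_resolution (A Quot I) X P dP \<epsilon>P \<longrightarrow>
        proj_resolution A (restrict_scalars A I X) Q dQ \<epsilon>Q \<longrightarrow>
        lifts_identity A Q dQ \<epsilon>Q (\<lambda>j. restrict_scalars A I (P j)) dP \<epsilon>P f \<longrightarrow>
        i \<ge> 1 \<longrightarrow>
        ext_map A Q dQ (restrict_scalars A I Y) f i
          \<in> iso (ext_group (A Quot I) P dP Y i) (ext_group A Q dQ (restrict_scalars A I Y) i))"


section \<open>Tensor products\<close>

definition tensor_rels :: "('r, 's) ring_scheme \<Rightarrow> ('r, 'm) module \<Rightarrow> ('r, 'n) module \<Rightarrow> ('m \<times> 'n \<Rightarrow> 'r) set" where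
  "tensor_rels R M N = (let F = free_module R (carrier M \<times> carrier N); g = free_gen R in
     {g (x \<oplus>\<^bsub>M\<^esub> x', y) \<ominus>\<^bsub>F\<^esub> (g (x, y) \<oplus>\<^bsub>F\<^esub> g (x', y)) | x x' y.
        x \<in> carrier M \<and> x' \<in> carrier M \<and> y \<in> carrier N} \<union>
     {g (x, y \<oplus>\<^bsub>N\<^esub> y') \<ominus>\<^bsub>F\<^esub> (g (x, y) \<oplus>\<^bsub>F\<^esub> g (x, y')) | x y y'.
        x \<in> carrier M \<and> y \<in> carrier N \<and> y' \<in> carrier N} \<union>
     {g (a \<odot>\<^bsub>M\<^esub> x, y) \<ominus>\<^bsub>F\<^esub> a \<odot>\<^bsub>F\<^esub> g (x, y) | a x y.
        a \<in> carrier R \<and> x \<in> carrier M \<and> y \<in> carrier N} \<union>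
     {g (x, a \<odot>\<^bsub>N\<^esub> y) \<ominus>\<^bsub>F\<^esub> a \<odot>\<^bsub>F\<^esub> g (x, y) | a x y.
        a \<in> carrier R \<and> x \<in> carrier M \<and> y \<in> carrier N})"

definition tensor_kernel :: "('r, 's) ring_scheme \<Rightarrow> ('r, 'm) module \<Rightarrow> ('r, 'n) module \<Rightarrow> ('m \<times> 'n \<Rightarrow> 'r) set" where
  "tensor_kernel R M N = (let F = free_module R (carrier M \<times> carrier N) in
     add_span F {a \<odot>\<^bsub>F\<^esub> t | a t. a \<in> carrier R \<and> t \<in> tensor_rels R M N})"

definition tensor_module ::
    "('r, 's) ring_scheme \<Rightarrow> ('r, 'm) module \<Rightarrow> ('r, 'n) module \<Rightarrow> ('r, ('m \<times> 'n \<Rightarrow> 'r) set) module" where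
  "tensor_module R M N = quot_module (free_module R (carrier M \<times> carrier N)) (tensor_kernel R M N)"

definition tens ::
    "('r, 's) ring_scheme \<Rightarrow> ('r, 'm) module \<Rightarrow> ('r, 'n) module \<Rightarrow> 'm \<Rightarrow> 'n \<Rightarrow> ('m \<times> 'n \<Rightarrow> 'r) set" where
  "tens R M N x y =
     tensor_kernel R M N +>\<^bsub>free_module R (carrier M \<times> carrier N)\<^esub> free_gen R (x, y)"

text \<open>
  The biadditive product on \<open>T\<close> prescribed by \<open>rule x y z\<close> (``\<open>x\<close> times \<open>y\<close> is \<open>z\<close>'').
  It is used only with rules that determine a unique such product.
\<close>

definition biadditive_product ::
    "('t, 's) ring_scheme \<Rightarrow> ('t \<Rightarrow> 't \<Rightarrow> 't \<Rightarrow> bool) \<Rightarrow> 't \<Rightarrow> 't \<Rightarrow> 't" where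
  "biadditive_product T rule = curry (THE m. m \<in> carrier T \<times> carrier T \<rightarrow>\<^sub>E carrier T \<and>
     (\<forall>x\<in>carrier T. \<forall>y\<in>carrier T. \<forall>z\<in>carrier T.
        m (x \<oplus>\<^bsub>T\<^esub> y, z) = m (x, z) \<oplus>\<^bsub>T\<^esub> m (y, z) \<and> m (z, x \<oplus>\<^bsub>T\<^esub> y) = m (z, x) \<oplus>\<^bsub>T\<^esub> m (z, y)) \<and>
     (\<forall>x y z. rule x y z \<longrightarrow> m (x, y) = z))"


section \<open>Universal enveloping algebras\<close>

text \<open>The free associative algebra on \<open>S\<close>: finitely supported functions on words.\<close>

definition free_algebra :: "('r, 's) ring_scheme \<Rightarrow> 'b set \<Rightarrow> ('r, 'b list \<Rightarrow> 'r) module" where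
  "free_algebra R S = (free_module R (lists S))
     \<lparr>mult := (\<lambda>f g w. \<Oplus>\<^bsub>R\<^esub>i\<in>{..length w}. f (take i w) \<otimes>\<^bsub>R\<^esub> g (drop i w)), one := free_gen R []\<rparr>"

text \<open>
  A Lie algebra is represented by a record whose \<open>mult\<close> is the bracket. Its tensor algebra is the
  free algebra on its underlying set modulo the linear relations.
\<close>

definition enveloping_rels :: "('r, 's) ring_scheme \<Rightarrow> ('r, 'l) module \<Rightarrow> ('l list \<Rightarrow> 'r) set" where
  "enveloping_rels R L = (let F = free_algebra R (carrier L); g = free_gen R in
     {g [x \<oplus>\<^bsub>L\<^esub> y] \<ominus>\<^bsub>F\<^esub> (g [x] \<oplus>\<^bsub>F\<^esub> g [y]) | x y. x \<in> carrier L \<and> y \<in> carrier L} \<union>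
     {g [a \<odot>\<^bsub>L\<^esub> x] \<ominus>\<^bsub>F\<^esub> a \<odot>\<^bsub>F\<^esub> g [x] | a x. a \<in> carrier R \<and> x \<in> carrier L} \<union>
     {(g [x] \<otimes>\<^bsub>F\<^esub> g [y] \<ominus>\<^bsub>F\<^esub> g [y] \<otimes>\<^bsub>F\<^esub> g [x]) \<ominus>\<^bsub>F\<^esub> g [x \<otimes>\<^bsub>L\<^esub> y] | x y. x \<in> carrier L \<and> y \<in> carrier L})"

definition enveloping_ideal :: "('r, 's) ring_scheme \<Rightarrow> ('r, 'l) module \<Rightarrow> ('l list \<Rightarrow> 'r) set" where
  "enveloping_ideal R L = Idl\<^bsub>free_algebra R (carrier L)\<^esub> enveloping_rels R L"

definition enveloping_algebra :: "('r, 's) ring_scheme \<Rightarrow> ('r, 'l) module \<Rightarrow> ('r, ('l list \<Rightarrow> 'r) set) module" where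
  "enveloping_algebra R L = quot_module (free_algebra R (carrier L)) (enveloping_ideal R L)"

definition enveloping_map :: "('r, 's) ring_scheme \<Rightarrow> ('r, 'l) module \<Rightarrow> 'l \<Rightarrow> ('l list \<Rightarrow> 'r) set" where
  "enveloping_map R L x = enveloping_ideal R L +>\<^bsub>free_algebra R (carrier L)\<^esub> free_gen R [x]"


section \<open>The Kostant form\<close>

text \<open>Rows, columns and coordinates are indexed by \<open>0, \<dots>, n - 1\<close>.\<close>

definition complex_ring :: "complex ring" where
  "complex_ring = \<lparr>carrier = UNIV, mult = (*), one = 1, zero = 0, add = (+)\<rparr>"

definition sl_plus :: "nat \<Rightarrow> (complex, complex mat) module" where
  "sl_plus n = \<lparr>carrier = {X \<in> carrier_mat n n. \<forall>i<n. \<forall>j<n. j \<le> i \<longrightarrow> X $$ (i, j) = 0},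
     mult = (\<lambda>X Y. X * Y - Y * X), one = undefined,
     zero = 0\<^sub>m n n, add = (+), smult = (\<cdot>\<^sub>m)\<rparr>"

definition mat_unit :: "nat \<Rightarrow> nat \<Rightarrow> nat \<Rightarrow> complex mat" where
  "mat_unit n i j = mat n n (\<lambda>(a, b). if a = i \<and> b = j then 1 else 0)"

type_synonym env = "(complex mat list \<Rightarrow> complex) set"

definition env_sl :: "nat \<Rightarrow> (complex, env) module" where
  "env_sl n = enveloping_algebra complex_ring (sl_plus n)"

definition divided_power :: "nat \<Rightarrow> nat \<Rightarrow> nat \<Rightarrow> nat \<Rightarrow> env" where
  "divided_power n i j k = (1 / fact k) \<odot>\<^bsub>env_sl n\<^esub>
     (enveloping_map complex_ring (sl_plus n) (mat_unit n i j) [^]\<^bsub>env_sl n\<^esub> k)"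

text \<open>The pairs \<open>i < j\<close>, with \<open>(j, i)\<close> lexicographically decreasing.\<close>

definition root_list :: "nat \<Rightarrow> (nat \<times> nat) list" where
  "root_list n = concat (map (\<lambda>j. map (\<lambda>i. (i, j)) (rev [0..<j])) (rev [0..<n]))"

definition kostant_monomial :: "nat \<Rightarrow> nat mat \<Rightarrow> env" where
  "kostant_monomial n k =
     foldr (\<lambda>(i, j) y. divided_power n i j (k $$ (i, j)) \<otimes>\<^bsub>env_sl n\<^esub> y) (root_list n) \<one>\<^bsub>env_sl n\<^esub>"

definition kostant_int :: "nat \<Rightarrow> (complex, env) module" where
  "kostant_int n = (env_sl n)\<lparr>carrier := add_span (env_sl n) (kostant_monomial n ` carrier_mat n n)\<rparr>"

type_synonym 'k kos = "('k \<times> env \<Rightarrow> int) set"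

definition kostant_tens :: "('k, 's) ring_scheme \<Rightarrow> nat \<Rightarrow> 'k \<Rightarrow> env \<Rightarrow> 'k kos" where
  "kostant_tens K n = tens \<Z> (int_module K) (int_module (kostant_int n))"

definition kostant_alg :: "('k, 's) ring_scheme \<Rightarrow> nat \<Rightarrow> ('k, 'k kos) module" where
  "kostant_alg K n = (let
       T = tensor_module \<Z> (int_module K) (int_module (kostant_int n));
       t = kostant_tens K n;
       m = biadditive_product T (\<lambda>x y z. \<exists>c\<in>carrier K. \<exists>c'\<in>carrier K.
             \<exists>u\<in>carrier (kostant_int n). \<exists>u'\<in>carrier (kostant_int n).
               x = t c u \<and> y = t c' u' \<and> z = t (c \<otimes>\<^bsub>K\<^esub> c') (u \<otimes>\<^bsub>kostant_int n\<^esub> u'))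
     in \<lparr>carrier = carrier T, mult = m, one = t \<one>\<^bsub>K\<^esub> \<one>\<^bsub>kostant_int n\<^esub>, zero = \<zero>\<^bsub>T\<^esub>, add = add T,
         smult = (\<lambda>c x. m (t c \<one>\<^bsub>kostant_int n\<^esub>) x)\<rparr>)"

text \<open>The submonoid generated by the simple roots \<open>v\<^sub>i - v\<^bsub>i+1\<^esub>\<close>.\<close>

inductive_set Psi :: "nat \<Rightarrow> int vec set" for n where
  Psi_zero: "0\<^sub>v n \<in> Psi n"
| Psi_add: "\<gamma> \<in> Psi n \<Longrightarrow> Suc i < n \<Longrightarrow> \<gamma> + (unit_vec n i - unit_vec n (Suc i)) \<in> Psi n"

definition monomial_degree :: "nat \<Rightarrow> nat mat \<Rightarrow> int vec" where
  "monomial_degree n k = finsum_vec TYPE(int) n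
     (\<lambda>(i, j). int (k $$ (i, j)) \<cdot>\<^sub>v (unit_vec n i - unit_vec n j)) {(i, j). i < j \<and> j < n}"

definition kostant_component :: "('k, 's) ring_scheme \<Rightarrow> nat \<Rightarrow> int vec \<Rightarrow> 'k kos set" where
  "kostant_component K n \<gamma> = add_span (kostant_alg K n)
     {kostant_tens K n c (kostant_monomial n k) | c k.
        c \<in> carrier K \<and> k \<in> carrier_mat n n \<and> monomial_degree n k = \<gamma>}"


section \<open>The skew product\<close>

definition fun_alg :: "('k, 's) ring_scheme \<Rightarrow> nat \<Rightarrow> ('k, int vec \<Rightarrow> 'k) module" where
  "fun_alg K n = \<lparr>carrier = carrier_vec n \<rightarrow>\<^sub>E carrier K,
     mult = (\<lambda>f g. \<lambda>z\<in>carrier_vec n. f z \<otimes>\<^bsub>K\<^esub> g z), one = (\<lambda>z\<in>carrier_vec n. \<one>\<^bsub>K\<^esub>),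
     zero = (\<lambda>z\<in>carrier_vec n. \<zero>\<^bsub>K\<^esub>), add = (\<lambda>f g. \<lambda>z\<in>carrier_vec n. f z \<oplus>\<^bsub>K\<^esub> g z),
     smult = (\<lambda>c f. \<lambda>z\<in>carrier_vec n. c \<otimes>\<^bsub>K\<^esub> f z)\<rparr>"

definition shift :: "nat \<Rightarrow> int vec \<Rightarrow> (int vec \<Rightarrow> 'k) \<Rightarrow> int vec \<Rightarrow> 'k" where
  "shift n \<gamma> f = (\<lambda>z\<in>carrier_vec n. f (z + \<gamma>))"

definition indicator_fun :: "('k, 's) ring_scheme \<Rightarrow> nat \<Rightarrow> int vec set \<Rightarrow> int vec \<Rightarrow> 'k" where
  "indicator_fun K n S = (\<lambda>z\<in>carrier_vec n. if z \<in> S then \<one>\<^bsub>K\<^esub> else \<zero>\<^bsub>K\<^esub>)"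

type_synonym 'k skew = "('k kos \<times> (int vec \<Rightarrow> 'k) \<Rightarrow> 'k) set"

definition skew_tens :: "('k, 's) ring_scheme \<Rightarrow> nat \<Rightarrow> 'k kos \<Rightarrow> (int vec \<Rightarrow> 'k) \<Rightarrow> 'k skew" where
  "skew_tens K n = tens K (kostant_alg K n) (fun_alg K n)"

definition skew_alg :: "('k, 's) ring_scheme \<Rightarrow> nat \<Rightarrow> ('k, 'k skew) module" where
  "skew_alg K n = (let A = kostant_alg K n; B = fun_alg K n; T = tensor_module K A B; t = skew_tens K n
     in T\<lparr>mult := biadditive_product T (\<lambda>x y z. \<exists>\<gamma>\<in>Psi n. \<exists>a\<in>carrier A. \<exists>a'\<in>kostant_component K n \<gamma>.
             \<exists>b\<in>carrier B. \<exists>b'\<in>carrier B.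
               x = t a b \<and> y = t a' b' \<and> z = t (a \<otimes>\<^bsub>A\<^esub> a') (shift n \<gamma> b \<otimes>\<^bsub>B\<^esub> b')),
          one := t \<one>\<^bsub>A\<^esub> \<one>\<^bsub>B\<^esub>\<rparr>)"

definition weights :: "nat \<Rightarrow> nat \<Rightarrow> int vec set" where
  "weights n r = {\<nu> \<in> carrier_vec n. (\<forall>i<n. 0 \<le> \<nu> $ i) \<and> (\<Sum>i<n. \<nu> $ i) = int r}"

definition dominates :: "nat \<Rightarrow> int vec \<Rightarrow> int vec \<Rightarrow> bool" where
  "dominates n \<nu> \<mu> \<longleftrightarrow> (\<forall>j<n. (\<Sum>i\<le>j. \<nu> $ i) \<ge> (\<Sum>i\<le>j. \<mu> $ i))"

definition tri_mats :: "nat \<Rightarrow> int vec \<Rightarrow> int vec \<Rightarrow> nat mat set" where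
  "tri_mats n \<nu> \<mu> = {k \<in> carrier_mat n n. upper_triangular k \<and>
     (\<forall>\<sigma><n. (\<Sum>\<rho>=\<sigma>..<n. int (k $$ (\<sigma>, \<rho>))) = \<nu> $ \<sigma>) \<and>
     (\<forall>\<rho><n. (\<Sum>\<sigma>\<le>\<rho>. int (k $$ (\<sigma>, \<rho>))) = \<mu> $ \<rho>)}"

definition e_bar :: "('k, 's) ring_scheme \<Rightarrow> nat \<Rightarrow> nat \<Rightarrow> 'k skew" where
  "e_bar K n r = \<one>\<^bsub>skew_alg K n\<^esub> \<ominus>\<^bsub>skew_alg K n\<^esub>
     skew_tens K n \<one>\<^bsub>kostant_alg K n\<^esub> (indicator_fun K n (weights n r))"

definition e_bar_ideal :: "('k, 's) ring_scheme \<Rightarrow> nat \<Rightarrow> nat \<Rightarrow> 'k skew set" where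
  "e_bar_ideal K n r = add_span (skew_alg K n)
     {x \<otimes>\<^bsub>skew_alg K n\<^esub> e_bar K n r \<otimes>\<^bsub>skew_alg K n\<^esub> y | x y.
        x \<in> carrier (skew_alg K n) \<and> y \<in> carrier (skew_alg K n)}"

definition JJ :: "('k, 's) ring_scheme \<Rightarrow> nat \<Rightarrow> nat \<Rightarrow> 'k skew set" where
  "JJ K n r = {skew_tens K n (kostant_tens K n \<one>\<^bsub>K\<^esub> (kostant_monomial n k)) (indicator_fun K n {\<mu>}) | k \<nu> \<mu>.
     \<nu> \<in> weights n r \<and> \<mu> \<in> weights n r \<and> dominates n \<nu> \<mu> \<and> k \<in> tri_mats n \<nu> \<mu>}"

end

theory Submission
  imports Defs
begin

text \<open>
  Write \<open>E k\<close> for the ordered product of divided powers with exponents \<open>k\<close>. The \<open>E k\<close> are linearly independent,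
  since derivations of a polynomial ring give functionals dual to them, and straightening with the Heisenberg
  relation shows how \<open>E l E m\<close> expands. It follows that \<open>E k f\<close> lies in the ideal \<open>I\<close> generated by \<open>e_bar\<close> if and
  only if each weight \<open>z\<close> in the support of \<open>f\<close> has total different from \<open>r\<close> or satisfies \<open>z\<^sub>q < c\<^sub>q\<close> for some \<open>q\<close>,
  where \<open>c\<^sub>q\<close> is the sum of column \<open>q\<close> of \<open>k\<close>: the factors of \<open>E k\<close> in the columns up to \<open>q\<close> lead from \<open>z\<close> to
  a weight with entry \<open>z\<^sub>q - c\<^sub>q\<close> at \<open>q\<close>. In the remaining case the numbers \<open>z\<^sub>q - c\<^sub>q\<close> are the diagonal of a
  triangular matrix, which yields the basis.

  For the first claim, let \<open>J\<^sub>p\<close> be the ideal given by the same condition with \<open>q \<ge> p\<close> only, let \<open>A'\<close> be the subalgebra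
  of the \<open>E k f\<close> with all rows of \<open>k\<close> from \<open>p\<close> on, and let \<open>f\<close> be the idempotent of the weights with \<open>z\<^sub>p < 0\<close>. The
  algebra is free over \<open>A'\<close>, \<open>f A' = f A' f\<close>, and \<open>J\<^sub>p\<close> is generated by \<open>f\<close> modulo \<open>J\<^sub>p\<^sub>+\<^sub>1\<close>. Hence, if \<open>Q\<close> is a
  projective resolution of a module killed by \<open>I\<close>, exactness of \<open>J\<^sub>p\<^sub>+\<^sub>1 Q\<close> implies that of \<open>J\<^sub>p Q\<close>, because \<open>f Q\<close> is
  contractible over \<open>A'\<close>. So \<open>I Q\<close> is exact, \<open>Q / I Q\<close> is a projective resolution over the quotient by \<open>I\<close>, and
  it computes the same extension groups.
\<close>

text \<open>For the ideals, the structure constants of the monomials matter only through their zero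
  pattern: under left multiplication column sums do not drop, degrees add, and rows that are empty
  in the left factor are inherited from the right one. Hence the characteristic does not matter.

  The chain of ideals follows the triangular shape. A monomial with all rows from p on has an empty
  column p, so for it the condition at q = p just says that z_p is negative, which is what right
  multiplication by f selects. Such a monomial can only raise the weight at p, whence f A' = f A' f.
  Moving a function past a monomial with rows of index less than p changes z_q, for q >= p, by
  exactly the column sum which that monomial contributes, so J_p is compatible with the
  decomposition of the algebra over A'.

  A contraction of f Q is linear over A' only and need not respect J_(p+1) Q; its extension to Q is
  therefore given by a formula that does. The identity obtained on J_p Q holds up to an error in
  J_(p+1) Q, and for cycles this error is a cycle to which the previous stage applies.\<close>

section \<open>Additive maps, spans and finitely supported sums\<close>

text \<open>Only additivity is recorded: source and target are often modules over different rings,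
  for instance over an algebra and over its quotient.\<close>

definition additive_map :: "('a, 's) ring_scheme => ('b, 't) ring_scheme => ('a => 'b) => bool" where
  "additive_map G H h \<longleftrightarrow> h \<in> carrier G \<rightarrow> carrier H \<and>
     (\<forall>x\<in>carrier G. \<forall>y\<in>carrier G. h (x \<oplus>\<^bsub>G\<^esub> y) = h x \<oplus>\<^bsub>H\<^esub> h y)"

lemma additive_mapI:
  "(!!x. x \<in> carrier G ==> h x \<in> carrier H) ==>
   (!!x y. x \<in> carrier G ==> y \<in> carrier G ==> h (x \<oplus>\<^bsub>G\<^esub> y) = h x \<oplus>\<^bsub>H\<^esub> h y) ==> additive_map G H h"
  by (auto simp: additive_map_def)

lemma additive_map_closed: "additive_map G H h ==> x \<in> carrier G ==> h x \<in> carrier H"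
  by (auto simp: additive_map_def)

lemma additive_map_add:
  "additive_map G H h ==> x \<in> carrier G ==> y \<in> carrier G ==> h (x \<oplus>\<^bsub>G\<^esub> y) = h x \<oplus>\<^bsub>H\<^esub> h y"
  by (auto simp: additive_map_def)

lemma additive_map_comp:
  assumes "additive_map N P g" "additive_map M N h"
  shows "additive_map M P (\<lambda>x. g (h x))"
  using assms by (auto simp: additive_map_def)

lemma additive_map_hom:
  assumes "additive_map G H h" "abelian_group G" "abelian_group H"
  shows "abelian_group_hom G H h"
  using assms
  by (intro abelian_group_homI)
    (auto simp: additive_map_def group_hom_def group_hom_axioms_def hom_def
      abelian_group.a_group)

lemma additive_map_zero:
  "additive_map G H h ==> abelian_group G ==> abelian_group H ==> h \<zero>\<^bsub>G\<^esub> = \<zero>\<^bsub>H\<^esub>"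
  using abelian_group_hom.hom_zero[OF additive_map_hom] .

lemma additive_map_minus:
  "additive_map G H h ==> abelian_group G ==> abelian_group H ==> x \<in> carrier G ==>
    h (\<ominus>\<^bsub>G\<^esub> x) = \<ominus>\<^bsub>H\<^esub> h x"
  using abelian_group_hom.hom_a_inv[OF additive_map_hom] .

lemma additive_map_diff:
  assumes "additive_map G H h" "abelian_group G" "abelian_group H" "x \<in> carrier G" "y \<in> carrier G"
  shows "h (x \<ominus>\<^bsub>G\<^esub> y) = h x \<ominus>\<^bsub>H\<^esub> h y"
  using assms additive_map_add[OF assms(1), of x "\<ominus>\<^bsub>G\<^esub> y"] additive_map_minus[OF assms(1-3), of y]
  by (simp add: a_minus_def abelian_group.a_inv_closed)

text \<open>\<open>finsum\<close> is zero on infinite index sets. Restricting it to the nonzero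
  terms gives meaningful sums over infinite families of finite support; many lemmas below carry that
  finiteness as a hypothesis.\<close>

definition fsum :: "('a, 's) ring_scheme => ('b => 'a) => 'b set => 'a" where
  "fsum G f S = (\<Oplus>\<^bsub>G\<^esub>s\<in>{s\<in>S. f s ~= \<zero>\<^bsub>G\<^esub>}. f s)"

lemmas subgroup_zero = additive_subgroup.zero_closed
  and subgroup_add = additive_subgroup.a_closed
  and subgroup_minus = additive_subgroup.a_inv_closed

context abelian_group
begin

lemmas ag = abelian_group_axioms

lemma zero_minus_zero [simp]: "\<ominus> \<zero> = \<zero>"
  using r_neg[OF zero_closed] l_zero[OF a_inv_closed[OF zero_closed]] by simp

lemma diff_zero [simp]: "x \<in> carrier G ==> x \<ominus> \<zero> = x"
  by (simp add: a_minus_def)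

lemma diff_add_cancel: "x \<in> carrier G ==> y \<in> carrier G ==> (x \<ominus> y) \<oplus> y = x"
  by (simp add: a_minus_def a_assoc l_neg)

lemma add_diff_cancel: "x \<in> carrier G ==> y \<in> carrier G ==> (x \<oplus> y) \<ominus> y = x"
  by (simp add: a_minus_def a_assoc r_neg)

lemma diff_self [simp]: "x \<in> carrier G ==> x \<ominus> x = \<zero>"
  by (simp add: a_minus_def r_neg)

lemma diff_eq_zero_iff: "x \<in> carrier G ==> y \<in> carrier G ==> x \<ominus> y = \<zero> \<longleftrightarrow> x = y"
  using diff_add_cancel[of x y] by auto

lemma add_span_subset: "S \<subseteq> carrier G ==> add_span G S \<subseteq> carrier G"
  unfolding add_span_def using add.generate_incl[of S] by simp

lemma add_span_incl: "s \<in> S ==> s \<in> add_span G S"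
  unfolding add_span_def by (rule generate.incl)

lemma add_span_subgroup: "S \<subseteq> carrier G ==> additive_subgroup (add_span G S) G"
  unfolding add_span_def additive_subgroup_def using add.generate_is_subgroup[of S] by simp

lemma add_span_least: "additive_subgroup H G ==> S \<subseteq> H ==> add_span G S \<subseteq> H"
  unfolding add_span_def additive_subgroup_def using add.generate_subgroup_incl[of S H] by simp

lemma additive_subgroupI':
  assumes "H \<subseteq> carrier G" "\<zero> \<in> H" "!!x y. x \<in> H ==> y \<in> H ==> x \<oplus> y \<in> H" "!!x. x \<in> H ==> \<ominus> x \<in> H"
  shows "additive_subgroup H G"
  unfolding additive_subgroup_def
  by (rule subgroup.intro) (use assms in \<open>auto simp: a_inv_def\<close>)

lemma add_span_induct [consumes 2, case_names zero incl minus add]: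
  assumes x: "x \<in> add_span G S" and S: "S \<subseteq> carrier G"
    and "P \<zero>" "!!s. s \<in> S ==> P s"
    and "!!x. x \<in> carrier G ==> P x ==> P (\<ominus> x)"
    and "!!x y. x \<in> carrier G ==> y \<in> carrier G ==> P x ==> P y ==> P (x \<oplus> y)"
  shows "P x"
proof -
  have "additive_subgroup {x \<in> carrier G. P x} G"
    by (rule additive_subgroupI') (use assms in auto)
  then have "add_span G S \<subseteq> {x \<in> carrier G. P x}"
    by (rule add_span_least) (use assms in auto)
  then show ?thesis using x by auto
qed

lemma add_span_mono: "S \<subseteq> S' ==> S' \<subseteq> carrier G ==> add_span G S \<subseteq> add_span G S'"
  by (rule add_span_least[OF add_span_subgroup]) (auto intro: add_span_incl)

lemma additive_subgroup_diff:
  "additive_subgroup H G ==> x \<in> H ==> y \<in> H ==> x \<ominus> y \<in> H"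
  unfolding a_minus_def
  using abelian_group_axioms by (simp add: subgroup_add subgroup_minus)

lemma fsum_closed [intro]: "(!!s. s \<in> S ==> f s \<in> carrier G) ==> fsum G f S \<in> carrier G"
  unfolding fsum_def by (intro add.finprod_closed) auto

lemma fsum_eq:
  assumes "finite A" "A \<subseteq> S" "!!s. s \<in> S ==> s \<notin> A ==> f s = \<zero>" "!!s. s \<in> S ==> f s \<in> carrier G"
  shows "fsum G f S = finsum G f A"
proof -
  have "{s\<in>S. f s ~= \<zero>} \<subseteq> A" using assms by auto
  then show ?thesis unfolding fsum_def
    by (intro add.finprod_mono_neutral_cong_left) (use assms in auto)
qed

lemma fsum_finite:
  assumes "finite S" "!!s. s \<in> S ==> f s \<in> carrier G"
  shows "fsum G f S = finsum G f S"
  by (rule fsum_eq) (use assms in auto)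

lemma fsum_cong:
  assumes "S = T" "!!s. s \<in> T ==> f s = g s" "!!s. s \<in> T ==> g s \<in> carrier G"
  shows "fsum G f S = fsum G g T"
proof -
  have *: "{s\<in>S. f s ~= \<zero>} = {s\<in>T. g s ~= \<zero>}" using assms by auto
  show ?thesis unfolding fsum_def *
    by (rule add.finprod_cong) (use assms in \<open>auto simp: simp_implies_def\<close>)
qed

lemma fsum_add:
  assumes "finite {s\<in>S. f s ~= \<zero>}" "finite {s\<in>S. g s ~= \<zero>}"
    and "!!s. s \<in> S ==> f s \<in> carrier G" "!!s. s \<in> S ==> g s \<in> carrier G"
  shows "fsum G (\<lambda>s. f s \<oplus> g s) S = fsum G f S \<oplus> fsum G g S"
proof -
  let ?A = "{s\<in>S. f s ~= \<zero>} \<union> {s\<in>S. g s ~= \<zero>}"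
  have "fsum G (\<lambda>s. f s \<oplus> g s) S = finsum G (\<lambda>s. f s \<oplus> g s) ?A"
    by (rule fsum_eq) (use assms in auto)
  also have "\<dots> = finsum G f ?A \<oplus> finsum G g ?A"
    by (rule add.finprod_multf) (use assms in auto)
  also have "finsum G f ?A = fsum G f S"
    by (rule fsum_eq[symmetric]) (use assms in auto)
  also have "finsum G g ?A = fsum G g S"
    by (rule fsum_eq[symmetric]) (use assms in auto)
  finally show ?thesis .
qed

lemma fsum_single:
  assumes "t \<in> S" "x \<in> carrier G" "!!s. s \<in> S ==> f s = (if s = t then x else \<zero>)"
  shows "fsum G f S = x"
proof -
  have "fsum G f S = finsum G f {t}"
    by (rule fsum_eq) (use assms in auto)
  also have "\<dots> = x" using assms by simp
  finally show ?thesis .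
qed

lemma fsum_zero: "(!!s. s \<in> S ==> f s = \<zero>) ==> fsum G f S = \<zero>"
proof -
  assume "!!s. s \<in> S ==> f s = \<zero>"
  then have *: "{s\<in>S. f s ~= \<zero>} = {}" by auto
  show ?thesis unfolding fsum_def * by simp
qed

lemma finsum_in_subgroup:
  assumes H: "additive_subgroup H G" and "!!s. s \<in> S ==> f s \<in> H"
  shows "finsum G f S \<in> H"
proof (cases "finite S")
  case True
  then show ?thesis using assms(2)
  proof (induction S rule: finite_induct)
    case empty
    then show ?case using H by (simp add: subgroup_zero)
  next
    case (insert s S)
    have "f \<in> insert s S \<rightarrow> carrier G" using insert additive_subgroup.a_subset[OF H] by auto
    then have "finsum G f (insert s S) = f s \<oplus> finsum G f S"
      using insert by (subst finsum_insert) auto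
    then show ?case using insert H by (simp add: subgroup_add)
  qed
next
  case False
  then show ?thesis using H by (simp add: subgroup_zero)
qed

lemma fsum_in_subgroup:
  assumes H: "additive_subgroup H G" and "!!s. s \<in> S ==> f s \<in> H"
  shows "fsum G f S \<in> H"
  unfolding fsum_def by (rule finsum_in_subgroup[OF H]) (use assms in auto)

lemma finsum_additive:
  assumes "additive_map G H h" "abelian_group H" "!!s. s \<in> S ==> f s \<in> carrier G"
  shows "h (finsum G f S) = finsum H (\<lambda>s. h (f s)) S"
proof (cases "finite S")
  case True
  interpret H: abelian_group H by fact
  show ?thesis using True assms(3)
  proof (induction S rule: finite_induct)
    case empty
    then show ?case using additive_map_zero[OF assms(1)] assms abelian_group_axioms by simp
  next
    case (insert s S)
    then have "h (finsum G f (insert s S)) = h (f s) \<oplus>\<^bsub>H\<^esub> h (finsum G f S)"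
      by (simp add: insert Pi_def additive_map_add[OF assms(1)] finsum_closed)
    also have "\<dots> = finsum H (\<lambda>s. h (f s)) (insert s S)"
      using insert additive_map_closed[OF assms(1)] by (subst H.finsum_insert) auto
    finally show ?case .
  qed
next
  case False
  interpret H: abelian_group H by fact
  show ?thesis using False additive_map_zero[OF assms(1) abelian_group_axioms assms(2)] by simp
qed

lemma fsum_additive:
  assumes h: "additive_map G H h" and H: "abelian_group H"
    and f: "!!s. s \<in> S ==> f s \<in> carrier G" and fin: "finite {s\<in>S. f s ~= \<zero>}"
  shows "h (fsum G f S) = fsum H (\<lambda>s. h (f s)) S"
proof -
  interpret H: abelian_group H by fact
  have "h (fsum G f S) = finsum H (\<lambda>s. h (f s)) {s\<in>S. f s ~= \<zero>}"
    unfolding fsum_def by (rule finsum_additive[OF h H]) (use f in auto)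
  also have "\<dots> = fsum H (\<lambda>s. h (f s)) S"
    by (rule H.fsum_eq[symmetric])
      (use f fin additive_map_closed[OF h] additive_map_zero[OF h abelian_group_axioms H] in auto)
  finally show ?thesis .
qed

lemma fsum_additive_map:
  assumes g: "!!s. s \<in> S ==> additive_map H G (g s)"
    and fin: "!!x. x \<in> carrier H ==> finite {s \<in> S. g s x ~= \<zero>}"
  shows "additive_map H G (\<lambda>x. fsum G (\<lambda>s. g s x) S)"
proof (rule additive_mapI)
  fix x assume x: "x \<in> carrier H"
  note c = additive_map_closed[OF g]
  show "fsum G (\<lambda>s. g s x) S \<in> carrier G" by (rule fsum_closed) (rule c[OF _ x])
  fix y assume y: "y \<in> carrier H"
  have "fsum G (\<lambda>s. g s (x \<oplus>\<^bsub>H\<^esub> y)) S = fsum G (\<lambda>s. g s x \<oplus> g s y) S"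
    by (rule fsum_cong) (simp_all add: x y additive_map_add[OF g] c)
  then show "fsum G (\<lambda>s. g s (x \<oplus>\<^bsub>H\<^esub> y)) S = fsum G (\<lambda>s. g s x) S \<oplus> fsum G (\<lambda>s. g s y) S"
    using fsum_add[OF fin[OF x] fin[OF y]] c x y by simp
qed

lemma zero_subgroup: "additive_subgroup {\<zero>} G"
  by (rule additive_subgroupI') auto

text \<open>Most subgroups below are given by generators; this is the form in which a statement
  about generators is extended to the whole span.\<close>

lemma span_image:
  assumes h: "additive_map G N h" and N: "abelian_group N" and K: "additive_subgroup K N"
    and S: "S \<subseteq> carrier G" and hS: "!!s. s \<in> S ==> h s \<in> K" and x: "x \<in> add_span G S"
  shows "h x \<in> K"
  using x S
  by (induction rule: add_span_induct)
    (use hS K in \<open>auto simp: additive_map_zero[OF h abelian_group_axioms N] additive_map_minus[OF h abelian_group_axioms N]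
      additive_map_add[OF h] intro: subgroup_zero subgroup_add subgroup_minus\<close>)

end

lemma additive_subgroup_equalizer:
  assumes M: "abelian_group M" and N: "abelian_group N" and g: "additive_map M N g" and h: "additive_map M N h"
  shows "additive_subgroup {x \<in> carrier M. g x = h x} M"
proof -
  interpret M: abelian_group M by fact
  show ?thesis
    by (rule M.additive_subgroupI')
      (auto simp: additive_map_zero[OF g M N] additive_map_zero[OF h M N] additive_map_add[OF g] additive_map_add[OF h]
        additive_map_minus[OF g M N] additive_map_minus[OF h M N])
qed

lemma (in abelian_group) additive_map_eq_span:
  assumes g: "additive_map G H g" and h: "additive_map G H h" and H: "abelian_group H"
    and S: "S \<subseteq> carrier G" and eq: "!!s. s \<in> S ==> g s = h s" and x: "x \<in> add_span G S"
  shows "g x = h x"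
proof -
  have "add_span G S \<subseteq> {x \<in> carrier G. g x = h x}"
    by (rule add_span_least[OF additive_subgroup_equalizer[OF abelian_group_axioms H g h]]) (use S eq in auto)
  then show ?thesis using x by auto
qed

section \<open>Left modules over arbitrary rings, their quotients, and free modules\<close>

section \<open>Modules\<close>

locale lmod = R: ring R + M: abelian_group M
  for R :: "('r, 's) ring_scheme" and M :: "('r, 'm) module" (structure) +
  assumes smult_closed [simp, intro]:
      "a \<in> carrier R ==> x \<in> carrier M ==> a \<odot> x \<in> carrier M"
    and smult_l_distr: "a \<in> carrier R ==> b \<in> carrier R ==> x \<in> carrier M ==>
        (a \<oplus>\<^bsub>R\<^esub> b) \<odot> x = a \<odot> x \<oplus> b \<odot> x"
    and smult_r_distr: "a \<in> carrier R ==> x \<in> carrier M ==> y \<in> carrier M ==>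
        a \<odot> (x \<oplus> y) = a \<odot> x \<oplus> a \<odot> y"
    and smult_assoc: "a \<in> carrier R ==> b \<in> carrier R ==> x \<in> carrier M ==>
        (a \<otimes>\<^bsub>R\<^esub> b) \<odot> x = a \<odot> (b \<odot> x)"
    and smult_one [simp]: "x \<in> carrier M ==> \<one>\<^bsub>R\<^esub> \<odot> x = x"

lemma left_module_iff: "left_module R M \<longleftrightarrow> lmod R M"
  by (auto simp: left_module_def lmod_def lmod_axioms_def)

context lmod
begin

lemma smult_additive: "a \<in> carrier R ==> additive_map M M (\<lambda>x. a \<odot> x)"
  by (auto intro!: additive_mapI smult_r_distr)

lemma smult_additive_l: "x \<in> carrier M ==> additive_map R M (\<lambda>a. a \<odot> x)"
  by (auto intro!: additive_mapI smult_l_distr)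

lemma smult_l_null [simp]: "x \<in> carrier M ==> \<zero>\<^bsub>R\<^esub> \<odot> x = \<zero>"
  using additive_map_zero[OF smult_additive_l R.ag M.ag] .

lemma smult_r_null [simp]: "a \<in> carrier R ==> a \<odot> \<zero> = \<zero>"
  using additive_map_zero[OF smult_additive M.ag M.ag] .

lemma smult_l_minus:
  "a \<in> carrier R ==> x \<in> carrier M ==> (\<ominus>\<^bsub>R\<^esub> a) \<odot> x = \<ominus> (a \<odot> x)"
  using additive_map_minus[OF smult_additive_l R.ag M.ag] .

lemma smult_r_diff:
  "a \<in> carrier R ==> x \<in> carrier M ==> y \<in> carrier M ==>
    a \<odot> (x \<ominus> y) = a \<odot> x \<ominus> a \<odot> y"
  using additive_map_diff[OF smult_additive M.ag M.ag] .

lemma smult_finsum: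
  "a \<in> carrier R ==> (!!s. s \<in> S ==> f s \<in> carrier M) ==>
    a \<odot> finsum M f S = finsum M (\<lambda>s. a \<odot> f s) S"
  using M.finsum_additive[OF smult_additive M.ag] .

lemma smult_fsum:
  "a \<in> carrier R ==> (!!s. s \<in> S ==> f s \<in> carrier M) ==> finite {s\<in>S. f s ~= \<zero>} ==>
    a \<odot> fsum M f S = fsum M (\<lambda>s. a \<odot> f s) S"
  using M.fsum_additive[OF smult_additive M.ag] .

end

lemma (in ring) mult_additive_l: "x \<in> carrier R ==> additive_map R R (\<lambda>y. y \<otimes> x)"
  by (auto intro!: additive_mapI simp: l_distr)

lemma (in ring) mult_additive_r: "x \<in> carrier R ==> additive_map R R (\<lambda>y. x \<otimes> y)"
  by (auto intro!: additive_mapI simp: r_distr)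

lemma mod_hom_iff:
  "h \<in> mod_hom R M N \<longleftrightarrow> h \<in> extensional (carrier M) \<and> additive_map M N h \<and>
     (\<forall>a\<in>carrier R. \<forall>x\<in>carrier M. h (a \<odot>\<^bsub>M\<^esub> x) = a \<odot>\<^bsub>N\<^esub> h x)"
  by (auto simp: mod_hom_def additive_map_def PiE_def)

lemma mod_hom_additive: "h \<in> mod_hom R M N ==> additive_map M N h"
  by (simp add: mod_hom_iff)

lemma mod_hom_smult:
  "h \<in> mod_hom R M N ==> a \<in> carrier R ==> x \<in> carrier M ==> h (a \<odot>\<^bsub>M\<^esub> x) = a \<odot>\<^bsub>N\<^esub> h x"
  by (simp add: mod_hom_iff)

lemma mod_hom_closed: "h \<in> mod_hom R M N ==> x \<in> carrier M ==> h x \<in> carrier N"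
  by (rule additive_map_closed[OF mod_hom_additive])

lemma mod_hom_add:
  "h \<in> mod_hom R M N ==> x \<in> carrier M ==> y \<in> carrier M ==> h (x \<oplus>\<^bsub>M\<^esub> y) = h x \<oplus>\<^bsub>N\<^esub> h y"
  by (rule additive_map_add[OF mod_hom_additive])

lemma abelian_group_cong:
  assumes "abelian_group R" "carrier S = carrier R" "zero S = zero R" "add S = add R"
  shows "abelian_group S"
proof -
  interpret R: abelian_group R by fact
  show ?thesis
  proof (rule abelian_groupI)
    fix x assume "x \<in> carrier S"
    then show "\<exists>y\<in>carrier S. y \<oplus>\<^bsub>S\<^esub> x = \<zero>\<^bsub>S\<^esub>" using assms R.l_neg[of x] R.a_inv_closed[of x] by metis
  qed (use assms R.a_assoc R.a_comm in auto)
qed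

lemma ring_cong:
  assumes "ring R" "carrier S = carrier R" "mult S = mult R" "one S = one R" "zero S = zero R" "add S = add R"
  shows "ring S"
proof -
  interpret R: ring R by fact
  have "abelian_group S" by (rule abelian_group_cong[OF R.ag]) (use assms in auto)
  moreover have "monoid S" by (rule monoidI) (use assms R.m_assoc in auto)
  ultimately show ?thesis
    by (rule ringI) (simp_all add: assms R.l_distr R.r_distr)
qed

subsection \<open>Quotients\<close>

locale submod = lmod R M + N: abelian_subgroup N M
  for R :: "('r, 's) ring_scheme" and M :: "('r, 'm) module" (structure) and N +
  assumes sub_smult: "a \<in> carrier R ==> x \<in> N ==> a \<odot> x \<in> N"

lemma submodI:
  assumes "lmod R M" "additive_subgroup N M" "!!a x. a \<in> carrier R ==> x \<in> N ==> a \<odot>\<^bsub>M\<^esub> x \<in> N"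
  shows "submod R M N"
proof -
  interpret lmod R M by fact
  show ?thesis
    by (intro submod.intro submod_axioms.intro abelian_subgroupI3 assms lmod_axioms M.ag)
qed

context submod
begin

abbreviation "Q \<equiv> quot_module M N"

lemma quot_carrier: "X \<in> carrier Q \<longleftrightarrow> (\<exists>x\<in>carrier M. X = N +> x)"
  by (auto simp: quot_module_def A_RCOSETS_def' )

lemma quot_carrierE:
  assumes "X \<in> carrier Q"
  obtains x where "x \<in> carrier M" "X = N +> x"
  using assms quot_carrier by auto

lemma coset_closed [simp]: "x \<in> carrier M ==> N +> x \<in> carrier Q"
  using quot_carrier by auto

lemma quot_zero: "\<zero>\<^bsub>Q\<^esub> = N"
  by (simp add: quot_module_def)

lemma coset_zero_eq [simp]: "N +> \<zero> = \<zero>\<^bsub>Q\<^esub>"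
  using M.a_coset_add_zero[OF N.a_subset] by (simp add: quot_zero)

lemma coset_add:
  "x \<in> carrier M ==> y \<in> carrier M ==> (N +> x) \<oplus>\<^bsub>Q\<^esub> (N +> y) = N +> (x \<oplus> y)"
  by (simp add: quot_module_def N.a_rcos_sum)

lemma coset_eq_iff:
  assumes "x \<in> carrier M" "y \<in> carrier M"
  shows "N +> x = N +> y \<longleftrightarrow> x \<ominus> y \<in> N"
proof
  assume "N +> x = N +> y"
  then have "x \<in> N +> y" using N.a_rcos_self[OF assms(1)] by simp
  then show "x \<ominus> y \<in> N" using N.a_rcos_module[OF assms(2,1)] by (simp add: a_minus_def)
next
  assume "x \<ominus> y \<in> N"
  then have "x \<in> N +> y" using N.a_rcos_module[OF assms(2,1)] by (simp add: a_minus_def)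
  then show "N +> x = N +> y"
    using M.add.repr_independence[OF _ assms(2) N.a_subgroup] by (simp add: a_r_coset_def)
qed

lemma coset_zero_iff: "x \<in> carrier M ==> N +> x = \<zero>\<^bsub>Q\<^esub> \<longleftrightarrow> x \<in> N"
  using coset_eq_iff[of x "\<zero>"] by simp

lemma coset_smult:
  assumes "a \<in> carrier R" "x \<in> carrier M"
  shows "a \<odot>\<^bsub>Q\<^esub> (N +> x) = N +> (a \<odot> x)"
proof -
  have *: "N +> (a \<odot> y) = N +> (a \<odot> x)" if "y \<in> N +> x" for y
  proof -
    have y: "y \<in> carrier M" using N.a_elemrcos_carrier[OF assms(2) that] .
    have "y \<ominus> x \<in> N" using that N.a_rcos_module[OF assms(2) y] by (simp add: a_minus_def)
    then have "a \<odot> (y \<ominus> x) \<in> N" using assms sub_smult by simp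
    then have "a \<odot> y \<ominus> a \<odot> x \<in> N" using smult_r_diff[OF assms(1) y assms(2)] by simp
    then show ?thesis using coset_eq_iff assms y by simp
  qed
  from UN_constant_eq[OF N.a_rcos_self[OF assms(2)] ballI[OF *]] show ?thesis by (simp add: quot_module_def)
qed

lemma quot_abelian_group: "abelian_group Q"
proof (rule abelian_groupI)
  fix X assume "X \<in> carrier Q"
  then obtain x where x: "x \<in> carrier M" "X = N +> x" by (rule quot_carrierE)
  then have "(N +> (\<ominus> x)) \<oplus>\<^bsub>Q\<^esub> X = \<zero>\<^bsub>Q\<^esub>" by (simp add: coset_add M.l_neg)
  then show "\<exists>Y\<in>carrier Q. Y \<oplus>\<^bsub>Q\<^esub> X = \<zero>\<^bsub>Q\<^esub>" using x(1) by auto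
next
  fix X assume "X \<in> carrier Q"
  then show "\<zero>\<^bsub>Q\<^esub> \<oplus>\<^bsub>Q\<^esub> X = X"
    by (elim quot_carrierE) (simp add: coset_add del: coset_zero_eq flip: coset_zero_eq)
next
  show "\<zero>\<^bsub>Q\<^esub> \<in> carrier Q" by (metis coset_zero_eq coset_closed M.zero_closed)
qed (elim quot_carrierE; simp add: coset_add M.a_assoc; simp add: M.a_comm)+

lemma quot_lmod: "lmod R Q"
proof (intro lmod.intro lmod_axioms.intro)
  show "ring R" by (rule R.ring_axioms)
  show "abelian_group Q" by (rule quot_abelian_group)
qed (auto elim!: quot_carrierE simp: coset_smult coset_add smult_l_distr smult_r_distr smult_assoc)

lemma coset_additive: "additive_map M Q (\<lambda>x. N +> x)"
  by (auto intro!: additive_mapI simp: coset_add)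

lemma quot_additive_lift:
  assumes G: "abelian_group G" and h: "additive_map M G h" and N: "!!x. x \<in> N ==> h x = \<zero>\<^bsub>G\<^esub>"
  shows "\<exists>g. additive_map Q G g \<and> (\<forall>x\<in>carrier M. g (N +> x) = h x)"
proof -
  interpret G: abelian_group G by fact
  define g where "g X = h (SOME x. x \<in> carrier M \<and> X = N +> x)" for X
  have g: "g (N +> x) = h x" if x: "x \<in> carrier M" for x
  proof -
    let ?y = "SOME y. y \<in> carrier M \<and> N +> x = N +> y"
    have y: "?y \<in> carrier M \<and> N +> x = N +> ?y" by (rule someI_ex) (use x in auto)
    then have "x \<ominus> ?y \<in> N" using coset_eq_iff x by blast
    then have "h (x \<ominus> ?y) = \<zero>\<^bsub>G\<^esub>" by (rule N)
    then have "h x \<ominus>\<^bsub>G\<^esub> h ?y = \<zero>\<^bsub>G\<^esub>"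
      using additive_map_diff[OF h M.ag G x] y by simp
    then show ?thesis unfolding g_def
      using additive_map_closed[OF h] x y by (simp add: G.diff_eq_zero_iff)
  qed
  have "additive_map Q G g"
    by (auto intro!: additive_mapI elim!: quot_carrierE
        simp: coset_add g additive_map_closed[OF h] additive_map_add[OF h])
  then show ?thesis using g by blast
qed

end

lemma coset_mult_ideal:
  fixes M :: "('r, 'm) module"
  assumes "ideal I M" "x \<in> carrier M" "y \<in> carrier M"
  shows "(I +>\<^bsub>M\<^esub> x) \<otimes>\<^bsub>quot_module M I\<^esub> (I +>\<^bsub>M\<^esub> y) = I +>\<^bsub>M\<^esub> (x \<otimes>\<^bsub>M\<^esub> y)"
  using ideal.rcoset_mult_add[OF assms] by (simp add: quot_module_def)

lemma quot_module_ring: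
  fixes M :: "('r, 'm) module"
  assumes "ideal I M"
  shows "ring (quot_module M I)"
  by (rule ring_cong[OF ideal.quotient_is_ring[OF assms]]) (simp_all add: quot_module_def FactRing_def)

subsection \<open>Free modules\<close>

lemma free_module_lmod:
  assumes "ring R"
  shows "lmod R (free_module R S)"
proof -
  interpret R: ring R by fact
  let ?F = "free_module R S"
  have carrier: "f \<in> carrier ?F \<longleftrightarrow> (\<forall>s. f s \<in> carrier R) \<and> finite {s. f s ~= \<zero>\<^bsub>R\<^esub>} \<and> {s. f s ~= \<zero>\<^bsub>R\<^esub>} \<subseteq> S" for f
    by (auto simp: free_module_def)
  have add: "(\<lambda>s. f s \<oplus>\<^bsub>R\<^esub> g s) \<in> carrier ?F" if "f \<in> carrier ?F" "g \<in> carrier ?F" for f g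
  proof -
    have "{s. f s \<oplus>\<^bsub>R\<^esub> g s ~= \<zero>\<^bsub>R\<^esub>} \<subseteq> {s. f s ~= \<zero>\<^bsub>R\<^esub>} \<union> {s. g s ~= \<zero>\<^bsub>R\<^esub>}" using that by auto
    then show ?thesis using that finite_subset unfolding carrier by (auto intro: finite_subset)
  qed
  have smult: "(\<lambda>s. a \<otimes>\<^bsub>R\<^esub> f s) \<in> carrier ?F" if "f \<in> carrier ?F" "a \<in> carrier R" for f a
  proof -
    have "{s. a \<otimes>\<^bsub>R\<^esub> f s ~= \<zero>\<^bsub>R\<^esub>} \<subseteq> {s. f s ~= \<zero>\<^bsub>R\<^esub>}" using that by auto
    then show ?thesis using that finite_subset unfolding carrier by (auto intro: finite_subset)
  qed
  have [simp]: "\<zero>\<^bsub>?F\<^esub> = (\<lambda>s. \<zero>\<^bsub>R\<^esub>)" "f \<oplus>\<^bsub>?F\<^esub> g = (\<lambda>s. f s \<oplus>\<^bsub>R\<^esub> g s)" "a \<odot>\<^bsub>?F\<^esub> f = (\<lambda>s. a \<otimes>\<^bsub>R\<^esub> f s)" for f g a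
    by (simp_all add: free_module_def)
  have "abelian_group ?F"
  proof (rule abelian_groupI)
    fix f assume f: "f \<in> carrier ?F"
    have "(\<lambda>s. (\<ominus>\<^bsub>R\<^esub> \<one>\<^bsub>R\<^esub>) \<otimes>\<^bsub>R\<^esub> f s) \<in> carrier ?F" by (rule smult[OF f]) simp
    moreover have "(\<lambda>s. (\<ominus>\<^bsub>R\<^esub> \<one>\<^bsub>R\<^esub>) \<otimes>\<^bsub>R\<^esub> f s) \<oplus>\<^bsub>?F\<^esub> f = \<zero>\<^bsub>?F\<^esub>"
      using f by (auto simp: carrier R.l_minus R.l_neg)
    ultimately show "\<exists>g\<in>carrier ?F. g \<oplus>\<^bsub>?F\<^esub> f = \<zero>\<^bsub>?F\<^esub>" by blast
  qed (auto simp: add, auto simp: carrier R.a_ac)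
  then show ?thesis
    by (intro lmod.intro lmod_axioms.intro R.ring_axioms)
      (auto simp: smult, auto simp: carrier R.l_distr R.r_distr R.m_assoc)
qed

lemma free_moduleI:
  "(!!s. f s \<in> carrier R) ==> finite {s. f s ~= \<zero>\<^bsub>R\<^esub>} ==> (!!s. f s ~= \<zero>\<^bsub>R\<^esub> ==> s \<in> S) ==>
    f \<in> carrier (free_module R S)"
  by (auto simp: free_module_def)

lemma free_moduleD:
  assumes "f \<in> carrier (free_module R S)"
  shows "f s \<in> carrier R" "finite {s. f s ~= \<zero>\<^bsub>R\<^esub>}" "f s ~= \<zero>\<^bsub>R\<^esub> ==> s \<in> S"
  using assms by (auto simp: free_module_def)

lemma free_module_simps:
  "\<zero>\<^bsub>free_module R S\<^esub> = (\<lambda>s. \<zero>\<^bsub>R\<^esub>)" "f \<oplus>\<^bsub>free_module R S\<^esub> g = (\<lambda>s. f s \<oplus>\<^bsub>R\<^esub> g s)"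
  "a \<odot>\<^bsub>free_module R S\<^esub> f = (\<lambda>s. a \<otimes>\<^bsub>R\<^esub> f s)"
  by (simp_all add: free_module_def)

lemma free_gen_closed: "ring R ==> s \<in> S ==> free_gen R s \<in> carrier (free_module R S)"
  by (rule free_moduleI)
    (auto simp: free_gen_def ring.ring_simprules intro!: finite_subset[of _ "{s}"] split: if_splits)

lemma free_module_span:
  assumes "ring R" and f: "f \<in> carrier (free_module R S)"
  shows "f \<in> add_span (free_module R S) {a \<odot>\<^bsub>free_module R S\<^esub> free_gen R s | a s. a \<in> carrier R \<and> s \<in> S}"
    (is "_ \<in> add_span ?F ?G")
proof -
  interpret R: ring R by fact
  interpret F: lmod R ?F by (rule free_module_lmod) fact
  have G: "?G \<subseteq> carrier ?F" using free_gen_closed[OF assms(1)] by (auto intro!: F.smult_closed)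
  have sub: "additive_subgroup (add_span ?F ?G) ?F" by (rule F.M.add_span_subgroup[OF G])
  \<comment> \<open>The induction runs over a finite set containing the support rather than over the
    support itself, so that erasing one value of f needs no computation of the new support.\<close>
  have "finite A ==> f \<in> carrier ?F ==> {s. f s ~= \<zero>\<^bsub>R\<^esub>} \<subseteq> A ==> f \<in> add_span ?F ?G" for A f
  proof (induction A arbitrary: f rule: finite_induct)
    case empty
    then have "f = \<zero>\<^bsub>?F\<^esub>" by (simp add: free_module_simps fun_eq_iff)
    then show ?case using subgroup_zero[OF sub] by simp
  next
    case (insert t A)
    note f = free_moduleD[OF insert.prems(1)]
    let ?g = "\<lambda>s. if s = t then \<zero>\<^bsub>R\<^esub> else f s"
    have "{s. ?g s ~= \<zero>\<^bsub>R\<^esub>} \<subseteq> {s. f s ~= \<zero>\<^bsub>R\<^esub>}" by auto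
    then have "finite {s. ?g s ~= \<zero>\<^bsub>R\<^esub>}" by (rule finite_subset[OF _ f(2)])
    then have g: "?g \<in> carrier ?F"
      by (rule free_moduleI[rotated]) (use f in \<open>auto split: if_splits\<close>)
    have g': "?g \<in> add_span ?F ?G" 
      by (rule insert.IH[OF g]) (use insert.prems in \<open>auto split: if_splits\<close>)
    show ?case
    proof (cases "t \<in> S")
      case True
      have eq: "f = f t \<odot>\<^bsub>?F\<^esub> free_gen R t \<oplus>\<^bsub>?F\<^esub> ?g"
        by (rule ext) (simp add: free_module_simps free_gen_def f(1))
      have "f t \<odot>\<^bsub>?F\<^esub> free_gen R t \<in> add_span ?F ?G"
        using True f(1) by (intro F.M.add_span_incl) blast
      then show ?thesis by (subst eq) (rule subgroup_add[OF sub _ g'])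
    next
      case False
      then have "f t = \<zero>\<^bsub>R\<^esub>" using f(3) by blast
      then have "?g = f" by (simp add: fun_eq_iff)
      then show ?thesis using g' by simp
    qed
  qed
  from this[OF free_moduleD(2)[OF f] f] show ?thesis by simp
qed

section \<open>Projectivity over a subring, and exactness of the complexes I Q\<close>

section \<open>Projective resolutions and ideals\<close>

lemma additive_map_minus_map:
  assumes N: "abelian_group N" and g: "additive_map M N g" and h: "additive_map M N h"
  shows "additive_map M N (\<lambda>x. g x \<ominus>\<^bsub>N\<^esub> h x)"
proof -
  interpret N: abelian_group N by fact
  show ?thesis
    by (rule additive_mapI)
      (use additive_map_closed[OF g] additive_map_closed[OF h] in
        \<open>auto simp: additive_map_add[OF g] additive_map_add[OF h] a_minus_def N.minus_add N.a_ac\<close>)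
qed

lemma (in abelian_group) finsum_cartesian:
  assumes "finite A" "finite B" "!!a b. a \<in> A ==> b \<in> B ==> f a b \<in> carrier G"
  shows "finsum G (\<lambda>(a, b). f a b) (A \<times> B) = finsum G (\<lambda>b. finsum G (\<lambda>a. f a b) A) B"
  using assms(2,3)
proof (induction B rule: finite_induct)
  case (insert b B)
  have inj: "inj_on (\<lambda>a. (a, b)) A" by (auto simp: inj_on_def)
  have eq: "A \<times> insert b B = (\<lambda>a. (a, b)) ` A \<union> A \<times> B" by auto
  have "finsum G (\<lambda>(a, b). f a b) (A \<times> insert b B)
      = finsum G (\<lambda>(a, b). f a b) ((\<lambda>a. (a, b)) ` A) \<oplus> finsum G (\<lambda>(a, b). f a b) (A \<times> B)"
    unfolding eq by (rule finsum_Un_disjoint) (use insert assms(1) in auto)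
  also have "finsum G (\<lambda>(a, b). f a b) ((\<lambda>a. (a, b)) ` A) = finsum G (\<lambda>a. f a b) A"
    by (subst finsum_reindex[OF _ inj]) (use insert in \<open>auto intro!: finsum_cong'\<close>)
  also have "finsum G (\<lambda>(a, b). f a b) (A \<times> B) = finsum G (\<lambda>b. finsum G (\<lambda>a. f a b) A) B"
    by (rule insert.IH) (use insert in auto)
  also have "finsum G (\<lambda>a. f a b) A \<oplus> finsum G (\<lambda>b. finsum G (\<lambda>a. f a b) A) B
      = finsum G (\<lambda>b. finsum G (\<lambda>a. f a b) A) (insert b B)"
    using insert by (subst finsum_insert) (auto intro!: finsum_closed)
  finally show ?case .
qed simp

lemma (in abelian_group) fsum_product:
  assumes fin: "finite {(a, b). a \<in> S \<and> b \<in> T \<and> f a b ~= \<zero>}"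
    and c: "!!a b. a \<in> S ==> b \<in> T ==> f a b \<in> carrier G"
  shows "fsum G (\<lambda>(a, b). f a b) (S \<times> T) = fsum G (\<lambda>b. fsum G (\<lambda>a. f a b) S) T"
proof -
  let ?P = "{(a, b). a \<in> S \<and> b \<in> T \<and> f a b ~= \<zero>}"
  let ?A = "fst ` ?P" and ?B = "snd ` ?P"
  have A: "finite ?A" "?A \<subseteq> S" and B: "finite ?B" "?B \<subseteq> T" using fin by auto
  have z: "f a b = \<zero>" if "a \<in> S" "b \<in> T" "a \<notin> ?A \<or> b \<notin> ?B" for a b
    using that by (force simp: image_iff)
  have inner: "fsum G (\<lambda>a. f a b) S = finsum G (\<lambda>a. f a b) ?A" if "b \<in> T" for b
    by (rule fsum_eq[OF A]) (use z c that in auto)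
  have "fsum G (\<lambda>(a, b). f a b) (S \<times> T) = finsum G (\<lambda>(a, b). f a b) (?A \<times> ?B)"
  proof (rule fsum_eq)
    fix s assume s: "s \<in> S \<times> T" "s \<notin> ?A \<times> ?B"
    obtain a b where ab: "s = (a, b)" "a \<in> S" "b \<in> T" using s(1) by auto
    then show "(case s of (a, b) => f a b) = \<zero>" using z[of a b] s(2) by (simp add: mem_Times_iff)
  qed (use A B c in auto)
  also have "\<dots> = finsum G (\<lambda>b. finsum G (\<lambda>a. f a b) ?A) ?B"
    by (rule finsum_cartesian[OF A(1) B(1)]) (use A B c in blast)
  also have "\<dots> = finsum G (\<lambda>b. fsum G (\<lambda>a. f a b) S) ?B"
    by (rule finsum_cong') (use B c inner in \<open>auto intro!: fsum_closed\<close>)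
  also have "\<dots> = fsum G (\<lambda>b. fsum G (\<lambda>a. f a b) S) T"
  proof (rule fsum_eq[OF B, symmetric])
    show "fsum G (\<lambda>a. f a b) S = \<zero>" if "b \<in> T" "b \<notin> ?B" for b
      by (rule fsum_zero) (use z that in blast)
  qed (use c in \<open>auto intro!: fsum_closed\<close>)
  finally show ?thesis .
qed

text \<open>The submodule usually written I M, here for any set I of scalars.\<close>

definition idl :: "'a set => ('a, 'm) module => 'm set" where
  "idl I M = add_span M {a \<odot>\<^bsub>M\<^esub> x | a x. a \<in> I \<and> x \<in> carrier M}"

context lmod
begin

lemma idl_gen: "I \<subseteq> carrier R ==> {a \<odot> x | a x. a \<in> I \<and> x \<in> carrier M} \<subseteq> carrier M"
  by auto

lemma idl_subgroup: "I \<subseteq> carrier R ==> additive_subgroup (idl I M) M"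
  unfolding idl_def by (rule M.add_span_subgroup[OF idl_gen])

lemma idl_carrier: "I \<subseteq> carrier R ==> x \<in> idl I M ==> x \<in> carrier M"
  using additive_subgroup.a_subset[OF idl_subgroup] by auto

lemma idl_incl: "a \<in> I ==> x \<in> carrier M ==> a \<odot> x \<in> idl I M"
  unfolding idl_def by (rule M.add_span_incl) blast

lemma idl_additive_in:
  assumes I: "I \<subseteq> carrier R" and h: "additive_map M N h" and N: "abelian_group N" and H: "additive_subgroup H N"
    and g: "!!a x. a \<in> I ==> x \<in> carrier M ==> h (a \<odot> x) \<in> H"
    and x: "x \<in> idl I M"
  shows "h x \<in> H"
  by (rule M.span_image[OF h N H idl_gen[OF I] _ x[unfolded idl_def]]) (use g in auto)

lemma idl_mono: "I \<subseteq> I' ==> I' \<subseteq> carrier R ==> idl I M \<subseteq> idl I' M"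
  unfolding idl_def by (rule M.add_span_mono[OF _ idl_gen]) auto

lemma idl_smult:
  assumes I: "ideal I R" and a: "a \<in> carrier R" and x: "x \<in> idl I M"
  shows "a \<odot> x \<in> idl I M"
proof -
  have sub: "I \<subseteq> carrier R" using ideal.Icarr[OF I] by auto
  show ?thesis
  proof (rule idl_additive_in[OF sub smult_additive[OF a] M.ag idl_subgroup[OF sub] _ x])
    fix b y assume b: "b \<in> I" and y: "y \<in> carrier M"
    have "a \<odot> (b \<odot> y) = (a \<otimes>\<^bsub>R\<^esub> b) \<odot> y" using a b y sub smult_assoc by auto
    then show "a \<odot> (b \<odot> y) \<in> idl I M"
      using ideal.I_l_closed[OF I b a] y idl_incl by simp
  qed
qed

end

lemma idl_hom:
  assumes "lmod R M" "lmod R N" "I \<subseteq> carrier R" "h \<in> mod_hom R M N" "x \<in> idl I M"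
  shows "h x \<in> idl I N"
proof -
  interpret M: lmod R M by fact
  interpret N: lmod R N by fact
  show ?thesis
  proof (rule M.idl_additive_in[OF assms(3) mod_hom_additive[OF assms(4)] N.M.ag N.idl_subgroup[OF assms(3)] _ assms(5)])
    fix a y assume "a \<in> I" "y \<in> carrier M"
    then show "h (a \<odot>\<^bsub>M\<^esub> y) \<in> idl I N"
      using assms(3) mod_hom_smult[OF assms(4)] mod_hom_closed[OF assms(4)] N.idl_incl by auto
  qed
qed

text \<open>The dual basis lemma in relative form: coefficients lie in \<open>A'\<close> and the
  coordinates commute with \<open>A'\<close>, so the data exhibit M as projective over
  \<open>A'\<close>, while the scalars still come from R. The generators \<open>u b\<close> may be
  dependent.\<close>

locale dual_basis = lmod R M for R :: "('r, 's) ring_scheme" and M :: "('r, 'm) module" +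
  fixes A' :: "'r set" and S :: "'b set" and u :: "'b => 'm" and \<theta> :: "'b => 'm => 'r"
  assumes sub: "A' \<subseteq> carrier R"
    and u_closed: "b \<in> S ==> u b \<in> carrier M"
    and theta_additive: "b \<in> S ==> additive_map M R (\<theta> b)"
    and theta_in: "b \<in> S ==> x \<in> carrier M ==> \<theta> b x \<in> A'"
    and theta_smult: "b \<in> S ==> a \<in> A' ==> x \<in> carrier M ==> \<theta> b (a \<odot>\<^bsub>M\<^esub> x) = a \<otimes>\<^bsub>R\<^esub> \<theta> b x"
    and theta_finite: "x \<in> carrier M ==> finite {b \<in> S. \<theta> b x ~= \<zero>\<^bsub>R\<^esub>}"
    and theta_expand: "x \<in> carrier M ==> x = fsum M (\<lambda>b. \<theta> b x \<odot>\<^bsub>M\<^esub> u b) S"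
begin

lemma theta_closed: "b \<in> S ==> x \<in> carrier M ==> \<theta> b x \<in> carrier R"
  using theta_in sub by auto

text \<open>The generators in the dual basis expansion are replaced by arbitrary elements. As the
  generators may be dependent, \<open>u b\<close> need not go to \<open>h b\<close>; what makes the
  formula useful is that maps can be pulled through it (\<open>comb_map\<close>).\<close>

definition comb :: "('r, 'n) module => ('b => 'n) => 'm => 'n" where
  "comb N h x = fsum N (\<lambda>b. \<theta> b x \<odot>\<^bsub>N\<^esub> h b) S"

context
  fixes N :: "('r, 'n) module" and h :: "'b => 'n"
  assumes N: "lmod R N" and h: "!!b. b \<in> S ==> h b \<in> carrier N"
begin

interpretation N: lmod R N by (rule N)

lemma comb_terms: "b \<in> S ==> x \<in> carrier M ==> \<theta> b x \<odot>\<^bsub>N\<^esub> h b \<in> carrier N"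
  using theta_closed h by auto

lemma comb_finite: "x \<in> carrier M ==> finite {b \<in> S. \<theta> b x \<odot>\<^bsub>N\<^esub> h b ~= \<zero>\<^bsub>N\<^esub>}"
  by (rule finite_subset[OF _ theta_finite]) (use h in auto)

lemma comb_additive: "additive_map M N (comb N h)"
  unfolding comb_def
  by (rule N.M.fsum_additive_map[OF additive_map_comp[OF N.smult_additive_l[OF h] theta_additive] comb_finite])

lemma comb_smult:
  assumes a: "a \<in> A'" and x: "x \<in> carrier M"
  shows "comb N h (a \<odot>\<^bsub>M\<^esub> x) = a \<odot>\<^bsub>N\<^esub> comb N h x"
proof -
  have aR: "a \<in> carrier R" using a sub by auto
  have "a \<odot>\<^bsub>N\<^esub> comb N h x = fsum N (\<lambda>b. a \<odot>\<^bsub>N\<^esub> (\<theta> b x \<odot>\<^bsub>N\<^esub> h b)) S"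
    unfolding comb_def by (rule N.smult_fsum[OF aR _ comb_finite[OF x]]) (rule comb_terms[OF _ x])
  also have "\<dots> = comb N h (a \<odot>\<^bsub>M\<^esub> x)"
    unfolding comb_def
    by (rule N.M.fsum_cong)
      (use a aR x theta_closed h theta_smult in \<open>auto simp: N.smult_assoc\<close>)
  finally show ?thesis ..
qed

lemma comb_in:
  assumes "additive_subgroup H N" "x \<in> carrier M" "!!b. b \<in> S ==> \<theta> b x \<odot>\<^bsub>N\<^esub> h b \<in> H"
  shows "comb N h x \<in> H"
  unfolding comb_def by (rule N.M.fsum_in_subgroup) (use assms in auto)

lemma comb_map:
  assumes g: "additive_map N N' g" and N': "lmod R N'"
    and lin: "!!a y. a \<in> A' ==> y \<in> carrier N ==> g (a \<odot>\<^bsub>N\<^esub> y) = a \<odot>\<^bsub>N'\<^esub> g y" and x: "x \<in> carrier M"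
  shows "g (comb N h x) = comb N' (\<lambda>b. g (h b)) x"
proof -
  interpret N': lmod R N' by fact
  have "g (comb N h x) = fsum N' (\<lambda>b. g (\<theta> b x \<odot>\<^bsub>N\<^esub> h b)) S"
    unfolding comb_def by (rule N.M.fsum_additive[OF g N'.M.ag comb_terms[OF _ x] comb_finite[OF x]])
  also have "\<dots> = comb N' (\<lambda>b. g (h b)) x"
    unfolding comb_def
    by (rule N'.M.fsum_cong)
      (use lin theta_in theta_closed x h additive_map_closed[OF g] in auto)
  finally show ?thesis .
qed

end

lemma comb_u: "x \<in> carrier M ==> comb M u x = x"
  unfolding comb_def by (rule theta_expand[symmetric])

end

text \<open>The generators are all elements of P, and the coordinates are those of a splitting of
  the canonical map from the free module on P.\<close>

lemma projective_dual_basis: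
  assumes "projective_module R P"
  shows "\<exists>\<theta>. dual_basis R P (carrier R) (carrier P) (\<lambda>x. x) \<theta>"
proof -
  from assms obtain s where P: "lmod R P" and s: "s \<in> mod_hom R P (free_module R (carrier P))"
    "!!x. x \<in> carrier P ==> lincomb R P (\<lambda>p. p) (s x) = x"
    unfolding projective_module_def left_module_iff by blast
  interpret P: lmod R P by fact
  have sc: "s x \<in> carrier (free_module R (carrier P))" if "x \<in> carrier P" for x
    using mod_hom_closed[OF s(1) that] .
  note sc = free_moduleD[OF sc]
  have "dual_basis R P (carrier R) (carrier P) (\<lambda>x. x) (\<lambda>b x. s x b)"
  proof (intro dual_basis.intro dual_basis_axioms.intro P.lmod_axioms)
    show "additive_map P R (\<lambda>x. s x b)" for b
      by (rule additive_mapI) (use sc mod_hom_add[OF s(1)] in \<open>auto simp: free_module_simps\<close>)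
    show "s (a \<odot>\<^bsub>P\<^esub> x) b = a \<otimes>\<^bsub>R\<^esub> s x b" if "a \<in> carrier R" "x \<in> carrier P" for a b x
      using mod_hom_smult[OF s(1) that] by (simp add: free_module_simps)
    fix x assume x: "x \<in> carrier P"
    show "finite {b \<in> carrier P. s x b ~= \<zero>\<^bsub>R\<^esub>}" by (rule finite_subset[OF _ sc(2)[OF x]]) auto
    have "fsum P (\<lambda>b. s x b \<odot>\<^bsub>P\<^esub> b) (carrier P) = finsum P (\<lambda>b. s x b \<odot>\<^bsub>P\<^esub> b) {b. s x b ~= \<zero>\<^bsub>R\<^esub>}"
      by (rule P.M.fsum_eq) (use sc[OF x] in auto)
    then show "x = fsum P (\<lambda>b. s x b \<odot>\<^bsub>P\<^esub> b) (carrier P)" using s(2)[OF x] by (simp add: lincomb_def)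
  qed (use sc in auto)
  then show ?thesis by blast
qed

text \<open>The same notion for R as a left module over \<open>A'\<close>. In the main application
  \<open>A'\<close> is spanned by the monomials with rows from p on, with functions as coefficients,
  and the \<open>e m\<close> are the monomials with rows before p.\<close>

locale ring_dual_basis = ring R for R (structure) +
  fixes A' :: "'a set" and S :: "'b set" and e :: "'b => 'a" and \<kappa> :: "'b => 'a => 'a"
  assumes sub: "A' \<subseteq> carrier R"
    and e_closed: "m \<in> S ==> e m \<in> carrier R"
    and kappa_additive: "m \<in> S ==> additive_map R R (\<kappa> m)"
    and kappa_in: "m \<in> S ==> x \<in> carrier R ==> \<kappa> m x \<in> A'"
    and kappa_mult: "m \<in> S ==> a \<in> A' ==> x \<in> carrier R ==> \<kappa> m (a \<otimes> x) = a \<otimes> \<kappa> m x"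
    and kappa_finite: "x \<in> carrier R ==> finite {m \<in> S. \<kappa> m x ~= \<zero>}"
    and kappa_expand: "x \<in> carrier R ==> x = fsum R (\<lambda>m. \<kappa> m x \<otimes> e m) S"
begin

lemma kappa_closed: "m \<in> S ==> x \<in> carrier R ==> \<kappa> m x \<in> carrier R"
  using kappa_in sub by auto

lemma kappa_zero: "m \<in> S ==> \<kappa> m \<zero> = \<zero>"
  by (rule additive_map_zero[OF kappa_additive abelian_group_axioms abelian_group_axioms])

text \<open>Transitivity of projectivity: expand first over R, then expand every coefficient over
  \<open>A'\<close>.\<close>

lemma compose_dual_basis:
  assumes "dual_basis R M (carrier R) T v s"
  shows "dual_basis R M A' (S \<times> T) (\<lambda>(m, b). e m \<odot>\<^bsub>M\<^esub> v b) (\<lambda>(m, b) x. \<kappa> m (s b x))"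
proof -
  interpret D: dual_basis R M "carrier R" T v s by fact
  have fin: "finite {(m, b). m \<in> S \<and> b \<in> T \<and> \<kappa> m (s b x) ~= \<zero>}" if x: "x \<in> carrier M" for x
  proof -
    have "{(m, b). m \<in> S \<and> b \<in> T \<and> \<kappa> m (s b x) ~= \<zero>} \<subseteq>
        (\<lambda>(b, m). (m, b)) ` (SIGMA b:{b \<in> T. s b x ~= \<zero>}. {m \<in> S. \<kappa> m (s b x) ~= \<zero>})"
      using kappa_zero by (force simp: image_iff)
    moreover have "finite (SIGMA b:{b \<in> T. s b x ~= \<zero>}. {m \<in> S. \<kappa> m (s b x) ~= \<zero>})"
      by (rule finite_SigmaI[OF D.theta_finite[OF x]]) (use kappa_finite D.theta_closed x in auto)
    ultimately show ?thesis using finite_subset by blast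
  qed
  show ?thesis
  proof (intro dual_basis.intro dual_basis_axioms.intro D.lmod_axioms sub)
    fix b assume b: "b \<in> S \<times> T"
    obtain m t where mt: "b = (m, t)" "m \<in> S" "t \<in> T" using b by auto
    show "(case b of (m, b) => e m \<odot>\<^bsub>M\<^esub> v b) \<in> carrier M" using mt e_closed D.u_closed by simp
    show "additive_map M R ((\<lambda>(m, b) x. \<kappa> m (s b x)) b)"
      using additive_map_comp[OF kappa_additive[OF mt(2)] D.theta_additive[OF mt(3)]] by (simp add: mt(1))
    fix x assume x: "x \<in> carrier M"
    show "(case b of (m, b) => \<lambda>x. \<kappa> m (s b x)) x \<in> A'" using mt x kappa_in D.theta_closed by simp
    fix a assume a: "a \<in> A'"
    show "(case b of (m, b) => \<lambda>x. \<kappa> m (s b x)) (a \<odot>\<^bsub>M\<^esub> x) = a \<otimes> (case b of (m, b) => \<lambda>x. \<kappa> m (s b x)) x"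
      using mt x a sub D.theta_smult kappa_mult D.theta_closed by auto
  next
    fix x assume x: "x \<in> carrier M"
    show "finite {b \<in> S \<times> T. (case b of (m, b) => \<lambda>x. \<kappa> m (s b x)) x ~= \<zero>}"
      by (rule finite_subset[OF _ fin[OF x]]) auto
    have c: "\<kappa> m (s b x) \<odot>\<^bsub>M\<^esub> (e m \<odot>\<^bsub>M\<^esub> v b) \<in> carrier M" if "m \<in> S" "b \<in> T" for m b
      using that kappa_closed D.theta_closed x e_closed D.u_closed by auto
    have "x = fsum M (\<lambda>b. s b x \<odot>\<^bsub>M\<^esub> v b) T" by (rule D.theta_expand[OF x])
    also have "\<dots> = fsum M (\<lambda>b. fsum M (\<lambda>m. \<kappa> m (s b x) \<odot>\<^bsub>M\<^esub> (e m \<odot>\<^bsub>M\<^esub> v b)) S) T"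
    proof (rule D.M.fsum_cong[OF refl])
      fix b assume b: "b \<in> T"
      have sb: "s b x \<in> carrier R" using D.theta_closed b x by auto
      have "s b x \<odot>\<^bsub>M\<^esub> v b = fsum R (\<lambda>m. \<kappa> m (s b x) \<otimes> e m) S \<odot>\<^bsub>M\<^esub> v b"
        using kappa_expand[OF sb] by simp
      also have "\<dots> = fsum M (\<lambda>m. (\<kappa> m (s b x) \<otimes> e m) \<odot>\<^bsub>M\<^esub> v b) S"
        by (rule fsum_additive[OF D.smult_additive_l[OF D.u_closed[OF b]] D.M.ag])
          (use kappa_closed sb e_closed in \<open>auto intro!: finite_subset[OF _ kappa_finite[OF sb]]\<close>)
      also have "\<dots> = fsum M (\<lambda>m. \<kappa> m (s b x) \<odot>\<^bsub>M\<^esub> (e m \<odot>\<^bsub>M\<^esub> v b)) S"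
        by (rule D.M.fsum_cong) (use c b kappa_closed sb e_closed D.u_closed in \<open>auto simp: D.smult_assoc\<close>)
      finally show "s b x \<odot>\<^bsub>M\<^esub> v b = fsum M (\<lambda>m. \<kappa> m (s b x) \<odot>\<^bsub>M\<^esub> (e m \<odot>\<^bsub>M\<^esub> v b)) S" .
    qed (use c in \<open>auto intro!: D.M.fsum_closed\<close>)
    also have "\<dots> = fsum M (\<lambda>(m, b). \<kappa> m (s b x) \<odot>\<^bsub>M\<^esub> (e m \<odot>\<^bsub>M\<^esub> v b)) (S \<times> T)"
    proof (rule D.M.fsum_product[symmetric])
      show "finite {(m, b). m \<in> S \<and> b \<in> T \<and> \<kappa> m (s b x) \<odot>\<^bsub>M\<^esub> (e m \<odot>\<^bsub>M\<^esub> v b) ~= \<zero>\<^bsub>M\<^esub>}"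
        by (rule finite_subset[OF _ fin[OF x]]) (use e_closed D.u_closed in auto)
    qed (rule c)
    also have "\<dots> = fsum M (\<lambda>b. (case b of (m, b) => \<lambda>x. \<kappa> m (s b x)) x \<odot>\<^bsub>M\<^esub> (case b of (m, b) => e m \<odot>\<^bsub>M\<^esub> v b)) (S \<times> T)"
      by (rule arg_cong[where f = "\<lambda>f. fsum M f (S \<times> T)"]) auto
    finally show "x = fsum M (\<lambda>b. (case b of (m, b) => \<lambda>x. \<kappa> m (s b x)) x \<odot>\<^bsub>M\<^esub> (case b of (m, b) => e m \<odot>\<^bsub>M\<^esub> v b)) (S \<times> T)" .
  qed
qed

end

locale resolution =
  fixes R :: "('a, 's) ring_scheme" and X :: "('a, 'x) module" and Q :: "nat => ('a, 'q) module"
    and d :: "nat => 'q => 'q" and \<epsilon> :: "'q => 'x"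
  assumes res: "proj_resolution R X Q d \<epsilon>"
begin

sublocale X: lmod R X
  using res by (simp add: proj_resolution_def left_module_iff)

lemma Q_lmod: "lmod R (Q i)"
  using res by (simp add: proj_resolution_def projective_module_def left_module_iff)

sublocale Q: lmod R "Q i" for i
  by (rule Q_lmod)

lemma Q_projective: "projective_module R (Q i)"
  using res by (simp add: proj_resolution_def)

lemma d_hom: "d i \<in> mod_hom R (Q (Suc i)) (Q i)" and eps_hom: "\<epsilon> \<in> mod_hom R (Q 0) X"
  using res by (simp_all add: proj_resolution_def)

lemmas d_additive = mod_hom_additive[OF d_hom]
lemmas d_smult = mod_hom_smult[OF d_hom]
lemmas d_closed = mod_hom_closed[OF d_hom]
lemmas d_add = mod_hom_add[OF d_hom]
lemmas d_zero = additive_map_zero[OF d_additive Q.M.ag Q.M.ag]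
lemmas d_diff = additive_map_diff[OF d_additive Q.M.ag Q.M.ag]

lemma eps_surj:
  assumes "x \<in> carrier X"
  shows "\<exists>q\<in>carrier (Q 0). \<epsilon> q = x"
proof -
  have "\<epsilon> ` carrier (Q 0) = carrier X" using res by (simp add: proj_resolution_def)
  then show ?thesis using assms by (metis imageE)
qed

lemma exact_0: "q \<in> carrier (Q 0) ==> \<epsilon> q = \<zero>\<^bsub>X\<^esub> ==> \<exists>w\<in>carrier (Q (Suc 0)). d 0 w = q"
  and eps_d: "q \<in> carrier (Q (Suc 0)) ==> \<epsilon> (d 0 q) = \<zero>\<^bsub>X\<^esub>"
proof -
  have "d 0 ` carrier (Q 1) = {x \<in> carrier (Q 0). \<epsilon> x = \<zero>\<^bsub>X\<^esub>}" using res by (simp add: proj_resolution_def)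
  then have eq: "y \<in> d 0 ` carrier (Q (Suc 0)) \<longleftrightarrow> y \<in> carrier (Q 0) \<and> \<epsilon> y = \<zero>\<^bsub>X\<^esub>" for y by simp
  show "q \<in> carrier (Q 0) ==> \<epsilon> q = \<zero>\<^bsub>X\<^esub> ==> \<exists>w\<in>carrier (Q (Suc 0)). d 0 w = q" using eq[of q] by (metis imageE)
  show "q \<in> carrier (Q (Suc 0)) ==> \<epsilon> (d 0 q) = \<zero>\<^bsub>X\<^esub>" using eq[of "d 0 q"] by blast
qed

lemma exact_Suc: "q \<in> carrier (Q (Suc i)) ==> d i q = \<zero>\<^bsub>Q i\<^esub> ==> \<exists>w\<in>carrier (Q (Suc (Suc i))). d (Suc i) w = q"
  and d_d: "q' \<in> carrier (Q (Suc (Suc i))) ==> d i (d (Suc i) q') = \<zero>\<^bsub>Q i\<^esub>"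
proof -
  have "d (Suc i) ` carrier (Q (Suc (Suc i))) = {x \<in> carrier (Q (Suc i)). d i x = \<zero>\<^bsub>Q i\<^esub>}"
    using res by (simp add: proj_resolution_def)
  then have eq: "y \<in> d (Suc i) ` carrier (Q (Suc (Suc i))) \<longleftrightarrow> y \<in> carrier (Q (Suc i)) \<and> d i y = \<zero>\<^bsub>Q i\<^esub>" for y by simp
  show "q \<in> carrier (Q (Suc i)) ==> d i q = \<zero>\<^bsub>Q i\<^esub> ==> \<exists>w\<in>carrier (Q (Suc (Suc i))). d (Suc i) w = q"
    using eq[of q] by (metis imageE)
  show "q' \<in> carrier (Q (Suc (Suc i))) ==> d i (d (Suc i) q') = \<zero>\<^bsub>Q i\<^esub>" using eq[of "d (Suc i) q'"] by blast
qed

definition cyc :: "nat => 'q => bool" where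
  "cyc i q = (case i of 0 => True | Suc j => d j q = \<zero>\<^bsub>Q j\<^esub>)"

text \<open>As \<open>cyc 0\<close> is no condition, this includes that \<open>d 0\<close> maps \<open>I Q\<^sub>1\<close> onto \<open>I Q\<^sub>0\<close>.\<close>

definition exact_idl :: "'a set => bool" where
  "exact_idl I \<longleftrightarrow> (\<forall>i. \<forall>x\<in>idl I (Q i). cyc i x --> (\<exists>w\<in>idl I (Q (Suc i)). d i w = x))"

lemma exact_idl_zero: "exact_idl {\<zero>\<^bsub>R\<^esub>}"
proof -
  have "x = \<zero>\<^bsub>Q i\<^esub>" if "x \<in> idl {\<zero>\<^bsub>R\<^esub>} (Q i)" for x i
  proof -
    have *: "additive_subgroup {\<zero>\<^bsub>Q i\<^esub>} (Q i)" by (rule Q.M.additive_subgroupI') auto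
    have id: "additive_map (Q i) (Q i) (\<lambda>x. x)" by (rule additive_mapI) auto
    show ?thesis using Q.idl_additive_in[OF _ id Q.M.ag * _ that] by auto
  qed
  moreover have "\<zero>\<^bsub>Q i\<^esub> \<in> idl {\<zero>\<^bsub>R\<^esub>} (Q i)" for i
    by (rule subgroup_zero[OF Q.idl_subgroup]) auto
  ultimately show ?thesis unfolding exact_idl_def using d_zero by metis
qed

text \<open>
  Passage from \<open>J\<close> to a larger ideal \<open>I\<close>. The complex \<open>f Q\<close> is exact because \<open>f\<close> kills \<open>X\<close>, and its
  terms are projective over \<open>f A' = f A' f\<close>; hence it is contractible. A contraction extends to
  \<open>A'\<close>-linear maps \<open>H\<close> on \<open>Q\<close>, given by the same formula in terms of a dual basis.
\<close>

context
  fixes J I A' :: "'a set" and f :: 'a and S :: "'b set" and e \<kappa>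
  assumes db: "ring_dual_basis R A' S e \<kappa>"
    and f: "f \<in> A'" "f \<otimes>\<^bsub>R\<^esub> f = f" "!!a. a \<in> A' ==> f \<otimes>\<^bsub>R\<^esub> a \<otimes>\<^bsub>R\<^esub> f = f \<otimes>\<^bsub>R\<^esub> a"
    and fX: "!!x. x \<in> carrier X ==> f \<odot>\<^bsub>X\<^esub> x = \<zero>\<^bsub>X\<^esub>"
    and J: "J \<subseteq> I" "!!j a. j \<in> J ==> a \<in> carrier R ==> j \<otimes>\<^bsub>R\<^esub> a \<in> J"
    and I: "I \<subseteq> carrier R" "f \<in> I" "!!a i. i \<in> I ==> a \<in> carrier R ==> a \<otimes>\<^bsub>R\<^esub> i \<in> I"
    and \<kappa>J: "!!m a. m \<in> S ==> a \<in> J ==> \<kappa> m a \<in> J"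
    and \<kappa>I: "!!m a. m \<in> S ==> a \<in> I ==> \<exists>c\<in>A'. \<kappa> m a \<ominus>\<^bsub>R\<^esub> c \<otimes>\<^bsub>R\<^esub> f \<in> J"
begin

interpretation D: ring_dual_basis R A' S e \<kappa> by (rule db)

lemma f_R: "f \<in> carrier R"
  using f(1) D.sub by auto

lemma J_R: "J \<subseteq> carrier R"
  using J(1) I(1) by auto

text \<open>A map that is linear over \<open>A'\<close> only need not preserve J Q. This is required
  separately, because the error terms of the contraction have to stay in J Q.\<close>

definition lin :: "nat => ('q => 'q) => bool" where
  "lin i H \<longleftrightarrow> additive_map (Q i) (Q (Suc i)) H \<and>
     (\<forall>a\<in>A'. \<forall>q\<in>carrier (Q i). H (a \<odot>\<^bsub>Q i\<^esub> q) = a \<odot>\<^bsub>Q (Suc i)\<^esub> H q) \<and>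
     (\<forall>q\<in>idl J (Q i). H q \<in> idl J (Q (Suc i)))"

lemma lin_zero_diff:
  assumes "lin i H"
  shows "H \<zero>\<^bsub>Q i\<^esub> = \<zero>\<^bsub>Q (Suc i)\<^esub>"
    and "x \<in> carrier (Q i) ==> y \<in> carrier (Q i) ==> H (x \<ominus>\<^bsub>Q i\<^esub> y) = H x \<ominus>\<^bsub>Q (Suc i)\<^esub> H y"
  using assms additive_map_zero[OF _ Q.M.ag Q.M.ag]
    additive_map_diff[OF _ Q.M.ag Q.M.ag] by (auto simp: lin_def)

text \<open>Linearity of Y for the scalars \<open>f a\<close> suffices: the coordinates of
  \<open>f q\<close> are f times those of q, so the lift prescribed on generators is correct on f Q.
  It preserves J Q because J is closed under right multiplication and the coefficient maps
  \<open>\<kappa>\<close> preserve J.\<close>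

lemma build:
  assumes Y: "!!q. q \<in> carrier (Q i) ==> \<exists>w\<in>carrier (Q (Suc i)). d i w = Y q"
    and Yadd: "additive_map (Q i) (Q i) Y"
    and Ylin: "!!a q. a \<in> A' ==> q \<in> carrier (Q i) ==> (f \<otimes>\<^bsub>R\<^esub> a) \<odot>\<^bsub>Q i\<^esub> Y q = Y ((f \<otimes>\<^bsub>R\<^esub> a) \<odot>\<^bsub>Q i\<^esub> q)"
  shows "\<exists>H. lin i H \<and> (\<forall>q\<in>carrier (Q i). d i (H (f \<odot>\<^bsub>Q i\<^esub> q)) = Y (f \<odot>\<^bsub>Q i\<^esub> q))"
proof -
  obtain s where "dual_basis R (Q i) (carrier R) (carrier (Q i)) (\<lambda>x. x) s"
    using projective_dual_basis[OF Q_projective] by blast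
  then interpret s: dual_basis R "Q i" "carrier R" "carrier (Q i)" "\<lambda>x. x" s .
  let ?u = "\<lambda>(m, b). e m \<odot>\<^bsub>Q i\<^esub> b" and ?\<theta> = "\<lambda>(m, b) x. \<kappa> m (s b x)"
  interpret t: dual_basis R "Q i" A' "S \<times> carrier (Q i)" ?u ?\<theta>
    by (rule D.compose_dual_basis) (rule s.dual_basis_axioms)
  have uc: "?u b \<in> carrier (Q i)" if "b \<in> S \<times> carrier (Q i)" for b by (rule t.u_closed[OF that])
  obtain h where h: "!!b. b \<in> S \<times> carrier (Q i) ==> h b \<in> carrier (Q (Suc i)) \<and> d i (h b) = Y (?u b)"
    using Y[OF uc] by metis
  let ?H = "t.comb (Q (Suc i)) h"
  have hc: "!!b. b \<in> S \<times> carrier (Q i) ==> h b \<in> carrier (Q (Suc i))" using h by blast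
  have "lin i ?H"
    unfolding lin_def
  proof (intro conjI ballI)
    show add: "additive_map (Q i) (Q (Suc i)) ?H" by (rule t.comb_additive[OF Q_lmod hc])
    show "?H (a \<odot>\<^bsub>Q i\<^esub> q) = a \<odot>\<^bsub>Q (Suc i)\<^esub> ?H q" if "a \<in> A'" "q \<in> carrier (Q i)" for a q
      by (rule t.comb_smult[OF Q_lmod hc that])
    fix q assume q: "q \<in> idl J (Q i)"
    show "?H q \<in> idl J (Q (Suc i))"
    proof (rule Q.idl_additive_in[OF J_R add Q.M.ag Q.idl_subgroup[OF J_R] _ q])
      fix j x assume j: "j \<in> J" and x: "x \<in> carrier (Q i)"
      have jx: "j \<odot>\<^bsub>Q i\<^esub> x \<in> carrier (Q i)" using j x J_R by auto
      show "?H (j \<odot>\<^bsub>Q i\<^esub> x) \<in> idl J (Q (Suc i))"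
      proof (rule t.comb_in[OF Q_lmod hc Q.idl_subgroup[OF J_R] jx])
        fix b assume b: "b \<in> S \<times> carrier (Q i)"
        obtain m v where mv: "b = (m, v)" "m \<in> S" "v \<in> carrier (Q i)" using b by auto
        have "s v (j \<odot>\<^bsub>Q i\<^esub> x) \<in> J"
          using s.theta_smult[OF mv(3) _ x, of j] j J_R J(2)[OF j s.theta_closed[OF mv(3) x]] by auto
        then have "?\<theta> b (j \<odot>\<^bsub>Q i\<^esub> x) \<in> J" using mv \<kappa>J by simp
        then show "?\<theta> b (j \<odot>\<^bsub>Q i\<^esub> x) \<odot>\<^bsub>Q (Suc i)\<^esub> h b \<in> idl J (Q (Suc i))"
          using Q.idl_incl hc[OF b] by simp
      qed
    qed
  qed
  moreover have "d i (?H (f \<odot>\<^bsub>Q i\<^esub> q)) = Y (f \<odot>\<^bsub>Q i\<^esub> q)" if q: "q \<in> carrier (Q i)" for q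
  proof -
    have fq: "f \<odot>\<^bsub>Q i\<^esub> q \<in> carrier (Q i)" using q f_R by auto
    have "d i (?H (f \<odot>\<^bsub>Q i\<^esub> q)) = t.comb (Q i) (\<lambda>b. d i (h b)) (f \<odot>\<^bsub>Q i\<^esub> q)"
      by (rule t.comb_map[OF Q_lmod hc d_additive Q_lmod _ fq]) (use d_smult D.sub in auto)
    also have "\<dots> = fsum (Q i) (\<lambda>b. Y (?\<theta> b (f \<odot>\<^bsub>Q i\<^esub> q) \<odot>\<^bsub>Q i\<^esub> ?u b)) (S \<times> carrier (Q i))"
      unfolding t.comb_def
    proof (rule Q.M.fsum_cong[OF refl])
      fix b assume b: "b \<in> S \<times> carrier (Q i)"
      have "?\<theta> b (f \<odot>\<^bsub>Q i\<^esub> q) = f \<otimes>\<^bsub>R\<^esub> ?\<theta> b q" by (rule t.theta_smult[OF b f(1) q])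
      then show "?\<theta> b (f \<odot>\<^bsub>Q i\<^esub> q) \<odot>\<^bsub>Q i\<^esub> d i (h b) = Y (?\<theta> b (f \<odot>\<^bsub>Q i\<^esub> q) \<odot>\<^bsub>Q i\<^esub> ?u b)"
        using h[OF b] Ylin[OF t.theta_in[OF b q] uc[OF b]] by simp
      show "Y (?\<theta> b (f \<odot>\<^bsub>Q i\<^esub> q) \<odot>\<^bsub>Q i\<^esub> ?u b) \<in> carrier (Q i)"
        using additive_map_closed[OF Yadd] t.theta_closed[OF b fq] uc[OF b] by blast
    qed
    also have "\<dots> = Y (fsum (Q i) (\<lambda>b. ?\<theta> b (f \<odot>\<^bsub>Q i\<^esub> q) \<odot>\<^bsub>Q i\<^esub> ?u b) (S \<times> carrier (Q i)))"
      by (rule Q.M.fsum_additive[OF Yadd Q.M.ag t.comb_terms[OF Q_lmod uc _ fq] t.comb_finite[OF Q_lmod uc fq], symmetric])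
    also have "\<dots> = Y (f \<odot>\<^bsub>Q i\<^esub> q)" using t.theta_expand[OF fq] by simp
    finally show ?thesis .
  qed
  ultimately show ?thesis by blast
qed

text \<open>The term H d of the homotopy identity d H + H d = 1. It is zero in degree 0: since f
  kills X, every element of \<open>f Q 0\<close> is a boundary.\<close>

definition pr :: "(nat => 'q => 'q) => nat => 'q => 'q" where
  "pr H i q = (case i of 0 => \<zero>\<^bsub>Q 0\<^esub> | Suc j => H j (d j q))"

text \<open>The usual contraction of an exact complex of projectives that is bounded below, built
  degree by degree: on f Q the map 1 - H d has values in cycles, by the identity of the previous
  degree, and is lifted through the next differential.\<close>

lemma homotopy:
  "\<exists>H. \<forall>i. lin i (H i) \<and> (\<forall>q\<in>carrier (Q i). d i (H i (f \<odot>\<^bsub>Q i\<^esub> q)) = f \<odot>\<^bsub>Q i\<^esub> q \<ominus>\<^bsub>Q i\<^esub> pr H i (f \<odot>\<^bsub>Q i\<^esub> q))"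
proof -
  note fR = f_R
  have fa: "f \<otimes>\<^bsub>R\<^esub> a \<in> carrier R" if "a \<in> A'" for a using that D.sub fR by auto
  have faf: "(f \<otimes>\<^bsub>R\<^esub> a) \<odot>\<^bsub>Q i\<^esub> (f \<odot>\<^bsub>Q i\<^esub> q) = (f \<otimes>\<^bsub>R\<^esub> a) \<odot>\<^bsub>Q i\<^esub> q" "f \<odot>\<^bsub>Q i\<^esub> ((f \<otimes>\<^bsub>R\<^esub> a) \<odot>\<^bsub>Q i\<^esub> q) = (f \<otimes>\<^bsub>R\<^esub> a) \<odot>\<^bsub>Q i\<^esub> q"
    if "a \<in> A'" "q \<in> carrier (Q i)" for a i q
  proof -
    have aR: "a \<in> carrier R" using that D.sub by auto
    show "(f \<otimes>\<^bsub>R\<^esub> a) \<odot>\<^bsub>Q i\<^esub> (f \<odot>\<^bsub>Q i\<^esub> q) = (f \<otimes>\<^bsub>R\<^esub> a) \<odot>\<^bsub>Q i\<^esub> q"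
      using Q.smult_assoc[OF fa[OF that(1)] fR that(2), symmetric] f(3)[OF that(1)] by simp
    have "f \<otimes>\<^bsub>R\<^esub> (f \<otimes>\<^bsub>R\<^esub> a) = f \<otimes>\<^bsub>R\<^esub> a" using ring.ring_simprules(11)[OF X.R.ring_axioms fR fR aR] f(2) by simp
    then show "f \<odot>\<^bsub>Q i\<^esub> ((f \<otimes>\<^bsub>R\<^esub> a) \<odot>\<^bsub>Q i\<^esub> q) = (f \<otimes>\<^bsub>R\<^esub> a) \<odot>\<^bsub>Q i\<^esub> q"
      using Q.smult_assoc[OF fR fa[OF that(1)] that(2)] by simp
  qed
  have ff: "f \<odot>\<^bsub>Q i\<^esub> (f \<odot>\<^bsub>Q i\<^esub> q) = f \<odot>\<^bsub>Q i\<^esub> q" if "q \<in> carrier (Q i)" for i q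
    using Q.smult_assoc[OF fR fR that] f(2) by simp
  \<comment> \<open>Only the effect on cycles is carried along, because the next degree applies it
    to boundaries. The full identity is recovered from the relation between consecutive
    choices.\<close>
  define good where "good i H \<longleftrightarrow> lin i H \<and> (\<forall>q\<in>carrier (Q i). cyc i q --> d i (H (f \<odot>\<^bsub>Q i\<^esub> q)) = f \<odot>\<^bsub>Q i\<^esub> q)"
    for i and H :: "'q => 'q"
  define P where "P i H \<longleftrightarrow> good i H \<and> (i = 0 --> (\<forall>q\<in>carrier (Q 0). d 0 (H (f \<odot>\<^bsub>Q 0\<^esub> q)) = f \<odot>\<^bsub>Q 0\<^esub> q))"
    for i and H :: "'q => 'q"
  have 0: "\<exists>H. P 0 H"
  proof -
    have "\<exists>H. lin 0 H \<and> (\<forall>q\<in>carrier (Q 0). d 0 (H (f \<odot>\<^bsub>Q 0\<^esub> q)) = f \<odot>\<^bsub>Q 0\<^esub> (f \<odot>\<^bsub>Q 0\<^esub> q))"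
    proof (rule build)
      fix q assume q: "q \<in> carrier (Q 0)"
      have "\<epsilon> (f \<odot>\<^bsub>Q 0\<^esub> q) = \<zero>\<^bsub>X\<^esub>"
        using mod_hom_smult[OF eps_hom fR q] fX mod_hom_closed[OF eps_hom q] by simp
      then show "\<exists>w\<in>carrier (Q (Suc 0)). d 0 w = f \<odot>\<^bsub>Q 0\<^esub> q" using exact_0 q fR by auto
    next
      show "additive_map (Q 0) (Q 0) ((\<odot>\<^bsub>Q 0\<^esub>) f)" using Q.smult_additive[OF fR] .
    qed (use faf in simp)
    then obtain H where "lin 0 H" "\<forall>q\<in>carrier (Q 0). d 0 (H (f \<odot>\<^bsub>Q 0\<^esub> q)) = f \<odot>\<^bsub>Q 0\<^esub> q"
      using ff by auto
    then show ?thesis by (auto simp: P_def good_def)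
  qed
  have Suc: "\<exists>H'. P (Suc i) H' \<and>
      (\<forall>q\<in>carrier (Q (Suc i)). d (Suc i) (H' (f \<odot>\<^bsub>Q (Suc i)\<^esub> q)) = f \<odot>\<^bsub>Q (Suc i)\<^esub> q \<ominus>\<^bsub>Q (Suc i)\<^esub> H (d i (f \<odot>\<^bsub>Q (Suc i)\<^esub> q)))"
    if "P i H" for i H
  proof -
    have H: "lin i H" and Hcyc: "!!q. q \<in> carrier (Q i) ==> cyc i q ==> d i (H (f \<odot>\<^bsub>Q i\<^esub> q)) = f \<odot>\<^bsub>Q i\<^esub> q"
      using that by (auto simp: P_def good_def)
    have Hadd: "additive_map (Q i) (Q (Suc i)) H"
      and Hlin: "!!a q. a \<in> A' ==> q \<in> carrier (Q i) ==> H (a \<odot>\<^bsub>Q i\<^esub> q) = a \<odot>\<^bsub>Q (Suc i)\<^esub> H q"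
      using H by (auto simp: lin_def)
    let ?M = "Q (Suc i)"
    let ?Y = "\<lambda>q. f \<odot>\<^bsub>?M\<^esub> q \<ominus>\<^bsub>?M\<^esub> H (d i (f \<odot>\<^bsub>?M\<^esub> q))"
    have fq: "f \<odot>\<^bsub>?M\<^esub> q \<in> carrier ?M" if "q \<in> carrier ?M" for q using that fR by auto
    have Hc: "H q \<in> carrier ?M" if "q \<in> carrier (Q i)" for q by (rule additive_map_closed[OF Hadd that])
    have Yadd: "additive_map ?M ?M ?Y"
    proof -
      have 1: "additive_map ?M ?M (\<lambda>q. f \<odot>\<^bsub>?M\<^esub> q)" by (rule Q.smult_additive[OF fR])
      have 2: "additive_map ?M ?M (\<lambda>q. H (d i (f \<odot>\<^bsub>?M\<^esub> q)))"
        by (rule additive_map_comp[OF Hadd additive_map_comp[OF d_additive 1]])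
      show ?thesis
        by (rule additive_map_minus_map[OF Q.M.ag 1 2])
    qed
    have "\<exists>H'. lin (Suc i) H' \<and> (\<forall>q\<in>carrier ?M. d (Suc i) (H' (f \<odot>\<^bsub>?M\<^esub> q)) = ?Y (f \<odot>\<^bsub>?M\<^esub> q))"
    proof (rule build[OF _ Yadd])
      fix q assume q: "q \<in> carrier ?M"
      have dq: "d i q \<in> carrier (Q i)" by (rule d_closed[OF q])
      have "cyc i (d i q)" by (cases i) (use q d_d in \<open>auto simp: cyc_def\<close>)
      from Hcyc[OF dq this] have "d i (H (d i (f \<odot>\<^bsub>?M\<^esub> q))) = d i (f \<odot>\<^bsub>?M\<^esub> q)"
        using d_smult[OF fR q] by simp
      then have "d i (?Y q) = \<zero>\<^bsub>Q i\<^esub>"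
        using d_diff[OF fq[OF q] Hc[OF d_closed[OF fq[OF q]]]] d_closed[OF fq[OF q]] by simp
      then show "\<exists>w\<in>carrier (Q (Suc (Suc i))). d (Suc i) w = ?Y q"
        by (rule exact_Suc[rotated]) (rule additive_map_closed[OF Yadd q])
    next
      fix a q assume a: "a \<in> A'" and q: "q \<in> carrier ?M"
      have aR: "a \<in> carrier R" using a D.sub by auto
      let ?c = "f \<otimes>\<^bsub>R\<^esub> a"
      \<comment> \<open>Linearity is applied for f and for a in turn, as \<open>A'\<close> is only a
        set of scalars here.\<close>
      have cH: "?c \<odot>\<^bsub>?M\<^esub> H y = H (?c \<odot>\<^bsub>Q i\<^esub> y)" if "y \<in> carrier (Q i)" for y
        using that a aR fR Hlin[OF f(1), of "a \<odot>\<^bsub>Q i\<^esub> y"] Hlin[OF a that] Hc[OF that]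
        by (simp add: Q.smult_assoc)
      have "?c \<odot>\<^bsub>?M\<^esub> ?Y q = ?c \<odot>\<^bsub>?M\<^esub> (f \<odot>\<^bsub>?M\<^esub> q) \<ominus>\<^bsub>?M\<^esub> H (d i (?c \<odot>\<^bsub>?M\<^esub> (f \<odot>\<^bsub>?M\<^esub> q)))"
        using fa[OF a] fq[OF q] Hc[OF d_closed[OF fq[OF q]]] cH[OF d_closed[OF fq[OF q]]]
        by (simp add: Q.smult_r_diff d_smult)
      then show "?c \<odot>\<^bsub>?M\<^esub> ?Y q = ?Y (?c \<odot>\<^bsub>?M\<^esub> q)" using faf[OF a q] by simp
    qed
    then obtain H' where H': "lin (Suc i) H'" "\<forall>q\<in>carrier ?M. d (Suc i) (H' (f \<odot>\<^bsub>?M\<^esub> q)) = ?Y q"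
      using ff by auto
    have "d (Suc i) (H' (f \<odot>\<^bsub>?M\<^esub> q)) = f \<odot>\<^bsub>?M\<^esub> q" if q: "q \<in> carrier ?M" "cyc (Suc i) q" for q
    proof -
      have "d i (f \<odot>\<^bsub>?M\<^esub> q) = \<zero>\<^bsub>Q i\<^esub>" using q fR by (simp add: d_smult cyc_def)
      then show ?thesis using H'(2) q(1) lin_zero_diff(1)[OF H] fq by simp
    qed
    then show ?thesis using H' by (auto simp: P_def good_def)
  qed
  from dependent_nat_choice[of P "\<lambda>i H H'. \<forall>q\<in>carrier (Q (Suc i)). d (Suc i) (H' (f \<odot>\<^bsub>Q (Suc i)\<^esub> q))
      = f \<odot>\<^bsub>Q (Suc i)\<^esub> q \<ominus>\<^bsub>Q (Suc i)\<^esub> H (d i (f \<odot>\<^bsub>Q (Suc i)\<^esub> q))", OF 0 Suc]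
  obtain H where HP: "!!i. P i (H i)" and HS: "!!i. \<forall>q\<in>carrier (Q (Suc i)). d (Suc i) (H (Suc i) (f \<odot>\<^bsub>Q (Suc i)\<^esub> q))
      = f \<odot>\<^bsub>Q (Suc i)\<^esub> q \<ominus>\<^bsub>Q (Suc i)\<^esub> H i (d i (f \<odot>\<^bsub>Q (Suc i)\<^esub> q))" by blast
  have "lin i (H i) \<and> (\<forall>q\<in>carrier (Q i). d i (H i (f \<odot>\<^bsub>Q i\<^esub> q)) = f \<odot>\<^bsub>Q i\<^esub> q \<ominus>\<^bsub>Q i\<^esub> pr H i (f \<odot>\<^bsub>Q i\<^esub> q))" for i
  proof (cases i)
    case 0
    then show ?thesis using HP[of 0] fR by (auto simp: P_def good_def pr_def)
  next
    case (Suc j)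
    then show ?thesis using HP[of i] HS[of j] by (auto simp: P_def good_def pr_def)
  qed
  then show ?thesis by blast
qed

text \<open>For a in I the coefficients of a are congruent to elements \<open>c f\<close> modulo J,
  and on multiples of those the contraction is available. A cycle of I Q is therefore a boundary
  from I Q up to a cycle of J Q, and the latter is a boundary by hypothesis.\<close>

lemma exact_idl_step:
  assumes EJ: "exact_idl J"
  shows "exact_idl I"
  unfolding exact_idl_def
proof (intro allI ballI impI)
  fix i x assume x: "x \<in> idl I (Q i)" and cx: "cyc i x"
  from homotopy obtain H where H: "!!i. lin i (H i)"
    "!!i q. q \<in> carrier (Q i) ==> d i (H i (f \<odot>\<^bsub>Q i\<^esub> q)) = f \<odot>\<^bsub>Q i\<^esub> q \<ominus>\<^bsub>Q i\<^esub> pr H i (f \<odot>\<^bsub>Q i\<^esub> q)" by blast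
  let ?M = "Q i" and ?N = "Q (Suc i)"
  have pr_add: "additive_map ?M ?M (pr H i)"
  proof (cases i)
    case 0
    then show ?thesis by (auto simp: pr_def intro!: additive_mapI)
  next
    case (Suc j)
    have "additive_map (Q j) (Q (Suc j)) (H j)" using H(1)[of j] by (simp add: lin_def)
    from additive_map_comp[OF this d_additive] show ?thesis by (simp add: pr_def[abs_def] Suc)
  qed
  have pr_lin: "pr H i (a \<odot>\<^bsub>?M\<^esub> q) = a \<odot>\<^bsub>?M\<^esub> pr H i q" if "a \<in> A'" "q \<in> carrier ?M" for a q
    using that H(1) D.sub by (cases i) (auto simp: pr_def lin_def d_smult d_closed subset_iff)
  have pr_J: "pr H i q \<in> idl J ?M" if "q \<in> idl J ?M" for q
  proof (cases i)
    case 0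
    then show ?thesis using subgroup_zero[OF Q.idl_subgroup[OF J_R]] by (simp add: pr_def)
  next
    case (Suc j)
    then show ?thesis using H(1)[of j] idl_hom[OF Q_lmod Q_lmod J_R d_hom, of q j] that by (simp add: pr_def lin_def)
  qed
  note pr_c = additive_map_closed[OF pr_add]
  note subI = Q.idl_subgroup[OF I(1)] and subJ = Q.idl_subgroup[OF J_R]
  note Ic = Q.idl_carrier[OF I(1)] and Jc = Q.idl_carrier[OF J_R]
  let ?D = "\<lambda>x. x \<ominus>\<^bsub>?M\<^esub> pr H i x"
  have id: "additive_map ?M ?M (\<lambda>x. x)" by (rule additive_mapI) auto
  have D_add: "additive_map ?M ?M ?D" by (rule additive_map_minus_map[OF Q.M.ag id pr_add])
  note D_c = additive_map_closed[OF D_add]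
  \<comment> \<open>W collects the elements for which the homotopy identity holds modulo J Q with a
    witness y in I Q. As W is a subgroup, it suffices to find the generators of I Q in it.\<close>
  define W where "W = {x \<in> carrier ?M. \<exists>y\<in>idl I ?N. \<exists>z\<in>idl J ?M. d i y = ?D x \<oplus>\<^bsub>?M\<^esub> z}"
  have WI: "x \<in> W" if "x \<in> carrier ?M" "y \<in> idl I ?N" "z \<in> idl J ?M" "d i y = ?D x \<oplus>\<^bsub>?M\<^esub> z" for x y z
    unfolding W_def using that by blast
  have W: "additive_subgroup W ?M"
  proof (rule Q.M.additive_subgroupI')
    show "\<zero>\<^bsub>?M\<^esub> \<in> W"
      by (rule WI[OF _ subgroup_zero[OF subI] subgroup_zero[OF subJ]])
        (simp_all add: d_zero additive_map_zero[OF D_add Q.M.ag Q.M.ag])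
    fix x assume "x \<in> W"
    then obtain y z where x: "x \<in> carrier ?M" "y \<in> idl I ?N" "z \<in> idl J ?M" "d i y = ?D x \<oplus>\<^bsub>?M\<^esub> z"
      unfolding W_def by blast
    show "\<ominus>\<^bsub>?M\<^esub> x \<in> W"
    proof (rule WI[OF _ subgroup_minus[OF subI x(2)] subgroup_minus[OF subJ x(3)]])
      show "d i (\<ominus>\<^bsub>?N\<^esub> y) = ?D (\<ominus>\<^bsub>?M\<^esub> x) \<oplus>\<^bsub>?M\<^esub> \<ominus>\<^bsub>?M\<^esub> z"
        unfolding additive_map_minus[OF d_additive Q.M.ag Q.M.ag Ic[OF x(2)]] x(4)
          additive_map_minus[OF D_add Q.M.ag Q.M.ag x(1)]
        by (rule Q.M.minus_add[OF D_c[OF x(1)] Jc[OF x(3)]])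
    qed (use x in simp)
    fix x' assume "x' \<in> W"
    then obtain y' z' where x': "x' \<in> carrier ?M" "y' \<in> idl I ?N" "z' \<in> idl J ?M" "d i y' = ?D x' \<oplus>\<^bsub>?M\<^esub> z'"
      unfolding W_def by blast
    show "x \<oplus>\<^bsub>?M\<^esub> x' \<in> W"
    proof (rule WI[OF _ subgroup_add[OF subI x(2) x'(2)] subgroup_add[OF subJ x(3) x'(3)]])
      show "d i (y \<oplus>\<^bsub>?N\<^esub> y') = ?D (x \<oplus>\<^bsub>?M\<^esub> x') \<oplus>\<^bsub>?M\<^esub> (z \<oplus>\<^bsub>?M\<^esub> z')"
        unfolding d_add[OF Ic[OF x(2)] Ic[OF x'(2)]] x(4) x'(4) additive_map_add[OF D_add x(1) x'(1)]
        using D_c[OF x(1)] D_c[OF x'(1)] Jc[OF x(3)] Jc[OF x'(3)] by (simp add: Q.M.a_ac)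
    qed (use x x' in simp)
  qed (auto simp: W_def)
  have W_J: "x \<in> W" if x: "x \<in> idl J ?M" for x
  proof (rule WI[OF Jc[OF x] subgroup_zero[OF subI]])
    have "?D x \<in> idl J ?M" by (rule Q.M.additive_subgroup_diff[OF subJ x pr_J[OF x]])
    then show "\<ominus>\<^bsub>?M\<^esub> ?D x \<in> idl J ?M" by (rule subgroup_minus[OF subJ])
    show "d i \<zero>\<^bsub>?N\<^esub> = ?D x \<oplus>\<^bsub>?M\<^esub> \<ominus>\<^bsub>?M\<^esub> ?D x" using Q.M.r_neg[OF D_c[OF Jc[OF x]]] d_zero by simp
  qed
  have W_f: "(c \<otimes>\<^bsub>R\<^esub> f) \<odot>\<^bsub>?M\<^esub> q \<in> W" if c: "c \<in> A'" and q: "q \<in> carrier ?M" for c q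
  proof -
    have cR: "c \<in> carrier R" using c D.sub by auto
    have fq: "f \<odot>\<^bsub>?M\<^esub> q \<in> carrier ?M" using q f_R by auto
    have s: "(c \<otimes>\<^bsub>R\<^esub> f) \<odot>\<^bsub>?M\<^esub> q = c \<odot>\<^bsub>?M\<^esub> (f \<odot>\<^bsub>?M\<^esub> q)" by (rule Q.smult_assoc[OF cR f_R q])
    have Hfq: "H i (f \<odot>\<^bsub>?M\<^esub> q) \<in> carrier ?N" and Hq: "H i q \<in> carrier ?N"
      using H(1)[of i] fq q by (auto simp: lin_def additive_map_closed)
    \<comment> \<open>The witness is c H(f q), rewritten as (c f) H(q). In the second form it
      visibly lies in I Q, because f lies in I and I is closed under left multiplication.\<close>
    have "c \<odot>\<^bsub>?N\<^esub> H i (f \<odot>\<^bsub>?M\<^esub> q) = (c \<otimes>\<^bsub>R\<^esub> f) \<odot>\<^bsub>?N\<^esub> H i q"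
      using H(1)[of i] f(1) q cR f_R Hq by (simp add: lin_def Q.smult_assoc)
    then have y: "c \<odot>\<^bsub>?N\<^esub> H i (f \<odot>\<^bsub>?M\<^esub> q) \<in> idl I ?N" using Q.idl_incl[OF I(3)[OF I(2) cR] Hq] by simp
    have "d i (c \<odot>\<^bsub>?N\<^esub> H i (f \<odot>\<^bsub>?M\<^esub> q)) = c \<odot>\<^bsub>?M\<^esub> ?D (f \<odot>\<^bsub>?M\<^esub> q)"
      using d_smult[OF cR Hfq] H(2)[OF q] by simp
    also have "\<dots> = ?D (c \<odot>\<^bsub>?M\<^esub> (f \<odot>\<^bsub>?M\<^esub> q))" unfolding pr_lin[OF c fq] by (rule Q.smult_r_diff[OF cR fq pr_c[OF fq]])
    finally show ?thesis
      unfolding s using y D_c[of "c \<odot>\<^bsub>?M\<^esub> (f \<odot>\<^bsub>?M\<^esub> q)"] cR fq by (intro WI[OF _ y subgroup_zero[OF subJ]]) simp_all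
  qed
  have "x \<in> W"
  proof (rule Q.idl_additive_in[OF I(1) id Q.M.ag W _ x])
    fix a q assume a: "a \<in> I" and q: "q \<in> carrier ?M"
    have aR: "a \<in> carrier R" using a I(1) by auto
    have "a \<odot>\<^bsub>?M\<^esub> q = fsum R (\<lambda>m. \<kappa> m a \<otimes>\<^bsub>R\<^esub> e m) S \<odot>\<^bsub>?M\<^esub> q" using D.kappa_expand[OF aR] by simp
    also have "\<dots> = fsum ?M (\<lambda>m. (\<kappa> m a \<otimes>\<^bsub>R\<^esub> e m) \<odot>\<^bsub>?M\<^esub> q) S"
      by (rule X.R.fsum_additive[OF Q.smult_additive_l[OF q] Q.M.ag])
        (use D.kappa_closed aR D.e_closed in \<open>auto intro!: finite_subset[OF _ D.kappa_finite[OF aR]]\<close>)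
    also have "\<dots> \<in> W"
    proof (rule Q.M.fsum_in_subgroup[OF W])
      fix m assume m: "m \<in> S"
      obtain c where c: "c \<in> A'" "\<kappa> m a \<ominus>\<^bsub>R\<^esub> c \<otimes>\<^bsub>R\<^esub> f \<in> J" using \<kappa>I[OF m a] by blast
      have cf: "c \<otimes>\<^bsub>R\<^esub> f \<in> carrier R" using c D.sub f_R by auto
      have ka: "\<kappa> m a \<in> carrier R" and em: "e m \<odot>\<^bsub>?M\<^esub> q \<in> carrier ?M" using D.kappa_closed[OF m aR] D.e_closed[OF m] q by auto
      have "(\<kappa> m a \<otimes>\<^bsub>R\<^esub> e m) \<odot>\<^bsub>?M\<^esub> q = \<kappa> m a \<odot>\<^bsub>?M\<^esub> (e m \<odot>\<^bsub>?M\<^esub> q)"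
        using ka D.e_closed[OF m] q by (rule Q.smult_assoc)
      also have "\<dots> = (\<kappa> m a \<ominus>\<^bsub>R\<^esub> c \<otimes>\<^bsub>R\<^esub> f) \<odot>\<^bsub>?M\<^esub> (e m \<odot>\<^bsub>?M\<^esub> q) \<oplus>\<^bsub>?M\<^esub> (c \<otimes>\<^bsub>R\<^esub> f) \<odot>\<^bsub>?M\<^esub> (e m \<odot>\<^bsub>?M\<^esub> q)"
        using Q.smult_l_distr[of "\<kappa> m a \<ominus>\<^bsub>R\<^esub> c \<otimes>\<^bsub>R\<^esub> f" "c \<otimes>\<^bsub>R\<^esub> f", OF _ cf em]
          X.R.diff_add_cancel[OF ka cf] J_R c(2) by auto
      also have "\<dots> \<in> W" by (rule subgroup_add[OF W W_J[OF Q.idl_incl[OF c(2) em]] W_f[OF c(1) em]])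
      finally show "(\<kappa> m a \<otimes>\<^bsub>R\<^esub> e m) \<odot>\<^bsub>?M\<^esub> q \<in> W" .
    qed
    finally show "a \<odot>\<^bsub>?M\<^esub> q \<in> W" .
  qed
  then obtain y z where xc: "x \<in> carrier ?M" and y: "y \<in> idl I ?N" and z: "z \<in> idl J ?M"
    and dy': "d i y = ?D x \<oplus>\<^bsub>?M\<^esub> z" unfolding W_def by blast
  \<comment> \<open>On a cycle the term H d vanishes, so membership in W reads d y = x + z.\<close>
  have "pr H i x = \<zero>\<^bsub>?M\<^esub>"
    using cx lin_zero_diff(1)[OF H(1)] by (cases i) (auto simp: pr_def cyc_def)
  then have dy: "d i y = x \<oplus>\<^bsub>?M\<^esub> z" using dy' Q.M.diff_zero[OF xc] by simp
  have "cyc i z"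
  proof (cases i)
    case (Suc j)
    have "d j (d i y) = d j x \<oplus>\<^bsub>Q j\<^esub> d j z"
      unfolding dy using d_add[of x j z] xc Jc[OF z] Suc by simp
    then show ?thesis using cx Ic[OF y] d_d[of y j] Jc[OF z] d_closed[of z j] Suc by (simp add: cyc_def)
  qed (simp add: cyc_def)
  then obtain w where w: "w \<in> idl J ?N" "d i w = z" using EJ z unfolding exact_idl_def by blast
  have wI: "w \<in> idl I ?N" using Q.idl_mono[OF J(1) I(1)] w(1) by blast
  have "d i (y \<ominus>\<^bsub>?N\<^esub> w) = x"
    using d_diff[OF Ic[OF y] Ic[OF wI]] dy w(2) Q.M.add_diff_cancel[OF xc Jc[OF z]] by simp
  then show "\<exists>w\<in>idl I ?N. d i w = x" using Q.M.additive_subgroup_diff[OF subI y wI] by blast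
qed

end

end

section \<open>Uniqueness of projective resolutions up to homotopy\<close>

section \<open>Comparison of resolutions\<close>

text \<open>\<open>mod_hom\<close> without the condition of being \<open>undefined\<close> outside
  the carrier, so that compositions and differences can be written without restricting them.\<close>

definition rlin :: "('r, 's) ring_scheme => ('r, 'm) module => ('r, 'n) module => ('m => 'n) => bool" where
  "rlin R M N h \<longleftrightarrow> additive_map M N h \<and> (\<forall>a\<in>carrier R. \<forall>x\<in>carrier M. h (a \<odot>\<^bsub>M\<^esub> x) = a \<odot>\<^bsub>N\<^esub> h x)"

lemma rlin_additive: "rlin R M N h ==> additive_map M N h"
  and rlin_smult: "rlin R M N h ==> a \<in> carrier R ==> x \<in> carrier M ==> h (a \<odot>\<^bsub>M\<^esub> x) = a \<odot>\<^bsub>N\<^esub> h x"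
  and rlin_closed: "rlin R M N h ==> x \<in> carrier M ==> h x \<in> carrier N"
  by (auto simp: rlin_def additive_map_closed)

lemma rlin_zero: "rlin R M N h ==> lmod R M ==> lmod R N ==> h \<zero>\<^bsub>M\<^esub> = \<zero>\<^bsub>N\<^esub>"
  by (rule additive_map_zero[OF rlin_additive lmod.axioms(2) lmod.axioms(2)])

lemma rlin_diff:
  "rlin R M N h ==> lmod R M ==> lmod R N ==> x \<in> carrier M ==> y \<in> carrier M ==>
    h (x \<ominus>\<^bsub>M\<^esub> y) = h x \<ominus>\<^bsub>N\<^esub> h y"
  by (rule additive_map_diff[OF rlin_additive lmod.axioms(2) lmod.axioms(2)])

lemma rlin_comp:
  assumes "rlin R N P g" "rlin R M N h"
  shows "rlin R M P (\<lambda>x. g (h x))"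
  using assms additive_map_comp[OF rlin_additive[OF assms(1)] rlin_additive[OF assms(2)]]
  by (auto simp: rlin_def additive_map_closed)

lemma rlin_id: "rlin R M M (\<lambda>x. x)"
  by (auto simp: rlin_def additive_map_def)

lemma rlin_minus_map:
  assumes N: "lmod R N" and g: "rlin R M N g" and h: "rlin R M N h"
  shows "rlin R M N (\<lambda>x. g x \<ominus>\<^bsub>N\<^esub> h x)"
proof -
  interpret N: lmod R N by fact
  have "additive_map M N (\<lambda>x. g x \<ominus>\<^bsub>N\<^esub> h x)"
    by (rule additive_map_minus_map[OF N.M.ag rlin_additive[OF g] rlin_additive[OF h]])
  then show ?thesis
    using rlin_smult[OF g] rlin_smult[OF h] rlin_closed[OF g] rlin_closed[OF h]
    by (auto simp: rlin_def N.smult_r_diff)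
qed

lemma mod_hom_rlin: "h \<in> mod_hom R M N \<longleftrightarrow> h \<in> extensional (carrier M) \<and> rlin R M N h"
  by (simp add: mod_hom_iff rlin_def)

lemma restrict_mod_hom:
  assumes M: "lmod R M" and h: "rlin R M N h"
  shows "restrict h (carrier M) \<in> mod_hom R M N"
proof -
  interpret M: lmod R M by fact
  show ?thesis using h by (auto simp: mod_hom_rlin rlin_def additive_map_def)
qed

text \<open>Projectivity as a lifting property. It is enough that single values can be lifted, since
  preimages are chosen for generators only.\<close>

lemma (in dual_basis) lifting:
  assumes A': "A' = carrier R" and N: "lmod R N" and N': "lmod R N'" and g: "rlin R N N' g" and \<phi>: "rlin R M N' \<phi>"
    and ex: "!!x. x \<in> carrier M ==> \<exists>y\<in>carrier N. g y = \<phi> x"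
  shows "\<exists>H. rlin R M N H \<and> (\<forall>x\<in>carrier M. g (H x) = \<phi> x)"
proof -
  interpret N': lmod R N' by fact
  obtain h where h: "!!b. b \<in> S ==> h b \<in> carrier N \<and> g (h b) = \<phi> (u b)" using ex[OF u_closed] by metis
  then have hc: "!!b. b \<in> S ==> h b \<in> carrier N" by blast
  have "g (comb N h x) = \<phi> x" if x: "x \<in> carrier M" for x
  proof -
    have "g (comb N h x) = comb N' (\<lambda>b. g (h b)) x"
      by (rule comb_map[OF N hc rlin_additive[OF g] N' _ x]) (use rlin_smult[OF g] A' in auto)
    also have "\<dots> = comb N' (\<lambda>b. \<phi> (u b)) x"
      unfolding comb_def
      by (rule N'.M.fsum_cong) (use h theta_closed x rlin_closed[OF \<phi>] u_closed in auto)
    also have "\<dots> = \<phi> (comb M u x)"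
      by (rule comb_map[OF lmod_axioms u_closed rlin_additive[OF \<phi>] N' _ x, symmetric]) (use rlin_smult[OF \<phi>] A' in auto)
    finally show ?thesis by (simp add: comb_u[OF x])
  qed
  moreover have "rlin R M N (comb N h)"
    unfolding rlin_def using comb_additive[OF N hc] comb_smult[OF N hc] A' by auto
  ultimately show ?thesis by blast
qed

definition cycle :: "('r, 'x) module => (nat => ('r, 'p) module) => (nat => 'p => 'p) => ('p => 'x) => nat => 'p => bool" where
  "cycle X P d \<epsilon> i y \<longleftrightarrow> (case i of 0 => \<epsilon> y = \<zero>\<^bsub>X\<^esub> | Suc j => d j y = \<zero>\<^bsub>P j\<^esub>)"

lemma cycle_simps: "cycle X P d \<epsilon> 0 y \<longleftrightarrow> \<epsilon> y = \<zero>\<^bsub>X\<^esub>" "cycle X P d \<epsilon> (Suc j) y \<longleftrightarrow> d j y = \<zero>\<^bsub>P j\<^esub>"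
  by (simp_all add: cycle_def)

text \<open>A projective resolution together with dual bases whose index sets are free to choose.
  The reduced complex Q/IQ is obtained in this form: its generators are indexed by elements of Q
  rather than by cosets.\<close>

locale proj_complex =
  fixes R :: "('r, 's) ring_scheme" and X :: "('r, 'x) module" and P :: "nat => ('r, 'p) module"
    and d :: "nat => 'p => 'p" and \<epsilon> :: "'p => 'x" and S :: "nat => 'b set" and u and \<theta>
  assumes X_lmod: "lmod R X"
    and dual: "dual_basis R (P i) (carrier R) (S i) (u i) (\<theta> i)"
    and d_rlin: "rlin R (P (Suc i)) (P i) (d i)"
    and eps_rlin: "rlin R (P 0) X \<epsilon>"
    and eps_surj: "x \<in> carrier X ==> \<exists>y\<in>carrier (P 0). \<epsilon> y = x"
    and d_cycle: "w \<in> carrier (P (Suc i)) ==> cycle X P d \<epsilon> i (d i w)"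
    and exact: "y \<in> carrier (P i) ==> cycle X P d \<epsilon> i y ==> \<exists>w\<in>carrier (P (Suc i)). d i w = y"
begin

sublocale P: lmod R "P i" for i
  using dual[of i] by (simp add: dual_basis_def)

lemma P_lmod: "lmod R (P i)"
  by (rule P.lmod_axioms)

lemmas d_closed = rlin_closed[OF d_rlin]

lemma eps_d: "w \<in> carrier (P (Suc 0)) ==> \<epsilon> (d 0 w) = \<zero>\<^bsub>X\<^esub>"
  and d_d: "w' \<in> carrier (P (Suc (Suc i))) ==> d i (d (Suc i) w') = \<zero>\<^bsub>P i\<^esub>"
  using d_cycle[of w 0] d_cycle[of w' "Suc i"] by (simp_all add: cycle_simps)

end

locale complex_pair =
  C: proj_complex R X P d \<epsilon> S u \<theta> + C': proj_complex R X P' d' \<epsilon>' S' u' \<theta>'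
  for R :: "('r, 's) ring_scheme" and X :: "('r, 'x) module"
    and P :: "nat => ('r, 'p) module" and d \<epsilon> and S :: "nat => 'b set" and u \<theta>
    and P' :: "nat => ('r, 'q) module" and d' \<epsilon>' and S' :: "nat => 'c set" and u' \<theta>'
begin

lemma chain_map:
  "\<exists>s. (\<forall>i. rlin R (P i) (P' i) (s i)) \<and> (\<forall>x\<in>carrier (P 0). \<epsilon>' (s 0 x) = \<epsilon> x) \<and>
    (\<forall>i. \<forall>x\<in>carrier (P (Suc i)). d' i (s (Suc i) x) = s i (d i x))"
proof -
  \<comment> \<open>The induction hypothesis says that s d has values in cycles, which makes the
    next lift possible.\<close>
  define Pr where "Pr i s \<longleftrightarrow> rlin R (P i) (P' i) s \<and> (\<forall>x\<in>carrier (P (Suc i)). cycle X P' d' \<epsilon>' i (s (d i x))) \<and>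
    (i = 0 --> (\<forall>x\<in>carrier (P 0). \<epsilon>' (s x) = \<epsilon> x))" for i s
  have "\<exists>s. rlin R (P 0) (P' 0) s \<and> (\<forall>x\<in>carrier (P 0). \<epsilon>' (s x) = \<epsilon> x)"
    by (rule dual_basis.lifting[OF C.dual refl C'.P_lmod C.X_lmod C'.eps_rlin C.eps_rlin])
      (use C'.eps_surj rlin_closed[OF C.eps_rlin] in auto)
  then obtain s0 where "rlin R (P 0) (P' 0) s0" "\<forall>x\<in>carrier (P 0). \<epsilon>' (s0 x) = \<epsilon> x" by blast
  then have "Pr 0 s0" using C.eps_d C.d_closed by (auto simp: Pr_def cycle_simps)
  then have 0: "\<exists>s. Pr 0 s" by blast
  have Suc: "\<exists>s'. Pr (Suc i) s' \<and> (\<forall>x\<in>carrier (P (Suc i)). d' i (s' x) = s (d i x))" if "Pr i s" for i s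
  proof -
    have s: "rlin R (P i) (P' i) s" and sc: "!!x. x \<in> carrier (P (Suc i)) ==> cycle X P' d' \<epsilon>' i (s (d i x))"
      using that by (auto simp: Pr_def)
    have "\<exists>s'. rlin R (P (Suc i)) (P' (Suc i)) s' \<and> (\<forall>x\<in>carrier (P (Suc i)). d' i (s' x) = s (d i x))"
      by (rule dual_basis.lifting[OF C.dual refl C'.P_lmod C'.P_lmod C'.d_rlin rlin_comp[OF s C.d_rlin]])
        (rule C'.exact[OF rlin_closed[OF s C.d_closed] sc])
    then obtain s' where s': "rlin R (P (Suc i)) (P' (Suc i)) s'" "!!x. x \<in> carrier (P (Suc i)) ==> d' i (s' x) = s (d i x)"
      by blast
    have "d' i (s' (d (Suc i) x)) = \<zero>\<^bsub>P' i\<^esub>" if "x \<in> carrier (P (Suc (Suc i)))" for x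
      using s'(2)[OF C.d_closed[OF that]] C.d_d[OF that] rlin_zero[OF s C.P_lmod C'.P_lmod] by simp
    then show ?thesis using s' by (auto simp: Pr_def cycle_simps)
  qed
  from dependent_nat_choice[of Pr "\<lambda>i s s'. \<forall>x\<in>carrier (P (Suc i)). d' i (s' x) = s (d i x)", OF 0 Suc]
  obtain s where "!!i. Pr i (s i)" "!!i. \<forall>x\<in>carrier (P (Suc i)). d' i (s (Suc i) x) = s i (d i x)" by blast
  then show ?thesis unfolding Pr_def by blast
qed

text \<open>The conclusion starts in degree 1, because only Ext groups of positive degree are
  compared.\<close>

lemma null_homotopy:
  assumes \<phi>: "!!i. rlin R (P i) (P' i) (\<phi> i)" and \<phi>0: "!!x. x \<in> carrier (P 0) ==> \<epsilon>' (\<phi> 0 x) = \<zero>\<^bsub>X\<^esub>"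
    and \<phi>d: "!!i x. x \<in> carrier (P (Suc i)) ==> d' i (\<phi> (Suc i) x) = \<phi> i (d i x)"
  shows "\<exists>h. (\<forall>i. rlin R (P i) (P' (Suc i)) (h i)) \<and>
    (\<forall>i. \<forall>x\<in>carrier (P (Suc i)). d' (Suc i) (h (Suc i) x) = \<phi> (Suc i) x \<ominus>\<^bsub>P' (Suc i)\<^esub> h i (d i x))"
proof -
  \<comment> \<open>It is enough to remember that d h agrees with \<open>\<phi>\<close> on
    boundaries: this makes the map to be lifted in the next degree take values in cycles.\<close>
  define Pr where "Pr i h \<longleftrightarrow> rlin R (P i) (P' (Suc i)) h \<and> (\<forall>x\<in>carrier (P (Suc i)). d' i (h (d i x)) = \<phi> i (d i x))" for i h
  have "\<exists>h. rlin R (P 0) (P' (Suc 0)) h \<and> (\<forall>x\<in>carrier (P 0). d' 0 (h x) = \<phi> 0 x)"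
    by (rule dual_basis.lifting[OF C.dual refl C'.P_lmod C'.P_lmod C'.d_rlin \<phi>])
      (rule C'.exact, use \<phi>0 rlin_closed[OF \<phi>] in \<open>auto simp: cycle_simps\<close>)
  then obtain h0 where "rlin R (P 0) (P' (Suc 0)) h0" "\<forall>x\<in>carrier (P 0). d' 0 (h0 x) = \<phi> 0 x" by blast
  then have "Pr 0 h0" using C.d_closed by (auto simp: Pr_def)
  then have 0: "\<exists>h. Pr 0 h" by blast
  have Suc: "\<exists>h'. Pr (Suc i) h' \<and> (\<forall>x\<in>carrier (P (Suc i)). d' (Suc i) (h' x) = \<phi> (Suc i) x \<ominus>\<^bsub>P' (Suc i)\<^esub> h (d i x))"
    if "Pr i h" for i h
  proof -
    have h: "rlin R (P i) (P' (Suc i)) h" and hd: "!!x. x \<in> carrier (P (Suc i)) ==> d' i (h (d i x)) = \<phi> i (d i x)"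
      using that by (auto simp: Pr_def)
    let ?y = "\<lambda>x. \<phi> (Suc i) x \<ominus>\<^bsub>P' (Suc i)\<^esub> h (d i x)"
    have y: "rlin R (P (Suc i)) (P' (Suc i)) ?y"
      by (rule rlin_minus_map[OF C'.P_lmod \<phi> rlin_comp[OF h C.d_rlin]])
    have "\<exists>h'. rlin R (P (Suc i)) (P' (Suc (Suc i))) h' \<and> (\<forall>x\<in>carrier (P (Suc i)). d' (Suc i) (h' x) = ?y x)"
    proof (rule dual_basis.lifting[OF C.dual refl C'.P_lmod C'.P_lmod C'.d_rlin y], rule C'.exact)
      fix x assume x: "x \<in> carrier (P (Suc i))"
      show "?y x \<in> carrier (P' (Suc i))" by (rule rlin_closed[OF y x])
      have c: "\<phi> i (d i x) \<in> carrier (P' i)" by (rule rlin_closed[OF \<phi> C.d_closed[OF x]])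
      have "d' i (?y x) = \<phi> i (d i x) \<ominus>\<^bsub>P' i\<^esub> \<phi> i (d i x)"
        using rlin_diff[OF C'.d_rlin C'.P_lmod C'.P_lmod rlin_closed[OF \<phi> x] rlin_closed[OF h C.d_closed[OF x]]]
        by (simp add: hd[OF x] \<phi>d[OF x])
      then show "cycle X P' d' \<epsilon>' (Suc i) (?y x)" using C'.P.M.diff_self[OF c] by (simp add: cycle_simps)
    qed
    then obtain h' where h': "rlin R (P (Suc i)) (P' (Suc (Suc i))) h'" "!!x. x \<in> carrier (P (Suc i)) ==> d' (Suc i) (h' x) = ?y x"
      by blast
    have "d' (Suc i) (h' (d (Suc i) x)) = \<phi> (Suc i) (d (Suc i) x)" if x: "x \<in> carrier (P (Suc (Suc i)))" for x
      using h'(2)[OF C.d_closed[OF x]] C.d_d[OF x] rlin_zero[OF h C.P_lmod C'.P_lmod]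
        C'.P.M.diff_zero[OF rlin_closed[OF \<phi> C.d_closed[OF x]]] by simp
    then show ?thesis using h' by (auto simp: Pr_def)
  qed
  from dependent_nat_choice[of Pr "\<lambda>i h h'. \<forall>x\<in>carrier (P (Suc i)). d' (Suc i) (h' x) = \<phi> (Suc i) x \<ominus>\<^bsub>P' (Suc i)\<^esub> h (d i x)", OF 0 Suc]
  obtain h where "!!i. Pr i (h i)"
    "!!i. \<forall>x\<in>carrier (P (Suc i)). d' (Suc i) (h (Suc i) x) = \<phi> (Suc i) x \<ominus>\<^bsub>P' (Suc i)\<^esub> h i (d i x)" by blast
  then show ?thesis unfolding Pr_def by blast
qed

end

text \<open>A chain endomorphism over the identity of X is homotopic to the identity. The cocycle k
  kills the d h part of the homotopy, and what remains is the coboundary of t = k h.\<close>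

lemma chain_map_homotopic_id:
  assumes C: "proj_complex R X P d \<epsilon> S u \<theta>" and g: "!!i. rlin R (P i) (P i) (g i)"
    and g0: "!!x. x \<in> carrier (P 0) ==> \<epsilon> (g 0 x) = \<epsilon> x"
    and gd: "!!i x. x \<in> carrier (P (Suc i)) ==> d i (g (Suc i) x) = g i (d i x)"
    and Y: "lmod R Y" and k: "rlin R (P (Suc j)) Y k"
    and kd: "!!x. x \<in> carrier (P (Suc (Suc j))) ==> k (d (Suc j) x) = \<zero>\<^bsub>Y\<^esub>"
  shows "\<exists>t. rlin R (P j) Y t \<and> (\<forall>x\<in>carrier (P (Suc j)). k (g (Suc j) x) = k x \<oplus>\<^bsub>Y\<^esub> t (d j x))"
proof -
  interpret C: proj_complex R X P d \<epsilon> S u \<theta> by fact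
  interpret CC: complex_pair R X P d \<epsilon> S u \<theta> P d \<epsilon> S u \<theta> by (intro complex_pair.intro C)
  interpret Y: lmod R Y by fact
  let ?\<phi> = "\<lambda>i x. g i x \<ominus>\<^bsub>P i\<^esub> x"
  have \<phi>: "rlin R (P i) (P i) (?\<phi> i)" for i by (rule rlin_minus_map[OF C.P_lmod g rlin_id])
  have "\<epsilon> (?\<phi> 0 x) = \<zero>\<^bsub>X\<^esub>" if x: "x \<in> carrier (P 0)" for x
  proof -
    interpret X: lmod R X by (rule C.X_lmod)
    show ?thesis
      using rlin_diff[OF C.eps_rlin C.P_lmod C.X_lmod rlin_closed[OF g x] x] g0[OF x]
        X.M.diff_self[OF rlin_closed[OF C.eps_rlin x]] by simp
  qed
  moreover have "d i (?\<phi> (Suc i) x) = ?\<phi> i (d i x)" if x: "x \<in> carrier (P (Suc i))" for i x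
    using rlin_diff[OF C.d_rlin C.P_lmod C.P_lmod rlin_closed[OF g x] x] gd[OF x] by simp
  ultimately obtain h where h: "!!i. rlin R (P i) (P (Suc i)) (h i)"
    "!!i x. x \<in> carrier (P (Suc i)) ==> d (Suc i) (h (Suc i) x) = ?\<phi> (Suc i) x \<ominus>\<^bsub>P (Suc i)\<^esub> h i (d i x)"
    using CC.null_homotopy[of ?\<phi>, OF \<phi>] by blast
  have "k (g (Suc j) x) = k x \<oplus>\<^bsub>Y\<^esub> k (h j (d j x))" if x: "x \<in> carrier (P (Suc j))" for x
  proof -
    note kl = C.P_lmod Y
    have gx: "g (Suc j) x \<in> carrier (P (Suc j))" and hx: "h j (d j x) \<in> carrier (P (Suc j))"
      and \<phi>x: "?\<phi> (Suc j) x \<in> carrier (P (Suc j))"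
      using rlin_closed[OF g x] rlin_closed[OF h(1) C.d_closed[OF x]] rlin_closed[OF \<phi> x] by auto
    have "\<zero>\<^bsub>Y\<^esub> = k (?\<phi> (Suc j) x) \<ominus>\<^bsub>Y\<^esub> k (h j (d j x))"
      using kd[OF rlin_closed[OF h(1) x]] h(2)[OF x] rlin_diff[OF k kl \<phi>x hx] by simp
    then have "k (?\<phi> (Suc j) x) = k (h j (d j x))"
      using Y.M.diff_eq_zero_iff[OF rlin_closed[OF k \<phi>x] rlin_closed[OF k hx]] by simp
    then have "k (g (Suc j) x) \<ominus>\<^bsub>Y\<^esub> k x = k (h j (d j x))" using rlin_diff[OF k kl gx x] by simp
    then show ?thesis
      using Y.M.diff_add_cancel[OF rlin_closed[OF k gx] rlin_closed[OF k x]]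
        Y.M.a_comm[OF rlin_closed[OF k x] rlin_closed[OF k hx]] by simp
  qed
  then show ?thesis using rlin_comp[OF k h(1)] by blast
qed

context complex_pair
begin

context
  fixes f :: "nat => 'q => 'p" and Y :: "('r, 'y) module"
  assumes f: "!!i. rlin R (P' i) (P i) (f i)" "!!x. x \<in> carrier (P' 0) ==> \<epsilon> (f 0 x) = \<epsilon>' x"
      "!!i x. x \<in> carrier (P' (Suc i)) ==> d i (f (Suc i) x) = f i (d' i x)"
    and Y: "lmod R Y"
begin

interpretation Y: lmod R Y by (rule Y)

text \<open>There is a chain map s in the opposite direction. The homotopy from f s to the identity
  turns a coboundary representing the pullback of k along f into one representing k.\<close>

lemma cohomology_inj:
  assumes k: "rlin R (P (Suc j)) Y k" "!!x. x \<in> carrier (P (Suc (Suc j))) ==> k (d (Suc j) x) = \<zero>\<^bsub>Y\<^esub>"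
    and g: "rlin R (P' j) Y g" "!!x. x \<in> carrier (P' (Suc j)) ==> k (f (Suc j) x) = g (d' j x)"
  shows "\<exists>t. rlin R (P j) Y t \<and> (\<forall>x\<in>carrier (P (Suc j)). k x = t (d j x))"
proof -
  obtain s where s: "!!i. rlin R (P i) (P' i) (s i)" "!!x. x \<in> carrier (P 0) ==> \<epsilon>' (s 0 x) = \<epsilon> x"
    "!!i x. x \<in> carrier (P (Suc i)) ==> d' i (s (Suc i) x) = s i (d i x)" using chain_map by blast
  have "\<exists>t. rlin R (P j) Y t \<and> (\<forall>x\<in>carrier (P (Suc j)). k (f (Suc j) (s (Suc j) x)) = k x \<oplus>\<^bsub>Y\<^esub> t (d j x))"
  proof (rule chain_map_homotopic_id[where g = "\<lambda>i x. f i (s i x)", OF C.proj_complex_axioms _ _ _ Y k])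
    show "rlin R (P i) (P i) (\<lambda>x. f i (s i x))" for i by (rule rlin_comp[OF f(1) s(1)])
    show "\<epsilon> (f 0 (s 0 x)) = \<epsilon> x" if "x \<in> carrier (P 0)" for x
      using f(2)[OF rlin_closed[OF s(1) that]] s(2)[OF that] by simp
    show "d i (f (Suc i) (s (Suc i) x)) = f i (s i (d i x))" if "x \<in> carrier (P (Suc i))" for i x
      using f(3)[OF rlin_closed[OF s(1) that]] s(3)[OF that] by simp
  qed
  then obtain t where t: "rlin R (P j) Y t"
    "!!x. x \<in> carrier (P (Suc j)) ==> k (f (Suc j) (s (Suc j) x)) = k x \<oplus>\<^bsub>Y\<^esub> t (d j x)" by blast
  let ?t = "\<lambda>x. g (s j x) \<ominus>\<^bsub>Y\<^esub> t x"
  have "k x = ?t (d j x)" if x: "x \<in> carrier (P (Suc j))" for x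
  proof -
    have "g (s j (d j x)) = k x \<oplus>\<^bsub>Y\<^esub> t (d j x)"
      using t(2)[OF x] g(2)[OF rlin_closed[OF s(1) x]] s(3)[OF x] by simp
    then show ?thesis
      using Y.M.add_diff_cancel[OF rlin_closed[OF k(1) x] rlin_closed[OF t(1) C.d_closed[OF x]]] by simp
  qed
  moreover have "rlin R (P j) Y ?t" by (rule rlin_minus_map[OF Y rlin_comp[OF g(1) s(1)] t(1)])
  ultimately show ?thesis by blast
qed

text \<open>The preimage is k s, and the homotopy from s f to the identity shows that its pullback
  differs from k by a coboundary.\<close>

lemma cohomology_surj:
  assumes k: "rlin R (P' (Suc j)) Y k" "!!x. x \<in> carrier (P' (Suc (Suc j))) ==> k (d' (Suc j) x) = \<zero>\<^bsub>Y\<^esub>"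
  shows "\<exists>h t. rlin R (P (Suc j)) Y h \<and> (\<forall>x\<in>carrier (P (Suc (Suc j))). h (d (Suc j) x) = \<zero>\<^bsub>Y\<^esub>) \<and>
    rlin R (P' j) Y t \<and> (\<forall>x\<in>carrier (P' (Suc j)). h (f (Suc j) x) = k x \<oplus>\<^bsub>Y\<^esub> t (d' j x))"
proof -
  obtain s where s: "!!i. rlin R (P i) (P' i) (s i)" "!!x. x \<in> carrier (P 0) ==> \<epsilon>' (s 0 x) = \<epsilon> x"
    "!!i x. x \<in> carrier (P (Suc i)) ==> d' i (s (Suc i) x) = s i (d i x)" using chain_map by blast
  have "\<exists>t. rlin R (P' j) Y t \<and> (\<forall>x\<in>carrier (P' (Suc j)). k (s (Suc j) (f (Suc j) x)) = k x \<oplus>\<^bsub>Y\<^esub> t (d' j x))"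
  proof (rule chain_map_homotopic_id[where g = "\<lambda>i x. s i (f i x)", OF C'.proj_complex_axioms _ _ _ Y k])
    show "rlin R (P' i) (P' i) (\<lambda>x. s i (f i x))" for i by (rule rlin_comp[OF s(1) f(1)])
    show "\<epsilon>' (s 0 (f 0 x)) = \<epsilon>' x" if "x \<in> carrier (P' 0)" for x
      using s(2)[OF rlin_closed[OF f(1) that]] f(2)[OF that] by simp
    show "d' i (s (Suc i) (f (Suc i) x)) = s i (f i (d' i x))" if "x \<in> carrier (P' (Suc i))" for i x
      using s(3)[OF rlin_closed[OF f(1) that]] f(3)[OF that] by simp
  qed
  moreover have "k (s (Suc j) (d (Suc j) x)) = \<zero>\<^bsub>Y\<^esub>" if x: "x \<in> carrier (P (Suc (Suc j)))" for x
    using k(2)[OF rlin_closed[OF s(1) x]] s(3)[OF x] by simp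
  moreover have "rlin R (P (Suc j)) Y (\<lambda>x. k (s (Suc j) x))" by (rule rlin_comp[OF k(1) s(1)])
  ultimately show ?thesis by blast
qed

end

end

section \<open>Ext groups over an algebra A and over its quotient A/I\<close>

section \<open>Ext groups\<close>

lemma hom_group_sub:
  assumes M: "lmod R M" and N: "lmod R N" and H: "H \<subseteq> mod_hom R M N"
    and zero: "(\<lambda>x\<in>carrier M. \<zero>\<^bsub>N\<^esub>) \<in> H"
    and diff: "!!g h. g \<in> H ==> h \<in> H ==> (\<lambda>x\<in>carrier M. g x \<ominus>\<^bsub>N\<^esub> h x) \<in> H"
  shows "comm_group ((hom_group R M N)\<lparr>carrier := H\<rparr>)"
proof -
  interpret M: lmod R M by fact
  interpret N: lmod R N by fact
  have c: "h x \<in> carrier N" if "h \<in> H" "x \<in> carrier M" for h x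
    using that H mod_hom_closed[of h] by blast
  have ext: "h \<in> extensional (carrier M)" if "h \<in> H" for h
    using that H by (auto simp: mod_hom_rlin)
  have minus: "(\<lambda>x\<in>carrier M. \<ominus>\<^bsub>N\<^esub> h x) \<in> H" if h: "h \<in> H" for h
  proof -
    have "(\<lambda>x\<in>carrier M. \<ominus>\<^bsub>N\<^esub> h x) = (\<lambda>x\<in>carrier M. (\<lambda>x\<in>carrier M. \<zero>\<^bsub>N\<^esub>) x \<ominus>\<^bsub>N\<^esub> h x)"
      by (rule restrict_ext) (use c[OF h] in \<open>simp add: a_minus_def\<close>)
    then show ?thesis using diff[OF zero h] by simp
  qed
  have add: "(\<lambda>x\<in>carrier M. g x \<oplus>\<^bsub>N\<^esub> h x) \<in> H" if g: "g \<in> H" and h: "h \<in> H" for g h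
  proof -
    have "(\<lambda>x\<in>carrier M. g x \<oplus>\<^bsub>N\<^esub> h x) = (\<lambda>x\<in>carrier M. g x \<ominus>\<^bsub>N\<^esub> (\<lambda>x\<in>carrier M. \<ominus>\<^bsub>N\<^esub> h x) x)"
      by (rule restrict_ext) (use c[OF h] in \<open>simp add: a_minus_def\<close>)
    then show ?thesis using diff[OF g minus[OF h]] by simp
  qed
  show ?thesis
  proof (rule comm_groupI, simp_all add: hom_group_def)
    show "(\<lambda>x\<in>carrier M. g x \<oplus>\<^bsub>N\<^esub> h x) \<in> H" if "g \<in> H" "h \<in> H" for g h by (rule add[OF that])
    show "(\<lambda>x\<in>carrier M. \<zero>\<^bsub>N\<^esub>) \<in> H" by (rule zero)
    show "(\<lambda>x\<in>carrier M. (if x \<in> carrier M then g x \<oplus>\<^bsub>N\<^esub> h x else undefined) \<oplus>\<^bsub>N\<^esub> k x) =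
        (\<lambda>x\<in>carrier M. g x \<oplus>\<^bsub>N\<^esub> (if x \<in> carrier M then h x \<oplus>\<^bsub>N\<^esub> k x else undefined))"
      if "g \<in> H" "h \<in> H" "k \<in> H" for g h k
      by (rule restrict_ext) (use that c N.M.a_assoc in simp)
    show "(\<lambda>x\<in>carrier M. g x \<oplus>\<^bsub>N\<^esub> h x) = (\<lambda>x\<in>carrier M. h x \<oplus>\<^bsub>N\<^esub> g x)" if "g \<in> H" "h \<in> H" for g h
      by (rule restrict_ext) (use that c N.M.a_comm in simp)
    show "(\<lambda>x\<in>carrier M. (if x \<in> carrier M then \<zero>\<^bsub>N\<^esub> else undefined) \<oplus>\<^bsub>N\<^esub> h x) = h" if "h \<in> H" for h
      by (rule extensionalityI[OF restrict_extensional ext[OF that]]) (use that c in simp)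
    show "\<exists>g\<in>H. (\<lambda>x\<in>carrier M. g x \<oplus>\<^bsub>N\<^esub> h x) = (\<lambda>x\<in>carrier M. \<zero>\<^bsub>N\<^esub>)" if "h \<in> H" for h
    proof (rule bexI[OF _ minus[OF that]])
      show "(\<lambda>x\<in>carrier M. (\<lambda>x\<in>carrier M. \<ominus>\<^bsub>N\<^esub> h x) x \<oplus>\<^bsub>N\<^esub> h x) = (\<lambda>x\<in>carrier M. \<zero>\<^bsub>N\<^esub>)"
        by (rule restrict_ext) (use that c N.M.l_neg in simp)
    qed
  qed
qed

text \<open>The map is written as a union of cosets in order to match \<open>ext_map\<close>; all
  members of the union agree because \<open>\<phi>\<close> maps N into N'. Bijectivity is formulated
  on representatives.\<close>

lemma FactGroup_iso:
  assumes G: "comm_group G" and G': "comm_group G'" and N: "subgroup N G" and N': "subgroup N' G'"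
    and \<phi>: "\<phi> \<in> hom G G'" and sub: "!!x. x \<in> N ==> \<phi> x \<in> N'"
    and inj: "!!x. x \<in> carrier G ==> \<phi> x \<in> N' ==> x \<in> N"
    and surj: "!!y. y \<in> carrier G' ==> \<exists>x\<in>carrier G. \<exists>z\<in>N'. \<phi> x = z \<otimes>\<^bsub>G'\<^esub> y"
  shows "(\<lambda>H. \<Union>h\<in>H. N' #>\<^bsub>G'\<^esub> \<phi> h) \<in> iso (G Mod N) (G' Mod N')"
proof -
  interpret G: comm_group G by fact
  interpret G': comm_group G' by fact
  interpret N: normal N G by (rule G.subgroup_imp_normal[OF N])
  interpret N': normal N' G' by (rule G'.subgroup_imp_normal[OF N'])
  interpret h: group_hom G G' \<phi> by (intro group_hom.intro group_hom_axioms.intro G.group_axioms G'.group_axioms \<phi>)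
  let ?\<Phi> = "\<lambda>H. \<Union>h\<in>H. N' #>\<^bsub>G'\<^esub> \<phi> h"
  have \<Phi>: "?\<Phi> (N #>\<^bsub>G\<^esub> x) = N' #>\<^bsub>G'\<^esub> \<phi> x" if x: "x \<in> carrier G" for x
  proof -
    have "N' #>\<^bsub>G'\<^esub> \<phi> h = N' #>\<^bsub>G'\<^esub> \<phi> x" if h: "h \<in> N #>\<^bsub>G\<^esub> x" for h
    proof -
      obtain z where z: "z \<in> N" "h = z \<otimes>\<^bsub>G\<^esub> x" using h by (auto simp: r_coset_def)
      have "\<phi> h = \<phi> z \<otimes>\<^bsub>G'\<^esub> \<phi> x" using z x N.subset by auto
      then have "\<phi> h \<in> N' #>\<^bsub>G'\<^esub> \<phi> x" using sub[OF z(1)] by (auto simp: r_coset_def)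
      then show ?thesis using G'.repr_independence[OF _ _ N'] x by simp
    qed
    moreover have "x \<in> N #>\<^bsub>G\<^esub> x" by (rule G.rcos_self[OF x N])
    ultimately show ?thesis by blast
  qed
  have car: "\<exists>x\<in>carrier G. H = N #>\<^bsub>G\<^esub> x" if "H \<in> carrier (G Mod N)" for H
    using that by (auto simp: FactGroup_def RCOSETS_def)
  show ?thesis
  proof (rule isoI)
    show "?\<Phi> \<in> hom (G Mod N) (G' Mod N')"
    proof (rule homI)
      fix H assume "H \<in> carrier (G Mod N)"
      then obtain x where "x \<in> carrier G" "H = N #>\<^bsub>G\<^esub> x" using car by blast
      then show "?\<Phi> H \<in> carrier (G' Mod N')" using \<Phi> by (auto simp: FactGroup_def RCOSETS_def)
    next
      fix H H' assume "H \<in> carrier (G Mod N)" "H' \<in> carrier (G Mod N)"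
      then obtain x x' where x: "x \<in> carrier G" "H = N #>\<^bsub>G\<^esub> x" "x' \<in> carrier G" "H' = N #>\<^bsub>G\<^esub> x'" using car by metis
      have "H \<otimes>\<^bsub>G Mod N\<^esub> H' = N #>\<^bsub>G\<^esub> (x \<otimes>\<^bsub>G\<^esub> x')" using x N.rcos_sum by (simp add: FactGroup_def)
      then show "?\<Phi> (H \<otimes>\<^bsub>G Mod N\<^esub> H') = ?\<Phi> H \<otimes>\<^bsub>G' Mod N'\<^esub> ?\<Phi> H'"
        using \<Phi>[of x] \<Phi>[of x'] \<Phi>[of "x \<otimes>\<^bsub>G\<^esub> x'"] x N'.rcos_sum by (simp add: FactGroup_def)
    qed
    show "bij_betw ?\<Phi> (carrier (G Mod N)) (carrier (G' Mod N'))"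
    proof (rule bij_betwI')
      fix H H' assume "H \<in> carrier (G Mod N)" "H' \<in> carrier (G Mod N)"
      then obtain x x' where x: "x \<in> carrier G" "H = N #>\<^bsub>G\<^esub> x" "x' \<in> carrier G" "H' = N #>\<^bsub>G\<^esub> x'" using car by metis
      show "?\<Phi> H = ?\<Phi> H' \<longleftrightarrow> H = H'"
      proof
        assume "?\<Phi> H = ?\<Phi> H'"
        then have "N' #>\<^bsub>G'\<^esub> \<phi> x = N' #>\<^bsub>G'\<^esub> \<phi> x'" using \<Phi> x by simp
        then have "\<phi> x \<in> N' #>\<^bsub>G'\<^esub> \<phi> x'" using G'.rcos_self[OF _ N', of "\<phi> x"] x by simp
        then have "\<phi> x \<otimes>\<^bsub>G'\<^esub> inv\<^bsub>G'\<^esub> \<phi> x' \<in> N'"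
          using N'.rcos_module_imp[OF G'.group_axioms, of "\<phi> x'" "\<phi> x"] x by simp
        then have "\<phi> (x \<otimes>\<^bsub>G\<^esub> inv\<^bsub>G\<^esub> x') \<in> N'" using x by simp
        then have "x \<otimes>\<^bsub>G\<^esub> inv\<^bsub>G\<^esub> x' \<in> N" using inj x by simp
        then have "x \<in> N #>\<^bsub>G\<^esub> x'" using N.rcos_module_rev[OF G.group_axioms, of x' x] x by simp
        then show "H = H'" using G.repr_independence[OF _ _ N] x by simp
      qed simp
    next
      fix H assume "H \<in> carrier (G Mod N)"
      then obtain x where "x \<in> carrier G" "H = N #>\<^bsub>G\<^esub> x" using car by blast
      then show "?\<Phi> H \<in> carrier (G' Mod N')" using \<Phi> by (auto simp: FactGroup_def RCOSETS_def)
    next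
      fix H assume "H \<in> carrier (G' Mod N')"
      then obtain y where y: "y \<in> carrier G'" "H = N' #>\<^bsub>G'\<^esub> y" by (auto simp: FactGroup_def RCOSETS_def)
      obtain x z where x: "x \<in> carrier G" "z \<in> N'" "\<phi> x = z \<otimes>\<^bsub>G'\<^esub> y" using surj[OF y(1)] by blast
      then have "\<phi> x \<in> N' #>\<^bsub>G'\<^esub> y" by (auto simp: r_coset_def)
      then have "H = ?\<Phi> (N #>\<^bsub>G\<^esub> x)" using \<Phi>[OF x(1)] G'.repr_independence[OF _ y(1) N'] y(2) by simp
      moreover have "N #>\<^bsub>G\<^esub> x \<in> carrier (G Mod N)" using x by (auto simp: FactGroup_def RCOSETS_def)
      ultimately show "\<exists>x\<in>carrier (G Mod N). H = ?\<Phi> x" by blast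
    qed
  qed
qed

lemma ext_cocycles_iff:
  assumes d: "!!i. d i \<in> mod_hom R (P (Suc i)) (P i)"
  shows "h \<in> carrier (ext_cocycles R P d Y i) \<longleftrightarrow>
    h \<in> mod_hom R (P i) Y \<and> (\<forall>x\<in>carrier (P (Suc i)). h (d i x) = \<zero>\<^bsub>Y\<^esub>)"
  by (auto simp: ext_cocycles_def compose_def restrict_def fun_eq_iff)

lemma ext_cocycles_ops:
  "g \<otimes>\<^bsub>ext_cocycles R P d Y i\<^esub> h = (\<lambda>x\<in>carrier (P i). g x \<oplus>\<^bsub>Y\<^esub> h x)"
  "\<one>\<^bsub>ext_cocycles R P d Y i\<^esub> = (\<lambda>x\<in>carrier (P i). \<zero>\<^bsub>Y\<^esub>)"
  by (simp_all add: ext_cocycles_def hom_group_def)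

lemma ext_cocycles_comm_group:
  fixes i :: nat
  assumes P: "!!i. lmod R (P i)" and d: "!!i. d i \<in> mod_hom R (P (Suc i)) (P i)" and Y: "lmod R Y"
  shows "comm_group (ext_cocycles R P d Y i)"
proof -
  interpret P: lmod R "P l" for l by (rule P)
  interpret Y: lmod R Y by (rule Y)
  note iff = ext_cocycles_iff[of d R P, OF d, of _ Y, unfolded ext_cocycles_def, simplified]
  let ?H = "{h \<in> mod_hom R (P i) Y. compose (carrier (P (Suc i))) h (d i) = (\<lambda>x\<in>carrier (P (Suc i)). \<zero>\<^bsub>Y\<^esub>)}"
  have "rlin R (P i) Y (\<lambda>x. \<zero>\<^bsub>Y\<^esub>)" by (auto simp: rlin_def additive_map_def)
  then have zero: "(\<lambda>x\<in>carrier (P i). \<zero>\<^bsub>Y\<^esub>) \<in> ?H"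
    using restrict_mod_hom[OF P] mod_hom_closed[OF d] by (simp add: iff)
  have diff: "(\<lambda>x\<in>carrier (P i). g x \<ominus>\<^bsub>Y\<^esub> h x) \<in> ?H" if "g \<in> ?H" "h \<in> ?H" for g h
  proof -
    have "rlin R (P i) Y (\<lambda>x. g x \<ominus>\<^bsub>Y\<^esub> h x)" by (rule rlin_minus_map[OF Y]) (use that in \<open>simp_all add: mod_hom_rlin\<close>)
    then show ?thesis
      using restrict_mod_hom[OF P] that mod_hom_closed[OF d] by (simp add: iff a_minus_def)
  qed
  show ?thesis
    unfolding ext_cocycles_def by (rule hom_group_sub[of R "P i", OF P Y _ zero diff]) auto
qed

lemma ext_coboundaries_iff:
  "h \<in> ext_coboundaries R P d Y (Suc j) \<longleftrightarrow>
    h \<in> extensional (carrier (P (Suc j))) \<and> (\<exists>g\<in>mod_hom R (P j) Y. \<forall>x\<in>carrier (P (Suc j)). h x = g (d j x))"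
proof
  assume "h \<in> ext_coboundaries R P d Y (Suc j)"
  then show "h \<in> extensional (carrier (P (Suc j))) \<and> (\<exists>g\<in>mod_hom R (P j) Y. \<forall>x\<in>carrier (P (Suc j)). h x = g (d j x))"
    by (auto simp: ext_coboundaries_def compose_def)
next
  assume "h \<in> extensional (carrier (P (Suc j))) \<and> (\<exists>g\<in>mod_hom R (P j) Y. \<forall>x\<in>carrier (P (Suc j)). h x = g (d j x))"
  then obtain g where "h \<in> extensional (carrier (P (Suc j)))" "g \<in> mod_hom R (P j) Y" "\<forall>x\<in>carrier (P (Suc j)). h x = g (d j x)" by blast
  then have "h = compose (carrier (P (Suc j))) g (d j)"
    by (intro extensionalityI[of _ "carrier (P (Suc j))"]) (auto simp: compose_def)
  then show "h \<in> ext_coboundaries R P d Y (Suc j)" using \<open>g \<in> mod_hom R (P j) Y\<close> by (auto simp: ext_coboundaries_def)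
qed

lemma ext_coboundaries_subgroup:
  assumes P: "!!i. lmod R (P i)" and d: "!!i. d i \<in> mod_hom R (P (Suc i)) (P i)" and Y: "lmod R Y"
    and dd: "!!x. x \<in> carrier (P (Suc (Suc j))) ==> d j (d (Suc j) x) = \<zero>\<^bsub>P j\<^esub>"
  shows "subgroup (ext_coboundaries R P d Y (Suc j)) (ext_cocycles R P d Y (Suc j))"
proof -
  interpret P: lmod R "P l" for l by (rule P)
  interpret Y: lmod R Y by (rule Y)
  let ?G = "ext_cocycles R P d Y (Suc j)" and ?\<delta> = "\<lambda>g. compose (carrier (P (Suc j))) g (d j)"
  note dr = d[unfolded mod_hom_rlin, THEN conjunct2]
  have "rlin R (P j) Y (\<lambda>x. \<zero>\<^bsub>Y\<^esub>)" by (auto simp: rlin_def additive_map_def)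
  then have zero: "(\<lambda>x\<in>carrier (P j). \<zero>\<^bsub>Y\<^esub>) \<in> mod_hom R (P j) Y" by (rule restrict_mod_hom[OF P])
  have diff: "(\<lambda>x\<in>carrier (P j). g x \<ominus>\<^bsub>Y\<^esub> h x) \<in> mod_hom R (P j) Y" if "g \<in> mod_hom R (P j) Y" "h \<in> mod_hom R (P j) Y" for g h
    by (rule restrict_mod_hom[OF P rlin_minus_map[OF Y]]) (use that in \<open>simp_all add: mod_hom_rlin\<close>)
  have "(hom_group R (P j) Y)\<lparr>carrier := mod_hom R (P j) Y\<rparr> = hom_group R (P j) Y" by (simp add: hom_group_def)
  with hom_group_sub[of R "P j" Y "mod_hom R (P j) Y", OF P Y subset_refl zero diff]
  have G0: "comm_group (hom_group R (P j) Y)" by metis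
  have "group_hom (hom_group R (P j) Y) ?G ?\<delta>"
  proof (intro group_hom.intro group_hom_axioms.intro homI)
    show "group (hom_group R (P j) Y)" "group ?G"
      using G0 ext_cocycles_comm_group[of R P d, OF P d Y] by (auto simp: comm_group_def)
    fix g assume "g \<in> carrier (hom_group R (P j) Y)"
    then have gr: "rlin R (P j) Y g" by (simp add: hom_group_def mod_hom_rlin)
    have "?\<delta> g (d (Suc j) x) = \<zero>\<^bsub>Y\<^esub>" if "x \<in> carrier (P (Suc (Suc j)))" for x
      using rlin_closed[OF dr that] dd[OF that] rlin_zero[OF gr P Y] by (simp add: compose_def)
    then show "?\<delta> g \<in> carrier ?G"
      using restrict_mod_hom[OF P rlin_comp[OF gr dr]] by (simp add: ext_cocycles_iff[of d R P, OF d] compose_def)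
    fix h
    show "?\<delta> (g \<otimes>\<^bsub>hom_group R (P j) Y\<^esub> h) = ?\<delta> g \<otimes>\<^bsub>?G\<^esub> ?\<delta> h"
      using rlin_closed[OF dr] by (simp add: ext_cocycles_ops hom_group_def compose_def cong: restrict_cong)
  qed
  from group_hom.img_is_subgroup[OF this] show ?thesis by (simp add: ext_coboundaries_def hom_group_def)
qed

subsection \<open>Reduction of a resolution modulo an ideal\<close>

text \<open>Inverse to \<open>restrict_scalars\<close> on modules killed by the ideal: a coset acts
  through an arbitrarily chosen element of it, and \<open>factor_smult\<close> shows that the choice
  does not matter.\<close>

definition factor_scalars :: "('a, 'm) module => ('a set, 'm) module" where
  "factor_scalars M = \<lparr>carrier = carrier M, mult = mult M, one = \<one>\<^bsub>M\<^esub>, zero = \<zero>\<^bsub>M\<^esub>, add = add M,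
     smult = (\<lambda>V x. (SOME a. a \<in> V) \<odot>\<^bsub>M\<^esub> x)\<rparr>"

lemma factor_simps [simp]:
  "carrier (factor_scalars M) = carrier M" "\<zero>\<^bsub>factor_scalars M\<^esub> = \<zero>\<^bsub>M\<^esub>"
  "x \<oplus>\<^bsub>factor_scalars M\<^esub> y = x \<oplus>\<^bsub>M\<^esub> y"
  by (simp_all add: factor_scalars_def)

lemma restrict_simps [simp]:
  "carrier (restrict_scalars A I M) = carrier M" "\<zero>\<^bsub>restrict_scalars A I M\<^esub> = \<zero>\<^bsub>M\<^esub>"
  "x \<oplus>\<^bsub>restrict_scalars A I M\<^esub> y = x \<oplus>\<^bsub>M\<^esub> y"
  "a \<odot>\<^bsub>restrict_scalars A I M\<^esub> x = (I +>\<^bsub>A\<^esub> a) \<odot>\<^bsub>M\<^esub> x"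
  by (simp_all add: restrict_scalars_def)

lemma factor_abelian_group: "abelian_group M ==> abelian_group (factor_scalars M)"
  by (erule abelian_group_cong) (simp_all add: factor_scalars_def)

lemma restrict_abelian_group: "abelian_group M ==> abelian_group (restrict_scalars A I M)"
  by (erule abelian_group_cong) (simp_all add: restrict_scalars_def)

locale ideal_quot = A: ring A + id: ideal I A for I and A :: "('a, 's) ring_scheme"
begin

abbreviation "R \<equiv> A Quot I"
abbreviation "cl a \<equiv> I +>\<^bsub>A\<^esub> a"

lemma I_sub: "I \<subseteq> carrier A"
  using id.Icarr by auto

lemma R_carrierE:
  assumes "V \<in> carrier R"
  obtains a where "a \<in> carrier A" "V = cl a"
  using assms by (auto simp: FactRing_def A_RCOSETS_def')

lemma cl_closed [simp]: "a \<in> carrier A ==> cl a \<in> carrier R"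
  by (auto simp: FactRing_def A_RCOSETS_def')

lemma cl_ops:
  "a \<in> carrier A ==> b \<in> carrier A ==> cl a \<oplus>\<^bsub>R\<^esub> cl b = cl (a \<oplus>\<^bsub>A\<^esub> b)"
  "a \<in> carrier A ==> b \<in> carrier A ==> cl a \<otimes>\<^bsub>R\<^esub> cl b = cl (a \<otimes>\<^bsub>A\<^esub> b)"
  "\<one>\<^bsub>R\<^esub> = cl \<one>\<^bsub>A\<^esub>"
  by (simp_all add: FactRing_def id.a_rcos_sum id.rcoset_mult_add)

lemma cl_zero: "a \<in> I ==> cl a = \<zero>\<^bsub>R\<^esub>"
  using A.a_coset_join2[OF id.Icarr id.a_subgroup] by (simp add: FactRing_def)

lemma R_ring: "ring R"
  by (rule id.quotient_is_ring)

lemma restrict_lmod: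
  assumes "lmod R M"
  shows "lmod A (restrict_scalars A I M)"
proof -
  interpret M: lmod R M by fact
  show ?thesis
  proof (intro lmod.intro lmod_axioms.intro A.ring_axioms restrict_abelian_group M.M.ag)
    fix a b x y assume ab: "a \<in> carrier A" "b \<in> carrier A" and x: "x \<in> carrier (restrict_scalars A I M)" "y \<in> carrier (restrict_scalars A I M)"
    then show "(a \<oplus>\<^bsub>A\<^esub> b) \<odot>\<^bsub>restrict_scalars A I M\<^esub> x = a \<odot>\<^bsub>restrict_scalars A I M\<^esub> x \<oplus>\<^bsub>restrict_scalars A I M\<^esub> b \<odot>\<^bsub>restrict_scalars A I M\<^esub> x"
      using M.smult_l_distr[of "cl a" "cl b" x] by (simp add: cl_ops)
    show "(a \<otimes>\<^bsub>A\<^esub> b) \<odot>\<^bsub>restrict_scalars A I M\<^esub> x = a \<odot>\<^bsub>restrict_scalars A I M\<^esub> (b \<odot>\<^bsub>restrict_scalars A I M\<^esub> x)"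
      using ab x M.smult_assoc[of "cl a" "cl b" x] by (simp add: cl_ops)
  next
    fix x assume "x \<in> carrier (restrict_scalars A I M)"
    then show "\<one>\<^bsub>A\<^esub> \<odot>\<^bsub>restrict_scalars A I M\<^esub> x = x" using M.smult_one[of x] by (simp add: cl_ops(3))
  qed (auto simp: M.smult_r_distr)
qed

lemma restrict_kills:
  assumes "lmod R M" "a \<in> I" "x \<in> carrier M"
  shows "cl a \<odot>\<^bsub>M\<^esub> x = \<zero>\<^bsub>M\<^esub>"
proof -
  interpret M: lmod R M by fact
  show ?thesis using assms by (simp add: cl_zero)
qed

context
  fixes M :: "('a, 'm) module"
  assumes M: "lmod A M" and kills: "!!a x. a \<in> I ==> x \<in> carrier M ==> a \<odot>\<^bsub>M\<^esub> x = \<zero>\<^bsub>M\<^esub>"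
begin

interpretation M: lmod A M by (rule M)

lemma factor_smult:
  assumes a: "a \<in> carrier A" and x: "x \<in> carrier M"
  shows "cl a \<odot>\<^bsub>factor_scalars M\<^esub> x = a \<odot>\<^bsub>M\<^esub> x"
proof -
  let ?b = "SOME b. b \<in> cl a"
  have "a \<in> cl a" by (rule id.a_rcos_self[OF a])
  then have b: "?b \<in> cl a" by (rule someI)
  then obtain i where i: "i \<in> I" "?b = i \<oplus>\<^bsub>A\<^esub> a" by (auto simp: a_r_coset_def')
  then have "?b \<odot>\<^bsub>M\<^esub> x = i \<odot>\<^bsub>M\<^esub> x \<oplus>\<^bsub>M\<^esub> a \<odot>\<^bsub>M\<^esub> x"
    using M.smult_l_distr[of i a x] a x id.Icarr by simp
  then show ?thesis using kills[OF i(1) x] a x by (simp add: factor_scalars_def)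
qed

lemma factor_lmod: "lmod R (factor_scalars M)"
  by (intro lmod.intro lmod_axioms.intro R_ring factor_abelian_group M.M.ag)
    (auto elim!: R_carrierE simp: factor_smult cl_ops M.smult_l_distr M.smult_r_distr M.smult_assoc)

end

context
  fixes X :: "('a set, 'x) module" and Q :: "nat => ('a, 'q) module" and d \<epsilon>
  assumes X: "lmod R X" and res: "resolution A (restrict_scalars A I X) Q d \<epsilon>"
    and ex: "resolution.exact_idl Q d I"
begin

interpretation Q: resolution A "restrict_scalars A I X" Q d \<epsilon> by (rule res)

lemma IQ_submod: "submod A (Q i) (idl I (Q i))"
  by (rule submodI[OF Q.Q_lmod Q.Q.idl_subgroup[OF I_sub]]) (rule Q.Q.idl_smult[OF id.ideal_axioms])

interpretation IQ: submod A "Q i" "idl I (Q i)" for i by (rule IQ_submod)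

definition qcl :: "nat => 'q => 'q set" where "qcl i q = idl I (Q i) +>\<^bsub>Q i\<^esub> q"

definition Qb :: "nat => ('a set, 'q set) module" where
  "Qb i = factor_scalars (quot_module (Q i) (idl I (Q i)))"

lemma quot_kills:
  assumes a: "a \<in> I" and V: "V \<in> carrier (quot_module (Q i) (idl I (Q i)))"
  shows "a \<odot>\<^bsub>quot_module (Q i) (idl I (Q i))\<^esub> V = \<zero>\<^bsub>quot_module (Q i) (idl I (Q i))\<^esub>"
proof -
  obtain q where q: "q \<in> carrier (Q i)" "V = idl I (Q i) +>\<^bsub>Q i\<^esub> q" using V by (rule IQ.quot_carrierE)
  have "a \<odot>\<^bsub>Q i\<^esub> q \<in> carrier (Q i)" using q id.Icarr[OF a] by simp
  then show ?thesis
    using q IQ.coset_smult[OF id.Icarr[OF a] q(1)] IQ.coset_zero_iff Q.Q.idl_incl[OF a q(1)] by simp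
qed

lemma Qb_lmod: "lmod R (Qb i)"
  unfolding Qb_def by (rule factor_lmod[OF IQ.quot_lmod quot_kills])

lemma QbE:
  assumes "V \<in> carrier (Qb i)"
  obtains q where "q \<in> carrier (Q i)" "V = qcl i q"
  using assms IQ.quot_carrierE[of V i] by (auto simp: Qb_def qcl_def)

lemma qcl_closed [simp]: "q \<in> carrier (Q i) ==> qcl i q \<in> carrier (Qb i)"
  by (simp add: Qb_def qcl_def)

lemma qcl_additive: "additive_map (Q i) (Qb i) (qcl i)"
  using IQ.coset_additive[of i] by (simp add: additive_map_def Qb_def qcl_def)

lemma qcl_smult: "a \<in> carrier A ==> q \<in> carrier (Q i) ==> cl a \<odot>\<^bsub>Qb i\<^esub> qcl i q = qcl i (a \<odot>\<^bsub>Q i\<^esub> q)"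
  unfolding Qb_def qcl_def
  by (subst factor_smult[OF IQ.quot_lmod quot_kills]) (simp_all add: IQ.coset_smult)

lemma qcl_zero_iff: "q \<in> carrier (Q i) ==> qcl i q = \<zero>\<^bsub>Qb i\<^esub> \<longleftrightarrow> q \<in> idl I (Q i)"
  by (simp add: Qb_def qcl_def IQ.coset_zero_iff)

lemma qcl_eqI:
  assumes "q \<in> carrier (Q i)" "q' \<in> carrier (Q i)" "q \<ominus>\<^bsub>Q i\<^esub> q' \<in> idl I (Q i)"
  shows "qcl i q = qcl i q'"
  using IQ.coset_eq_iff[OF assms(1,2)] assms(3) by (simp add: qcl_def)

lemma additive_lift:
  assumes N: "abelian_group N" and h: "additive_map (Q i) N h"
    and k: "!!a q. a \<in> I ==> q \<in> carrier (Q i) ==> h (a \<odot>\<^bsub>Q i\<^esub> q) = \<zero>\<^bsub>N\<^esub>"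
  shows "\<exists>g. additive_map (Qb i) N g \<and> (\<forall>q\<in>carrier (Q i). g (qcl i q) = h q)"
proof -
  interpret N: abelian_group N by fact
  have "additive_subgroup {\<zero>\<^bsub>N\<^esub>} N" by (rule N.additive_subgroupI') auto
  then have "h q = \<zero>\<^bsub>N\<^esub>" if "q \<in> idl I (Q i)" for q
    using Q.Q.idl_additive_in[OF I_sub h N _ _ that, of "{\<zero>\<^bsub>N\<^esub>}"] k by auto
  from IQ.quot_additive_lift[OF N h this] show ?thesis by (simp add: additive_map_def Qb_def qcl_def)
qed

lemma lift:
  assumes N: "lmod R N" and h: "rlin A (Q i) (restrict_scalars A I N) h"
  shows "\<exists>g. rlin R (Qb i) N g \<and> (\<forall>q\<in>carrier (Q i). g (qcl i q) = h q)"
proof -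
  interpret N: lmod R N by fact
  have hadd: "additive_map (Q i) N h" using rlin_additive[OF h] by (simp add: additive_map_def)
  have "\<exists>g. additive_map (Qb i) N g \<and> (\<forall>q\<in>carrier (Q i). g (qcl i q) = h q)"
    by (rule additive_lift[OF N.M.ag hadd])
      (use rlin_smult[OF h] id.Icarr restrict_kills[OF N] additive_map_closed[OF hadd] in auto)
  then obtain g where g: "additive_map (Qb i) N g" "!!q. q \<in> carrier (Q i) ==> g (qcl i q) = h q" by blast
  have "g (V \<odot>\<^bsub>Qb i\<^esub> W) = V \<odot>\<^bsub>N\<^esub> g W" if VW: "V \<in> carrier R" "W \<in> carrier (Qb i)" for V W
  proof -
    obtain a where a: "a \<in> carrier A" "V = cl a" using VW(1) by (rule R_carrierE)
    obtain q where q: "q \<in> carrier (Q i)" "W = qcl i q" using VW(2) by (rule QbE)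
    have "a \<odot>\<^bsub>Q i\<^esub> q \<in> carrier (Q i)" using a q by simp
    then show ?thesis using a q g(2) rlin_smult[OF h a(1) q(1)] by (simp add: qcl_smult)
  qed
  then have "rlin R (Qb i) N g" using g(1) by (simp add: rlin_def)
  then show ?thesis using g(2) by blast
qed

lemma rlin_qcl:
  assumes g: "rlin R (Qb i) N g"
  shows "rlin A (Q i) (restrict_scalars A I N) (\<lambda>q. g (qcl i q))"
proof -
  have "additive_map (Q i) N (\<lambda>q. g (qcl i q))" by (rule additive_map_comp[OF rlin_additive[OF g] qcl_additive])
  then show ?thesis using rlin_smult[OF g] by (simp add: rlin_def additive_map_def qcl_smult[symmetric])
qed

text \<open>The coordinates over A send I Q into I, since they are linear and I is closed under
  right multiplication; so they descend to coordinates over A/I.\<close>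

lemma Qb_dual_basis: "\<exists>\<theta>. dual_basis R (Qb i) (carrier R) (carrier (Q i)) (qcl i) \<theta>"
proof -
  obtain \<theta> where "dual_basis A (Q i) (carrier A) (carrier (Q i)) (\<lambda>x. x) \<theta>"
    using projective_dual_basis[OF Q.Q_projective] by blast
  then interpret \<theta>: dual_basis A "Q i" "carrier A" "carrier (Q i)" "\<lambda>x. x" \<theta> .
  interpret R: ring R by (rule R_ring)
  interpret Qb: lmod R "Qb i" by (rule Qb_lmod)
  have cl_add: "additive_map A R (\<lambda>a. cl a)" by (rule additive_mapI) (simp_all add: cl_ops)
  have "\<exists>g. additive_map (Qb i) R g \<and> (\<forall>q\<in>carrier (Q i). g (qcl i q) = cl (\<theta> b q))" if b: "b \<in> carrier (Q i)" for b
  proof (rule additive_lift[OF R.ag additive_map_comp[OF cl_add \<theta>.theta_additive[OF b]]])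
    fix a q assume a: "a \<in> I" and q: "q \<in> carrier (Q i)"
    have "\<theta> b (a \<odot>\<^bsub>Q i\<^esub> q) \<in> I"
      using \<theta>.theta_smult[OF b id.Icarr[OF a] q] id.I_r_closed[OF a \<theta>.theta_closed[OF b q]] by simp
    then show "cl (\<theta> b (a \<odot>\<^bsub>Q i\<^esub> q)) = \<zero>\<^bsub>R\<^esub>" by (rule cl_zero)
  qed
  then obtain \<eta> where \<eta>: "!!b. b \<in> carrier (Q i) ==> additive_map (Qb i) R (\<eta> b) \<and> (\<forall>q\<in>carrier (Q i). \<eta> b (qcl i q) = cl (\<theta> b q))"
    by metis
  then have \<eta>add: "!!b. b \<in> carrier (Q i) ==> additive_map (Qb i) R (\<eta> b)"
    and \<eta>c: "!!b q. b \<in> carrier (Q i) ==> q \<in> carrier (Q i) ==> \<eta> b (qcl i q) = cl (\<theta> b q)" by blast+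
  have "dual_basis R (Qb i) (carrier R) (carrier (Q i)) (qcl i) \<eta>"
  proof (intro dual_basis.intro dual_basis_axioms.intro Qb_lmod)
    show "\<eta> b V \<in> carrier R" if "b \<in> carrier (Q i)" "V \<in> carrier (Qb i)" for b V
      by (rule additive_map_closed[OF \<eta>add[OF that(1)] that(2)])
    show "\<eta> b (V \<odot>\<^bsub>Qb i\<^esub> W) = V \<otimes>\<^bsub>R\<^esub> \<eta> b W" if b: "b \<in> carrier (Q i)" and VW: "V \<in> carrier R" "W \<in> carrier (Qb i)" for b V W
    proof -
      obtain a where a: "a \<in> carrier A" "V = cl a" using VW(1) by (rule R_carrierE)
      obtain q where q: "q \<in> carrier (Q i)" "W = qcl i q" using VW(2) by (rule QbE)
      have "a \<odot>\<^bsub>Q i\<^esub> q \<in> carrier (Q i)" using a q by simp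
      then show ?thesis
        using a q \<eta>c[OF b] \<theta>.theta_smult[OF b a(1) q(1)] \<theta>.theta_closed[OF b q(1)] by (simp add: qcl_smult cl_ops)
    qed
    fix V assume "V \<in> carrier (Qb i)"
    then obtain q where q: "q \<in> carrier (Q i)" "V = qcl i q" by (rule QbE)
    have z: "cl \<zero>\<^bsub>A\<^esub> = \<zero>\<^bsub>R\<^esub>" by (rule cl_zero) (rule subgroup_zero[OF id.additive_subgroup_axioms])
    show "finite {b \<in> carrier (Q i). \<eta> b V ~= \<zero>\<^bsub>R\<^esub>}"
      by (rule finite_subset[OF _ \<theta>.theta_finite[OF q(1)]]) (use \<eta>c[OF _ q(1)] q(2) z in auto)
    have t: "\<theta> b q \<odot>\<^bsub>Q i\<^esub> b \<in> carrier (Q i)" if "b \<in> carrier (Q i)" for b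
      using \<theta>.theta_closed[OF that q(1)] that by simp
    have "V = qcl i (fsum (Q i) (\<lambda>b. \<theta> b q \<odot>\<^bsub>Q i\<^esub> b) (carrier (Q i)))"
      using \<theta>.theta_expand[OF q(1)] q(2) by simp
    also have "\<dots> = fsum (Qb i) (\<lambda>b. qcl i (\<theta> b q \<odot>\<^bsub>Q i\<^esub> b)) (carrier (Q i))"
      by (rule Q.Q.M.fsum_additive[OF qcl_additive Qb.M.ag t])
        (auto intro!: finite_subset[OF _ \<theta>.theta_finite[OF q(1)]])
    also have "\<dots> = fsum (Qb i) (\<lambda>b. \<eta> b V \<odot>\<^bsub>Qb i\<^esub> qcl i b) (carrier (Q i))"
    proof (rule Qb.M.fsum_cong[OF refl])
      fix b assume b: "b \<in> carrier (Q i)"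
      show *: "qcl i (\<theta> b q \<odot>\<^bsub>Q i\<^esub> b) = \<eta> b V \<odot>\<^bsub>Qb i\<^esub> qcl i b"
        using \<eta>c[OF b q(1)] qcl_smult[OF \<theta>.theta_closed[OF b q(1)] b] q(2) by simp
      show "\<eta> b V \<odot>\<^bsub>Qb i\<^esub> qcl i b \<in> carrier (Qb i)" unfolding *[symmetric] by (rule qcl_closed[OF t[OF b]])
    qed
    finally show "V = fsum (Qb i) (\<lambda>b. \<eta> b V \<odot>\<^bsub>Qb i\<^esub> qcl i b) (carrier (Q i))" .
  qed (auto simp: \<eta>add)
  then show ?thesis by blast
qed

text \<open>Exactness of Q/IQ follows from that of Q and of I Q: if d q lies in I Q, then it equals
  d w for some w in I Q, and q - w is a cycle of Q, hence a boundary. Thus q is a boundary modulo I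
  Q.\<close>

lemma reduced_complex:
  "\<exists>db \<epsilon>b \<theta>. proj_complex R X Qb db \<epsilon>b (\<lambda>i. carrier (Q i)) qcl \<theta> \<and>
    (\<forall>i. \<forall>q\<in>carrier (Q (Suc i)). db i (qcl (Suc i) q) = qcl i (d i q)) \<and>
    (\<forall>q\<in>carrier (Q 0). \<epsilon>b (qcl 0 q) = \<epsilon> q)"
proof -
  interpret X: lmod R X by (rule X)
  have "\<exists>g. rlin R (Qb (Suc i)) (Qb i) g \<and> (\<forall>q\<in>carrier (Q (Suc i)). g (qcl (Suc i) q) = qcl i (d i q))" for i
  proof (rule lift[OF Qb_lmod])
    have "additive_map (Q (Suc i)) (Qb i) (\<lambda>q. qcl i (d i q))" by (rule additive_map_comp[OF qcl_additive Q.d_additive])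
    then show "rlin A (Q (Suc i)) (restrict_scalars A I (Qb i)) (\<lambda>q. qcl i (d i q))"
      using Q.d_closed by (simp add: rlin_def additive_map_def qcl_smult Q.d_smult)
  qed
  then obtain db where db: "!!i. rlin R (Qb (Suc i)) (Qb i) (db i)"
    "!!i q. q \<in> carrier (Q (Suc i)) ==> db i (qcl (Suc i) q) = qcl i (d i q)" by metis
  have "rlin A (Q 0) (restrict_scalars A I X) \<epsilon>" using Q.eps_hom by (simp add: mod_hom_rlin)
  from lift[OF X this] obtain \<epsilon>b where \<epsilon>b: "rlin R (Qb 0) X \<epsilon>b" "!!q. q \<in> carrier (Q 0) ==> \<epsilon>b (qcl 0 q) = \<epsilon> q" by blast
  obtain \<theta> where \<theta>: "!!i. dual_basis R (Qb i) (carrier R) (carrier (Q i)) (qcl i) (\<theta> i)"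
    using Qb_dual_basis by metis
  have cz: "qcl i \<zero>\<^bsub>Q i\<^esub> = \<zero>\<^bsub>Qb i\<^esub>" for i
    using qcl_zero_iff[of "\<zero>\<^bsub>Q i\<^esub>" i] subgroup_zero[OF Q.Q.idl_subgroup[OF I_sub]] by simp
  have "proj_complex R X Qb db \<epsilon>b (\<lambda>i. carrier (Q i)) qcl \<theta>"
  proof (rule proj_complex.intro[OF X \<theta> db(1) \<epsilon>b(1)])
    fix x assume "x \<in> carrier X"
    then obtain q where "q \<in> carrier (Q 0)" "\<epsilon> q = x" using Q.eps_surj[of x] by auto
    then show "\<exists>V\<in>carrier (Qb 0). \<epsilon>b V = x" using \<epsilon>b(2) by (intro bexI[of _ "qcl 0 q"]) auto
  next
    fix i W assume "W \<in> carrier (Qb (Suc i))"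
    then obtain q where q: "q \<in> carrier (Q (Suc i))" "W = qcl (Suc i) q" by (rule QbE)
    show "cycle X Qb db \<epsilon>b i (db i W)"
    proof (cases i)
      case 0
      then show ?thesis using q db(2) \<epsilon>b(2) Q.eps_d[of q] Q.d_closed[of q 0] by (simp add: cycle_simps)
    next
      case (Suc j)
      then show ?thesis
        using q db(2)[of q i] db(2)[of "d i q" j] Q.d_d[of q j] Q.d_closed[of q i] cz by (simp add: cycle_simps)
    qed
  next
    fix i V assume "V \<in> carrier (Qb i)" and c: "cycle X Qb db \<epsilon>b i V"
    then obtain q where q: "q \<in> carrier (Q i)" "V = qcl i q" using QbE by blast
    have "\<exists>v\<in>carrier (Q (Suc i)). qcl i (d i v) = qcl i q"
    proof (cases i)
      case 0
      then show ?thesis using c q \<epsilon>b(2) Q.exact_0[of q] by (auto simp: cycle_simps)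
    next
      case (Suc j)
      have dq: "d j q \<in> carrier (Q j)" using q(1) Suc Q.d_closed by simp
      have "qcl j (d j q) = \<zero>\<^bsub>Qb j\<^esub>" using c q db(2)[of q j] Suc by (simp add: cycle_simps)
      then have dI: "d j q \<in> idl I (Q j)" using qcl_zero_iff[OF dq] by simp
      have "Q.cyc j (d j q)" using q(1) Suc Q.d_d by (cases j) (auto simp: Q.cyc_def)
      then obtain w where w: "w \<in> idl I (Q (Suc j))" "d j w = d j q" using ex dI unfolding Q.exact_idl_def by blast
      have wc: "w \<in> carrier (Q (Suc j))" by (rule Q.Q.idl_carrier[OF I_sub w(1)])
      have qc: "q \<in> carrier (Q (Suc j))" using q(1) Suc by simp
      have "d j (q \<ominus>\<^bsub>Q (Suc j)\<^esub> w) = \<zero>\<^bsub>Q j\<^esub>"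
        using Q.d_diff[OF qc wc] w(2) Q.Q.M.diff_self[OF dq] by simp
      then obtain v where v: "v \<in> carrier (Q (Suc (Suc j)))" "d (Suc j) v = q \<ominus>\<^bsub>Q (Suc j)\<^esub> w"
        using Q.exact_Suc[OF Q.Q.M.minus_closed[OF qc wc]] by blast
      have dv: "d (Suc j) v \<in> carrier (Q (Suc j))" by (rule Q.d_closed[OF v(1)])
      have "w \<oplus>\<^bsub>Q (Suc j)\<^esub> d (Suc j) v = q"
        using Q.Q.M.diff_add_cancel[OF qc wc] Q.Q.M.a_comm[OF wc dv] v(2) by simp
      then have "q \<ominus>\<^bsub>Q (Suc j)\<^esub> d (Suc j) v \<in> idl I (Q (Suc j))"
        using Q.Q.M.add_diff_cancel[OF wc dv] w(1) by simp
      from qcl_eqI[OF qc dv this] show ?thesis using v(1) Suc by auto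
    qed
    then obtain v where "v \<in> carrier (Q (Suc i))" "qcl i (d i v) = qcl i q" by blast
    then show "\<exists>W\<in>carrier (Qb (Suc i)). db i W = V" using db(2) q(2) by (intro bexI[of _ "qcl (Suc i) v"]) auto
  qed
  then show ?thesis using db(2) \<epsilon>b(2) by blast
qed

end

end

lemma resolution_complex:
  assumes "proj_resolution R X P d \<epsilon>"
  shows "\<exists>\<theta>. proj_complex R X P d \<epsilon> (\<lambda>i. carrier (P i)) (\<lambda>i x. x) \<theta>"
proof -
  interpret P: resolution R X P d \<epsilon> by (rule resolution.intro) fact
  obtain \<theta> where \<theta>: "!!i. dual_basis R (P i) (carrier R) (carrier (P i)) (\<lambda>x. x) (\<theta> i)"
    using projective_dual_basis[OF P.Q_projective] by metis
  have "proj_complex R X P d \<epsilon> (\<lambda>i. carrier (P i)) (\<lambda>i x. x) \<theta>"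
  proof (rule proj_complex.intro[OF P.X.lmod_axioms \<theta>])
    show "rlin R (P (Suc i)) (P i) (d i)" for i using P.d_hom by (simp add: mod_hom_rlin)
    show "rlin R (P 0) X \<epsilon>" using P.eps_hom by (simp add: mod_hom_rlin)
    show "\<exists>y\<in>carrier (P 0). \<epsilon> y = x" if "x \<in> carrier X" for x by (rule P.eps_surj[OF that])
    show "cycle X P d \<epsilon> i (d i w)" if "w \<in> carrier (P (Suc i))" for i w
      using that P.eps_d P.d_d by (cases i) (auto simp: cycle_simps)
    show "\<exists>w\<in>carrier (P (Suc i)). d i w = y" if "y \<in> carrier (P i)" "cycle X P d \<epsilon> i y" for i y
      using that P.exact_0 P.exact_Suc by (cases i) (auto simp: cycle_simps)
  qed
  then show ?thesis by blast
qed

text \<open>Homomorphisms over A from Q into a module over A/I factor uniquely through Q/IQ. So Ext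
  over A is computed by Q/IQ, which is a projective resolution over A/I just as P is, and the
  comparison of two such resolutions applies.\<close>

theorem ext_map_iso:
  assumes I: "ideal I A" and X: "left_module (A Quot I) X" and Y: "left_module (A Quot I) Y"
    and resP: "proj_resolution (A Quot I) X P dP \<epsilon>P"
    and resQ: "proj_resolution A (restrict_scalars A I X) Q dQ \<epsilon>Q"
    and f: "lifts_identity A Q dQ \<epsilon>Q (\<lambda>j. restrict_scalars A I (P j)) dP \<epsilon>P f"
    and ex: "resolution.exact_idl Q dQ I" and i: "i \<ge> 1"
  shows "ext_map A Q dQ (restrict_scalars A I Y) f i
    \<in> iso (ext_group (A Quot I) P dP Y i) (ext_group A Q dQ (restrict_scalars A I Y) i)"
proof -
  interpret ideal_quot I A using I by (intro ideal_quot.intro) (auto simp: ideal_def)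
  obtain j where j: "i = Suc j" using i by (cases i) auto
  have Xl: "lmod R X" and Yl: "lmod R Y" using X Y by (simp_all add: left_module_iff)
  let ?Y = "restrict_scalars A I Y"
  interpret Q: resolution A "restrict_scalars A I X" Q dQ \<epsilon>Q by (rule resolution.intro) fact
  interpret P: resolution R X P dP \<epsilon>P by (rule resolution.intro) fact
  interpret Y: lmod R Y by (rule Yl)
  note Y' = restrict_lmod[OF Yl]
  have fh: "f i \<in> mod_hom A (Q i) (restrict_scalars A I (P i))"
    and f0: "x \<in> carrier (Q 0) ==> \<epsilon>P (f 0 x) = \<epsilon>Q x"
    and fd: "y \<in> carrier (Q (Suc i)) ==> dP i (f (Suc i) y) = f i (dQ i y)" for i x y
    using f by (auto simp: lifts_identity_def)
  have fr: "rlin A (Q i) (restrict_scalars A I (P i)) (f i)" for i using fh by (simp add: mod_hom_rlin)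
  have fc: "f i x \<in> carrier (P i)" if "x \<in> carrier (Q i)" for i x using rlin_closed[OF fr that] by simp
  have dQr: "rlin A (Q (Suc i)) (Q i) (dQ i)" for i using Q.d_hom by (simp add: mod_hom_rlin)
  note context_facts = Xl Q.resolution_axioms ex
  let ?qcl = "qcl Q" and ?Qb = "Qb Q"
  note lift' = lift[OF context_facts] and rlin_qcl' = rlin_qcl[OF context_facts]
  have comp_f: "rlin A (Q i) ?Y (\<lambda>x. g (f i x))" if g: "rlin R (P i) Y g" for g i
  proof -
    have "rlin A (restrict_scalars A I (P i)) ?Y g"
      using g by (simp add: rlin_def additive_map_def)
    from rlin_comp[OF this fr] show ?thesis .
  qed
  obtain db \<epsilon>b \<theta>' where D: "proj_complex R X ?Qb db \<epsilon>b (\<lambda>i. carrier (Q i)) ?qcl \<theta>'"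
    and db: "!!i q. q \<in> carrier (Q (Suc i)) ==> db i (?qcl (Suc i) q) = ?qcl i (dQ i q)"
    and \<epsilon>b: "!!q. q \<in> carrier (Q 0) ==> \<epsilon>b (?qcl 0 q) = \<epsilon>Q q"
    using reduced_complex[OF context_facts] by blast
  obtain \<theta> where C: "proj_complex R X P dP \<epsilon>P (\<lambda>i. carrier (P i)) (\<lambda>i x. x) \<theta>"
    using resolution_complex[OF resP] by blast
  interpret CD: complex_pair R X P dP \<epsilon>P "\<lambda>i. carrier (P i)" "\<lambda>i x. x" \<theta> ?Qb db \<epsilon>b "\<lambda>i. carrier (Q i)" ?qcl \<theta>'
    by (intro complex_pair.intro C D)
  \<comment> \<open>The given lift f factors through Q/IQ, because each \<open>P i\<close> is a
    module over A/I.\<close>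
  obtain fb where fb: "!!i. rlin R (?Qb i) (P i) (fb i)" "!!i q. q \<in> carrier (Q i) ==> fb i (?qcl i q) = f i q"
    using lift'[OF P.Q_lmod fr] by metis
  have fb0: "\<epsilon>P (fb 0 V) = \<epsilon>b V" if V: "V \<in> carrier (?Qb 0)" for V
  proof -
    obtain q where q: "q \<in> carrier (Q 0)" "V = ?qcl 0 q" using V by (rule QbE[OF context_facts])
    then show ?thesis using fb(2) f0 \<epsilon>b by simp
  qed
  have fbd: "dP i (fb (Suc i) V) = fb i (db i V)" if V: "V \<in> carrier (?Qb (Suc i))" for i V
  proof -
    obtain q where q: "q \<in> carrier (Q (Suc i))" "V = ?qcl (Suc i) q" using V by (rule QbE[OF context_facts])
    then show ?thesis using fb(2)[of q "Suc i"] fb(2)[of "dQ i q" i] fd[of q i] db[of q i] Q.d_closed[of q i] by simp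
  qed
  let ?G = "ext_cocycles R P dP Y (Suc j)" and ?G' = "ext_cocycles A Q dQ ?Y (Suc j)"
  let ?N = "ext_coboundaries R P dP Y (Suc j)" and ?N' = "ext_coboundaries A Q dQ ?Y (Suc j)"
  let ?\<phi> = "\<lambda>h. compose (carrier (Q (Suc j))) h (f (Suc j))"
  note Giff = ext_cocycles_iff[of dP R P, OF P.d_hom] and Giff' = ext_cocycles_iff[of dQ A Q, OF Q.d_hom]
  have \<phi>in: "?\<phi> h \<in> carrier ?G'" if h: "h \<in> carrier ?G" for h
  proof -
    have hr: "rlin R (P (Suc j)) Y h" using h by (simp add: Giff mod_hom_rlin)
    have "?\<phi> h \<in> mod_hom A (Q (Suc j)) ?Y"
      using restrict_mod_hom[OF Q.Q_lmod comp_f[OF hr]] by (simp add: compose_def)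
    moreover have "?\<phi> h (dQ (Suc j) x) = \<zero>\<^bsub>?Y\<^esub>" if "x \<in> carrier (Q (Suc (Suc j)))" for x
      using h Q.d_closed[OF that] fd[OF that, symmetric] fc[OF that] by (simp add: compose_def Giff)
    ultimately show ?thesis by (simp add: Giff')
  qed
  have "(\<lambda>H. \<Union>h\<in>H. ?N' #>\<^bsub>?G'\<^esub> ?\<phi> h) \<in> iso (?G Mod ?N) (?G' Mod ?N')"
  proof (rule FactGroup_iso)
    show "comm_group ?G" by (rule ext_cocycles_comm_group[of R P dP, OF P.Q_lmod P.d_hom Yl])
    show "comm_group ?G'" by (rule ext_cocycles_comm_group[of A Q dQ, OF Q.Q_lmod Q.d_hom Y'])
    show "subgroup ?N ?G" by (rule ext_coboundaries_subgroup[of R P dP, OF P.Q_lmod P.d_hom Yl P.d_d])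
    show "subgroup ?N' ?G'" by (rule ext_coboundaries_subgroup[of A Q dQ, OF Q.Q_lmod Q.d_hom Y' Q.d_d])
    show "?\<phi> \<in> hom ?G ?G'"
    proof (rule homI[OF \<phi>in])
      fix g h
      show "?\<phi> (g \<otimes>\<^bsub>?G\<^esub> h) = ?\<phi> g \<otimes>\<^bsub>?G'\<^esub> ?\<phi> h"
        unfolding ext_cocycles_ops by (rule extensionalityI[of _ "carrier (Q (Suc j))"]) (auto simp: compose_def fc)
    qed
    show "?\<phi> h \<in> ?N'" if h: "h \<in> ?N" for h
    proof -
      obtain g where g: "g \<in> mod_hom R (P j) Y" "!!x. x \<in> carrier (P (Suc j)) ==> h x = g (dP j x)"
        using h by (auto simp: ext_coboundaries_iff)
      have "rlin R (P j) Y g" using g by (simp add: mod_hom_rlin)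
      from restrict_mod_hom[OF Q.Q_lmod comp_f[OF this]]
      show ?thesis
        unfolding ext_coboundaries_iff
        by (intro conjI bexI) (use g(2) fc fd Q.d_closed in \<open>auto simp: compose_def\<close>)
    qed
    show "h \<in> ?N" if h: "h \<in> carrier ?G" and \<phi>h: "?\<phi> h \<in> ?N'" for h
    proof -
      obtain g where g: "g \<in> mod_hom A (Q j) ?Y" "!!x. x \<in> carrier (Q (Suc j)) ==> h (f (Suc j) x) = g (dQ j x)"
        using \<phi>h by (auto simp: ext_coboundaries_iff compose_def)
      have "rlin A (Q j) ?Y g" using g by (simp add: mod_hom_rlin)
      from lift'[OF Yl this] obtain gb where gb: "rlin R (?Qb j) Y gb" "!!q. q \<in> carrier (Q j) ==> gb (?qcl j q) = g q" by blast
      have "h (fb (Suc j) V) = gb (db j V)" if V: "V \<in> carrier (?Qb (Suc j))" for V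
      proof -
        obtain q where q: "q \<in> carrier (Q (Suc j))" "V = ?qcl (Suc j) q" using V by (rule QbE[OF context_facts])
        then show ?thesis using fb(2)[of q "Suc j"] g(2)[of q] gb(2)[of "dQ j q"] db[of q j] Q.d_closed[of q j] by simp
      qed
      moreover have "rlin R (P (Suc j)) Y h" "!!x. x \<in> carrier (P (Suc (Suc j))) ==> h (dP (Suc j) x) = \<zero>\<^bsub>Y\<^esub>"
        using h by (simp_all add: Giff mod_hom_rlin)
      ultimately obtain t where t: "rlin R (P j) Y t" "\<forall>x\<in>carrier (P (Suc j)). h x = t (dP j x)"
        using CD.cohomology_inj[OF fb(1) fb0 fbd Yl _ _ gb(1)] by blast
      have "h \<in> extensional (carrier (P (Suc j)))" using h by (simp add: Giff mod_hom_rlin)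
      moreover have "\<forall>x\<in>carrier (P (Suc j)). h x = restrict t (carrier (P j)) (dP j x)" using t(2) P.d_closed by simp
      ultimately show ?thesis using restrict_mod_hom[OF P.Q_lmod t(1)] unfolding ext_coboundaries_iff by blast
    qed
    show "\<exists>h\<in>carrier ?G. \<exists>z\<in>?N'. ?\<phi> h = z \<otimes>\<^bsub>?G'\<^esub> y" if y: "y \<in> carrier ?G'" for y
    proof -
      have yr: "rlin A (Q (Suc j)) ?Y y" and yd: "!!x. x \<in> carrier (Q (Suc (Suc j))) ==> y (dQ (Suc j) x) = \<zero>\<^bsub>Y\<^esub>"
        using y by (simp_all add: Giff' mod_hom_rlin)
      from lift'[OF Yl yr] obtain yb where yb: "rlin R (?Qb (Suc j)) Y yb"
        "!!q. q \<in> carrier (Q (Suc j)) ==> yb (?qcl (Suc j) q) = y q" by blast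
      have "yb (db (Suc j) V) = \<zero>\<^bsub>Y\<^esub>" if V: "V \<in> carrier (?Qb (Suc (Suc j)))" for V
      proof -
        obtain q where q: "q \<in> carrier (Q (Suc (Suc j)))" "V = ?qcl (Suc (Suc j)) q" using V by (rule QbE[OF context_facts])
        then show ?thesis using yb(2)[of "dQ (Suc j) q"] yd[of q] db[of q "Suc j"] Q.d_closed[of q "Suc j"] by simp
      qed
      then obtain h t where h: "rlin R (P (Suc j)) Y h" "!!x. x \<in> carrier (P (Suc (Suc j))) ==> h (dP (Suc j) x) = \<zero>\<^bsub>Y\<^esub>"
        and t: "rlin R (?Qb j) Y t" "!!V. V \<in> carrier (?Qb (Suc j)) ==> h (fb (Suc j) V) = yb V \<oplus>\<^bsub>Y\<^esub> t (db j V)"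
        using CD.cohomology_surj[OF fb(1) fb0 fbd Yl yb(1)] by blast
      let ?h = "restrict h (carrier (P (Suc j)))" and ?t = "restrict (\<lambda>q. t (?qcl j q)) (carrier (Q j))"
      let ?z = "\<lambda>q\<in>carrier (Q (Suc j)). ?t (dQ j q)"
      have "?h \<in> carrier ?G" using restrict_mod_hom[OF P.Q_lmod h(1)] h(2) P.d_closed by (simp add: Giff)
      moreover have "?z \<in> ?N'"
        using restrict_mod_hom[OF Q.Q_lmod rlin_qcl'[OF t(1)]] unfolding ext_coboundaries_iff
        by (intro conjI bexI[of _ ?t]) auto
      moreover have "?\<phi> ?h = ?z \<otimes>\<^bsub>?G'\<^esub> y"
        unfolding ext_cocycles_ops
      proof (rule extensionalityI[of _ "carrier (Q (Suc j))"])
        fix q assume q: "q \<in> carrier (Q (Suc j))"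
        have c: "?qcl (Suc j) q \<in> carrier (?Qb (Suc j))" and c': "?qcl j (dQ j q) \<in> carrier (?Qb j)"
          using qcl_closed[OF context_facts] q Q.d_closed[OF q] by blast+
        have "h (f (Suc j) q) = y q \<oplus>\<^bsub>Y\<^esub> t (?qcl j (dQ j q))"
          using t(2)[OF c] fb(2)[OF q] yb(2)[OF q] db[OF q] by simp
        also have "\<dots> = t (?qcl j (dQ j q)) \<oplus>\<^bsub>Y\<^esub> y q"
          using rlin_closed[OF yr q] rlin_closed[OF t(1) c'] by (intro Y.M.a_comm) simp_all
        finally show "?\<phi> ?h q = (\<lambda>x\<in>carrier (Q (Suc j)). ?z x \<oplus>\<^bsub>?Y\<^esub> y x) q"
          using q fc[OF q] Q.d_closed[OF q] by (simp add: compose_def)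
      qed (auto simp: compose_def)
      ultimately show ?thesis by blast
    qed
  qed
  then show ?thesis unfolding j ext_group_def by (simp add: ext_map_def[abs_def])
qed

section \<open>Free algebras over the complex numbers and their representations\<close>

section \<open>Free and enveloping algebras over the complex numbers\<close>

lemma complex_ring_simps [simp]:
  "carrier complex_ring = UNIV" "mult complex_ring = (*)" "one complex_ring = 1"
  "zero complex_ring = 0" "add complex_ring = (+)"
  by (simp_all add: complex_ring_def)

lemma complex_cring: "cring complex_ring"
proof (rule cringI)
  show "abelian_group complex_ring"
  proof (rule abelian_groupI)
    fix x show "\<exists>y\<in>carrier complex_ring. y \<oplus>\<^bsub>complex_ring\<^esub> x = \<zero>\<^bsub>complex_ring\<^esub>"
      by (auto intro: exI[of _ "-x"])
  qed auto
  show "comm_monoid complex_ring" by (rule comm_monoidI) auto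
qed (auto simp: distrib_right)

interpretation complex: cring complex_ring by (rule complex_cring)

lemma complex_ring_minus [simp]: "\<ominus>\<^bsub>complex_ring\<^esub> x = - x" "x \<ominus>\<^bsub>complex_ring\<^esub> y = x - y"
proof -
  show *: "\<ominus>\<^bsub>complex_ring\<^esub> x = - x" for x by (rule complex.minus_equality) auto
  show "x \<ominus>\<^bsub>complex_ring\<^esub> y = x - y" by (simp add: a_minus_def *)
qed

lemma complex_finsum [simp]: "finsum complex_ring f A = sum f A"
proof (cases "finite A")
  case True
  then show ?thesis by (induction A rule: finite_induct) auto
qed auto

lemma free_algebra_simps:
  "carrier (free_algebra R S) = carrier (free_module R (lists S))"
  "add (free_algebra R S) = add (free_module R (lists S))"
  "zero (free_algebra R S) = zero (free_module R (lists S))"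
  "one (free_algebra R S) = free_gen R []"
  "smult (free_algebra R S) = smult (free_module R (lists S))"
  by (simp_all add: free_algebra_def)

locale cfree =
  fixes S :: "'b set"
begin

abbreviation "F \<equiv> free_algebra complex_ring S"
abbreviation F_mult (infixl "\<otimes>\<^sub>F" 70) where "x \<otimes>\<^sub>F y \<equiv> x \<otimes>\<^bsub>F\<^esub> y"
abbreviation F_add (infixl "\<oplus>\<^sub>F" 65) where "x \<oplus>\<^sub>F y \<equiv> x \<oplus>\<^bsub>F\<^esub> y"
abbreviation F_smult (infixr "\<odot>\<^sub>F" 70) where "a \<odot>\<^sub>F x \<equiv> a \<odot>\<^bsub>F\<^esub> x"
abbreviation F_diff (infixl "\<ominus>\<^sub>F" 65) where "x \<ominus>\<^sub>F y \<equiv> x \<ominus>\<^bsub>F\<^esub> y"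
abbreviation F_one ("\<one>\<^sub>F") where "\<one>\<^sub>F \<equiv> \<one>\<^bsub>F\<^esub>"

lemma mem: "f \<in> carrier F \<longleftrightarrow> finite {w. f w ~= 0} \<and> (\<forall>w. f w ~= 0 --> w \<in> lists S)"
  unfolding free_algebra_simps by (auto simp: free_module_def)

lemma mult: "(f \<otimes>\<^sub>F g) w = (\<Sum>i\<le>length w. f (take i w) * g (drop i w))"
  by (simp add: free_algebra_def)

lemma gen_eq: "free_gen complex_ring s t = (if t = s then 1 else 0)"
  by (simp add: free_gen_def)

lemma lmodF: "lmod complex_ring F"
proof -
  interpret L: lmod complex_ring "free_module complex_ring (lists S)"
    by (rule free_module_lmod) (rule complex.ring_axioms)
  show ?thesis
    by (intro lmod.intro lmod_axioms.intro complex.ring_axioms abelian_group_cong[OF L.M.ag])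
      (simp_all add: free_algebra_simps L.smult_l_distr[simplified] L.smult_r_distr[simplified]
        L.smult_assoc[simplified] L.smult_one[simplified] L.smult_closed[simplified])
qed

sublocale F: lmod complex_ring F by (rule lmodF)

lemma ops: "f \<oplus>\<^sub>F g = (\<lambda>w. f w + g w)" "\<zero>\<^bsub>F\<^esub> = (\<lambda>w. 0)" "a \<odot>\<^sub>F f = (\<lambda>w. a * f w)"
  "\<one>\<^sub>F = free_gen complex_ring []"
  by (simp_all add: free_algebra_simps free_module_simps)

lemma uminus: "f \<in> carrier F ==> \<ominus>\<^bsub>F\<^esub> f = (\<lambda>w. - f w)"
  using F.smult_l_minus[of 1 f] F.smult_one[of f] by (simp add: ops)

lemma diff: "f \<in> carrier F ==> g \<in> carrier F ==> f \<ominus>\<^sub>F g = (\<lambda>w. f w - g w)"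
  by (simp add: a_minus_def uminus ops)

lemma mult_closed:
  assumes f: "f \<in> carrier F" and g: "g \<in> carrier F"
  shows "f \<otimes>\<^sub>F g \<in> carrier F"
proof -
  have *: "\<exists>u v. f u ~= 0 \<and> g v ~= 0 \<and> w = u @ v" if w: "(f \<otimes>\<^sub>F g) w ~= 0" for w
  proof -
    from w obtain i where "f (take i w) * g (drop i w) ~= 0"
      unfolding mult using sum.neutral by (metis (no_types, lifting))
    then show ?thesis by (intro exI[of _ "take i w"] exI[of _ "drop i w"]) auto
  qed
  have "{w. (f \<otimes>\<^sub>F g) w ~= 0} \<subseteq> (\<lambda>(u, v). u @ v) ` ({u. f u ~= 0} \<times> {v. g v ~= 0})"
    using * by fastforce
  then have "finite {w. (f \<otimes>\<^sub>F g) w ~= 0}" using f g by (auto simp: mem intro: finite_subset)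
  moreover have "w \<in> lists S" if w: "(f \<otimes>\<^sub>F g) w ~= 0" for w
  proof -
    obtain u v where "f u ~= 0" "g v ~= 0" "w = u @ v" using *[OF w] by blast
    then show ?thesis using f g unfolding mem by simp
  qed
  ultimately show ?thesis by (simp add: mem)
qed

text \<open>Both sides enumerate the ways to cut a word of length n into three pieces, sorted by the
  second cut or by the first.\<close>

lemma sum_take_drop:
  fixes n :: nat
  shows "(\<Sum>i\<le>n. \<Sum>j\<le>i. a j i) = (\<Sum>j\<le>n. \<Sum>i\<le>n - j. (a j (j + i) :: complex))"
proof -
  have "(\<Sum>i\<le>n. \<Sum>j\<le>i. a j i) = (\<Sum>(i, j)\<in>Sigma {..n} (\<lambda>i. {..i}). a j i)"
    by (simp add: sum.Sigma)
  also have "\<dots> = (\<Sum>(j, i)\<in>Sigma {..n} (\<lambda>j. {..n - j}). a j (j + i))"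
    by (rule sum.reindex_bij_witness[of _ "\<lambda>(j, i). (j + i, j)" "\<lambda>(i, j). (j, i - j)"]) auto
  also have "\<dots> = (\<Sum>j\<le>n. \<Sum>i\<le>n - j. a j (j + i))"
    by (simp add: sum.Sigma)
  finally show ?thesis .
qed

lemma ringF: "ring F"
proof (rule ringI)
  show "abelian_group F" by (rule F.M.ag)
  show "monoid F"
  proof (rule monoidI)
    show "\<one>\<^sub>F \<in> carrier F" by (auto simp: mem ops gen_eq split: if_splits)
  next
    fix f g h
    show "f \<otimes>\<^sub>F g \<otimes>\<^sub>F h = f \<otimes>\<^sub>F (g \<otimes>\<^sub>F h)"
    proof (rule ext)
      fix w
      have "(f \<otimes>\<^sub>F g \<otimes>\<^sub>F h) w =
          (\<Sum>i\<le>length w. \<Sum>j\<le>i. f (take j w) * g (drop j (take i w)) * h (drop i w))"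
        unfolding mult sum_distrib_right by (intro sum.cong refl) (auto simp: min_def)
      also have "\<dots> = (\<Sum>j\<le>length w. \<Sum>i\<le>length w - j.
          f (take j w) * g (drop j (take (j + i) w)) * h (drop (j + i) w))"
        by (rule sum_take_drop)
      also have "\<dots> = (f \<otimes>\<^sub>F (g \<otimes>\<^sub>F h)) w"
        unfolding mult sum_distrib_left
        by (intro sum.cong refl) (auto simp: mult.assoc drop_take add.commute)
      finally show "(f \<otimes>\<^sub>F g \<otimes>\<^sub>F h) w = (f \<otimes>\<^sub>F (g \<otimes>\<^sub>F h)) w" .
    qed
  next
    fix f
    show "\<one>\<^sub>F \<otimes>\<^sub>F f = f"
    proof (rule ext)
      fix w
      have "(\<one>\<^sub>F \<otimes>\<^sub>F f) w = (\<Sum>i\<le>length w. if i = 0 then f w else 0)"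
        unfolding mult by (intro sum.cong) (auto simp: ops gen_eq)
      then show "(\<one>\<^sub>F \<otimes>\<^sub>F f) w = f w" by simp
    qed
    show "f \<otimes>\<^sub>F \<one>\<^sub>F = f"
    proof (rule ext)
      fix w
      have "(f \<otimes>\<^sub>F \<one>\<^sub>F) w = (\<Sum>i\<le>length w. if i = length w then f w else 0)"
        unfolding mult by (intro sum.cong) (auto simp: ops gen_eq)
      then show "(f \<otimes>\<^sub>F \<one>\<^sub>F) w = f w" by simp
    qed
  qed (rule mult_closed)
qed (auto simp: fun_eq_iff mult ops sum.distrib algebra_simps)

lemma smult_mult: "(a \<odot>\<^sub>F f) \<otimes>\<^sub>F g = a \<odot>\<^sub>F (f \<otimes>\<^sub>F g)" "f \<otimes>\<^sub>F (a \<odot>\<^sub>F g) = a \<odot>\<^sub>F (f \<otimes>\<^sub>F g)"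
  by (auto simp: fun_eq_iff mult ops sum_distrib_left algebra_simps)

lemma gen_closed: "w \<in> lists S ==> free_gen complex_ring w \<in> carrier F"
  by (auto simp: mem gen_eq split: if_splits)

end

text \<open>Linear operators, one for each letter, extended to a representation of the free algebra
  on a space of functions. Its kernel is an ideal, so a quotient of the free algebra acts as soon as
  the defining relations do so by zero.\<close>

locale cfree_rep = cfree S for S :: "'b set" +
  fixes act :: "'b => ('v => complex) => 'v => complex"
  assumes act_add: "act x (\<lambda>\<kappa>. G \<kappa> + H \<kappa>) = (\<lambda>\<kappa>. act x G \<kappa> + act x H \<kappa>)"
    and act_smult: "act x (\<lambda>\<kappa>. c * G \<kappa>) = (\<lambda>\<kappa>. c * act x G \<kappa>)"
begin

definition rep :: "('b list => complex) => ('v => complex) => 'v => complex" where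
  "rep f G \<kappa> = (\<Sum>w | f w ~= 0. f w * foldr act w G \<kappa>)"

lemma word_add: "foldr act w (\<lambda>\<kappa>. G \<kappa> + H \<kappa>) = (\<lambda>\<kappa>. foldr act w G \<kappa> + foldr act w H \<kappa>)"
  by (induction w) (simp_all add: act_add)

lemma word_smult: "foldr act w (\<lambda>\<kappa>. c * G \<kappa>) = (\<lambda>\<kappa>. c * foldr act w G \<kappa>)"
  by (induction w) (simp_all add: act_smult)

lemma word_sum: "finite A ==> foldr act w (\<lambda>\<kappa>. \<Sum>a\<in>A. H a \<kappa>) = (\<lambda>\<kappa>. \<Sum>a\<in>A. foldr act w (H a) \<kappa>)"
proof (induction A rule: finite_induct)
  case empty
  show ?case using word_smult[of w 0] by simp
next
  case (insert a A)
  then show ?case by (simp add: word_add)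
qed

lemma rep_eq: "finite A ==> (!!w. f w ~= 0 ==> w \<in> A) ==> rep f G \<kappa> = (\<Sum>w\<in>A. f w * foldr act w G \<kappa>)"
  unfolding rep_def by (rule sum.mono_neutral_left) auto

lemma rep_add:
  assumes "f \<in> carrier F" "g \<in> carrier F"
  shows "rep (f \<oplus>\<^sub>F g) G \<kappa> = rep f G \<kappa> + rep g G \<kappa>"
proof -
  let ?A = "{w. f w ~= 0} \<union> {w. g w ~= 0}"
  have fin: "finite ?A" using assms by (simp add: mem)
  have "rep (f \<oplus>\<^sub>F g) G \<kappa> = (\<Sum>w\<in>?A. (f \<oplus>\<^sub>F g) w * foldr act w G \<kappa>)"
    by (rule rep_eq[OF fin]) (auto simp: ops)
  also have "\<dots> = (\<Sum>w\<in>?A. f w * foldr act w G \<kappa>) + (\<Sum>w\<in>?A. g w * foldr act w G \<kappa>)"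
    by (simp add: ops sum.distrib distrib_right)
  also have "(\<Sum>w\<in>?A. f w * foldr act w G \<kappa>) = rep f G \<kappa>"
    by (rule rep_eq[OF fin, symmetric]) auto
  also have "(\<Sum>w\<in>?A. g w * foldr act w G \<kappa>) = rep g G \<kappa>"
    by (rule rep_eq[OF fin, symmetric]) auto
  finally show ?thesis .
qed

lemma rep_smult:
  assumes "f \<in> carrier F"
  shows "rep (a \<odot>\<^sub>F f) G \<kappa> = a * rep f G \<kappa>"
proof -
  let ?A = "{w. f w ~= 0}"
  have fin: "finite ?A" using assms by (simp add: mem)
  have "rep (a \<odot>\<^sub>F f) G \<kappa> = (\<Sum>w\<in>?A. (a \<odot>\<^sub>F f) w * foldr act w G \<kappa>)"
    by (rule rep_eq[OF fin]) (auto simp: ops)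
  then show ?thesis by (simp add: ops rep_def sum_distrib_left mult.assoc)
qed

lemma rep_gen: "rep (free_gen complex_ring w) G = foldr act w G"
proof (rule ext)
  fix \<kappa>
  have "rep (free_gen complex_ring w) G \<kappa> = (\<Sum>v\<in>{w}. free_gen complex_ring w v * foldr act v G \<kappa>)"
    by (rule rep_eq) (simp_all add: gen_eq split: if_splits)
  then show "rep (free_gen complex_ring w) G \<kappa> = foldr act w G \<kappa>" by (simp add: gen_eq)
qed

lemma rep_linear:
  "rep f (\<lambda>\<kappa>. G \<kappa> + H \<kappa>) = (\<lambda>\<kappa>. rep f G \<kappa> + rep f H \<kappa>)"
  "rep f (\<lambda>\<kappa>. c * G \<kappa>) = (\<lambda>\<kappa>. c * rep f G \<kappa>)"
  by (rule ext, simp add: rep_def word_add word_smult distrib_left sum.distrib)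
    (rule ext, simp add: rep_def word_smult sum_distrib_left mult.left_commute)

lemma rep_mult:
  assumes f: "f \<in> carrier F" and g: "g \<in> carrier F"
  shows "rep (f \<otimes>\<^sub>F g) G = rep f (rep g G)"
proof (rule ext)
  fix \<kappa>
  let ?A = "{w. f w ~= 0}" and ?B = "{w. g w ~= 0}"
  have fin: "finite ?A" "finite ?B" using assms by (simp_all add: mem)
  let ?C = "(\<lambda>(u, v). u @ v) ` (?A \<times> ?B)"
  have C: "w \<in> ?C" if "f (take i w) * g (drop i w) ~= 0" for w i
    using that by (intro image_eqI[of _ _ "(take i w, drop i w)"]) auto
  have supp: "w \<in> ?C" if w: "(f \<otimes>\<^sub>F g) w ~= 0" for w
  proof -
    obtain i where "f (take i w) * g (drop i w) ~= 0"
      using w unfolding mult by (metis (no_types, lifting) sum.neutral)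
    then show ?thesis by (rule C)
  qed
  have "rep (f \<otimes>\<^sub>F g) G \<kappa> = (\<Sum>w\<in>?C. (f \<otimes>\<^sub>F g) w * foldr act w G \<kappa>)"
    by (rule rep_eq) (use fin supp in auto)
  also have "\<dots> = (\<Sum>w\<in>?C. \<Sum>i\<le>length w. f (take i w) * g (drop i w) * foldr act w G \<kappa>)"
    by (simp add: mult sum_distrib_right)
  also have "\<dots> = (\<Sum>(w, i)\<in>Sigma ?C (\<lambda>w. {..length w}). f (take i w) * g (drop i w) * foldr act w G \<kappa>)"
    using fin by (subst sum.Sigma) auto
  \<comment> \<open>Different pairs of words may have the same concatenation; keeping the position
    of the cut makes the reindexing injective.\<close>
  also have "\<dots> = (\<Sum>(w, i)\<in>(\<lambda>(u, v). (u @ v, length u)) ` (?A \<times> ?B).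
      f (take i w) * g (drop i w) * foldr act w G \<kappa>)"
  proof (rule sum.mono_neutral_right)
    show "finite (Sigma ?C (\<lambda>w. {..length w}))" using fin by auto
    show "(\<lambda>(u, v). (u @ v, length u)) ` (?A \<times> ?B) \<subseteq> Sigma ?C (\<lambda>w. {..length w})" by auto
    show "\<forall>x\<in>Sigma ?C (\<lambda>w. {..length w}) - (\<lambda>(u, v). (u @ v, length u)) ` (?A \<times> ?B).
        (case x of (w, i) => f (take i w) * g (drop i w) * foldr act w G \<kappa>) = 0"
    proof (safe, rule ccontr)
      fix w i u v assume "i \<le> length (u @ v)"
        and *: "(u @ v, i) \<notin> (\<lambda>(u, v). (u @ v, length u)) ` (?A \<times> ?B)"
        and "f (take i (u @ v)) * g (drop i (u @ v)) * foldr act (u @ v) G \<kappa> ~= 0"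
      then have "(u @ v, i) \<in> (\<lambda>(u, v). (u @ v, length u)) ` (?A \<times> ?B)"
        by (intro image_eqI[of _ _ "(take i (u @ v), drop i (u @ v))"]) (auto simp del: take_append drop_append)
      with * show False by simp
    qed
  qed
  also have "\<dots> = (\<Sum>(u, v)\<in>?A \<times> ?B. f u * g v * foldr act u (foldr act v G) \<kappa>)"
    by (subst sum.reindex) (auto simp: inj_on_def intro!: sum.cong)
  also have "\<dots> = (\<Sum>u\<in>?A. f u * foldr act u (rep g G) \<kappa>)"
  proof -
    have "foldr act u (rep g G) \<kappa> = (\<Sum>v\<in>?B. g v * foldr act u (foldr act v G) \<kappa>)" for u
    proof -
      have "rep g G = (\<lambda>\<kappa>. \<Sum>v\<in>?B. g v * foldr act v G \<kappa>)" by (simp add: rep_def fun_eq_iff)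
      then show ?thesis by (simp add: word_sum[OF fin(2)] word_smult)
    qed
    then show ?thesis by (simp add: sum.cartesian_product[symmetric] sum_distrib_left mult.assoc)
  qed
  finally show "rep (f \<otimes>\<^sub>F g) G \<kappa> = rep f (rep g G) \<kappa>" by (simp add: rep_def)
qed

lemma rep_diff:
  assumes "f \<in> carrier F" "g \<in> carrier F"
  shows "rep (f \<ominus>\<^sub>F g) G \<kappa> = rep f G \<kappa> - rep g G \<kappa>"
proof -
  have "f \<ominus>\<^sub>F g = f \<oplus>\<^sub>F (-1) \<odot>\<^sub>F g" using assms by (simp add: diff ops)
  then show ?thesis using assms rep_add[of f "(-1) \<odot>\<^sub>F g"] rep_smult[of g "-1"] by simp
qed

lemma rep_zero: "rep (\<lambda>w. 0) G = (\<lambda>\<kappa>. 0)" "rep f (\<lambda>\<kappa>. 0) = (\<lambda>\<kappa>. 0)"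
  using rep_linear(2)[of f 0] by (simp_all add: rep_def fun_eq_iff)

lemma rep_kernel_ideal: "ideal {f \<in> carrier F. \<forall>G. rep f G = (\<lambda>\<kappa>. 0)} F"
proof (rule idealI)
  interpret R: ring F by (rule ringF)
  show "ring F" by (rule ringF)
  show "subgroup {f \<in> carrier F. \<forall>G. rep f G = (\<lambda>\<kappa>. 0)} (add_monoid F)"
    unfolding additive_subgroup_def[symmetric]
  proof (rule F.M.additive_subgroupI')
    fix f assume f: "f \<in> {f \<in> carrier F. \<forall>G. rep f G = (\<lambda>\<kappa>. 0)}"
    then have eq: "\<ominus>\<^bsub>F\<^esub> f = (-1) \<odot>\<^sub>F f" by (simp add: uminus ops)
    have "rep (\<ominus>\<^bsub>F\<^esub> f) G = (\<lambda>\<kappa>. 0)" for G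
      unfolding eq by (rule ext) (use f rep_smult in simp)
    then show "\<ominus>\<^bsub>F\<^esub> f \<in> {f \<in> carrier F. \<forall>G. rep f G = (\<lambda>\<kappa>. 0)}" using f by simp
  qed (auto simp: fun_eq_iff rep_add, auto simp: ops(2) rep_zero)
next
  interpret R: ring F by (rule ringF)
  fix f g assume f: "f \<in> {f \<in> carrier F. \<forall>G. rep f G = (\<lambda>\<kappa>. 0)}" and g: "g \<in> carrier F"
  then show "g \<otimes>\<^sub>F f \<in> {f \<in> carrier F. \<forall>G. rep f G = (\<lambda>\<kappa>. 0)}"
    "f \<otimes>\<^sub>F g \<in> {f \<in> carrier F. \<forall>G. rep f G = (\<lambda>\<kappa>. 0)}"
    by (auto simp: rep_mult rep_zero)
qed

end

section \<open>Linear independence of ordered products, by derivations of a polynomial ring\<close>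

section \<open>The enveloping algebra of the strictly upper triangular matrices\<close>

lemma sl_plus_simps:
  "X \<in> carrier (sl_plus n) \<longleftrightarrow> X \<in> carrier_mat n n \<and> (\<forall>i<n. \<forall>j<n. j \<le> i --> X $$ (i, j) = 0)"
  "mult (sl_plus n) X Y = X * Y - Y * X" "add (sl_plus n) = (+)" "smult (sl_plus n) = (\<cdot>\<^sub>m)"
  by (simp_all add: sl_plus_def)

lemma mat_mult_index:
  "X \<in> carrier_mat n n ==> Y \<in> carrier_mat n n ==> i < n ==> j < n ==>
    (X * Y) $$ (i, j) = (\<Sum>k<n. X $$ (i, k) * Y $$ (k, j))"
  by (simp add: scalar_prod_def atLeast0LessThan)

lemma sl_plus_mult:
  assumes X: "X \<in> carrier (sl_plus n)" and Y: "Y \<in> carrier (sl_plus n)"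
  shows "X * Y \<in> carrier (sl_plus n)"
proof -
  have XY: "X \<in> carrier_mat n n" "Y \<in> carrier_mat n n" using assms by (auto simp: sl_plus_simps)
  have "(X * Y) $$ (i, j) = 0" if "i < n" "j < n" "j \<le> i" for i j
  proof -
    have *: "X $$ (i, k) * Y $$ (k, j) = 0" if "k < n" for k
      using X Y that \<open>i < n\<close> \<open>j < n\<close> \<open>j \<le> i\<close> by (cases "k \<le> i") (auto simp: sl_plus_simps)
    show ?thesis unfolding mat_mult_index[OF XY that(1,2)] by (rule sum.neutral) (use * in simp)
  qed
  then show ?thesis using XY by (simp add: sl_plus_simps del: index_mult_mat(1))
qed

lemma sl_plus_diff: "A \<in> carrier (sl_plus n) ==> B \<in> carrier (sl_plus n) ==> A - B \<in> carrier (sl_plus n)"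
  by (auto simp: sl_plus_simps)

lemma sl_plus_closed:
  assumes X: "X \<in> carrier (sl_plus n)" and Y: "Y \<in> carrier (sl_plus n)"
  shows "X + Y \<in> carrier (sl_plus n)" "a \<cdot>\<^sub>m X \<in> carrier (sl_plus n)"
    "X * Y - Y * X \<in> carrier (sl_plus n)"
proof -
  show "X + Y \<in> carrier (sl_plus n)" using X Y by (auto simp: sl_plus_simps)
  show "a \<cdot>\<^sub>m X \<in> carrier (sl_plus n)" using X by (auto simp: sl_plus_simps)
  show "X * Y - Y * X \<in> carrier (sl_plus n)" by (rule sl_plus_diff[OF sl_plus_mult[OF X Y] sl_plus_mult[OF Y X]])
qed

lemma zero_in_sl_plus: "0\<^sub>m n n \<in> carrier (sl_plus n)"
  by (simp add: sl_plus_simps)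

lemma mat_unit_in_sl_plus: "i < j ==> mat_unit n i j \<in> carrier (sl_plus n)"
  by (auto simp: sl_plus_simps mat_unit_def)

lemma mat_unit_mult:
  assumes "j < n"
  shows "mat_unit n i j * mat_unit n k l = (if j = k then mat_unit n i l else 0\<^sub>m n n)"
proof (rule eq_matI)
  fix a b assume *: "a < dim_row (if j = k then mat_unit n i l else 0\<^sub>m n n)"
    "b < dim_col (if j = k then mat_unit n i l else 0\<^sub>m n n)"
  then have ab: "a < n" "b < n" by (auto simp: mat_unit_def split: if_splits)
  have "(mat_unit n i j * mat_unit n k l) $$ (a, b)
      = (\<Sum>c<n. mat_unit n i j $$ (a, c) * mat_unit n k l $$ (c, b))"
    by (rule mat_mult_index) (use ab in \<open>auto simp: mat_unit_def\<close>)
  also have "\<dots> = (\<Sum>c<n. if c = j then (if a = i \<and> j = k \<and> b = l then 1 else 0) else 0)"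
    by (intro sum.cong) (use ab in \<open>auto simp: mat_unit_def\<close>)
  also have "\<dots> = (if a = i \<and> j = k \<and> b = l then 1 else 0)" using assms by simp
  finally show "(mat_unit n i j * mat_unit n k l) $$ (a, b)
      = (if j = k then mat_unit n i l else 0\<^sub>m n n) $$ (a, b)"
    using ab by (auto simp: mat_unit_def)
qed (auto simp: mat_unit_def)

subsection \<open>Action on functions of exponent matrices\<close>

text \<open>The operator x_ip d/dx_jp takes its contribution to the coefficient at
  \<open>\<kappa>\<close> from the exponent \<open>mv (i, j, p) \<kappa>\<close>. Integer exponents
  make this shift total.\<close>

definition mv :: "nat \<times> nat \<times> nat => (nat \<times> nat => int) => nat \<times> nat => int" where
  "mv t \<kappa> = (case t of (i, j, p) => \<lambda>x. \<kappa> x - of_bool (x = (i, p)) + of_bool (x = (j, p)))"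

text \<open>
  The action of matrices as derivations \<open>\<Sum> X\<^sub>i\<^sub>j x\<^sub>i\<^sub>p \<partial>/\<partial>x\<^sub>j\<^sub>p\<close> on polynomials in the entries of a matrix
  \<open>(x\<^sub>i\<^sub>p)\<close>, in terms of the coefficients with respect to divided powers of the variables.
\<close>

definition mat_act :: "nat => complex mat => ((nat \<times> nat => int) => complex) => (nat \<times> nat => int) => complex" where
  "mat_act n X G \<kappa> = (\<Sum>(i, j, p)\<in>{..<n} \<times> {..<n} \<times> {..<n}. of_int (\<kappa> (i, p)) * X $$ (i, j) * G (mv (i, j, p) \<kappa>))"

text \<open>In the composite of two operators the exponent at \<open>x s\<close> after the shift by
  t has three terms. The first two make up E, which is symmetric in the two matrices. The third
  occurs only for \<open>x s = y t\<close> and makes up D, the action of the matrix product. In the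
  commutator only D survives.\<close>

lemma mat_act_bracket:
  assumes X: "X \<in> carrier_mat n n" and Y: "Y \<in> carrier_mat n n"
  shows "mat_act n X (mat_act n Y G) \<kappa> - mat_act n Y (mat_act n X G) \<kappa> = mat_act n (X * Y - Y * X) G \<kappa>"
proof -
  let ?I = "{..<n} \<times> {..<n} \<times> {..<n}"
  have mv_commute: "mv s (mv t \<kappa>) = mv t (mv s \<kappa>)" for s t
    by (auto simp: mv_def split: prod.splits)
  have mv_mv: "mv (j, b, p) (mv (i, j, p) \<kappa>) = mv (i, b, p) \<kappa>" for i j p b
    by (rule ext) (auto simp: mv_def)
  define x y where "x = (\<lambda>t::nat \<times> nat \<times> nat. (fst t, snd (snd t)))"
    and "y = (\<lambda>t::nat \<times> nat \<times> nat. (fst (snd t), snd (snd t)))"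
  define c where "c Z t = Z $$ (fst t, fst (snd t))" for Z :: "complex mat" and t :: "nat \<times> nat \<times> nat"
  have mv_x: "mv t \<kappa> z = \<kappa> z - of_bool (z = x t) + of_bool (z = y t)" for t \<kappa> z
    by (simp add: mv_def x_def y_def case_prod_unfold)
  have act: "mat_act n Z G \<kappa> = (\<Sum>t\<in>?I. of_int (\<kappa> (x t)) * c Z t * G (mv t \<kappa>))" for Z G \<kappa>
    by (simp add: mat_act_def x_def c_def case_prod_unfold)
  define E where "E Z W = (\<Sum>t\<in>?I. \<Sum>s\<in>?I.
      of_int (\<kappa> (x t)) * (of_int (\<kappa> (x s)) - of_bool (x s = x t)) * (c Z t * c W s) * G (mv s (mv t \<kappa>)))"
    for Z W :: "complex mat"
  define D where "D Z W = (\<Sum>t\<in>?I. \<Sum>s\<in>?I.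
      of_int (\<kappa> (x t)) * of_bool (x s = y t) * (c Z t * c W s) * G (mv s (mv t \<kappa>)))" for Z W :: "complex mat"
  have ED: "mat_act n Z (mat_act n W G) \<kappa> = E Z W + D Z W" for Z W
    unfolding E_def D_def act sum.distrib[symmetric] sum_distrib_left mv_x
    by (intro sum.cong refl) (simp add: algebra_simps)
  have E: "E Z W = E W Z" for Z W
  proof -
    have *: "of_int (\<kappa> u) * (of_int (\<kappa> v) - of_bool (v = u))
        = (of_int (\<kappa> v) * (of_int (\<kappa> u) - of_bool (u = v)) :: complex)" for u v
      by (cases "u = v") auto
    show ?thesis
      unfolding E_def
    proof (subst sum.swap, intro sum.cong refl)
      fix t s
      show "of_int (\<kappa> (x s)) * (of_int (\<kappa> (x t)) - of_bool (x t = x s)) * (c Z s * c W t) * G (mv t (mv s \<kappa>)) =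
          of_int (\<kappa> (x t)) * (of_int (\<kappa> (x s)) - of_bool (x s = x t)) * (c W t * c Z s) * G (mv s (mv t \<kappa>))"
        unfolding *[of "x s" "x t"] mv_commute[of t s] mult.commute[of "c Z s"] ..
    qed
  qed
  have D: "D Z W = mat_act n (Z * W) G \<kappa>" if Z: "Z \<in> carrier_mat n n" and W: "W \<in> carrier_mat n n" for Z W
  proof -
    have inner: "(\<Sum>s\<in>?I. of_int (\<kappa> (x t)) * of_bool (x s = y t) * (c Z t * c W s) * G (mv s (mv t \<kappa>)))
        = (case t of (i, j, p) => \<Sum>b<n. of_int (\<kappa> (i, p)) * (Z $$ (i, j) * W $$ (j, b)) * G (mv (i, b, p) \<kappa>))"
      if t: "t \<in> ?I" for t
    proof -
      obtain i j p where t': "t = (i, j, p)" "i < n" "j < n" "p < n" using t by auto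
      have inj: "inj_on (\<lambda>b. (j, b, p)) {..<n}" by (auto simp: inj_on_def)
      have "(\<Sum>s\<in>?I. of_int (\<kappa> (x t)) * of_bool (x s = y t) * (c Z t * c W s) * G (mv s (mv t \<kappa>)))
        = (\<Sum>s\<in>(\<lambda>b. (j, b, p)) ` {..<n}. of_int (\<kappa> (x t)) * of_bool (x s = y t) * (c Z t * c W s) * G (mv s (mv t \<kappa>)))"
        by (rule sum.mono_neutral_right) (use t' in \<open>auto simp: x_def y_def\<close>)
      also have "\<dots> = (\<Sum>b<n. of_int (\<kappa> (i, p)) * (Z $$ (i, j) * W $$ (j, b)) * G (mv (i, b, p) \<kappa>))"
        by (simp add: sum.reindex[OF inj] t'(1) x_def y_def c_def mv_mv)
      finally show ?thesis by (simp add: t'(1))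
    qed
    have "D Z W = (\<Sum>(i, j, p)\<in>?I. \<Sum>b<n. of_int (\<kappa> (i, p)) * (Z $$ (i, j) * W $$ (j, b)) * G (mv (i, b, p) \<kappa>))"
      unfolding D_def by (rule sum.cong[OF refl inner])
    also have "\<dots> = (\<Sum>i<n. \<Sum>j<n. \<Sum>p<n. \<Sum>b<n. of_int (\<kappa> (i, p)) * (Z $$ (i, j) * W $$ (j, b)) * G (mv (i, b, p) \<kappa>))"
      by (simp flip: sum.cartesian_product)
    also have "\<dots> = (\<Sum>i<n. \<Sum>b<n. \<Sum>p<n. \<Sum>j<n. of_int (\<kappa> (i, p)) * (Z $$ (i, j) * W $$ (j, b)) * G (mv (i, b, p) \<kappa>))"
    proof (rule sum.cong[OF refl])
      fix i
      let ?f = "\<lambda>j p b. of_int (\<kappa> (i, p)) * (Z $$ (i, j) * W $$ (j, b)) * G (mv (i, b, p) \<kappa>)"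
      have "(\<Sum>j<n. \<Sum>p<n. \<Sum>b<n. ?f j p b) = (\<Sum>p<n. \<Sum>j<n. \<Sum>b<n. ?f j p b)" by (rule sum.swap)
      also have "\<dots> = (\<Sum>p<n. \<Sum>b<n. \<Sum>j<n. ?f j p b)" by (intro sum.cong refl sum.swap)
      also have "\<dots> = (\<Sum>b<n. \<Sum>p<n. \<Sum>j<n. ?f j p b)" by (rule sum.swap)
      finally show "(\<Sum>j<n. \<Sum>p<n. \<Sum>b<n. ?f j p b) = (\<Sum>b<n. \<Sum>p<n. \<Sum>j<n. ?f j p b)" .
    qed
    also have "\<dots> = (\<Sum>i<n. \<Sum>b<n. \<Sum>p<n. of_int (\<kappa> (i, p)) * (Z * W) $$ (i, b) * G (mv (i, b, p) \<kappa>))"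
      by (intro sum.cong refl) (simp add: mat_mult_index[OF Z W] sum_distrib_left sum_distrib_right del: index_mult_mat)
    also have "\<dots> = mat_act n (Z * W) G \<kappa>"
      by (simp add: mat_act_def sum.cartesian_product)
    finally show ?thesis .
  qed
  have "mat_act n (X * Y - Y * X) G \<kappa> = mat_act n (X * Y) G \<kappa> - mat_act n (Y * X) G \<kappa>"
    unfolding mat_act_def sum_subtractf[symmetric]
    by (intro sum.cong refl) (use X Y in \<open>auto simp: algebra_simps\<close>)
  then show ?thesis using ED[of X Y] ED[of Y X] E[of X Y] D[OF X Y] D[OF Y X] by simp
qed

lemma mat_act_linear:
  "mat_act n X (\<lambda>\<kappa>. G \<kappa> + H \<kappa>) = (\<lambda>\<kappa>. mat_act n X G \<kappa> + mat_act n X H \<kappa>)"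
  "mat_act n X (\<lambda>\<kappa>. c * G \<kappa>) = (\<lambda>\<kappa>. c * mat_act n X G \<kappa>)"
  by (rule ext, simp add: mat_act_def case_prod_unfold distrib_left sum.distrib)
    (rule ext, simp add: mat_act_def case_prod_unfold sum_distrib_left mult.left_commute)

lemma mat_act_add:
  "X \<in> carrier_mat n n ==> Y \<in> carrier_mat n n ==> mat_act n (X + Y) G \<kappa> = mat_act n X G \<kappa> + mat_act n Y G \<kappa>"
  unfolding mat_act_def sum.distrib[symmetric] by (intro sum.cong refl) (auto simp: algebra_simps)

lemma mat_act_smult:
  "X \<in> carrier_mat n n ==> mat_act n (a \<cdot>\<^sub>m X) G \<kappa> = a * mat_act n X G \<kappa>"
  unfolding mat_act_def sum_distrib_left by (intro sum.cong refl) (auto simp: algebra_simps)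

lemma mat_act_unit:
  assumes "i < n" "j < n"
  shows "mat_act n (mat_unit n i j) G \<kappa> = (\<Sum>p<n. of_int (\<kappa> (i, p)) * G (mv (i, j, p) \<kappa>))"
proof -
  let ?I = "{..<n} \<times> {..<n} \<times> {..<n}"
  have inj: "inj_on (\<lambda>p. (i, j, p)) {..<n}" by (auto simp: inj_on_def)
  have "mat_act n (mat_unit n i j) G \<kappa> =
      (\<Sum>(i', j', p)\<in>(\<lambda>p. (i, j, p)) ` {..<n}. of_int (\<kappa> (i', p)) * mat_unit n i j $$ (i', j') * G (mv (i', j', p) \<kappa>))"
    unfolding mat_act_def
    by (rule sum.mono_neutral_right) (use assms in \<open>auto simp: mat_unit_def split: if_splits\<close>)
  then show ?thesis using assms by (simp add: sum.reindex[OF inj] mat_unit_def)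
qed

lemma (in abelian_group) diff_diff:
  "x \<in> carrier G ==> y \<in> carrier G ==> z \<in> carrier G ==> x \<ominus> y \<ominus> z = x \<ominus> (y \<oplus> z)"
  by (simp add: a_minus_def a_assoc minus_add)

locale kos =
  fixes n :: nat
begin

sublocale W: cfree_rep "carrier (sl_plus n)" "mat_act n"
  by unfold_locales (simp_all add: mat_act_linear)

abbreviation "I \<equiv> enveloping_ideal complex_ring (sl_plus n)"
abbreviation "U \<equiv> env_sl n"
abbreviation U_mult (infixl "\<otimes>\<^sub>U" 70) where "x \<otimes>\<^sub>U y \<equiv> x \<otimes>\<^bsub>U\<^esub> y"
abbreviation U_add (infixl "\<oplus>\<^sub>U" 65) where "x \<oplus>\<^sub>U y \<equiv> x \<oplus>\<^bsub>U\<^esub> y"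
abbreviation U_smult (infixr "\<odot>\<^sub>U" 70) where "a \<odot>\<^sub>U x \<equiv> a \<odot>\<^bsub>U\<^esub> x"
abbreviation U_zero ("\<zero>\<^sub>U") where "\<zero>\<^sub>U \<equiv> \<zero>\<^bsub>U\<^esub>"
abbreviation U_one ("\<one>\<^sub>U") where "\<one>\<^sub>U \<equiv> \<one>\<^bsub>U\<^esub>"
abbreviation U_pow (infixr "[^]\<^sub>U" 75) where "x [^]\<^sub>U m \<equiv> x [^]\<^bsub>U\<^esub> (m::nat)"
abbreviation "\<iota> \<equiv> enveloping_map complex_ring (sl_plus n)"

lemma rels_subset:
  "enveloping_rels complex_ring (sl_plus n) \<subseteq> {f \<in> carrier W.F. \<forall>G. W.rep f G = (\<lambda>\<kappa>. 0)}"
proof -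
  interpret F: ring W.F by (rule W.ringF)
  have [simp]: "free_gen complex_ring [x] \<in> carrier W.F" if "x \<in> carrier (sl_plus n)" for x
    by (rule W.gen_closed) (use that in auto)
  have c: "x \<in> carrier_mat n n" if "x \<in> carrier (sl_plus n)" for x using that by (simp add: sl_plus_simps)
  show ?thesis
    unfolding enveloping_rels_def Let_def
    by (safe; simp add: fun_eq_iff sl_plus_simps(2-4) sl_plus_closed W.rep_diff W.rep_add W.rep_smult W.rep_mult
        W.rep_gen mat_act_add mat_act_smult c mat_act_bracket)
qed

lemma rels_carrier: "enveloping_rels complex_ring (sl_plus n) \<subseteq> carrier W.F"
  using rels_subset by auto

lemma ideal_I: "ideal I W.F"
  unfolding enveloping_ideal_def by (rule ring.genideal_ideal[OF W.ringF rels_carrier])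

lemma I_kernel: "f \<in> I ==> W.rep f G = (\<lambda>\<kappa>. 0)"
  using ring.genideal_minimal[OF W.ringF W.rep_kernel_ideal rels_subset]
  unfolding enveloping_ideal_def by auto

sublocale Iq: submod complex_ring W.F I
proof (rule submodI)
  interpret F: ring W.F by (rule W.ringF)
  show "lmod complex_ring W.F" by (rule W.lmodF)
  show "additive_subgroup I W.F" using ideal_I by (simp add: ideal_def)
  fix a x assume a: "a \<in> carrier complex_ring" and x: "x \<in> I"
  have xc: "x \<in> carrier W.F" using x ideal.Icarr[OF ideal_I] by simp
  have "(a \<odot>\<^bsub>W.F\<^esub> \<one>\<^bsub>W.F\<^esub>) \<otimes>\<^bsub>W.F\<^esub> x \<in> I"
    by (rule ideal.I_l_closed[OF ideal_I x]) (use a W.F.smult_closed in auto)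
  then show "a \<odot>\<^bsub>W.F\<^esub> x \<in> I" by (simp add: W.smult_mult xc)
qed

lemma U_eq: "U = Iq.Q"
  by (simp add: env_sl_def enveloping_algebra_def)

sublocale U: ring U
  unfolding U_eq by (rule quot_module_ring[OF ideal_I])

sublocale UM: lmod complex_ring U
  unfolding U_eq by (rule Iq.quot_lmod)

lemma cosetE:
  assumes "u \<in> carrier U"
  obtains f where "f \<in> carrier W.F" "u = I +>\<^bsub>W.F\<^esub> f"
  using assms unfolding U_eq by (rule Iq.quot_carrierE)

lemma coset_simps:
  "f \<in> carrier W.F ==> I +>\<^bsub>W.F\<^esub> f \<in> carrier U"
  "f \<in> carrier W.F ==> g \<in> carrier W.F ==> (I +>\<^bsub>W.F\<^esub> f) \<oplus>\<^sub>U (I +>\<^bsub>W.F\<^esub> g) = I +>\<^bsub>W.F\<^esub> (f \<oplus>\<^bsub>W.F\<^esub> g)"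
  "f \<in> carrier W.F ==> g \<in> carrier W.F ==> (I +>\<^bsub>W.F\<^esub> f) \<otimes>\<^sub>U (I +>\<^bsub>W.F\<^esub> g) = I +>\<^bsub>W.F\<^esub> (f \<otimes>\<^bsub>W.F\<^esub> g)"
  "f \<in> carrier W.F ==> a \<odot>\<^sub>U (I +>\<^bsub>W.F\<^esub> f) = I +>\<^bsub>W.F\<^esub> (a \<odot>\<^bsub>W.F\<^esub> f)"
  "\<one>\<^sub>U = I +>\<^bsub>W.F\<^esub> \<one>\<^bsub>W.F\<^esub>"
  unfolding U_eq
  by (simp_all add: Iq.coset_add coset_mult_ideal[OF ideal_I] Iq.coset_smult, simp add: quot_module_def)

lemma smult_mult:
  assumes "u \<in> carrier U" "v \<in> carrier U"
  shows "(a \<odot>\<^sub>U u) \<otimes>\<^sub>U v = a \<odot>\<^sub>U (u \<otimes>\<^sub>U v)" "u \<otimes>\<^sub>U (a \<odot>\<^sub>U v) = a \<odot>\<^sub>U (u \<otimes>\<^sub>U v)"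
  using assms
  by (auto elim!: cosetE simp: coset_simps W.F.smult_closed[simplified] W.mult_closed W.smult_mult)

lemma gen_in_F [simp]: "x \<in> carrier (sl_plus n) ==> free_gen complex_ring [x] \<in> carrier W.F"
  by (rule W.gen_closed) simp

lemma \<iota>_closed: "x \<in> carrier (sl_plus n) ==> \<iota> x \<in> carrier U"
  by (simp add: enveloping_map_def coset_simps)

lemma \<iota>_bracket:
  assumes x: "x \<in> carrier (sl_plus n)" and y: "y \<in> carrier (sl_plus n)"
  shows "\<iota> x \<otimes>\<^sub>U \<iota> y = \<iota> y \<otimes>\<^sub>U \<iota> x \<oplus>\<^sub>U \<iota> (x * y - y * x)"
proof -
  interpret F: ring W.F by (rule W.ringF)
  let ?g = "\<lambda>x. free_gen complex_ring [x]"
  have z: "x * y - y * x \<in> carrier (sl_plus n)" using sl_plus_closed(3)[OF x y] .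
  have *: "(?g x \<otimes>\<^bsub>W.F\<^esub> ?g y \<ominus>\<^bsub>W.F\<^esub> ?g y \<otimes>\<^bsub>W.F\<^esub> ?g x) \<ominus>\<^bsub>W.F\<^esub> ?g (x \<otimes>\<^bsub>sl_plus n\<^esub> y)
      \<in> enveloping_rels complex_ring (sl_plus n)"
    unfolding enveloping_rels_def Let_def using x y by blast
  have eq: "(?g x \<otimes>\<^bsub>W.F\<^esub> ?g y \<ominus>\<^bsub>W.F\<^esub> ?g y \<otimes>\<^bsub>W.F\<^esub> ?g x) \<ominus>\<^bsub>W.F\<^esub> ?g (x * y - y * x)
      = ?g x \<otimes>\<^bsub>W.F\<^esub> ?g y \<ominus>\<^bsub>W.F\<^esub> (?g y \<otimes>\<^bsub>W.F\<^esub> ?g x \<oplus>\<^bsub>W.F\<^esub> ?g (x * y - y * x))"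
    using x y z by (simp add: W.F.M.diff_diff)
  have "?g x \<otimes>\<^bsub>W.F\<^esub> ?g y \<ominus>\<^bsub>W.F\<^esub> (?g y \<otimes>\<^bsub>W.F\<^esub> ?g x \<oplus>\<^bsub>W.F\<^esub> ?g (x * y - y * x)) \<in> I"
    using subsetD[OF ring.genideal_self[OF W.ringF rels_carrier] *]
    by (simp only: enveloping_ideal_def sl_plus_simps eq)
  then show ?thesis
    using x y z
    by (simp add: enveloping_map_def coset_simps) (simp add: Iq.coset_eq_iff)
qed

text \<open>Put x = y = 0 in the bracket relation.\<close>

lemma \<iota>_zero: "\<iota> (0\<^sub>m n n) = \<zero>\<^sub>U"
proof -
  let ?a = "\<iota> (0\<^sub>m n n) \<otimes>\<^sub>U \<iota> (0\<^sub>m n n)"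
  have a: "?a \<in> carrier U" "\<iota> (0\<^sub>m n n) \<in> carrier U" by (simp_all add: \<iota>_closed zero_in_sl_plus)
  have "0\<^sub>m n n * 0\<^sub>m n n - 0\<^sub>m n n * 0\<^sub>m n n = (0\<^sub>m n n :: complex mat)"
    by (rule eq_matI) (auto simp: scalar_prod_def)
  then have "?a = \<iota> (0\<^sub>m n n) \<oplus>\<^sub>U ?a"
    using \<iota>_bracket[OF zero_in_sl_plus zero_in_sl_plus] a U.a_comm by metis
  then show ?thesis using U.add_diff_cancel[OF a(2,1)] U.diff_self[OF a(1)] by simp
qed

definition e :: "nat => nat => env" where "e i j = \<iota> (mat_unit n i j)"

lemma e_closed [simp]: "i < j ==> e i j \<in> carrier U"
  by (simp add: e_def \<iota>_closed mat_unit_in_sl_plus)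

lemma e_comm:
  assumes "i < j" "j < n" "k < l" "l < n" "j ~= k" "i ~= l"
  shows "e i j \<otimes>\<^sub>U e k l = e k l \<otimes>\<^sub>U e i j"
proof -
  have "mat_unit n i j * mat_unit n k l - mat_unit n k l * mat_unit n i j = 0\<^sub>m n n"
    using assms by (simp add: mat_unit_mult)
  then show ?thesis
    using \<iota>_bracket[OF mat_unit_in_sl_plus[OF assms(1)] mat_unit_in_sl_plus[OF assms(3)]] assms
    by (simp add: \<iota>_zero flip: e_def)
qed

lemma e_bracket:
  assumes "i < j" "j < l" "l < n"
  shows "e i j \<otimes>\<^sub>U e j l = e j l \<otimes>\<^sub>U e i j \<oplus>\<^sub>U e i l"
proof -
  have "mat_unit n i j * mat_unit n j l - mat_unit n j l * mat_unit n i j = mat_unit n i l"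
    using assms by (simp add: mat_unit_mult) (rule eq_matI, auto simp: mat_unit_def)
  then show ?thesis
    using \<iota>_bracket[OF mat_unit_in_sl_plus[OF assms(1)] mat_unit_in_sl_plus[OF assms(2)]] assms
    by (simp flip: e_def)
qed

subsection \<open>Coordinate functionals\<close>

text \<open>The action of the quotient through a chosen representative; \<open>urep_coset\<close>
  removes the choice, since the ideal acts by zero.\<close>

definition urep :: "env => ((nat \<times> nat => int) => complex) => (nat \<times> nat => int) => complex" where
  "urep u = W.rep (SOME f. f \<in> carrier W.F \<and> u = I +>\<^bsub>W.F\<^esub> f)"

lemma urep_coset:
  assumes f: "f \<in> carrier W.F"
  shows "urep (I +>\<^bsub>W.F\<^esub> f) G = W.rep f G"
proof -
  let ?g = "SOME g. g \<in> carrier W.F \<and> I +>\<^bsub>W.F\<^esub> f = I +>\<^bsub>W.F\<^esub> g"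
  have g: "?g \<in> carrier W.F \<and> I +>\<^bsub>W.F\<^esub> f = I +>\<^bsub>W.F\<^esub> ?g" 
    by (rule someI[of "\<lambda>g. g \<in> carrier W.F \<and> I +>\<^bsub>W.F\<^esub> f = I +>\<^bsub>W.F\<^esub> g" f]) (use f in simp)
  then have "f \<ominus>\<^bsub>W.F\<^esub> ?g \<in> I" using Iq.coset_eq_iff[OF f] by blast
  then have "W.rep (f \<ominus>\<^bsub>W.F\<^esub> ?g) G = (\<lambda>\<kappa>. 0)" by (rule I_kernel)
  then show ?thesis unfolding urep_def using W.rep_diff[OF f conjunct1[OF g], of G] by (simp add: fun_eq_iff)
qed

lemma urep_simps:
  assumes "u \<in> carrier U" "v \<in> carrier U"
  shows "urep (u \<oplus>\<^sub>U v) G \<kappa> = urep u G \<kappa> + urep v G \<kappa>" "urep (u \<otimes>\<^sub>U v) G = urep u (urep v G)"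
  using assms
  by (auto elim!: cosetE simp: coset_simps W.F.smult_closed[simplified] W.mult_closed urep_coset
      W.rep_add W.rep_mult W.rep_smult fun_eq_iff)

lemma urep_smult: "u \<in> carrier U ==> urep (a \<odot>\<^sub>U u) G \<kappa> = a * urep u G \<kappa>"
  by (auto elim!: cosetE simp: coset_simps W.F.smult_closed[simplified] urep_coset W.rep_smult)

lemma urep_one: "urep \<one>\<^sub>U G = G"
  using ring.ring_simprules(6)[OF W.ringF]
  by (simp add: coset_simps urep_coset) (simp add: fun_eq_iff W.ops W.rep_gen)

lemma urep_e: "i < j ==> urep (e i j) G = mat_act n (mat_unit n i j) G"
  by (simp add: e_def enveloping_map_def mat_unit_in_sl_plus urep_coset fun_eq_iff W.rep_gen)

text \<open>The diagonal is left out because \<open>Ind\<close> ignores it.\<close>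

definition nonneg :: "(nat \<times> nat => int) => bool" where
  "nonneg \<kappa> \<longleftrightarrow> (\<forall>i j. i ~= j --> \<kappa> (i, j) \<ge> 0)"

text \<open>Values at negative exponents are artefacts of the indexing by integers; they never
  influence the others (\<open>agree_mat_act\<close>).\<close>

definition agree :: "((nat \<times> nat => int) => complex) => ((nat \<times> nat => int) => complex) => bool" where
  "agree G H \<longleftrightarrow> (\<forall>\<kappa>. nonneg \<kappa> --> G \<kappa> = H \<kappa>)"

text \<open>Formally, the monomial with divided exponents k off the diagonal, times the exponential
  of the sum of the diagonal variables: every diagonal exponent has coefficient 1. As d/dx_jj fixes
  the exponential, \<open>e i j\<close> can act as multiplication by x_ij
  (\<open>act_Ind\<close>).\<close>

definition Ind :: "(nat \<times> nat => nat) => (nat \<times> nat => int) => complex" where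
  "Ind k \<kappa> = (if \<forall>i j. i ~= j --> \<kappa> (i, j) = int (k (i, j)) then 1 else 0)"

lemma agree_mat_act:
  assumes "agree G H"
  shows "agree (mat_act n X G) (mat_act n X H)"
proof -
  have "of_int (\<kappa> (i, p)) * X $$ (i, j) * G (mv (i, j, p) \<kappa>) = of_int (\<kappa> (i, p)) * X $$ (i, j) * H (mv (i, j, p) \<kappa>)"
    if "nonneg \<kappa>" for \<kappa> i j p
  proof (cases "\<kappa> (i, p) = 0")
    case False
    have "nonneg (mv (i, j, p) \<kappa>)"
      unfolding nonneg_def
    proof (intro allI impI)
      fix a b :: nat assume "a ~= b"
      then have "\<kappa> (a, b) \<ge> 0" using that by (simp add: nonneg_def)
      then show "0 \<le> mv (i, j, p) \<kappa> (a, b)" using False by (auto simp: mv_def)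
    qed
    then show ?thesis using assms by (simp add: agree_def)
  qed simp
  then show ?thesis by (auto simp: agree_def mat_act_def intro!: sum.cong)
qed

text \<open>For p ~= j the derivation differentiates by x_jp, which does not occur since row j is
  empty. For p = j it differentiates the exponential, and multiplication by x_ij remains; on divided
  powers this produces the factor.\<close>

lemma act_Ind:
  assumes ij: "i < j" "j < n" and k: "!!p. p ~= j ==> k (j, p) = 0"
  shows "agree (mat_act n (mat_unit n i j) (Ind k)) (\<lambda>\<kappa>. of_nat (Suc (k (i, j))) * Ind (k((i, j) := Suc (k (i, j)))) \<kappa>)"
  unfolding agree_def
proof (intro allI impI)
  fix \<kappa> assume \<kappa>: "nonneg \<kappa>"
  have "Ind k (mv (i, j, p) \<kappa>) = 0" if "p ~= j" for p
  proof -
    have "\<kappa> (j, p) \<ge> 0" using \<kappa> that by (simp add: nonneg_def)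
    then have "mv (i, j, p) \<kappa> (j, p) ~= int (k (j, p))"
      using k[OF that] ij by (simp add: mv_def)
    then have "\<not> (\<forall>a b. a ~= b --> mv (i, j, p) \<kappa> (a, b) = int (k (a, b)))" using that by metis
    then show ?thesis unfolding Ind_def by (rule if_not_P)
  qed
  then have "(\<Sum>p<n. of_int (\<kappa> (i, p)) * Ind k (mv (i, j, p) \<kappa>))
      = (\<Sum>p<n. if p = j then of_int (\<kappa> (i, j)) * Ind k (mv (i, j, j) \<kappa>) else 0)"
    by (intro sum.cong) auto
  also have "\<dots> = of_int (\<kappa> (i, j)) * Ind k (mv (i, j, j) \<kappa>)" using ij by simp
  also have "Ind k (mv (i, j, j) \<kappa>) = Ind (k((i, j) := Suc (k (i, j)))) \<kappa>"
  proof -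
    have "(\<forall>a b. a ~= b --> mv (i, j, j) \<kappa> (a, b) = int (k (a, b))) \<longleftrightarrow>
        (\<forall>a b. a ~= b --> \<kappa> (a, b) = int ((k((i, j) := Suc (k (i, j)))) (a, b)))"
    proof (intro all_cong1 imp_cong refl)
      fix a b :: nat assume "a ~= b"
      then show "(mv (i, j, j) \<kappa> (a, b) = int (k (a, b))) \<longleftrightarrow>
        (\<kappa> (a, b) = int ((k((i, j) := Suc (k (i, j)))) (a, b)))"
        by (auto simp: mv_def)
    qed
    then show ?thesis by (simp add: Ind_def)
  qed
  also have "of_int (\<kappa> (i, j)) * Ind (k((i, j) := Suc (k (i, j)))) \<kappa>
      = of_nat (Suc (k (i, j))) * Ind (k((i, j) := Suc (k (i, j)))) \<kappa>"
    using ij by (auto simp: Ind_def)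
  finally show "mat_act n (mat_unit n i j) (Ind k) \<kappa> = of_nat (Suc (k (i, j))) * Ind (k((i, j) := Suc (k (i, j)))) \<kappa>"
    using ij by (simp add: mat_act_unit)
qed

lemma agree_trans [trans]: "agree F G ==> agree G H ==> agree F H"
  by (simp add: agree_def)

lemma e_pow_Ind:
  assumes ij: "i < j" "j < n" and k: "!!p. p ~= j ==> k (j, p) = 0" "k (i, j) = 0"
  shows "agree (urep (e i j [^]\<^sub>U m) (Ind k)) (\<lambda>\<kappa>. fact m * Ind (k((i, j) := m)) \<kappa>)"
proof (induction m)
  case 0
  have "k((i, j) := 0) = k" using k(2) by auto
  then show ?case by (simp add: urep_one agree_def)
next
  case (Suc m)
  let ?k = "k((i, j) := m)"
  have "e i j [^]\<^sub>U Suc m = e i j \<otimes>\<^sub>U e i j [^]\<^sub>U m"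
    using U.nat_pow_Suc2[of "e i j" m] ij by simp
  then have "urep (e i j [^]\<^sub>U Suc m) (Ind k) = mat_act n (mat_unit n i j) (urep (e i j [^]\<^sub>U m) (Ind k))"
    using ij by (simp add: urep_simps(2) urep_e)
  moreover have "agree (mat_act n (mat_unit n i j) (urep (e i j [^]\<^sub>U m) (Ind k)))
     (mat_act n (mat_unit n i j) (\<lambda>\<kappa>. fact m * Ind ?k \<kappa>))"
    by (rule agree_mat_act[OF Suc])
  moreover have "agree (mat_act n (mat_unit n i j) (Ind ?k)) (\<lambda>\<kappa>. of_nat (Suc m) * Ind (k((i, j) := Suc m)) \<kappa>)"
    using act_Ind[OF ij, of ?k] k ij by simp
  ultimately show ?case
    unfolding agree_def mat_act_linear by (simp add: mult.assoc[symmetric] mult.commute del: of_nat_Suc)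
qed

lemma dp_closed [simp]: "i < j ==> divided_power n i j m \<in> carrier U"
  by (simp add: divided_power_def flip: e_def)

lemma dp_Ind:
  assumes "i < j" "j < n" "!!p. p ~= j ==> k (j, p) = 0" "k (i, j) = 0"
  shows "agree (urep (divided_power n i j m) (Ind k)) (Ind (k((i, j) := m)))"
proof -
  have "agree (urep (e i j [^]\<^sub>U m) (Ind k)) (\<lambda>\<kappa>. fact m * Ind (k((i, j) := m)) \<kappa>)"
    by (rule e_pow_Ind) (use assms in auto)
  then show ?thesis
    using assms by (simp add: agree_def divided_power_def urep_smult flip: e_def)
qed

lemma agree_urep:
  assumes u: "u \<in> carrier U" and "agree G H"
  shows "agree (urep u G) (urep u H)"
proof -
  have word: "agree (foldr (mat_act n) w G) (foldr (mat_act n) w H)" for w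
    by (induction w) (simp_all add: assms(2) agree_mat_act)
  obtain f where "f \<in> carrier W.F" "u = I +>\<^bsub>W.F\<^esub> f" using u by (rule cosetE)
  then show ?thesis using word by (simp add: agree_def urep_coset W.rep_def)
qed

subsection \<open>Ordered products of divided powers\<close>

definition pm :: "(nat \<times> nat => nat) => (nat \<times> nat) list => env" where
  "pm k xs = foldr (\<lambda>(i, j) y. divided_power n i j (k (i, j)) \<otimes>\<^sub>U y) xs \<one>\<^sub>U"

definition E :: "(nat \<times> nat => nat) => env" where "E k = pm k (root_list n)"

lemma pm_simps [simp]: "pm k [] = \<one>\<^sub>U" "pm k (x # xs) = divided_power n (fst x) (snd x) (k x) \<otimes>\<^sub>U pm k xs"
  by (simp_all add: pm_def case_prod_unfold)

lemma root_list_Suc: "root_list (Suc c) = map (\<lambda>i. (i, c)) (rev [0..<c]) @ root_list c"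
  by (simp add: root_list_def)

lemma root_list_0 [simp]: "root_list 0 = []"
  by (simp add: root_list_def)

lemma set_root_list: "set (root_list c) = {(i, j). i < j \<and> j < c}"
  by (auto simp: root_list_def)

lemma distinct_root_list: "distinct (root_list c)"
  by (induction c) (auto simp: root_list_Suc distinct_map set_root_list inj_on_def)

lemma sorted_root_list:
  "sorted_wrt (\<lambda>x y. snd y < snd x \<or> snd y = snd x \<and> fst y < fst x) (root_list c)"
proof (induction c)
  case (Suc c)
  have "sorted_wrt (\<lambda>x y. y < x) (rev [0..<c])" by (simp add: sorted_wrt_rev)
  with Suc show ?case by (auto simp: root_list_Suc sorted_wrt_append sorted_wrt_map set_root_list)
qed simp

lemma pm_closed [simp]: "(!!x. x \<in> set xs ==> fst x < snd x) ==> pm k xs \<in> carrier U"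
  by (induction xs) simp_all

lemma E_closed [simp]: "E k \<in> carrier U"
  unfolding E_def by (rule pm_closed) (auto simp: set_root_list)

text \<open>The factors act from right to left, hence by increasing column. When
  \<open>e i j\<close> is applied, all entries present lie in columns up to j, while off-diagonal
  entries of row j would lie in later columns; so row j is still empty, as \<open>act_Ind\<close>
  demands.\<close>

lemma pm_Ind:
  assumes "sorted_wrt (\<lambda>x y. snd y < snd x \<or> snd y = snd x \<and> fst y < fst x) xs"
    and "set xs \<subseteq> {(i, j). i < j \<and> j < n}"
  shows "agree (urep (pm k xs) (Ind (\<lambda>_. 0))) (Ind (\<lambda>x. if x \<in> set xs then k x else 0))"
  using assms
proof (induction xs)
  case Nil
  then show ?case by (simp add: urep_one agree_def)
next
  case (Cons x xs)
  obtain i j where x: "x = (i, j)" by (cases x)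
  have ij: "i < j" "j < n" using Cons.prems x by auto
  let ?k = "\<lambda>x. if x \<in> set xs then k x else 0"
  have pmc: "pm k xs \<in> carrier U" by (rule pm_closed) (use Cons.prems in auto)
  have xs: "snd y < j \<or> snd y = j \<and> fst y < i" "fst y < snd y" if "y \<in> set xs" for y
    using Cons.prems that x by auto
  have "agree (urep (divided_power n i j (k x)) (urep (pm k xs) (Ind (\<lambda>_. 0)))) (urep (divided_power n i j (k x)) (Ind ?k))"
    by (rule agree_urep) (use ij Cons in auto)
  also have "agree (urep (divided_power n i j (k x)) (Ind ?k)) (Ind (?k((i, j) := k x)))"
    by (rule dp_Ind[OF ij]) (use xs in fastforce)+
  also have "?k((i, j) := k x) = (\<lambda>y. if y \<in> set (x # xs) then k y else 0)"
    using x by auto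
  finally show ?case using ij pmc x by (simp add: urep_simps)
qed

definition gam :: "(nat \<times> nat => nat) => env => complex" where
  "gam k u = urep u (Ind (\<lambda>_. 0)) (\<lambda>x. int (k x))"

definition exps :: "(nat \<times> nat => nat) set" where
  "exps = {k. \<forall>i j. k (i, j) ~= 0 --> i < j \<and> j < n}"

text \<open>Different E l send the exponential to different monomials, so they are linearly
  independent. This is the part of the Poincare-Birkhoff-Witt theorem that supplies the coordinates
  used from here on.\<close>

lemma gam_E:
  assumes k: "k \<in> exps" and l: "l \<in> exps"
  shows "gam k (E l) = (if k = l then 1 else 0)"
proof -
  have "agree (urep (E l) (Ind (\<lambda>_. 0))) (Ind (\<lambda>x. if x \<in> set (root_list n) then l x else 0))"
    unfolding E_def by (rule pm_Ind[OF sorted_root_list]) (simp add: set_root_list)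
  moreover have "(\<lambda>x. if x \<in> set (root_list n) then l x else 0) = l"
  proof (rule ext, clarify)
    fix i j
    show "(if (i, j) \<in> set (root_list n) then l (i, j) else 0) = l (i, j)"
      using l unfolding set_root_list exps_def by (cases "l (i, j) = 0") auto
  qed
  moreover have "nonneg (\<lambda>x. int (k x))" by (simp add: nonneg_def)
  ultimately have "gam k (E l) = Ind l (\<lambda>x. int (k x))"
    by (simp add: agree_def gam_def)
  also have "\<dots> = (if k = l then 1 else 0)"
  proof -
    have "k = l" if *: "\<forall>i j. i ~= j --> k (i, j) = l (i, j)"
    proof (rule ext, clarify)
      fix i j
      show "k (i, j) = l (i, j)"
      proof (cases "i = j")
        case True
        have "k (i, i) = 0" "l (i, i) = 0" using k l by (auto simp: exps_def)
        then show ?thesis using True by simp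
      qed (use * in simp)
    qed
    then show ?thesis by (auto simp: Ind_def)
  qed
  finally show ?thesis .
qed

lemma gam_additive: "additive_map U complex_ring (gam k)"
  by (rule additive_mapI) (simp_all add: gam_def urep_simps)

end

section \<open>Products of ordered monomials, and the integral form as a ring\<close>

section \<open>Straightening and the Kostant form\<close>

context kos
begin

abbreviation dp :: "nat => nat => nat => env" where "dp \<equiv> divided_power n"

lemma UM_simps [simp]:
  "u \<in> carrier U ==> a \<odot>\<^sub>U u \<in> carrier U"
  "u \<in> carrier U ==> 1 \<odot>\<^sub>U u = u"
  "u \<in> carrier U ==> 0 \<odot>\<^sub>U u = \<zero>\<^sub>U"
  "a \<odot>\<^sub>U \<zero>\<^sub>U = \<zero>\<^sub>U"
  using UM.smult_closed[of a u] UM.smult_one[of u] UM.smult_l_null[of u] UM.smult_r_null[of a] by simp_all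

lemma smult_smult: "u \<in> carrier U ==> a \<odot>\<^sub>U (b \<odot>\<^sub>U u) = (a * b) \<odot>\<^sub>U u"
  using UM.smult_assoc[of a b u] by simp

lemma smult_add_l: "u \<in> carrier U ==> (a + b) \<odot>\<^sub>U u = a \<odot>\<^sub>U u \<oplus>\<^sub>U b \<odot>\<^sub>U u"
  using UM.smult_l_distr[of a b u] by simp

lemma smult_add_r: "u \<in> carrier U ==> v \<in> carrier U ==> a \<odot>\<^sub>U (u \<oplus>\<^sub>U v) = a \<odot>\<^sub>U u \<oplus>\<^sub>U a \<odot>\<^sub>U v"
  using UM.smult_r_distr[of a u v] by simp

lemma dp_def': "dp i j m = (1 / fact m) \<odot>\<^sub>U e i j [^]\<^sub>U m"
  by (simp add: divided_power_def e_def)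

lemma dp_0 [simp]: "dp i j 0 = \<one>\<^sub>U"
  by (simp add: dp_def')

lemma dp_mult:
  assumes "i < j"
  shows "dp i j a \<otimes>\<^sub>U dp i j b = of_nat ((a + b) choose a) \<odot>\<^sub>U dp i j (a + b)"
proof -
  have "e i j [^]\<^sub>U a \<otimes>\<^sub>U e i j [^]\<^sub>U b = e i j [^]\<^sub>U (a + b)"
    using assms by (simp add: U.nat_pow_mult)
  moreover have "1 / fact a * (1 / fact b) = of_nat ((a + b) choose a) * (1 / fact (a + b) :: complex)"
    by (simp add: binomial_fact)
  ultimately show ?thesis
    using assms by (simp add: dp_def' smult_mult smult_smult mult.commute)
qed

lemma e_dp:
  assumes "i < j"
  shows "e i j \<otimes>\<^sub>U dp i j m = of_nat (Suc m) \<odot>\<^sub>U dp i j (Suc m)"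
proof -
  have "e i j = dp i j 1" using assms by (simp add: dp_def')
  then show ?thesis using dp_mult[OF assms, of 1 m] by simp
qed

lemma pow_comm:
  assumes "u \<in> carrier U" "v \<in> carrier U" "u \<otimes>\<^sub>U v = v \<otimes>\<^sub>U u"
  shows "u \<otimes>\<^sub>U v [^]\<^sub>U (b::nat) = v [^]\<^sub>U b \<otimes>\<^sub>U u"
proof (induction b)
  case (Suc b)
  have "u \<otimes>\<^sub>U (v [^]\<^sub>U b \<otimes>\<^sub>U v) = v [^]\<^sub>U b \<otimes>\<^sub>U (u \<otimes>\<^sub>U v)"
    using Suc assms(1,2) by (simp add: U.m_assoc[symmetric])
  also have "\<dots> = v [^]\<^sub>U b \<otimes>\<^sub>U v \<otimes>\<^sub>U u"
    using assms by (simp add: U.m_assoc)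
  finally show ?case by simp
qed (use assms in simp)

text \<open>Both products of the two matrix units vanish, so the corresponding elements
  commute.\<close>

definition comm :: "nat \<times> nat => nat \<times> nat => bool" where
  "comm x y \<longleftrightarrow> snd x ~= fst y \<and> fst x ~= snd y"

definition root :: "nat \<times> nat => bool" where "root x \<longleftrightarrow> fst x < snd x \<and> snd x < n"

lemma dp_root [simp]: "root x ==> dp (fst x) (snd x) m \<in> carrier U"
  by (simp add: root_def)

lemma dp_comm:
  assumes "root x" "root y" "comm x y"
  shows "dp (fst x) (snd x) a \<otimes>\<^sub>U dp (fst y) (snd y) b = dp (fst y) (snd y) b \<otimes>\<^sub>U dp (fst x) (snd x) a"
proof -
  let ?u = "e (fst x) (snd x)" and ?v = "e (fst y) (snd y)"
  have c: "?u \<in> carrier U" "?v \<in> carrier U" using assms by (simp_all add: root_def)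
  have "?u \<otimes>\<^sub>U ?v = ?v \<otimes>\<^sub>U ?u" using assms by (intro e_comm) (auto simp: root_def comm_def)
  from pow_comm[OF c this, of b] have "?v [^]\<^sub>U b \<otimes>\<^sub>U ?u [^]\<^sub>U a = ?u [^]\<^sub>U a \<otimes>\<^sub>U ?v [^]\<^sub>U b"
    by (intro pow_comm) (use c in auto)
  then show ?thesis using c by (simp add: dp_def' smult_mult smult_smult mult.commute)
qed

text \<open>Since \<open>e i c\<close> commutes with \<open>e j c\<close>, bracketing with
  \<open>e i j\<close> acts on powers of \<open>e j c\<close> like a derivative, and divided powers
  absorb its coefficient.\<close>

lemma e_dp_bracket:
  assumes "i < j" "j < c" "c < n"
  shows "e i j \<otimes>\<^sub>U dp j c (Suc b) = dp j c (Suc b) \<otimes>\<^sub>U e i j \<oplus>\<^sub>U dp j c b \<otimes>\<^sub>U e i c"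
proof -
  let ?x = "e i j" and ?y = "e j c" and ?z = "e i c"
  have c: "?x \<in> carrier U" "?y \<in> carrier U" "?z \<in> carrier U" using assms by simp_all
  have zy: "?z \<otimes>\<^sub>U ?y = ?y \<otimes>\<^sub>U ?z" using assms by (intro e_comm) auto
  have pow: "?x \<otimes>\<^sub>U ?y [^]\<^sub>U Suc b = ?y [^]\<^sub>U Suc b \<otimes>\<^sub>U ?x \<oplus>\<^sub>U of_nat (Suc b) \<odot>\<^sub>U (?y [^]\<^sub>U b \<otimes>\<^sub>U ?z)"
    for b
  proof (induction b)
    case 0
    show ?case using e_bracket[OF assms] c by simp
  next
    case (Suc b)
    have "?x \<otimes>\<^sub>U ?y [^]\<^sub>U Suc (Suc b) = (?x \<otimes>\<^sub>U ?y [^]\<^sub>U Suc b) \<otimes>\<^sub>U ?y"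
      using c by (simp add: U.m_assoc)
    also have "\<dots> = ?y [^]\<^sub>U Suc b \<otimes>\<^sub>U (?x \<otimes>\<^sub>U ?y) \<oplus>\<^sub>U of_nat (Suc b) \<odot>\<^sub>U (?y [^]\<^sub>U b \<otimes>\<^sub>U (?z \<otimes>\<^sub>U ?y))"
      unfolding Suc using c by (simp add: U.l_distr smult_mult U.m_assoc del: of_nat_Suc)
    also have "?y [^]\<^sub>U b \<otimes>\<^sub>U (?z \<otimes>\<^sub>U ?y) = ?y [^]\<^sub>U Suc b \<otimes>\<^sub>U ?z"
      using c by (simp add: zy U.m_assoc)
    also have "?y [^]\<^sub>U Suc b \<otimes>\<^sub>U (?x \<otimes>\<^sub>U ?y) = ?y [^]\<^sub>U Suc (Suc b) \<otimes>\<^sub>U ?x \<oplus>\<^sub>U ?y [^]\<^sub>U Suc b \<otimes>\<^sub>U ?z"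
      unfolding e_bracket[OF assms] using c by (simp add: U.r_distr U.m_assoc)
    finally show ?case
      using c smult_add_l[of "?y [^]\<^sub>U Suc b \<otimes>\<^sub>U ?z" 1 "of_nat (Suc b)"]
      by (simp add: U.a_assoc)
  qed
  have "1 / fact (Suc b) * of_nat (Suc b) = (1 / fact b :: complex)"
    unfolding fact_Suc using of_nat_neq_0[of b, where 'a = complex] by (simp add: divide_simps del: of_nat_Suc)
  then show ?thesis
    unfolding dp_def' using c pow[of b]
    by (simp add: smult_mult smult_add_r smult_smult del: of_nat_Suc fact_Suc U.nat_pow_Suc)
qed

text \<open>Terms of the expansion of \<open>e\<^sub>i\<^sub>j\<^sup>(\<^sup>m\<^sup>) e\<^sub>j\<^sub>c\<^sup>(\<^sup>b\<^sup>)\<close> in the Heisenberg relation \<open>[e\<^sub>i\<^sub>j, e\<^sub>j\<^sub>c] = e\<^sub>i\<^sub>c\<close>.\<close>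

definition heis :: "nat => nat => nat => nat => nat => nat => env" where
  "heis i j c m b s = (if s \<le> m \<and> s \<le> b then dp j c (b - s) \<otimes>\<^sub>U (dp i c s \<otimes>\<^sub>U dp i j (m - s)) else \<zero>\<^sub>U)"

lemma heis_closed [simp]: "i < j ==> j < c ==> heis i j c m b s \<in> carrier U"
  by (simp add: heis_def)

lemma e_heis:
  assumes "i < j" "j < c" "c < n" "s \<le> m"
  shows "e i j \<otimes>\<^sub>U heis i j c m b s = of_nat (Suc m - s) \<odot>\<^sub>U heis i j c (Suc m) b s
     \<oplus>\<^sub>U of_nat (Suc s) \<odot>\<^sub>U heis i j c (Suc m) b (Suc s)"
proof (cases "s \<le> b")
  case False
  then show ?thesis using assms by (simp add: heis_def)
next
  case True
  have c [simp]: "i < c" using assms by simp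
  have x: "e i j \<otimes>\<^sub>U dp i c s = dp i c s \<otimes>\<^sub>U e i j"
    using dp_comm[of "(i, j)" "(i, c)" 1 s] assms by (simp add: root_def comm_def dp_def')
  have y: "e i j \<otimes>\<^sub>U (dp i c s \<otimes>\<^sub>U dp i j (m - s))
      = of_nat (Suc m - s) \<odot>\<^sub>U (dp i c s \<otimes>\<^sub>U dp i j (Suc m - s))"
  proof -
    have "e i j \<otimes>\<^sub>U (dp i c s \<otimes>\<^sub>U dp i j (m - s)) = dp i c s \<otimes>\<^sub>U (e i j \<otimes>\<^sub>U dp i j (m - s))"
      using assms x by (simp add: U.m_assoc[symmetric])
    also have "\<dots> = of_nat (Suc (m - s)) \<odot>\<^sub>U (dp i c s \<otimes>\<^sub>U dp i j (Suc (m - s)))"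
      using assms by (simp add: e_dp smult_mult del: of_nat_Suc of_nat_diff)
    finally show ?thesis unfolding Suc_diff_le[OF assms(4)] .
  qed
  show ?thesis
  proof (cases "s = b")
    case True
    then show ?thesis using assms y by (simp add: heis_def del: of_nat_Suc)
  next
    case False
    then have sb: "b - s = Suc (b - Suc s)" using \<open>s \<le> b\<close> by simp
    have z: "e i c \<otimes>\<^sub>U (dp i c s \<otimes>\<^sub>U dp i j (m - s)) = of_nat (Suc s) \<odot>\<^sub>U (dp i c (Suc s) \<otimes>\<^sub>U dp i j (m - s))"
      using assms by (simp add: U.m_assoc[symmetric] e_dp smult_mult del: of_nat_Suc)
    have "e i j \<otimes>\<^sub>U heis i j c m b s
        = (e i j \<otimes>\<^sub>U dp j c (b - s)) \<otimes>\<^sub>U (dp i c s \<otimes>\<^sub>U dp i j (m - s))"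
      using assms \<open>s \<le> b\<close> by (simp add: heis_def U.m_assoc)
    also have "\<dots> = dp j c (b - s) \<otimes>\<^sub>U (e i j \<otimes>\<^sub>U (dp i c s \<otimes>\<^sub>U dp i j (m - s)))
        \<oplus>\<^sub>U dp j c (b - Suc s) \<otimes>\<^sub>U (e i c \<otimes>\<^sub>U (dp i c s \<otimes>\<^sub>U dp i j (m - s)))"
      unfolding sb e_dp_bracket[OF assms(1-3)] using assms by (simp add: U.l_distr U.m_assoc)
    also have "\<dots> = of_nat (Suc m - s) \<odot>\<^sub>U heis i j c (Suc m) b s
     \<oplus>\<^sub>U of_nat (Suc s) \<odot>\<^sub>U heis i j c (Suc m) b (Suc s)"
      unfolding y z using assms \<open>s \<le> b\<close> False
      by (simp add: heis_def smult_mult Suc_le_eq order_less_le del: of_nat_Suc of_nat_diff)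
    finally show ?thesis .
  qed
qed

text \<open>Multiplication by \<open>e i j\<close> sends term s to the terms s and s + 1 of the next
  level, with coefficients m + 1 - s and s + 1. Each term of the next level thus collects the
  coefficient (m + 1 - s) + s = m + 1, which cancels against that of the divided power.\<close>

lemma dp_heis:
  assumes "i < j" "j < c" "c < n"
  shows "dp i j m \<otimes>\<^sub>U dp j c b = finsum U (heis i j c m b) {..m}"
proof (induction m)
  case 0
  then show ?case using assms by (simp add: heis_def)
next
  case (Suc m)
  let ?T = "heis i j c (Suc m) b"
  have T: "?T s \<in> carrier U" "heis i j c m b s \<in> carrier U" for s using assms by simp_all
  have "of_nat (Suc m) \<odot>\<^sub>U (dp i j (Suc m) \<otimes>\<^sub>U dp j c b) = e i j \<otimes>\<^sub>U (dp i j m \<otimes>\<^sub>U dp j c b)"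
    using assms by (simp add: U.m_assoc[symmetric] e_dp smult_mult del: of_nat_Suc)
  also have "\<dots> = finsum U (\<lambda>s. e i j \<otimes>\<^sub>U heis i j c m b s) {..m}"
    unfolding Suc using assms T by (intro U.finsum_rdistr) auto
  also have "\<dots> = finsum U (\<lambda>s. of_nat (Suc m - s) \<odot>\<^sub>U ?T s \<oplus>\<^sub>U of_nat (Suc s) \<odot>\<^sub>U ?T (Suc s)) {..m}"
    using assms by (intro U.finsum_cong') (auto simp: e_heis simp del: of_nat_Suc)
  also have "\<dots> = finsum U (\<lambda>s. of_nat (Suc m - s) \<odot>\<^sub>U ?T s) {..m}
      \<oplus>\<^sub>U finsum U (\<lambda>s. of_nat (Suc s) \<odot>\<^sub>U ?T (Suc s)) {..m}"
    using T by (intro U.finsum_addf) auto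
  also have "finsum U (\<lambda>s. of_nat (Suc m - s) \<odot>\<^sub>U ?T s) {..m} = finsum U (\<lambda>s. of_nat (Suc m - s) \<odot>\<^sub>U ?T s) {..Suc m}"
    using T by (subst U.finsum_Suc) auto
  also have "finsum U (\<lambda>s. of_nat (Suc s) \<odot>\<^sub>U ?T (Suc s)) {..m} = finsum U (\<lambda>s. of_nat s \<odot>\<^sub>U ?T s) {..Suc m}"
    using T by (subst U.finsum_Suc2) auto
  also have "finsum U (\<lambda>s. of_nat (Suc m - s) \<odot>\<^sub>U ?T s) {..Suc m} \<oplus>\<^sub>U finsum U (\<lambda>s. of_nat s \<odot>\<^sub>U ?T s) {..Suc m}
      = finsum U (\<lambda>s. of_nat (Suc m - s) \<odot>\<^sub>U ?T s \<oplus>\<^sub>U of_nat s \<odot>\<^sub>U ?T s) {..Suc m}"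
    using T by (intro U.finsum_addf[symmetric]) auto
  also have "\<dots> = finsum U (\<lambda>s. of_nat (Suc m) \<odot>\<^sub>U ?T s) {..Suc m}"
    using T by (intro U.finsum_cong')
      (auto simp: smult_add_l[symmetric] of_nat_add[symmetric] simp del: of_nat_Suc of_nat_add)
  also have "\<dots> = of_nat (Suc m) \<odot>\<^sub>U finsum U ?T {..Suc m}"
    using T UM.smult_finsum[of "of_nat (Suc m)" "{..Suc m}" ?T] by simp
  finally have eq: "of_nat (Suc m) \<odot>\<^sub>U (dp i j (Suc m) \<otimes>\<^sub>U dp j c b) = of_nat (Suc m) \<odot>\<^sub>U finsum U ?T {..Suc m}" .
  have sumc: "finsum U ?T {..Suc m} \<in> carrier U" using T by (intro U.finsum_closed) auto
  have "(1 / of_nat (Suc m)) * of_nat (Suc m) = (1::complex)"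
    using of_nat_neq_0[of m, where 'a = complex] by (simp del: of_nat_Suc)
  with arg_cong[OF eq, of "\<lambda>u. (1 / of_nat (Suc m)) \<odot>\<^sub>U u"] sumc assms
  show ?case by (simp add: smult_smult del: of_nat_Suc)
qed

subsection \<open>Commuting products\<close>

lemma pm_cong: "(!!x. x \<in> set xs ==> k x = l x) ==> pm k xs = pm l xs"
  by (induction xs) auto

lemma pm_carrier [simp]: "(!!x. x \<in> set xs ==> root x) ==> pm k xs \<in> carrier U"
  by (rule pm_closed) (auto simp: root_def)

lemma pm_append:
  "(!!x. x \<in> set (xs @ ys) ==> root x) ==> pm k (xs @ ys) = pm k xs \<otimes>\<^sub>U pm k ys"
  by (induction xs) (simp_all add: U.m_assoc)

lemma pm_zero: "(!!x. x \<in> set xs ==> k x = 0) ==> pm k xs = \<one>\<^sub>U"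
  by (induction xs) auto

lemma dp_comm_pm:
  assumes "!!y. y \<in> set xs ==> root y" "!!y. y \<in> set xs ==> k y = 0 \<or> comm x y" "root x"
  shows "dp (fst x) (snd x) m \<otimes>\<^sub>U pm k xs = pm k xs \<otimes>\<^sub>U dp (fst x) (snd x) m"
  using assms
proof (induction xs)
  case (Cons y xs)
  let ?u = "dp (fst x) (snd x) m" and ?v = "dp (fst y) (snd y) (k y)"
  have c: "?u \<in> carrier U" "?v \<in> carrier U" "pm k xs \<in> carrier U" using Cons.prems by simp_all
  have "?u \<otimes>\<^sub>U ?v = ?v \<otimes>\<^sub>U ?u"
  proof (cases "k y = 0")
    case True
    then show ?thesis using c by simp
  next
    case False
    then show ?thesis using Cons.prems(1)[of y] Cons.prems(2)[of y] Cons.prems(3) by (intro dp_comm) simp_all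
  qed
  then have "?u \<otimes>\<^sub>U pm k (y # xs) = ?v \<otimes>\<^sub>U (?u \<otimes>\<^sub>U pm k xs)"
    using c by (simp add: U.m_assoc[symmetric])
  also have "?u \<otimes>\<^sub>U pm k xs = pm k xs \<otimes>\<^sub>U ?u" using Cons by simp
  finally show ?case using c by (simp add: U.m_assoc)
qed simp

lemma dp_pm_update:
  assumes "distinct xs" "!!y. y \<in> set xs ==> root y" "!!y. y \<in> set xs ==> comm x y" "x \<in> set xs"
  shows "dp (fst x) (snd x) s \<otimes>\<^sub>U pm k xs = of_nat ((k x + s) choose s) \<odot>\<^sub>U pm (k(x := k x + s)) xs"
  using assms
proof (induction xs)
  case (Cons y xs)
  let ?u = "dp (fst x) (snd x) s" and ?v = "dp (fst y) (snd y) (k y)"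
  have x: "root x" using Cons.prems by blast
  have c: "?u \<in> carrier U" "?v \<in> carrier U" "pm k xs \<in> carrier U" "!!k. pm k xs \<in> carrier U"
    using Cons.prems x by simp_all
  show ?case
  proof (cases "x = y")
    case True
    have "pm (k(x := k x + s)) xs = pm k xs" by (rule pm_cong) (use Cons.prems True in auto)
    moreover have "?u \<otimes>\<^sub>U ?v = of_nat ((k x + s) choose s) \<odot>\<^sub>U dp (fst x) (snd x) (k x + s)"
      using dp_mult[of "fst x" "snd x" s "k x"] x True by (simp add: root_def add.commute)
    ultimately show ?thesis using True c x
      by (simp add: U.m_assoc[symmetric] smult_mult del: fun_upd_apply add: fun_upd_same)
  next
    case False
    then have "?u \<otimes>\<^sub>U pm k (y # xs) = ?v \<otimes>\<^sub>U (?u \<otimes>\<^sub>U pm k xs)"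
      using c Cons.prems dp_comm[OF x, of y s "k y"] by (simp add: U.m_assoc[symmetric])
    also have "?u \<otimes>\<^sub>U pm k xs = of_nat ((k x + s) choose s) \<odot>\<^sub>U pm (k(x := k x + s)) xs"
      using Cons False by (simp add: fun_upd_def)
    finally show ?thesis using c False by (simp add: smult_mult fun_upd_def)
  qed
qed simp

text \<open>Only pairs in which a factor outside P stands before one in P have to be interchanged,
  hence the one-sided hypothesis.\<close>

lemma pm_filter:
  assumes "sorted_wrt (\<lambda>x y. \<not> P x \<and> P y --> comm x y) xs" "!!x. x \<in> set xs ==> root x"
  shows "pm k xs = pm k (filter P xs) \<otimes>\<^sub>U pm k (filter (\<lambda>x. \<not> P x) xs)"
  using assms
proof (induction xs)
  case (Cons x xs)
  let ?u = "dp (fst x) (snd x) (k x)"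
  have "pm k (filter Q xs) \<in> carrier U" for Q by (rule pm_carrier) (use Cons.prems in auto)
  then have c: "?u \<in> carrier U" "pm k (filter P xs) \<in> carrier U" "pm k (filter (\<lambda>x. \<not> P x) xs) \<in> carrier U"
    using Cons.prems by simp_all
  have IH: "pm k xs = pm k (filter P xs) \<otimes>\<^sub>U pm k (filter (\<lambda>x. \<not> P x) xs)" using Cons by simp
  show ?case
  proof (cases "P x")
    case True
    then show ?thesis using IH c by (simp add: U.m_assoc)
  next
    case False
    have "?u \<otimes>\<^sub>U pm k (filter P xs) = pm k (filter P xs) \<otimes>\<^sub>U ?u"
      by (rule dp_comm_pm) (use Cons.prems False in auto)
    then show ?thesis using False IH c by (simp add: U.m_assoc[symmetric])
  qed
qed simp

lemma root_list_root: "c \<le> n ==> x \<in> set (root_list c) ==> root x"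
  by (auto simp: set_root_list root_def)

text \<open>For complementary supports, a product of ordered monomials is again ordered up to
  interchanges of commuting factors. The splittings used later are those by columns and by
  rows.\<close>

lemma E_add:
  assumes "!!x y. root x ==> root y ==> \<not> P x ==> P y ==>
      snd y < snd x \<or> snd y = snd x \<and> fst y < fst x ==> comm x y"
    and a: "!!x. a x ~= 0 ==> P x" and b: "!!x. b x ~= 0 ==> \<not> P x"
  shows "E a \<otimes>\<^sub>U E b = E (\<lambda>x. a x + b x)"
proof -
  let ?P = "filter P (root_list n)" and ?N = "filter (\<lambda>x. \<not> P x) (root_list n)"
  have "sorted_wrt (\<lambda>x y. \<not> P x \<and> P y --> comm x y) (root_list n)"
    by (rule sorted_wrt_mono_rel[OF _ sorted_root_list]) (use assms(1) root_list_root[OF order_refl] in blast)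
  then have *: "E k = pm k ?P \<otimes>\<^sub>U pm k ?N" for k
    unfolding E_def by (rule pm_filter) (rule root_list_root, auto)
  have "pm a ?N = \<one>\<^sub>U" by (rule pm_zero) (use a in auto)
  moreover have "pm b ?P = \<one>\<^sub>U" by (rule pm_zero) (use b in auto)
  moreover have "pm (\<lambda>x. a x + b x) ?P = pm a ?P" by (rule pm_cong) (use b in auto)
  moreover have "pm (\<lambda>x. a x + b x) ?N = pm b ?N" by (rule pm_cong) (use a in auto)
  moreover have "pm k (filter Q (root_list n)) \<in> carrier U" for k Q
    by (rule pm_carrier) (rule root_list_root[OF order_refl], simp)
  ultimately show ?thesis unfolding * by simp
qed

subsection \<open>Left multiplication on ordered products\<close>

definition icol :: "nat => (nat \<times> nat => nat) => int" where "icol q k = (\<Sum>a<n. int (k (a, q)))"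
definition irow :: "nat => (nat \<times> nat => nat) => int" where "irow q k = (\<Sum>b<n. int (k (q, b)))"
definition wt :: "(nat \<times> nat => nat) => nat => int" where "wt k q = irow q k - icol q k"

lemma icol_upd: "a < n ==> icol q (k((a, b) := v)) = icol q k + (if q = b then int v - int (k (a, b)) else 0)"
  by (auto simp: icol_def sum.remove[of "{..<n}" a] intro!: sum.cong)

lemma irow_upd: "b < n ==> irow q (k((a, b) := v)) = irow q k + (if q = a then int v - int (k (a, b)) else 0)"
  by (auto simp: irow_def sum.remove[of "{..<n}" b] intro!: sum.cong)

lemma exps_upd: "k \<in> exps ==> v = 0 \<or> a < b \<and> b < n ==> k((a, b) := v) \<in> exps"
  by (auto simp: exps_def)

text \<open>Bounds the exponents that occur in the product of a divided power of
  \<open>e i j\<close> with \<open>E k\<close>; coefficients are deliberately forgotten. The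
  Heisenberg relation moves exponents from row j to row i within a column, and what is left of the
  factor is finally added at (i, j): so no column sum drops, rows before i stay, and degrees
  add.\<close>

definition reach :: "nat => nat => nat => (nat \<times> nat => nat) => (nat \<times> nat => nat) set" where
  "reach i j m k = {k' \<in> exps. (\<forall>q. icol q k \<le> icol q k') \<and> (\<forall>a b. a < i --> k' (a, b) = k (a, b)) \<and>
     (\<forall>q. wt k' q = wt k q + (if q = i then int m else 0) - (if q = j then int m else 0))}"

lemma span_smult_nat:
  assumes "S \<subseteq> carrier U" "x \<in> add_span U S"
  shows "of_nat N \<odot>\<^sub>U x \<in> add_span U S"
proof (induction N)
  note sub = U.add_span_subgroup[OF assms(1)]
  have x: "x \<in> carrier U" using U.add_span_subset assms by auto
  case 0
  then show ?case using x subgroup_zero[OF sub] by simp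
  case (Suc N)
  then show ?case using x subgroup_add[OF sub assms(2)] smult_add_l[OF x, of 1 "of_nat N"] by simp
qed

lemma span_lmult:
  assumes "S \<subseteq> carrier U" "x \<in> add_span U S" "a \<in> carrier U" "additive_subgroup H U" "!!s. s \<in> S ==> a \<otimes>\<^sub>U s \<in> H"
  shows "a \<otimes>\<^sub>U x \<in> H"
  by (rule U.span_image[OF U.mult_additive_r[OF assms(3)] U.ag assms(4,1,5,2)])

lemma span_rmult:
  assumes "S \<subseteq> carrier U" "x \<in> add_span U S" "a \<in> carrier U" "additive_subgroup H U" "!!s. s \<in> S ==> s \<otimes>\<^sub>U a \<in> H"
  shows "x \<otimes>\<^sub>U a \<in> H"
  by (rule U.span_image[OF U.mult_additive_l[OF assms(3)] U.ag assms(4,1,5,2)])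

abbreviation "colm c \<equiv> map (\<lambda>i. (i, c)) (rev [0..<c])"

lemma colm_facts:
  assumes "c < n"
  shows "distinct (colm c)" "x \<in> set (colm c) ==> root x" "x \<in> set (colm c) ==> y \<in> set (colm c) ==> comm x y"
    "(i, j) \<in> set (colm c) \<longleftrightarrow> j = c \<and> i < c"
  using assms by (auto simp: distinct_map inj_on_def root_def comm_def)

lemma dp_colm:
  assumes ij: "i < j" "j < c" "c < n"
  defines "k' \<equiv> \<lambda>k s. k((j, c) := k (j, c) - s, (i, c) := k (i, c) + s)"
  shows "dp i j m \<otimes>\<^sub>U pm k (colm c) = finsum U (\<lambda>s. if s \<le> k (j, c)
      then of_nat ((k (i, c) + s) choose s) \<odot>\<^sub>U (pm (k' k s) (colm c) \<otimes>\<^sub>U dp i j (m - s)) else \<zero>\<^sub>U) {..m}"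
proof -
  let ?k0 = "k((j, c) := 0)"
  note col = colm_facts[OF ij(3)]
  have pc [simp]: "pm k (colm c) \<in> carrier U" for k by (rule pm_carrier) (rule col(2))
  have [simp]: "i < c" using ij by simp
  have upd: "dp a c s \<otimes>\<^sub>U pm k (colm c) = of_nat ((k (a, c) + s) choose s) \<odot>\<^sub>U pm (k((a, c) := k (a, c) + s)) (colm c)"
    if "a < c" for a s k
    using dp_pm_update[of "colm c" "(a, c)" s k] col(1) col(2,3) that by auto
  \<comment> \<open>Split off the only factor of column c that does not commute with
    \<open>e i j\<close>.\<close>
  have k: "pm k (colm c) = dp j c (k (j, c)) \<otimes>\<^sub>U pm ?k0 (colm c)"
    using upd[OF ij(2), of "k (j, c)" ?k0] by simp
  have comm: "dp i j t \<otimes>\<^sub>U pm ?k0 (colm c) = pm ?k0 (colm c) \<otimes>\<^sub>U dp i j t" for t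
  proof -
    have "?k0 y = 0 \<or> comm (i, j) y" if "y \<in> set (colm c)" for y
    proof -
      obtain a where "y = (a, c)" using \<open>y \<in> set (colm c)\<close> by auto
      then show ?thesis using ij by (cases "a = j") (simp_all add: comm_def)
    qed
    then show ?thesis using dp_comm_pm[of "colm c" ?k0 "(i, j)" t] col(2) ij by (simp add: root_def)
  qed
  have "dp i j m \<otimes>\<^sub>U pm k (colm c) = finsum U (heis i j c m (k (j, c))) {..m} \<otimes>\<^sub>U pm ?k0 (colm c)"
    unfolding k dp_heis[OF ij, symmetric] using ij by (simp add: U.m_assoc)
  also have "\<dots> = finsum U (\<lambda>s. heis i j c m (k (j, c)) s \<otimes>\<^sub>U pm ?k0 (colm c)) {..m}"
    using ij by (intro U.finsum_ldistr) auto
  also have "\<dots> = finsum U (\<lambda>s. if s \<le> k (j, c)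
      then of_nat ((k (i, c) + s) choose s) \<odot>\<^sub>U (pm (k' k s) (colm c) \<otimes>\<^sub>U dp i j (m - s)) else \<zero>\<^sub>U) {..m}"
  proof (intro U.finsum_cong' refl)
    fix s assume s: "s \<in> {..m}"
    show "heis i j c m (k (j, c)) s \<otimes>\<^sub>U pm ?k0 (colm c) = (if s \<le> k (j, c)
      then of_nat ((k (i, c) + s) choose s) \<odot>\<^sub>U (pm (k' k s) (colm c) \<otimes>\<^sub>U dp i j (m - s)) else \<zero>\<^sub>U)"
    proof (cases "s \<le> k (j, c)")
      case True
      have "heis i j c m (k (j, c)) s \<otimes>\<^sub>U pm ?k0 (colm c)
          = dp j c (k (j, c) - s) \<otimes>\<^sub>U (dp i c s \<otimes>\<^sub>U (dp i j (m - s) \<otimes>\<^sub>U pm ?k0 (colm c)))"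
        using True s ij by (simp add: heis_def U.m_assoc)
      also have "\<dots> = dp j c (k (j, c) - s) \<otimes>\<^sub>U (dp i c s \<otimes>\<^sub>U pm ?k0 (colm c)) \<otimes>\<^sub>U dp i j (m - s)"
        unfolding comm using ij by (simp add: U.m_assoc)
      also have "dp i c s \<otimes>\<^sub>U pm ?k0 (colm c) = of_nat ((k (i, c) + s) choose s) \<odot>\<^sub>U pm (?k0((i, c) := k (i, c) + s)) (colm c)"
        using upd[of i s ?k0] ij by simp
      also have "dp j c (k (j, c) - s) \<otimes>\<^sub>U (of_nat ((k (i, c) + s) choose s) \<odot>\<^sub>U pm (?k0((i, c) := k (i, c) + s)) (colm c))
          = of_nat ((k (i, c) + s) choose s) \<odot>\<^sub>U pm (k' k s) (colm c)"
        using upd[OF ij(2), of "k (j, c) - s" "?k0((i, c) := k (i, c) + s)"] ij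
        by (simp add: smult_mult k'_def fun_upd_twist[of "(i, c)"])
      finally show ?thesis using True ij by (simp add: smult_mult fun_upd_def)
    qed (use s ij in \<open>simp add: heis_def\<close>)
  qed (use ij in auto)
  finally show ?thesis .
qed

text \<open>Columns occur in decreasing order, so the new factor travels to the right through one
  column after another, leaving contributions in row i, until column j absorbs it. That columns from
  c on are unchanged allows a column already passed to be put back in front.\<close>

lemma dp_pm_span:
  assumes "i < j" "j < c" "c \<le> n" "k \<in> exps"
  shows "dp i j m \<otimes>\<^sub>U pm k (root_list c) \<in>
    add_span U {pm k' (root_list c) | k'. k' \<in> reach i j m k \<and> (\<forall>a b. b \<ge> c --> k' (a, b) = k (a, b))}"
  using assms(2-4)
proof (induction c arbitrary: k m)
  case 0
  then show ?case by simp
next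
  case (Suc c)
  let ?S = "{pm k' (root_list (Suc c)) | k'. k' \<in> reach i j m k \<and> (\<forall>a b. b \<ge> Suc c --> k' (a, b) = k (a, b))}"
  have cn: "c < n" and [simp]: "i < c" using Suc.prems assms(1) by auto
  note col = colm_facts[OF cn]
  have pc [simp]: "pm k (colm c) \<in> carrier U" for k by (rule pm_carrier) (rule col(2))
  have pr [simp]: "pm k (root_list c) \<in> carrier U" for k
    by (rule pm_carrier) (rule root_list_root, use cn in auto)
  have split: "pm k (root_list (Suc c)) = pm k (colm c) \<otimes>\<^sub>U pm k (root_list c)" for k
    unfolding root_list_Suc by (rule pm_append) (use col(2) root_list_root[of c] cn in auto)
  have S: "?S \<subseteq> carrier U" unfolding split by auto
  note sub = U.add_span_subgroup[OF S]
  show ?case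
  proof (cases "j = c")
    case True
    let ?k = "k((i, j) := k (i, j) + m)"
    have "dp i j m \<otimes>\<^sub>U pm k (colm c) = of_nat ((k (i, j) + m) choose m) \<odot>\<^sub>U pm ?k (colm c)"
      using dp_pm_update[of "colm c" "(i, c)" m k] col(1) col(2,3) True by auto
    moreover have "pm ?k (root_list c) = pm k (root_list c)"
      by (rule pm_cong) (auto simp: set_root_list True)
    ultimately have "dp i j m \<otimes>\<^sub>U pm k (root_list (Suc c)) = of_nat ((k (i, j) + m) choose m) \<odot>\<^sub>U pm ?k (root_list (Suc c))"
      using assms(1) by (simp add: split U.m_assoc[symmetric] smult_mult)
    moreover have "?k \<in> reach i j m k"
    proof -
      have "i < n" "j < n" "i ~= j" using True cn less_trans[OF assms(1), of n] less_imp_neq[OF assms(1)] by simp_all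
      moreover have "?k \<in> exps" by (rule exps_upd[OF Suc.prems(3)]) (use assms(1) \<open>j < n\<close> in simp)
      ultimately show ?thesis
        by (simp add: reach_def wt_def icol_upd irow_upd)
    qed
    then have "pm ?k (root_list (Suc c)) \<in> ?S" using True by auto
    ultimately show ?thesis using span_smult_nat[OF S U.add_span_incl] by simp
  next
    case False
    then have jc: "j < c" using Suc.prems by simp
    let ?k = "\<lambda>s. k((j, c) := k (j, c) - s, (i, c) := k (i, c) + s)"
    let ?f = "\<lambda>s. if s \<le> k (j, c)
      then of_nat ((k (i, c) + s) choose s) \<odot>\<^sub>U (pm (?k s) (colm c) \<otimes>\<^sub>U dp i j (m - s)) else \<zero>\<^sub>U"
    have "dp i j m \<otimes>\<^sub>U pm k (root_list (Suc c)) = finsum U ?f {..m} \<otimes>\<^sub>U pm k (root_list c)"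
      using assms(1) dp_colm[OF assms(1) jc cn, of m k] by (simp add: split U.m_assoc[symmetric])
    also have "\<dots> = finsum U (\<lambda>s. ?f s \<otimes>\<^sub>U pm k (root_list c)) {..m}"
      using assms(1) by (intro U.finsum_ldistr) auto
    also have "\<dots> \<in> add_span U ?S"
    proof (rule U.finsum_in_subgroup[OF sub])
      fix s assume s: "s \<in> {..m}"
      show "?f s \<otimes>\<^sub>U pm k (root_list c) \<in> add_span U ?S"
      proof (cases "s \<le> k (j, c)")
        case True
        have ks: "?k s \<in> exps" by (intro exps_upd Suc.prems(3)) (use jc cn in auto)
        have eq: "pm k (root_list c) = pm (?k s) (root_list c)"
          by (rule pm_cong) (auto simp: set_root_list)
        let ?T = "{pm k' (root_list c) | k'. k' \<in> reach i j (m - s) (?k s) \<and> (\<forall>a b. b \<ge> c --> k' (a, b) = ?k s (a, b))}"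
        have IH: "dp i j (m - s) \<otimes>\<^sub>U pm k (root_list c) \<in> add_span U ?T"
          unfolding eq by (rule Suc.IH[OF jc _ ks]) (use cn in simp)
        have "pm (?k s) (colm c) \<otimes>\<^sub>U (dp i j (m - s) \<otimes>\<^sub>U pm k (root_list c)) \<in> add_span U ?S"
        proof (rule span_lmult[OF _ IH _ sub])
          show "?T \<subseteq> carrier U" by auto
          fix t assume "t \<in> ?T"
          then obtain k' where k': "t = pm k' (root_list c)" "k' \<in> reach i j (m - s) (?k s)"
            "!!a b. b \<ge> c ==> k' (a, b) = ?k s (a, b)" by auto
          have "pm (?k s) (colm c) = pm k' (colm c)"
          proof (rule pm_cong)
            fix x assume "x \<in> set (colm c)"
            then obtain a where "x = (a, c)" by auto
            then show "?k s x = k' x" using k'(3)[of c a] by simp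
          qed
          then have t: "pm (?k s) (colm c) \<otimes>\<^sub>U t = pm k' (root_list (Suc c))" by (simp add: k'(1) split)
          have "icol q (?k s) = icol q k" "wt (?k s) q = wt k q + (if q = i then int s else 0) - (if q = j then int s else 0)" for q
            using True cn jc assms(1) by (auto simp: wt_def icol_upd irow_upd)
          then have "k' \<in> reach i j m k"
            using k'(2) s assms(1) by (auto simp: reach_def)
          moreover have "\<forall>a b. b \<ge> Suc c --> k' (a, b) = k (a, b)" using k'(3) by auto
          ultimately show "pm (?k s) (colm c) \<otimes>\<^sub>U t \<in> add_span U ?S"
            unfolding t by (intro U.add_span_incl) blast
        qed simp
        then have "of_nat ((k (i, c) + s) choose s) \<odot>\<^sub>U
            (pm (?k s) (colm c) \<otimes>\<^sub>U (dp i j (m - s) \<otimes>\<^sub>U pm k (root_list c))) \<in> add_span U ?S"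
          by (rule span_smult_nat[OF S])
        then show ?thesis using True assms(1) by (simp add: smult_mult U.m_assoc)
      next
        case False
        then show ?thesis using subgroup_zero[OF sub] by simp
      qed
    qed
    finally show ?thesis .
  qed
qed

text \<open>The zero pattern of the product \<open>E l E m\<close>. The condition on columns serves
  the ideals, the one on \<open>wt\<close> the grading, and the one on rows makes monomials with
  rows from p on closed under products.\<close>

definition reach_prod :: "(nat \<times> nat => nat) => (nat \<times> nat => nat) => (nat \<times> nat => nat) set" where
  "reach_prod l m = {k \<in> exps. (\<forall>q. icol q m \<le> icol q k) \<and> (\<forall>q. wt k q = wt l q + wt m q) \<and>
     (\<forall>p. (\<forall>a b. a < p --> l (a, b) = 0) --> (\<forall>a b. a < p --> k (a, b) = m (a, b)))}"

lemma E_span_subset: "{E k | k. P k} \<subseteq> carrier U"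
  by auto

lemma pm_E_span:
  assumes m: "m \<in> exps" and "distinct xs" "!!x. x \<in> set xs ==> root x"
  shows "pm l xs \<otimes>\<^sub>U E m \<in> add_span U {E k | k. k \<in> reach_prod (\<lambda>x. if x \<in> set xs then l x else 0) m}"
  using assms(2,3)
proof (induction xs)
  case Nil
  have "m \<in> reach_prod (\<lambda>x. if x \<in> set [] then l x else 0) m"
    using m by (simp add: reach_prod_def wt_def icol_def irow_def)
  then show ?case by (simp add: U.add_span_incl) (rule U.add_span_incl, auto)
next
  case (Cons x xs)
  show ?case
  \<comment> \<open>A zero exponent is treated apart: row i may then be among those that must stay
    unchanged, and for this row \<open>reach\<close> promises nothing.\<close>
  proof (cases "l x = 0")
    case True
    then have "(\<lambda>y. if y \<in> set (x # xs) then l y else 0) = (\<lambda>y. if y \<in> set xs then l y else 0)" by auto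
    moreover have "pm l (x # xs) = pm l xs" using Cons.prems True by simp
    ultimately show ?thesis using Cons.IH Cons.prems by simp
  next
  case False
  obtain i j where x: "x = (i, j)" by (cases x)
  have ij: "i < j" "j < n" using Cons.prems(2)[of x] x by (auto simp: root_def)
  let ?l = "\<lambda>y. if y \<in> set xs then l y else 0" and ?l' = "\<lambda>y. if y \<in> set (x # xs) then l y else 0"
  have l': "?l' = ?l(x := l x)" by auto
  have lx: "?l (i, j) = 0" using Cons.prems x by auto
  have wt': "wt ?l' q = wt ?l q + (if q = i then int (l x) else 0) - (if q = j then int (l x) else 0)" for q
    unfolding l' using ij lx by (simp add: x wt_def icol_upd irow_upd)
  note S = E_span_subset[of "\<lambda>k. k \<in> reach_prod ?l' m"]
  have pc: "pm l xs \<in> carrier U" using Cons.prems by simp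
  have "dp i j (l x) \<otimes>\<^sub>U (pm l xs \<otimes>\<^sub>U E m) \<in> add_span U {E k | k. k \<in> reach_prod ?l' m}"
  proof (rule span_lmult[OF E_span_subset Cons.IH _ U.add_span_subgroup[OF S]])
    fix t assume "t \<in> {E k | k. k \<in> reach_prod ?l m}"
    then obtain k where k: "t = E k" "k \<in> reach_prod ?l m" by auto
    have kx: "k \<in> exps" using k(2) by (simp add: reach_prod_def)
    have sub: "{E k' | k'. k' \<in> reach i j (l x) k} \<subseteq> {E k | k. k \<in> reach_prod ?l' m}"
    proof -
      have "k' \<in> reach_prod ?l' m" if k': "k' \<in> reach i j (l x) k" for k'
      proof -
        have "k' (a, b) = m (a, b)" if p: "\<forall>a b. a < p --> ?l' (a, b) = 0" "a < p" for p a b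
        proof -
          have "p \<le> i" using p(1)[rule_format, of i j] False x by (cases "i < p") auto
          moreover have "\<forall>a b. a < p --> ?l (a, b) = 0"
          proof (intro allI impI)
            fix a b assume "a < p"
            then show "?l (a, b) = 0" using p(1)[rule_format, of a b] by (auto split: if_splits)
          qed
          ultimately show ?thesis using k(2) k' p(2) by (auto simp: reach_def reach_prod_def)
        qed
        moreover have "icol q m \<le> icol q k'" for q
          using k(2) k' order_trans[of "icol q m" "icol q k" "icol q k'"] by (simp add: reach_def reach_prod_def)
        moreover have "wt k' q = wt ?l' q + wt m q" for q
          unfolding wt' using k(2) k' by (simp add: reach_def reach_prod_def)
        ultimately show ?thesis using k' unfolding reach_def reach_prod_def by blast
      qed
      then show ?thesis by auto
    qed
    have "dp i j (l x) \<otimes>\<^sub>U E k \<in> add_span U {E k' | k'. k' \<in> reach i j (l x) k}"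
      by (rule subsetD[OF U.add_span_mono dp_pm_span[OF ij(1) ij(2) order_refl kx, of "l x", folded E_def]]) auto
    then show "dp i j (l x) \<otimes>\<^sub>U t \<in> add_span U {E k | k. k \<in> reach_prod ?l' m}"
      unfolding k(1) using U.add_span_mono[OF sub S] by blast
  qed (use Cons.prems ij in auto)
  then show ?thesis using pc ij x by (simp add: U.m_assoc)
  qed
qed

subsection \<open>The integral form as a ring\<close>

lemma E_mult_span:
  assumes l: "l \<in> exps" and m: "m \<in> exps"
  shows "E l \<otimes>\<^sub>U E m \<in> add_span U {E k | k. k \<in> reach_prod l m}"
proof -
  have "(\<lambda>x. if x \<in> set (root_list n) then l x else 0) = l"
  proof (rule ext, clarify)
    fix i j
    show "(if (i, j) \<in> set (root_list n) then l (i, j) else 0) = l (i, j)"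
      using l unfolding set_root_list exps_def by (cases "l (i, j) = 0") auto
  qed
  then show ?thesis
    using pm_E_span[OF m distinct_root_list[of n], where l = l, OF root_list_root[OF order_refl]] by (simp add: E_def)
qed

lemma gam_span_zero:
  assumes "x \<in> add_span U {E k | k. k \<in> G}" "G \<subseteq> exps" "k \<in> exps" "k \<notin> G"
  shows "gam k x = 0"
proof -
  have "gam k x \<in> {\<zero>\<^bsub>complex_ring\<^esub>}"
    by (rule U.span_image[OF gam_additive complex.ag complex.zero_subgroup E_span_subset _ assms(1)])
      (use assms gam_E in auto)
  then show ?thesis by simp
qed

lemma gam_E_mult:
  assumes "l \<in> exps" "m \<in> exps" "k \<in> exps" "gam k (E l \<otimes>\<^sub>U E m) ~= 0"
  shows "k \<in> reach_prod l m"
proof (rule ccontr)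
  have "reach_prod l m \<subseteq> exps" by (auto simp: reach_prod_def)
  moreover assume "k \<notin> reach_prod l m"
  ultimately show False using gam_span_zero[OF E_mult_span[OF assms(1,2)] _ assms(3)] assms(4) by simp
qed

abbreviation "L \<equiv> kostant_int n"
abbreviation L_mult (infixl "\<otimes>\<^sub>L" 70) where "x \<otimes>\<^sub>L y \<equiv> x \<otimes>\<^bsub>L\<^esub> y"
abbreviation L_add (infixl "\<oplus>\<^sub>L" 65) where "x \<oplus>\<^sub>L y \<equiv> x \<oplus>\<^bsub>L\<^esub> y"
abbreviation L_zero ("\<zero>\<^sub>L") where "\<zero>\<^sub>L \<equiv> \<zero>\<^bsub>L\<^esub>"
abbreviation L_one ("\<one>\<^sub>L") where "\<one>\<^sub>L \<equiv> \<one>\<^bsub>L\<^esub>"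

text \<open>A Kostant monomial depends on the entries above the diagonal only. Exponents are
  therefore encoded as functions supported there, for which different exponents give different
  monomials.\<close>

definition strict :: "nat mat => nat \<times> nat => nat" where
  "strict k x = (if fst x < snd x \<and> snd x < n then k $$ x else 0)"

lemma strict_exps: "strict k \<in> exps"
  by (auto simp: exps_def strict_def split: if_splits)

lemma kostant_monomial_E: "kostant_monomial n k = E (strict k)"
  unfolding kostant_monomial_def E_def pm_def
  by (intro foldr_cong refl) (auto simp: set_root_list strict_def)

lemma strict_mat: "k \<in> exps ==> strict (mat n n k) = k"
  by (rule ext, clarify) (auto simp: strict_def exps_def)

lemma kostant_monomials: "kostant_monomial n ` carrier_mat n n = {E k | k. k \<in> exps}"
proof (intro equalityI subsetI)
  fix x assume "x \<in> {E k | k. k \<in> exps}"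
  then obtain k where "x = E k" "k \<in> exps" by auto
  then show "x \<in> kostant_monomial n ` carrier_mat n n"
    by (intro image_eqI[of _ _ "mat n n k"]) (simp_all add: kostant_monomial_E strict_mat)
qed (auto simp: kostant_monomial_E strict_exps)

lemma L_simps:
  "carrier L = add_span U {E k | k. k \<in> exps}" "mult L = mult U" "one L = one U" "zero L = zero U" "add L = add U"
  by (simp_all add: kostant_int_def kostant_monomials)

lemma E_zero: "E (\<lambda>_. 0) = \<one>\<^sub>U"
  unfolding E_def by (rule pm_zero) simp

lemma L_subgroup: "additive_subgroup (carrier L) U"
  unfolding L_simps by (rule U.add_span_subgroup) auto

lemma L_subset: "u \<in> carrier L ==> u \<in> carrier U"
  using additive_subgroup.a_subset[OF L_subgroup] by auto

lemma E_in_L: "k \<in> exps ==> E k \<in> carrier L"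
  unfolding L_simps by (rule U.add_span_incl) auto

lemma L_mult_closed:
  assumes "u \<in> carrier L" "v \<in> carrier L"
  shows "u \<otimes>\<^sub>U v \<in> carrier L"
proof (rule span_rmult[OF _ assms(1)[unfolded L_simps] L_subset[OF assms(2)] L_subgroup])
  fix s assume "s \<in> {E k | k. k \<in> exps}"
  then obtain l where l: "s = E l" "l \<in> exps" by auto
  show "s \<otimes>\<^sub>U v \<in> carrier L"
  proof (rule span_lmult[OF _ assms(2)[unfolded L_simps] _ L_subgroup])
    fix t assume "t \<in> {E k | k. k \<in> exps}"
    then obtain m where m: "t = E m" "m \<in> exps" by auto
    have "add_span U {E k | k. k \<in> reach_prod l m} \<subseteq> carrier L"
      unfolding L_simps by (rule U.add_span_mono) (auto simp: reach_prod_def)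
    then show "s \<otimes>\<^sub>U t \<in> carrier L" using E_mult_span[OF l(2) m(2)] l m by auto
  qed (auto simp: l)
qed auto

lemma L_ring: "ring L"
proof (rule ringI)
  note sub = L_subgroup
  show "abelian_group L"
  proof (rule abelian_groupI)
    fix x assume x: "x \<in> carrier L"
    then have "\<ominus>\<^bsub>U\<^esub> x \<in> carrier L" by (rule subgroup_minus[OF sub])
    then show "\<exists>y\<in>carrier L. y \<oplus>\<^sub>L x = \<zero>\<^sub>L"
      using U.l_neg[OF L_subset[OF x]] by (auto simp: L_simps(4,5))
    show "x \<oplus>\<^sub>L y \<oplus>\<^sub>L z = x \<oplus>\<^sub>L (y \<oplus>\<^sub>L z)" if "y \<in> carrier L" "z \<in> carrier L" for y z
      using that x by (simp add: L_simps(5) L_subset U.a_assoc)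
    show "x \<oplus>\<^sub>L y = y \<oplus>\<^sub>L x" if "y \<in> carrier L" for y
      using that x by (simp add: L_simps(5) L_subset U.a_comm)
  qed (auto simp: L_simps(4,5) subgroup_add[OF sub] subgroup_zero[OF sub] L_subset)
  have "\<one>\<^sub>U \<in> carrier L" unfolding E_zero[symmetric] by (rule E_in_L) (simp add: exps_def)
  then show "monoid L"
    by (intro monoidI) (auto simp: L_simps(2-5) L_mult_closed L_subset U.m_assoc)
qed (auto simp: L_simps(2-5) L_subset U.l_distr U.r_distr)

text \<open>On the integral form \<open>gam\<close> has integer values (\<open>gam_int\<close>);
  real part and floor only change the type.\<close>

definition gz :: "(nat \<times> nat => nat) => env => int" where "gz k u = \<lfloor>Re (gam k u)\<rfloor>"

lemma gam_int:
  assumes "u \<in> carrier L" "k \<in> exps"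
  shows "gam k u = of_int (gz k u)"
proof -
  have "additive_subgroup \<int> complex_ring" by (rule complex.additive_subgroupI') auto
  then have "gam k u \<in> \<int>"
    by (rule U.span_image[OF gam_additive complex.ag _ E_span_subset _ assms(1)[unfolded L_simps]])
      (use assms gam_E in auto)
  then show ?thesis unfolding gz_def by (auto elim!: Ints_cases)
qed

lemma gz_E: "k \<in> exps ==> l \<in> exps ==> gz k (E l) = (if k = l then 1 else 0)"
  by (simp add: gz_def gam_E)

lemma gz_add:
  assumes "u \<in> carrier L" "v \<in> carrier L" "k \<in> exps"
  shows "gz k (u \<oplus>\<^sub>L v) = gz k u + gz k v"
proof -
  have "u \<oplus>\<^sub>L v \<in> carrier L" using assms L_ring by (simp add: ring.ring_simprules)
  then have "of_int (gz k (u \<oplus>\<^sub>L v)) = (of_int (gz k u + gz k v) :: complex)"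
    using assms gam_int additive_map_add[OF gam_additive, of u v k] L_subset by (simp add: L_simps)
  then show ?thesis by (simp only: of_int_eq_iff)
qed

lemma gz_E_mult:
  assumes "l \<in> exps" "m \<in> exps" "k \<in> exps" "gz k (E l \<otimes>\<^sub>L E m) ~= 0"
  shows "k \<in> reach_prod l m"
  using gam_E_mult[OF assms(1-3)] assms gam_int[OF L_mult_closed[OF E_in_L E_in_L]] by (simp add: L_simps)

end

section \<open>Direct sum decompositions of tensor products\<close>

section \<open>Tensor products of modules with bases\<close>

text \<open>T is the direct sum of copies of D indexed by S, with inclusions \<open>\<tau>\<close>
  and projections \<open>\<Gamma>\<close>. Only additive groups are involved, so the notion covers
  both the Kostant algebra, with D = K and tensor products over the integers, and the skew product,
  with D = B and tensor products over K.\<close>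

locale coords = T: abelian_group T + D: abelian_group D
  for T :: "('t, 'u) ring_scheme" and D :: "('d, 'v) ring_scheme" +
  fixes S :: "'s set" and \<tau> :: "'s => 'd => 't" and \<Gamma> :: "'s => 't => 'd"
  assumes tau_additive: "k \<in> S ==> additive_map D T (\<tau> k)"
    and gam_additive: "k \<in> S ==> additive_map T D (\<Gamma> k)"
    and gam_tau: "k \<in> S ==> l \<in> S ==> d \<in> carrier D ==> \<Gamma> k (\<tau> l d) = (if k = l then d else \<zero>\<^bsub>D\<^esub>)"
    and gam_finite: "x \<in> carrier T ==> finite {k \<in> S. \<Gamma> k x ~= \<zero>\<^bsub>D\<^esub>}"
    and expand: "x \<in> carrier T ==> x = fsum T (\<lambda>k. \<tau> k (\<Gamma> k x)) S"
begin

lemma tau_closed [simp]: "k \<in> S ==> d \<in> carrier D ==> \<tau> k d \<in> carrier T"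
  by (rule additive_map_closed[OF tau_additive])

lemma gam_closed [simp]: "k \<in> S ==> x \<in> carrier T ==> \<Gamma> k x \<in> carrier D"
  by (rule additive_map_closed[OF gam_additive])

lemma tau_zero: "k \<in> S ==> \<tau> k \<zero>\<^bsub>D\<^esub> = \<zero>\<^bsub>T\<^esub>"
  by (rule additive_map_zero[OF tau_additive D.ag T.ag])

lemma gam_zero: "k \<in> S ==> \<Gamma> k \<zero>\<^bsub>T\<^esub> = \<zero>\<^bsub>D\<^esub>"
  by (rule additive_map_zero[OF gam_additive T.ag D.ag])

lemma coord_eqI:
  assumes "x \<in> carrier T" "y \<in> carrier T" "!!k. k \<in> S ==> \<Gamma> k x = \<Gamma> k y"
  shows "x = y"
proof -
  have "fsum T (\<lambda>k. \<tau> k (\<Gamma> k x)) S = fsum T (\<lambda>k. \<tau> k (\<Gamma> k y)) S"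
    by (rule T.fsum_cong) (use assms in auto)
  then show ?thesis using expand[OF assms(1)] expand[OF assms(2)] by simp
qed

lemma in_subgroupI:
  assumes "additive_subgroup H T" "x \<in> carrier T" "!!k. k \<in> S ==> \<tau> k (\<Gamma> k x) \<in> H"
  shows "x \<in> H"
  using T.fsum_in_subgroup[OF assms(1), of S "\<lambda>k. \<tau> k (\<Gamma> k x)"] assms(3) expand[OF assms(2)] by simp

lemma span: "carrier T = add_span T {\<tau> k d | k d. k \<in> S \<and> d \<in> carrier D}"
proof (intro equalityI subsetI)
  fix x assume x: "x \<in> carrier T"
  show "x \<in> add_span T {\<tau> k d | k d. k \<in> S \<and> d \<in> carrier D}"
  proof (rule in_subgroupI[OF T.add_span_subgroup x])
    fix k assume "k \<in> S"
    then show "\<tau> k (\<Gamma> k x) \<in> add_span T {\<tau> k d | k d. k \<in> S \<and> d \<in> carrier D}"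
      using gam_closed[OF _ x] by (intro T.add_span_incl) blast
  qed auto
next
  fix x assume "x \<in> add_span T {\<tau> k d | k d. k \<in> S \<and> d \<in> carrier D}"
  moreover have "{\<tau> k d | k d. k \<in> S \<and> d \<in> carrier D} \<subseteq> carrier T" by auto
  ultimately show "x \<in> carrier T" using T.add_span_subset by blast
qed

lemma coord_lift:
  assumes G: "abelian_group G" and h: "!!k. k \<in> S ==> additive_map D G (h k)"
  shows "additive_map T G (\<lambda>x. fsum G (\<lambda>k. h k (\<Gamma> k x)) S)"
    and "k \<in> S ==> d \<in> carrier D ==> fsum G (\<lambda>l. h l (\<Gamma> l (\<tau> k d))) S = h k d"
proof -
  interpret G: abelian_group G by fact
  have hc: "h k d \<in> carrier G" if "k \<in> S" "d \<in> carrier D" for k d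
    using additive_map_closed[OF h] that by blast
  have h0: "h k \<zero>\<^bsub>D\<^esub> = \<zero>\<^bsub>G\<^esub>" if "k \<in> S" for k
    by (rule additive_map_zero[OF h[OF that] D.ag G])
  show "additive_map T G (\<lambda>x. fsum G (\<lambda>k. h k (\<Gamma> k x)) S)"
  proof (rule G.fsum_additive_map[OF additive_map_comp[OF h gam_additive]])
    show "finite {k \<in> S. h k (\<Gamma> k x) ~= \<zero>\<^bsub>G\<^esub>}" if "x \<in> carrier T" for x
      by (rule finite_subset[OF _ gam_finite[OF that]]) (use h0 in auto)
  qed auto
  assume "k \<in> S" "d \<in> carrier D"
  then show "fsum G (\<lambda>l. h l (\<Gamma> l (\<tau> k d))) S = h k d"
    by (intro G.fsum_single[of k]) (auto simp: gam_tau h0 hc)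
qed

text \<open>On a direct sum a biadditive map can be prescribed freely on pairs of summands.
  Existence of both products below rests on this.\<close>

lemma bilinear_extension:
  assumes l: "!!k l d. k \<in> S ==> l \<in> S ==> d \<in> carrier D ==> additive_map D T (\<lambda>d'. w k l d d')"
    and r: "!!k l d. k \<in> S ==> l \<in> S ==> d \<in> carrier D ==> additive_map D T (\<lambda>d'. w k l d' d)"
  shows "\<exists>m. (\<forall>x\<in>carrier T. additive_map T T (m x)) \<and> (\<forall>y\<in>carrier T. additive_map T T (\<lambda>x. m x y)) \<and>
     (\<forall>k\<in>S. \<forall>l\<in>S. \<forall>d\<in>carrier D. \<forall>d'\<in>carrier D. m (\<tau> k d) (\<tau> l d') = w k l d d')"
proof -
  define g where "g k d y = fsum T (\<lambda>l. w k l d (\<Gamma> l y)) S" for k d y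
  define m where "m x y = fsum T (\<lambda>k. g k (\<Gamma> k x) y) S" for x y
  note Tg = T.ag and Dg = D.ag
  have g_y: "additive_map T T (g k d)" if "k \<in> S" "d \<in> carrier D" for k d
    unfolding g_def by (rule coord_lift(1)[OF Tg l[OF that(1) _ that(2)]])
  have w0: "w k l d \<zero>\<^bsub>D\<^esub> = \<zero>\<^bsub>T\<^esub>" "w k l \<zero>\<^bsub>D\<^esub> d = \<zero>\<^bsub>T\<^esub>" if "k \<in> S" "l \<in> S" "d \<in> carrier D" for k l d
    using additive_map_zero[OF l[OF that] Dg Tg] additive_map_zero[OF r[OF that] Dg Tg] by auto
  have g_d: "additive_map D T (\<lambda>d. g k d y)" if "k \<in> S" "y \<in> carrier T" for k y
    unfolding g_def
    by (rule T.fsum_additive_map[OF r], use that in simp_all)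
      (rule finite_subset[OF _ gam_finite[OF that(2)]], use that w0 in auto)
  have g0: "g k \<zero>\<^bsub>D\<^esub> y = \<zero>\<^bsub>T\<^esub>" if "k \<in> S" "y \<in> carrier T" for k y
    by (rule additive_map_zero[OF g_d[OF that] Dg Tg])
  have "additive_map T T (\<lambda>x. m x y)" if "y \<in> carrier T" for y
    unfolding m_def by (rule coord_lift(1)[OF Tg g_d[OF _ that]])
  moreover have "additive_map T T (m x)" if "x \<in> carrier T" for x
    unfolding m_def
    by (rule T.fsum_additive_map[OF g_y], use that in simp_all)
      (rule finite_subset[OF _ gam_finite[OF that]], use that g0 in auto)
  moreover have "m (\<tau> k d) (\<tau> l d') = w k l d d'"
    if "k \<in> S" "l \<in> S" "d \<in> carrier D" "d' \<in> carrier D" for k l d d'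
  proof -
    have "m (\<tau> k d) (\<tau> l d') = g k d (\<tau> l d')"
      unfolding m_def by (rule coord_lift(2)[OF Tg g_d]) (use that in auto)
    also have "\<dots> = w k l d d'"
      unfolding g_def by (rule coord_lift(2)[OF Tg l]) (use that in auto)
    finally show ?thesis .
  qed
  ultimately show ?thesis by blast
qed

end

text \<open>The expansion is an equality of additive maps, so it is checked on generators;
  finiteness of supports passes to sums and negatives.\<close>

lemma coordsI:
  assumes T: "abelian_group T" and D: "abelian_group D"
    and tau: "!!k. k \<in> S ==> additive_map D T (\<tau> k)"
    and gam: "!!k. k \<in> S ==> additive_map T D (\<Gamma> k)"
    and gam_tau: "!!k l d. k \<in> S ==> l \<in> S ==> d \<in> carrier D ==> \<Gamma> k (\<tau> l d) = (if k = l then d else \<zero>\<^bsub>D\<^esub>)"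
    and X: "X \<subseteq> carrier T" "carrier T \<subseteq> add_span T X"
    and fin: "!!x. x \<in> X ==> finite {k \<in> S. \<Gamma> k x ~= \<zero>\<^bsub>D\<^esub>}"
    and expand: "!!x. x \<in> X ==> x = fsum T (\<lambda>k. \<tau> k (\<Gamma> k x)) S"
  shows "coords T D S \<tau> \<Gamma>"
proof -
  interpret T: abelian_group T by fact
  interpret D: abelian_group D by fact
  have tau0: "\<tau> k \<zero>\<^bsub>D\<^esub> = \<zero>\<^bsub>T\<^esub>" if "k \<in> S" for k by (rule additive_map_zero[OF tau[OF that] D T])
  have gam0: "\<Gamma> k \<zero>\<^bsub>T\<^esub> = \<zero>\<^bsub>D\<^esub>" if "k \<in> S" for k by (rule additive_map_zero[OF gam[OF that] T D])
  have finT: "finite {k \<in> S. \<Gamma> k x ~= \<zero>\<^bsub>D\<^esub>}" if "x \<in> carrier T" for x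
    using subsetD[OF X(2) that] X(1)
  proof (induction rule: T.add_span_induct)
    case zero
    show ?case by (simp add: gam0 cong: conj_cong)
  next
    case (incl s)
    then show ?case by (rule fin)
  next
    case (minus x)
    have "{k \<in> S. \<Gamma> k (\<ominus>\<^bsub>T\<^esub> x) ~= \<zero>\<^bsub>D\<^esub>} \<subseteq> {k \<in> S. \<Gamma> k x ~= \<zero>\<^bsub>D\<^esub>}"
      using minus by (auto simp: additive_map_minus[OF gam T D])
    then show ?case using minus(2) by (rule finite_subset)
  next
    case (add x y)
    have "{k \<in> S. \<Gamma> k (x \<oplus>\<^bsub>T\<^esub> y) ~= \<zero>\<^bsub>D\<^esub>} \<subseteq> {k \<in> S. \<Gamma> k x ~= \<zero>\<^bsub>D\<^esub>} \<union> {k \<in> S. \<Gamma> k y ~= \<zero>\<^bsub>D\<^esub>}"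
      using add by (auto simp: additive_map_add[OF gam])
    then show ?case using add by (auto intro: finite_subset)
  qed
  have add: "additive_map T T (\<lambda>x. fsum T (\<lambda>k. \<tau> k (\<Gamma> k x)) S)"
  proof (rule T.fsum_additive_map[OF additive_map_comp[OF tau gam]])
    show "finite {k \<in> S. \<tau> k (\<Gamma> k x) ~= \<zero>\<^bsub>T\<^esub>}" if "x \<in> carrier T" for x
      by (rule finite_subset[OF _ finT[OF that]]) (use tau0 in auto)
  qed auto
  have id: "additive_map T T (\<lambda>x. x)" by (rule additive_mapI) auto
  have "x = fsum T (\<lambda>k. \<tau> k (\<Gamma> k x)) S" if "x \<in> carrier T" for x
    by (rule T.additive_map_eq_span[OF id add T X(1)]) (use expand X(2) that in auto)
  then show ?thesis
    by (intro coords.intro coords_axioms.intro T D tau gam gam_tau finT)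
qed

locale mod_basis = lmod R M for R :: "('r, 's) ring_scheme" and M :: "('r, 'm) module" +
  fixes S :: "'b set" and u :: "'b => 'm" and \<gamma> :: "'b => 'm => 'r"
  assumes u_closed: "k \<in> S ==> u k \<in> carrier M"
    and coord_additive: "k \<in> S ==> additive_map M R (\<gamma> k)"
    and coord_smult: "k \<in> S ==> a \<in> carrier R ==> x \<in> carrier M ==> \<gamma> k (a \<odot>\<^bsub>M\<^esub> x) = a \<otimes>\<^bsub>R\<^esub> \<gamma> k x"
    and coord_u: "k \<in> S ==> l \<in> S ==> \<gamma> k (u l) = (if k = l then \<one>\<^bsub>R\<^esub> else \<zero>\<^bsub>R\<^esub>)"
    and coord_finite: "x \<in> carrier M ==> finite {k \<in> S. \<gamma> k x ~= \<zero>\<^bsub>R\<^esub>}"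
    and coord_expand: "x \<in> carrier M ==> x = fsum M (\<lambda>k. \<gamma> k x \<odot>\<^bsub>M\<^esub> u k) S"
begin

lemma coord_closed: "k \<in> S ==> x \<in> carrier M ==> \<gamma> k x \<in> carrier R"
  by (rule additive_map_closed[OF coord_additive])

end

locale tensor = R: cring R + M: lmod R M + N: lmod R N
  for R :: "('r, 's) ring_scheme" and M :: "('r, 'm) module" and N :: "('r, 'n) module"
begin

abbreviation "F \<equiv> free_module R (carrier M \<times> carrier N)"
abbreviation "T \<equiv> tensor_module R M N"
abbreviation "t \<equiv> tens R M N"

sublocale F: lmod R F
  by (rule free_module_lmod) (rule R.ring_axioms)

lemma gen_closed: "x \<in> carrier M ==> y \<in> carrier N ==> free_gen R (x, y) \<in> carrier F"
  by (rule free_gen_closed) (simp_all add: R.ring_axioms)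

lemma rels_closed: "tensor_rels R M N \<subseteq> carrier F"
  unfolding tensor_rels_def Let_def
  by (auto intro!: F.M.minus_closed F.M.a_closed F.smult_closed gen_closed)

lemma smult_rels_closed: "{a \<odot>\<^bsub>F\<^esub> t | a t. a \<in> carrier R \<and> t \<in> tensor_rels R M N} \<subseteq> carrier F"
  using rels_closed by (auto intro!: F.smult_closed)

sublocale K: submod R F "tensor_kernel R M N"
proof (rule submodI)
  show "lmod R F" by (rule F.lmod_axioms)
  show sub: "additive_subgroup (tensor_kernel R M N) F"
    unfolding tensor_kernel_def Let_def by (rule F.M.add_span_subgroup[OF smult_rels_closed])
  fix a x assume a: "a \<in> carrier R" and "x \<in> tensor_kernel R M N"
  then have "x \<in> add_span F {a \<odot>\<^bsub>F\<^esub> t | a t. a \<in> carrier R \<and> t \<in> tensor_rels R M N}"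
    by (simp add: tensor_kernel_def Let_def)
  then show "a \<odot>\<^bsub>F\<^esub> x \<in> tensor_kernel R M N"
  proof (rule F.M.span_image[OF F.smult_additive[OF a] F.M.ag sub smult_rels_closed, rotated])
    fix s assume "s \<in> {a \<odot>\<^bsub>F\<^esub> t | a t. a \<in> carrier R \<and> t \<in> tensor_rels R M N}"
    then obtain b r where r: "s = b \<odot>\<^bsub>F\<^esub> r" "b \<in> carrier R" "r \<in> tensor_rels R M N" by auto
    then have "a \<odot>\<^bsub>F\<^esub> s = (a \<otimes>\<^bsub>R\<^esub> b) \<odot>\<^bsub>F\<^esub> r" using a rels_closed F.smult_assoc by auto
    then show "a \<odot>\<^bsub>F\<^esub> s \<in> tensor_kernel R M N" unfolding tensor_kernel_def Let_def
      using a r by (intro F.M.add_span_incl) auto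
  qed
qed

lemma T_eq: "T = K.Q"
  by (simp add: tensor_module_def)

sublocale T: lmod R T
  unfolding T_eq by (rule K.quot_lmod)

lemma tens_eq: "t x y = tensor_kernel R M N +>\<^bsub>F\<^esub> free_gen R (x, y)"
  by (simp add: tens_def)

lemma tens_closed [simp]: "x \<in> carrier M ==> y \<in> carrier N ==> t x y \<in> carrier T"
  unfolding tens_eq T_eq by (rule K.coset_closed) (rule gen_closed)

lemma rel_in_kernel: "r \<in> tensor_rels R M N ==> r \<in> tensor_kernel R M N"
proof -
  assume r: "r \<in> tensor_rels R M N"
  then have "\<one>\<^bsub>R\<^esub> \<odot>\<^bsub>F\<^esub> r = r" using rels_closed by auto
  then show ?thesis unfolding tensor_kernel_def Let_def using r
    by (intro F.M.add_span_incl) (metis (mono_tags, lifting) R.one_closed mem_Collect_eq)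
qed

lemma tens_add_l:
  assumes "x \<in> carrier M" "x' \<in> carrier M" "y \<in> carrier N"
  shows "t (x \<oplus>\<^bsub>M\<^esub> x') y = t x y \<oplus>\<^bsub>T\<^esub> t x' y"
proof -
  have "free_gen R (x \<oplus>\<^bsub>M\<^esub> x', y) \<ominus>\<^bsub>F\<^esub> (free_gen R (x, y) \<oplus>\<^bsub>F\<^esub> free_gen R (x', y)) \<in> tensor_kernel R M N"
    by (rule rel_in_kernel) (unfold tensor_rels_def Let_def, use assms in blast)
  then show ?thesis unfolding tens_eq T_eq using assms
    by (simp add: K.coset_add gen_closed K.coset_eq_iff)
qed

lemma tens_add_r:
  assumes "x \<in> carrier M" "y \<in> carrier N" "y' \<in> carrier N"
  shows "t x (y \<oplus>\<^bsub>N\<^esub> y') = t x y \<oplus>\<^bsub>T\<^esub> t x y'"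
proof -
  have "free_gen R (x, y \<oplus>\<^bsub>N\<^esub> y') \<ominus>\<^bsub>F\<^esub> (free_gen R (x, y) \<oplus>\<^bsub>F\<^esub> free_gen R (x, y')) \<in> tensor_kernel R M N"
    by (rule rel_in_kernel) (unfold tensor_rels_def Let_def, use assms in blast)
  then show ?thesis unfolding tens_eq T_eq using assms
    by (simp add: K.coset_add gen_closed K.coset_eq_iff)
qed

lemma tens_smult_l:
  assumes "a \<in> carrier R" "x \<in> carrier M" "y \<in> carrier N"
  shows "t (a \<odot>\<^bsub>M\<^esub> x) y = a \<odot>\<^bsub>T\<^esub> t x y"
proof -
  have "free_gen R (a \<odot>\<^bsub>M\<^esub> x, y) \<ominus>\<^bsub>F\<^esub> a \<odot>\<^bsub>F\<^esub> free_gen R (x, y) \<in> tensor_kernel R M N"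
    by (rule rel_in_kernel) (unfold tensor_rels_def Let_def, use assms in blast)
  then show ?thesis unfolding tens_eq T_eq using assms
    by (simp add: K.coset_smult gen_closed K.coset_eq_iff)
qed

lemma tens_smult_r:
  assumes "a \<in> carrier R" "x \<in> carrier M" "y \<in> carrier N"
  shows "t x (a \<odot>\<^bsub>N\<^esub> y) = a \<odot>\<^bsub>T\<^esub> t x y"
proof -
  have "free_gen R (x, a \<odot>\<^bsub>N\<^esub> y) \<ominus>\<^bsub>F\<^esub> a \<odot>\<^bsub>F\<^esub> free_gen R (x, y) \<in> tensor_kernel R M N"
    by (rule rel_in_kernel) (unfold tensor_rels_def Let_def, use assms in blast)
  then show ?thesis unfolding tens_eq T_eq using assms
    by (simp add: K.coset_smult gen_closed K.coset_eq_iff)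
qed

lemma tens_additive_l: "y \<in> carrier N ==> additive_map M T (\<lambda>x. t x y)"
  by (rule additive_mapI) (simp_all add: tens_add_l)

lemma tens_additive_r: "x \<in> carrier M ==> additive_map N T (t x)"
  by (rule additive_mapI) (simp_all add: tens_add_r)

abbreviation "pure \<equiv> {t x y | x y. x \<in> carrier M \<and> y \<in> carrier N}"

lemma pure_closed: "pure \<subseteq> carrier T"
  by auto

lemma pure_span: "carrier T \<subseteq> add_span T pure"
proof
  fix X assume "X \<in> carrier T"
  then obtain f where f: "f \<in> carrier F" "X = tensor_kernel R M N +>\<^bsub>F\<^esub> f"
    unfolding T_eq by (rule K.quot_carrierE)
  note sub = T.M.add_span_subgroup[OF pure_closed]
  let ?G = "{a \<odot>\<^bsub>F\<^esub> free_gen R s | a s. a \<in> carrier R \<and> s \<in> carrier M \<times> carrier N}"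
  have G: "?G \<subseteq> carrier F" by (auto intro!: F.smult_closed gen_closed)
  note c = K.coset_additive[folded T_eq]
  have "tensor_kernel R M N +>\<^bsub>F\<^esub> f \<in> add_span T pure"
  proof (rule F.M.span_image[OF c T.M.ag sub G _ free_module_span[OF R.ring_axioms f(1)]])
    fix s assume "s \<in> ?G"
    then obtain a x y where s: "s = a \<odot>\<^bsub>F\<^esub> free_gen R (x, y)" "a \<in> carrier R" "x \<in> carrier M" "y \<in> carrier N"
      by auto
    have "tensor_kernel R M N +>\<^bsub>F\<^esub> s = t (a \<odot>\<^bsub>M\<^esub> x) y"
      unfolding tens_smult_l[OF s(2-4)] unfolding s(1) tens_eq T_eq
      by (rule K.coset_smult[symmetric]) (use s gen_closed in auto)
    then show "tensor_kernel R M N +>\<^bsub>F\<^esub> s \<in> add_span T pure" using s by (intro T.M.add_span_incl) auto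
  qed
  then show "X \<in> add_span T pure" using f by simp
qed

lemma lift:
  assumes G: "abelian_group G"
    and l: "!!y. y \<in> carrier N ==> additive_map M G (\<lambda>x. \<beta> x y)"
    and r: "!!x. x \<in> carrier M ==> additive_map N G (\<beta> x)"
    and bal: "!!a x y. a \<in> carrier R ==> x \<in> carrier M ==> y \<in> carrier N ==> \<beta> (a \<odot>\<^bsub>M\<^esub> x) y = \<beta> x (a \<odot>\<^bsub>N\<^esub> y)"
  shows "\<exists>\<phi>. additive_map T G \<phi> \<and> (\<forall>x\<in>carrier M. \<forall>y\<in>carrier N. \<phi> (t x y) = \<beta> x y)"
proof -
  interpret G: abelian_group G by fact
  let ?B = "carrier M \<times> carrier N"
  \<comment> \<open>The coefficient of a pair is moved into its left component, because the target
    has no scalars.\<close>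
  define h where "h f = fsum G (\<lambda>s. \<beta> (f s \<odot>\<^bsub>M\<^esub> fst s) (snd s)) ?B" for f
  have bc: "\<beta> x y \<in> carrier G" if "x \<in> carrier M" "y \<in> carrier N" for x y
    using additive_map_closed[OF l[OF that(2)] that(1)] .
  have b0: "\<beta> \<zero>\<^bsub>M\<^esub> y = \<zero>\<^bsub>G\<^esub>" if "y \<in> carrier N" for y
    by (rule additive_map_zero[OF l[OF that] M.M.ag G])
  have h: "additive_map F G h"
    unfolding h_def
  proof (rule G.fsum_additive_map)
    fix s assume s: "s \<in> ?B"
    have "f s \<in> carrier R" if "f \<in> carrier F" for f by (rule free_moduleD(1)[OF that])
    then have "additive_map F M (\<lambda>f. f s \<odot>\<^bsub>M\<^esub> fst s)"
      by (intro additive_mapI) (use s in \<open>auto simp: free_module_simps M.smult_l_distr\<close>)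
    then show "additive_map F G (\<lambda>f. \<beta> (f s \<odot>\<^bsub>M\<^esub> fst s) (snd s))"
      by (rule additive_map_comp[OF l, rotated]) (use s in auto)
  next
    fix f assume "f \<in> carrier F"
    then show "finite {s \<in> ?B. \<beta> (f s \<odot>\<^bsub>M\<^esub> fst s) (snd s) ~= \<zero>\<^bsub>G\<^esub>}"
      by (intro finite_subset[OF _ free_moduleD(2)[of f R ?B]]) (auto simp: b0)
  qed
  have h_gen: "h (a \<odot>\<^bsub>F\<^esub> free_gen R (x, y)) = \<beta> (a \<odot>\<^bsub>M\<^esub> x) y"
    if "a \<in> carrier R" "x \<in> carrier M" "y \<in> carrier N" for a x y
    unfolding h_def
    by (rule G.fsum_single[of "(x, y)"])
      (use that in \<open>auto simp: free_module_simps free_gen_def b0 intro!: bc M.smult_closed\<close>)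
  note Fg = F.M.ag
  note hdiff = additive_map_diff[OF h Fg G] and hadd = additive_map_add[OF h]
  have rel: "h (a \<odot>\<^bsub>F\<^esub> r) = \<zero>\<^bsub>G\<^esub>" if a: "a \<in> carrier R" and r: "r \<in> tensor_rels R M N" for a r
  proof -
    have eq: "h (a \<odot>\<^bsub>F\<^esub> (g \<ominus>\<^bsub>F\<^esub> g')) = h (a \<odot>\<^bsub>F\<^esub> g) \<ominus>\<^bsub>G\<^esub> h (a \<odot>\<^bsub>F\<^esub> g')"
      "h (a \<odot>\<^bsub>F\<^esub> (g \<oplus>\<^bsub>F\<^esub> g')) = h (a \<odot>\<^bsub>F\<^esub> g) \<oplus>\<^bsub>G\<^esub> h (a \<odot>\<^bsub>F\<^esub> g')" if "g \<in> carrier F" "g' \<in> carrier F" for g g'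
      using that a by (simp_all add: F.smult_r_diff F.smult_r_distr hdiff hadd)
    have eq': "h (a \<odot>\<^bsub>F\<^esub> (b \<odot>\<^bsub>F\<^esub> free_gen R (x, y))) = \<beta> (a \<odot>\<^bsub>M\<^esub> (b \<odot>\<^bsub>M\<^esub> x)) y"
      if "b \<in> carrier R" "x \<in> carrier M" "y \<in> carrier N" for b x y
      using that a h_gen[of "a \<otimes>\<^bsub>R\<^esub> b" x y] by (simp add: F.smult_assoc gen_closed M.smult_assoc)
    from r consider
      (1) x x' y where "r = free_gen R (x \<oplus>\<^bsub>M\<^esub> x', y) \<ominus>\<^bsub>F\<^esub> (free_gen R (x, y) \<oplus>\<^bsub>F\<^esub> free_gen R (x', y))"
        "x \<in> carrier M" "x' \<in> carrier M" "y \<in> carrier N"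
    | (2) x y y' where "r = free_gen R (x, y \<oplus>\<^bsub>N\<^esub> y') \<ominus>\<^bsub>F\<^esub> (free_gen R (x, y) \<oplus>\<^bsub>F\<^esub> free_gen R (x, y'))"
        "x \<in> carrier M" "y \<in> carrier N" "y' \<in> carrier N"
    | (3) b x y where "r = free_gen R (b \<odot>\<^bsub>M\<^esub> x, y) \<ominus>\<^bsub>F\<^esub> b \<odot>\<^bsub>F\<^esub> free_gen R (x, y)"
        "b \<in> carrier R" "x \<in> carrier M" "y \<in> carrier N"
    | (4) b x y where "r = free_gen R (x, b \<odot>\<^bsub>N\<^esub> y) \<ominus>\<^bsub>F\<^esub> b \<odot>\<^bsub>F\<^esub> free_gen R (x, y)"
        "b \<in> carrier R" "x \<in> carrier M" "y \<in> carrier N"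
      unfolding tensor_rels_def Let_def by blast
    then show ?thesis
    proof cases
      case 1
      then show ?thesis using a
        by (simp add: eq gen_closed h_gen M.smult_r_distr additive_map_add[OF l] bc)
    next
      case 2
      then show ?thesis using a
        by (simp add: eq gen_closed h_gen additive_map_add[OF assms(3)] bc)
    next
      case 3
      then show ?thesis using a
        by (simp add: eq eq' gen_closed h_gen bc)
    next
      case 4
      \<comment> \<open>Balancing moves b from the right component to the left of a, so
        commutativity of R is used.\<close>
      have "a \<odot>\<^bsub>M\<^esub> (b \<odot>\<^bsub>M\<^esub> x) = b \<odot>\<^bsub>M\<^esub> (a \<odot>\<^bsub>M\<^esub> x)"
        using 4 a by (simp add: M.smult_assoc[symmetric] R.m_comm)
      then show ?thesis using a 4
        by (simp add: eq eq' gen_closed h_gen bc bal)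
    qed
  qed
  have "h f = \<zero>\<^bsub>G\<^esub>" if "f \<in> tensor_kernel R M N" for f
    using F.M.span_image[OF h G G.zero_subgroup smult_rels_closed _ that[unfolded tensor_kernel_def Let_def]] rel by auto
  from K.quot_additive_lift[OF G h this]
  obtain g where g: "additive_map K.Q G g" "\<forall>x\<in>carrier F. g (tensor_kernel R M N +>\<^bsub>F\<^esub> x) = h x" by blast
  have "g (t x y) = \<beta> x y" if "x \<in> carrier M" "y \<in> carrier N" for x y
    unfolding tens_eq using that g(2) h_gen[of "\<one>\<^bsub>R\<^esub>" x y] by (simp add: gen_closed)
  then show ?thesis using g(1) unfolding T_eq by blast
qed

text \<open>Here \<open>p d y\<close> stands for \<open>d \<otimes> y\<close> or for \<open>y \<otimes> d\<close>.\<close>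

lemma coords_pure:
  assumes B: "mod_basis R V S u \<gamma>" and D: "lmod R D"
    and d: "!!y. y \<in> carrier V ==> additive_map D T (\<lambda>d. p d y)"
    and y: "!!d. d \<in> carrier D ==> additive_map V T (p d)"
    and bal: "!!a d y. a \<in> carrier R ==> d \<in> carrier D ==> y \<in> carrier V ==> p (a \<odot>\<^bsub>D\<^esub> d) y = p d (a \<odot>\<^bsub>V\<^esub> y)"
    and pure: "pure = {p d y | d y. d \<in> carrier D \<and> y \<in> carrier V}"
    and lift: "!!k. k \<in> S ==> \<exists>\<phi>. additive_map T D \<phi> \<and> (\<forall>d\<in>carrier D. \<forall>y\<in>carrier V. \<phi> (p d y) = \<gamma> k y \<odot>\<^bsub>D\<^esub> d)"
  shows "\<exists>\<Gamma>. coords T D S (\<lambda>k d. p d (u k)) \<Gamma> \<and>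
     (\<forall>k\<in>S. \<forall>d\<in>carrier D. \<forall>y\<in>carrier V. \<Gamma> k (p d y) = \<gamma> k y \<odot>\<^bsub>D\<^esub> d)"
proof -
  interpret B: mod_basis R V S u \<gamma> by fact
  interpret D: lmod R D by fact
  obtain \<Gamma> where G: "!!k. k \<in> S ==> additive_map T D (\<Gamma> k)"
    "!!k d y. k \<in> S ==> d \<in> carrier D ==> y \<in> carrier V ==> \<Gamma> k (p d y) = \<gamma> k y \<odot>\<^bsub>D\<^esub> d"
    using lift by metis
  have "coords T D S (\<lambda>k d. p d (u k)) \<Gamma>"
  proof (rule coordsI[OF T.M.ag D.M.ag d[OF B.u_closed] G(1) _ pure_closed pure_span])
    show "\<Gamma> k (p d (u l)) = (if k = l then d else \<zero>\<^bsub>D\<^esub>)" if "k \<in> S" "l \<in> S" "d \<in> carrier D" for k l d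
      using that by (simp add: G(2) B.u_closed B.coord_u)
    fix X assume "X \<in> pure"
    then obtain d y where x: "X = p d y" "d \<in> carrier D" "y \<in> carrier V" unfolding pure by auto
    show "finite {k \<in> S. \<Gamma> k X ~= \<zero>\<^bsub>D\<^esub>}"
      by (rule finite_subset[OF _ B.coord_finite[OF x(3)]]) (use x in \<open>auto simp: G(2)\<close>)
    have fin: "finite {k \<in> S. \<gamma> k y \<odot>\<^bsub>V\<^esub> u k ~= \<zero>\<^bsub>V\<^esub>}"
      by (rule finite_subset[OF _ B.coord_finite[OF x(3)]]) (auto simp: B.u_closed)
    have "X = p d (fsum V (\<lambda>k. \<gamma> k y \<odot>\<^bsub>V\<^esub> u k) S)" using x B.coord_expand[OF x(3)] by simp
    also have "\<dots> = fsum T (\<lambda>k. p d (\<gamma> k y \<odot>\<^bsub>V\<^esub> u k)) S"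
      by (rule B.M.fsum_additive[OF y T.M.ag _ fin]) (use x B.u_closed B.coord_closed in auto)
    also have "\<dots> = fsum T (\<lambda>k. p (\<Gamma> k X) (u k)) S"
      by (rule T.M.fsum_cong)
        (use x assms(3) in \<open>auto simp: G(2) bal B.coord_closed B.u_closed intro!: additive_map_closed[OF d]\<close>)
    finally show "X = fsum T (\<lambda>k. p (\<Gamma> k X) (u k)) S" .
  qed auto
  then show ?thesis using G(2) by blast
qed

lemma coords_r:
  assumes "mod_basis R N S u \<gamma>"
  shows "\<exists>\<Gamma>. coords T M S (\<lambda>k x. t x (u k)) \<Gamma> \<and>
     (\<forall>k\<in>S. \<forall>x\<in>carrier M. \<forall>y\<in>carrier N. \<Gamma> k (t x y) = \<gamma> k y \<odot>\<^bsub>M\<^esub> x)"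
proof (rule coords_pure[OF assms M.lmod_axioms tens_additive_l tens_additive_r])
  interpret B: mod_basis R N S u \<gamma> by fact
  show "\<exists>\<phi>. additive_map T M \<phi> \<and> (\<forall>x\<in>carrier M. \<forall>y\<in>carrier N. \<phi> (t x y) = \<gamma> k y \<odot>\<^bsub>M\<^esub> x)" if k: "k \<in> S" for k
  proof (rule lift[OF M.M.ag M.smult_additive[OF B.coord_closed[OF k]]])
    show "additive_map N M (\<lambda>y. \<gamma> k y \<odot>\<^bsub>M\<^esub> x)" if "x \<in> carrier M" for x
      by (rule additive_map_comp[OF M.smult_additive_l[OF that] B.coord_additive[OF k]])
    show "\<gamma> k y \<odot>\<^bsub>M\<^esub> (a \<odot>\<^bsub>M\<^esub> x) = \<gamma> k (a \<odot>\<^bsub>N\<^esub> y) \<odot>\<^bsub>M\<^esub> x" if "a \<in> carrier R" "x \<in> carrier M" "y \<in> carrier N" for a x y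
      using that k by (simp add: B.coord_smult B.coord_closed M.smult_assoc[symmetric] R.m_comm)
  qed
qed (auto simp: tens_smult_l tens_smult_r)

lemma coords_l:
  assumes "mod_basis R M S u \<gamma>"
  shows "\<exists>\<Gamma>. coords T N S (\<lambda>k y. t (u k) y) \<Gamma> \<and>
     (\<forall>k\<in>S. \<forall>x\<in>carrier M. \<forall>y\<in>carrier N. \<Gamma> k (t x y) = \<gamma> k x \<odot>\<^bsub>N\<^esub> y)"
proof -
  interpret B: mod_basis R M S u \<gamma> by fact
  have "\<exists>\<Gamma>. coords T N S (\<lambda>k y. t (u k) y) \<Gamma> \<and>
     (\<forall>k\<in>S. \<forall>y\<in>carrier N. \<forall>x\<in>carrier M. \<Gamma> k (t x y) = \<gamma> k x \<odot>\<^bsub>N\<^esub> y)"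
  proof (rule coords_pure[where p = "\<lambda>y x. t x y", OF assms N.lmod_axioms tens_additive_r tens_additive_l])
    fix k assume k: "k \<in> S"
    have "\<exists>\<phi>. additive_map T N \<phi> \<and> (\<forall>x\<in>carrier M. \<forall>y\<in>carrier N. \<phi> (t x y) = \<gamma> k x \<odot>\<^bsub>N\<^esub> y)"
    proof (rule lift[OF N.M.ag _ N.smult_additive[OF B.coord_closed[OF k]]])
      show "additive_map M N (\<lambda>x. \<gamma> k x \<odot>\<^bsub>N\<^esub> y)" if "y \<in> carrier N" for y
        by (rule additive_map_comp[OF N.smult_additive_l[OF that] B.coord_additive[OF k]])
      show "\<gamma> k (a \<odot>\<^bsub>M\<^esub> x) \<odot>\<^bsub>N\<^esub> y = \<gamma> k x \<odot>\<^bsub>N\<^esub> (a \<odot>\<^bsub>N\<^esub> y)" if "a \<in> carrier R" "x \<in> carrier M" "y \<in> carrier N" for a x y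
        using that k by (simp add: B.coord_smult B.coord_closed N.smult_assoc[symmetric] R.m_comm)
    qed
    then show "\<exists>\<phi>. additive_map T N \<phi> \<and> (\<forall>y\<in>carrier N. \<forall>x\<in>carrier M. \<phi> (t x y) = \<gamma> k x \<odot>\<^bsub>N\<^esub> y)" by blast
  qed (auto simp: tens_smult_l tens_smult_r)
  then show ?thesis by blast
qed

end

section \<open>Products determined by their values on generators\<close>

section \<open>Biadditive products\<close>

text \<open>The definite description denotes something because the rule fixes the product on pairs
  from X and Y, both of which generate the group, and because a biadditive m obeying the rule is
  given.\<close>

lemma biadditive_product:
  assumes T: "abelian_group T"
    and X: "X \<subseteq> carrier T" "carrier T \<subseteq> add_span T X" and Y: "Y \<subseteq> carrier T" "carrier T \<subseteq> add_span T Y"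
    and XY: "!!x y. x \<in> X ==> y \<in> Y ==> \<exists>z. rule x y z"
    and rule: "!!x y z. rule x y z ==> x \<in> carrier T \<and> y \<in> carrier T \<and> m x y = z"
    and l: "!!x. x \<in> carrier T ==> additive_map T T (m x)"
    and r: "!!y. y \<in> carrier T ==> additive_map T T (\<lambda>x. m x y)"
    and xy: "x \<in> carrier T" "y \<in> carrier T"
  shows "biadditive_product T rule x y = m x y"
proof -
  interpret T: abelian_group T by fact
  let ?P = "\<lambda>m. m \<in> carrier T \<times> carrier T \<rightarrow>\<^sub>E carrier T \<and>
     (\<forall>x\<in>carrier T. \<forall>y\<in>carrier T. \<forall>z\<in>carrier T.
        m (x \<oplus>\<^bsub>T\<^esub> y, z) = m (x, z) \<oplus>\<^bsub>T\<^esub> m (y, z) \<and> m (z, x \<oplus>\<^bsub>T\<^esub> y) = m (z, x) \<oplus>\<^bsub>T\<^esub> m (z, y)) \<and>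
     (\<forall>x y z. rule x y z --> m (x, y) = z)"
  let ?m = "\<lambda>p\<in>carrier T \<times> carrier T. m (fst p) (snd p)"
  have "(THE m. ?P m) = ?m"
  proof (rule the_equality)
    show "?P ?m"
      using additive_map_closed[OF l] rule by (auto simp: additive_map_add[OF l] additive_map_add[OF r])
    fix m' assume m': "?P m'"
    have c: "m' (x, y) \<in> carrier T" if "x \<in> carrier T" "y \<in> carrier T" for x y using m' that by blast
    have l': "additive_map T T (\<lambda>y. m' (x, y))" if "x \<in> carrier T" for x
      by (rule additive_mapI) (use m' that c in auto)
    have r': "additive_map T T (\<lambda>x. m' (x, y))" if "y \<in> carrier T" for y
      by (rule additive_mapI) (use m' that c in auto)
    have "m' (x, y) = m x y" if x: "x \<in> carrier T" and y: "y \<in> carrier T" for x y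
    proof -
      have "m' (x, y) = m x y" if x: "x \<in> X" for x
      proof (rule T.additive_map_eq_span[OF l' l T Y(1) _ subsetD[OF Y(2) y]])
        fix y assume "y \<in> Y"
        then obtain z where z: "rule x y z" using XY x by blast
        then show "m' (x, y) = m x y" using m' rule[OF z] by simp
      qed (use x X in auto)
      then show ?thesis
        by (rule T.additive_map_eq_span[OF r'[OF y] r[OF y] T X(1) _ subsetD[OF X(2) x]])
    qed
    then show "m' = ?m" using m' by (intro ext) (auto simp: PiE_def extensional_def)
  qed
  then show ?thesis unfolding biadditive_product_def using xy by (simp add: curry_def)
qed

text \<open>Both sides of the associative law are additive in each argument, so it is extended from
  generators one argument at a time.\<close>

lemma ring_from_span:
  assumes T: "abelian_group R"
    and closed: "!!x y. x \<in> carrier R ==> y \<in> carrier R ==> x \<otimes>\<^bsub>R\<^esub> y \<in> carrier R"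
    and l: "!!x. x \<in> carrier R ==> additive_map R R (\<lambda>y. x \<otimes>\<^bsub>R\<^esub> y)"
    and r: "!!y. y \<in> carrier R ==> additive_map R R (\<lambda>x. x \<otimes>\<^bsub>R\<^esub> y)"
    and one: "\<one>\<^bsub>R\<^esub> \<in> carrier R"
    and X: "X \<subseteq> carrier R" "carrier R \<subseteq> add_span R X"
    and unit: "!!x. x \<in> X ==> \<one>\<^bsub>R\<^esub> \<otimes>\<^bsub>R\<^esub> x = x" "!!x. x \<in> X ==> x \<otimes>\<^bsub>R\<^esub> \<one>\<^bsub>R\<^esub> = x"
    and assoc: "!!x y z. x \<in> X ==> y \<in> X ==> z \<in> X ==> x \<otimes>\<^bsub>R\<^esub> y \<otimes>\<^bsub>R\<^esub> z = x \<otimes>\<^bsub>R\<^esub> (y \<otimes>\<^bsub>R\<^esub> z)"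
  shows "ring R"
proof -
  interpret T: abelian_group R by fact
  have comp: "additive_map R R (\<lambda>x. g (h x))" if "additive_map R R g" "additive_map R R h" for g h
    using that by (auto simp: additive_map_def Pi_iff)
  have id: "additive_map R R (\<lambda>x. x)" by (rule additive_mapI) auto
  have assoc1: "x \<otimes>\<^bsub>R\<^esub> y \<otimes>\<^bsub>R\<^esub> z = x \<otimes>\<^bsub>R\<^esub> (y \<otimes>\<^bsub>R\<^esub> z)" if "x \<in> X" "y \<in> X" "z \<in> carrier R" for x y z
  proof (rule T.additive_map_eq_span[OF l comp[OF l l] T X(1) assoc[OF that(1,2)] subsetD[OF X(2) that(3)]])
    show "x \<in> carrier R" "y \<in> carrier R" using that X(1) by auto
    then show "x \<otimes>\<^bsub>R\<^esub> y \<in> carrier R" by (rule closed)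
  qed
  have assoc2: "x \<otimes>\<^bsub>R\<^esub> y \<otimes>\<^bsub>R\<^esub> z = x \<otimes>\<^bsub>R\<^esub> (y \<otimes>\<^bsub>R\<^esub> z)" if "x \<in> X" "y \<in> carrier R" "z \<in> carrier R" for x y z
  proof (rule T.additive_map_eq_span[OF comp[OF r l] comp[OF l r] T X(1) _ subsetD[OF X(2) that(2)]])
    show "x \<otimes>\<^bsub>R\<^esub> y \<otimes>\<^bsub>R\<^esub> z = x \<otimes>\<^bsub>R\<^esub> (y \<otimes>\<^bsub>R\<^esub> z)" if "y \<in> X" for y
      by (rule assoc1) (use \<open>x \<in> X\<close> \<open>z \<in> carrier R\<close> that in auto)
  qed (use that X closed in auto)
  have assoc3: "x \<otimes>\<^bsub>R\<^esub> y \<otimes>\<^bsub>R\<^esub> z = x \<otimes>\<^bsub>R\<^esub> (y \<otimes>\<^bsub>R\<^esub> z)" if "x \<in> carrier R" "y \<in> carrier R" "z \<in> carrier R" for x y z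
  proof (rule T.additive_map_eq_span[OF comp[OF r r] r T X(1) _ subsetD[OF X(2) that(1)]])
    show "x \<otimes>\<^bsub>R\<^esub> y \<otimes>\<^bsub>R\<^esub> z = x \<otimes>\<^bsub>R\<^esub> (y \<otimes>\<^bsub>R\<^esub> z)" if "x \<in> X" for x
      by (rule assoc2) (use \<open>y \<in> carrier R\<close> \<open>z \<in> carrier R\<close> that in auto)
  qed (use that closed in auto)
  have "monoid R"
  proof (rule monoidI)
    fix x assume x: "x \<in> carrier R"
    show "\<one>\<^bsub>R\<^esub> \<otimes>\<^bsub>R\<^esub> x = x"
      by (rule T.additive_map_eq_span[OF l[OF one] id T X(1) unit(1) subsetD[OF X(2) x]])
    show "x \<otimes>\<^bsub>R\<^esub> \<one>\<^bsub>R\<^esub> = x"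
      by (rule T.additive_map_eq_span[OF r[OF one] id T X(1) unit(2) subsetD[OF X(2) x]])
  qed (use closed one assoc3 in auto)
  then show ?thesis
    by (rule ringI[OF T]) (auto simp: additive_map_add[OF l] additive_map_add[OF r])
qed

lemma int_module_lmod:
  assumes "abelian_group G"
  shows "lmod \<Z> (int_module G)"
proof -
  interpret G: abelian_group G by fact
  have "abelian_group (int_module G)"
    by (rule abelian_group_cong[OF assms]) (simp_all add: int_module_def)
  then show ?thesis
  proof (intro lmod.intro lmod_axioms.intro)
    show "ring \<Z>" using int_is_cring by (rule cring.axioms(1))
  qed (auto simp: int_module_def G.add.int_pow_mult G.add.int_pow_distrib G.add.int_pow_pow mult.commute)
qed

lemma additive_map_int_pow:
  assumes h: "additive_map G H h" and G: "abelian_group G" and H: "abelian_group H" and x: "x \<in> carrier G"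
  shows "h ([(z::int)] \<cdot>\<^bsub>G\<^esub> x) = [z] \<cdot>\<^bsub>H\<^esub> h x"
proof -
  interpret abelian_group_hom G H h by (rule additive_map_hom[OF assms(1-3)])
  show ?thesis using group_hom.hom_int_pow[OF a_group_hom] x by (simp add: add_pow_def)
qed

lemma int_ring_int_pow: "[(z::int)] \<cdot>\<^bsub>\<Z>\<^esub> w = z * w"
proof -
  have "abelian_group \<Z>" using int_is_cring by (simp add: cring_def ring_def)
  then have minus: "\<ominus>\<^bsub>\<Z>\<^esub> x = - x" for x by (rule abelian_group.minus_equality) auto
  have nat: "[(n::nat)] \<cdot>\<^bsub>\<Z>\<^esub> w = int n * w" for n
    by (induction n) (simp_all add: algebra_simps)
  show ?thesis
  proof (cases "z \<ge> 0")
    case True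
    then show ?thesis using nat[of "nat z"] add_pow_int_ge[OF True, of \<Z> w] by simp
  next
    case False
    then have "z < 0" by simp
    then show ?thesis using nat[of "nat (-z)"] add_pow_int_lt[OF \<open>z < 0\<close>, of \<Z> w] by (simp add: minus)
  qed
qed

section \<open>The Kostant algebra over K, the skew product, and their coordinates\<close>

section \<open>The Kostant algebra and the skew product\<close>

lemma int_module_simps [simp]:
  "carrier (int_module G) = carrier G" "add (int_module G) = add G" "zero (int_module G) = zero G"
  "smult (int_module G) z x = [(z::int)] \<cdot>\<^bsub>G\<^esub> x"
  by (simp_all add: int_module_def)

text \<open>A tensor product and the algebra built on it are different records with the same
  additive structure; this lemma and the next two pass between them.\<close>

lemma additive_map_cong:
  "carrier G = carrier G' ==> add G = add G' ==> carrier H = carrier H' ==> add H = add H' ==>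
    additive_map G H h ==> additive_map G' H' h"
  by (simp add: additive_map_def)

lemma fsum_cong_record:
  assumes "carrier G = carrier G'" "add G = add G'" "zero G = zero G'"
  shows "fsum G f S = fsum G' f S"
  using assms by (simp add: fsum_def finsum_def finprod_def)

lemma add_span_cong_record:
  fixes G :: "('a, 's) ring_scheme" and G' :: "('a, 't) ring_scheme"
  assumes "abelian_group G" "carrier G = carrier G'" "add G = add G'" "zero G = zero G'" "X \<subseteq> carrier G"
  shows "add_span G X = add_span G' X"
proof -
  interpret G: abelian_group G by fact
  interpret G': abelian_group G' by (rule abelian_group_cong[OF assms(1)]) (simp_all add: assms)
  have sub: "additive_subgroup H G \<longleftrightarrow> additive_subgroup H G'" for H
  proof -
    have *: "\<ominus>\<^bsub>G\<^esub> x = \<ominus>\<^bsub>G'\<^esub> x" if "x \<in> carrier G" for x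
      by (rule G.minus_equality) (use that assms G'.l_neg[of x] in auto)
    show ?thesis
    proof
      assume H: "additive_subgroup H G"
      show "additive_subgroup H G'"
        by (rule G'.additive_subgroupI')
          (use H assms additive_subgroup.a_subset[OF H] subgroup_zero[OF H] subgroup_add[OF H]
            subgroup_minus[OF H] * in \<open>auto simp: subset_iff\<close>)
    next
      assume H: "additive_subgroup H G'"
      show "additive_subgroup H G"
        by (rule G.additive_subgroupI')
          (use H assms additive_subgroup.a_subset[OF H] subgroup_zero[OF H] subgroup_add[OF H]
            subgroup_minus[OF H] * in \<open>auto simp: subset_iff\<close>)
    qed
  qed
  have X': "X \<subseteq> carrier G'" using assms by simp
  show ?thesis
  proof
    show "add_span G X \<subseteq> add_span G' X"
      by (rule G.add_span_least) (use G'.add_span_subgroup[OF X'] sub in \<open>auto intro: G'.add_span_incl\<close>)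
    show "add_span G' X \<subseteq> add_span G X"
      by (rule G'.add_span_least) (use G.add_span_subgroup[OF assms(5)] sub in \<open>auto intro: G.add_span_incl\<close>)
  qed
qed

locale kosK = kos n + K: cring K for n :: nat and K :: "('k, 's) ring_scheme"
begin

abbreviation K_mult (infixl "\<otimes>\<^sub>K" 70) where "x \<otimes>\<^sub>K y \<equiv> x \<otimes>\<^bsub>K\<^esub> y"
abbreviation K_add (infixl "\<oplus>\<^sub>K" 65) where "x \<oplus>\<^sub>K y \<equiv> x \<oplus>\<^bsub>K\<^esub> y"
abbreviation K_zero ("\<zero>\<^sub>K") where "\<zero>\<^sub>K \<equiv> \<zero>\<^bsub>K\<^esub>"
abbreviation K_one ("\<one>\<^sub>K") where "\<one>\<^sub>K \<equiv> \<one>\<^bsub>K\<^esub>"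

sublocale L: ring L by (rule L_ring)

sublocale TK: tensor \<Z> "int_module K" "int_module L"
proof (intro tensor.intro)
  show "cring \<Z>" by (rule int_is_cring)
  show "lmod \<Z> (int_module K)" by (rule int_module_lmod[OF K.ag])
  show "lmod \<Z> (int_module L)" by (rule int_module_lmod[OF L.ag])
qed

abbreviation "kt \<equiv> kostant_tens K n"

lemma kt_eq: "kt = TK.t"
  by (simp add: kostant_tens_def)

lemma gz_additive: "k \<in> exps ==> additive_map L \<Z> (gz k)"
  by (rule additive_mapI) (simp_all add: gz_add)

lemma gz_int_pow: "k \<in> exps ==> u \<in> carrier L ==> gz k ([(z::int)] \<cdot>\<^bsub>L\<^esub> u) = z * gz k u"
  using additive_map_int_pow[OF gz_additive L.ag cring.axioms(1)[OF int_is_cring, THEN ring.is_abelian_group]]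
  by (simp add: int_ring_int_pow)

lemma L_minus: "u \<in> carrier L ==> \<ominus>\<^bsub>L\<^esub> u = \<ominus>\<^bsub>U\<^esub> u"
  by (rule L.minus_equality)
    (use subgroup_minus[OF L_subgroup] L_subset U.l_neg in \<open>auto simp: L_simps(4,5)\<close>)

lemma L_span: "carrier L = add_span L {E k | k. k \<in> exps}"
proof
  let ?X = "{E k | k. k \<in> exps}"
  have X: "?X \<subseteq> carrier L" "?X \<subseteq> carrier U" by (auto simp: E_in_L)
  show "add_span L ?X \<subseteq> carrier L" by (rule L.add_span_subset[OF X(1)])
  note sub = L.add_span_subgroup[OF X(1)]
  show "carrier L \<subseteq> add_span L ?X"
  proof
    fix u assume "u \<in> carrier L"
    then have "u \<in> add_span U ?X" by (simp only: L_simps(1))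
    then show "u \<in> add_span L ?X" using X(2)
    proof (induction rule: U.add_span_induct)
      case zero
      show ?case using subgroup_zero[OF sub] by (simp add: L_simps(4))
    next
      case (minus x)
      then show ?case
        using subgroup_minus[OF sub, of x] L_minus[of x] additive_subgroup.a_subset[OF sub] by auto
    next
      case (add x y)
      then show ?case using subgroup_add[OF sub, of x y] by (simp add: L_simps(5))
    qed (rule L.add_span_incl)
  qed
qed

text \<open>Freeness of the integral form over the integers: it is the reason why the monomials
  remain a basis after extension of scalars, in every characteristic.\<close>

lemma L_basis: "mod_basis \<Z> (int_module L) exps E gz"
proof -
  have Zg: "abelian_group \<Z>" using int_is_cring by (simp add: cring_def ring_def)
  let ?\<tau> = "\<lambda>k z. [(z::int)] \<cdot>\<^bsub>L\<^esub> E k"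
  have c: "coords L \<Z> exps ?\<tau> gz"
  proof (rule coordsI[OF L.ag Zg])
    show "additive_map \<Z> L (?\<tau> k)" if "k \<in> exps" for k
      using additive_map_cong[OF refl refl _ _ TK.N.smult_additive_l[of "E k"], of L] that by (simp add: E_in_L)
    show "additive_map L \<Z> (gz k)" if "k \<in> exps" for k by (rule gz_additive[OF that])
    show "gz k (?\<tau> l d) = (if k = l then d else \<zero>\<^bsub>\<Z>\<^esub>)" if "k \<in> exps" "l \<in> exps" for k l d
      using that by (simp add: gz_int_pow E_in_L gz_E)
    show X: "{E k | k. k \<in> exps} \<subseteq> carrier L" by (auto simp: E_in_L)
    show "carrier L \<subseteq> add_span L {E k | k. k \<in> exps}" using L_span by simp
    fix x assume "x \<in> {E k | k. k \<in> exps}"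
    then obtain l where l: "x = E l" "l \<in> exps" by auto
    show "finite {k \<in> exps. gz k x ~= \<zero>\<^bsub>\<Z>\<^esub>}"
      by (rule finite_subset[of _ "{l}"]) (use l in \<open>auto simp: gz_E split: if_splits\<close>)
    have "fsum L (\<lambda>k. ?\<tau> k (gz k x)) exps = x"
    proof (rule L.fsum_single[of l])
      have "[(0::int)] \<cdot>\<^bsub>L\<^esub> v = \<zero>\<^sub>L" for v by (simp add: add_pow_def)
      then show "?\<tau> k (gz k x) = (if k = l then x else \<zero>\<^sub>L)" if "k \<in> exps" for k
        using that l E_in_L by (simp add: gz_E)
    qed (use l E_in_L in auto)
    then show "x = fsum L (\<lambda>k. ?\<tau> k (gz k x)) exps" ..
  qed
  interpret c: coords L \<Z> exps ?\<tau> gz by (rule c)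
  show ?thesis
  proof (intro mod_basis.intro mod_basis_axioms.intro TK.N.lmod_axioms)
    show "additive_map (int_module L) \<Z> (gz k)" if "k \<in> exps" for k
      using additive_map_cong[OF _ _ refl refl c.gam_additive[OF that], of "int_module L"] by simp
    show "x = fsum (int_module L) (\<lambda>k. gz k x \<odot>\<^bsub>int_module L\<^esub> E k) exps" if "x \<in> carrier (int_module L)" for x
      using c.expand[of x] that by (simp add: fsum_cong_record[of "int_module L" L])
  qed (use c.gam_finite in \<open>simp_all add: E_in_L gz_int_pow gz_E\<close>)
qed

definition cK :: "(nat \<times> nat => nat) => 'k kos => 'k" where
  "cK = (SOME \<Gamma>. coords TK.T (int_module K) exps (\<lambda>k c. TK.t c (E k)) \<Gamma> \<and>
     (\<forall>k\<in>exps. \<forall>c\<in>carrier (int_module K). \<forall>u\<in>carrier (int_module L).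
       \<Gamma> k (TK.t c u) = gz k u \<odot>\<^bsub>int_module K\<^esub> c))"

lemma cK: "coords TK.T (int_module K) exps (\<lambda>k c. kt c (E k)) cK \<and>
     (\<forall>k\<in>exps. \<forall>c\<in>carrier K. \<forall>u\<in>carrier L. cK k (kt c u) = [gz k u] \<cdot>\<^bsub>K\<^esub> c)"
  using someI_ex[OF TK.coords_r[OF L_basis]] unfolding cK_def[symmetric] by (simp add: kt_eq)

sublocale cK: coords TK.T "int_module K" exps "\<lambda>k c. kt c (E k)" cK
  using cK by blast

lemma cK_kt: "k \<in> exps ==> c \<in> carrier K ==> u \<in> carrier L ==> cK k (kt c u) = [gz k u] \<cdot>\<^bsub>K\<^esub> c"
  using cK by blast

abbreviation "A \<equiv> kostant_alg K n"
abbreviation A_mult (infixl "\<otimes>\<^sub>A" 70) where "x \<otimes>\<^sub>A y \<equiv> x \<otimes>\<^bsub>A\<^esub> y"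
abbreviation A_add (infixl "\<oplus>\<^sub>A" 65) where "x \<oplus>\<^sub>A y \<equiv> x \<oplus>\<^bsub>A\<^esub> y"
abbreviation A_smult (infixr "\<odot>\<^sub>A" 70) where "a \<odot>\<^sub>A x \<equiv> a \<odot>\<^bsub>A\<^esub> x"
abbreviation A_one ("\<one>\<^sub>A") where "\<one>\<^sub>A \<equiv> \<one>\<^bsub>A\<^esub>"

lemma A_simps:
  "carrier A = carrier TK.T" "add A = add TK.T" "zero A = zero TK.T" "one A = kt \<one>\<^sub>K \<one>\<^sub>L"
  "smult A c x = kt c \<one>\<^sub>L \<otimes>\<^sub>A x"
  "mult A = biadditive_product TK.T (\<lambda>x y z. \<exists>c\<in>carrier K. \<exists>c'\<in>carrier K.
             \<exists>u\<in>carrier L. \<exists>u'\<in>carrier L. x = kt c u \<and> y = kt c' u' \<and> z = kt (c \<otimes>\<^sub>K c') (u \<otimes>\<^sub>L u'))"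
  by (simp_all add: kostant_alg_def Let_def kt_eq)

lemma kt_closed [simp]: "c \<in> carrier K ==> u \<in> carrier L ==> kt c u \<in> carrier A"
  by (simp add: kt_eq A_simps)

lemma A_group: "abelian_group A"
  by (rule abelian_group_cong[OF TK.T.M.ag]) (simp_all add: A_simps)

lemma kt_additive_l: "u \<in> carrier L ==> additive_map K A (\<lambda>c. kt c u)"
  using additive_map_cong[OF _ _ _ _ TK.tens_additive_l[of u], of K A] by (simp add: A_simps kt_eq)

lemma kt_additive_r: "c \<in> carrier K ==> additive_map L A (kt c)"
  using additive_map_cong[OF _ _ _ _ TK.tens_additive_r[of c], of L A] by (simp add: A_simps kt_eq)

lemma additive_L_eqI:
  assumes "additive_map L G g" "additive_map L G h" "abelian_group G" "!!k. k \<in> exps ==> g (E k) = h (E k)"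
    "u \<in> carrier L"
  shows "g u = h u"
  by (rule L.additive_map_eq_span[OF assms(1-3), of "{E k | k. k \<in> exps}"]) (use assms L_span E_in_L in auto)

text \<open>The product is prescribed on the basis, where nothing has to be well defined; the
  formula for pure tensors then follows by additivity in the second tensor factors.\<close>

lemma A_mult_ex:
  "\<exists>m. (\<forall>x\<in>carrier A. additive_map A A (m x)) \<and> (\<forall>y\<in>carrier A. additive_map A A (\<lambda>x. m x y)) \<and>
    (\<forall>c\<in>carrier K. \<forall>c'\<in>carrier K. \<forall>u\<in>carrier L. \<forall>u'\<in>carrier L. m (kt c u) (kt c' u') = kt (c \<otimes>\<^sub>K c') (u \<otimes>\<^sub>L u'))"
proof -
  note cong = additive_map_cong[OF _ _ _ _ ]
  have "\<exists>m. (\<forall>x\<in>carrier TK.T. additive_map TK.T TK.T (m x)) \<and> (\<forall>y\<in>carrier TK.T. additive_map TK.T TK.T (\<lambda>x. m x y)) \<and>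
     (\<forall>k\<in>exps. \<forall>l\<in>exps. \<forall>d\<in>carrier (int_module K). \<forall>d'\<in>carrier (int_module K).
       m (kt d (E k)) (kt d' (E l)) = kt (d \<otimes>\<^sub>K d') (E k \<otimes>\<^sub>L E l))"
  proof (rule cK.bilinear_extension)
    fix k l d assume *: "k \<in> exps" "l \<in> exps" "d \<in> carrier (int_module K)"
    have "additive_map K A (\<lambda>d'. kt (d \<otimes>\<^sub>K d') (E k \<otimes>\<^sub>L E l))"
      by (rule additive_map_comp[OF kt_additive_l K.mult_additive_r]) (use * E_in_L in auto)
    then show "additive_map (int_module K) TK.T (\<lambda>d'. kt (d \<otimes>\<^sub>K d') (E k \<otimes>\<^sub>L E l))"
      by (rule cong[rotated -1]) (simp_all add: A_simps)
    have "additive_map K A (\<lambda>d'. kt (d' \<otimes>\<^sub>K d) (E k \<otimes>\<^sub>L E l))"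
      by (rule additive_map_comp[OF kt_additive_l K.mult_additive_l]) (use * E_in_L in auto)
    then show "additive_map (int_module K) TK.T (\<lambda>d'. kt (d' \<otimes>\<^sub>K d) (E k \<otimes>\<^sub>L E l))"
      by (rule cong[rotated -1]) (simp_all add: A_simps)
  qed
  then obtain m where m0: "\<forall>x\<in>carrier TK.T. additive_map TK.T TK.T (m x)"
    "\<forall>y\<in>carrier TK.T. additive_map TK.T TK.T (\<lambda>x. m x y)"
    and m3: "\<forall>k\<in>exps. \<forall>l\<in>exps. \<forall>d\<in>carrier (int_module K). \<forall>d'\<in>carrier (int_module K).
       m (kt d (E k)) (kt d' (E l)) = kt (d \<otimes>\<^sub>K d') (E k \<otimes>\<^sub>L E l)"
    by blast
  have m1: "additive_map A A (m x)" "additive_map A A (\<lambda>y. m y x)" if "x \<in> carrier A" for x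
    using m0 that by (simp_all add: additive_map_def A_simps)
  have m: "!!x. x \<in> carrier A ==> additive_map A A (m x)"
    "!!y. y \<in> carrier A ==> additive_map A A (\<lambda>x. m x y)"
    "!!k l d d'. k \<in> exps ==> l \<in> exps ==> d \<in> carrier K ==> d' \<in> carrier K ==>
       m (kt d (E k)) (kt d' (E l)) = kt (d \<otimes>\<^sub>K d') (E k \<otimes>\<^sub>L E l)"
    using m1 m3 by simp_all
  have "m (kt c u) (kt c' u') = kt (c \<otimes>\<^sub>K c') (u \<otimes>\<^sub>L u')"
    if c: "c \<in> carrier K" "c' \<in> carrier K" and u: "u \<in> carrier L" "u' \<in> carrier L" for c c' u u'
  proof (rule additive_L_eqI[OF additive_map_comp[OF m(2) kt_additive_r]
        additive_map_comp[OF kt_additive_r L.mult_additive_l] A_group _ u(1)])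
    fix k assume k: "k \<in> exps"
    show "m (kt c (E k)) (kt c' u') = kt (c \<otimes>\<^sub>K c') (E k \<otimes>\<^sub>L u')"
      by (rule additive_L_eqI[OF additive_map_comp[OF m(1) kt_additive_r]
        additive_map_comp[OF kt_additive_r L.mult_additive_r] A_group _ u(2)]) (use c k m(3) E_in_L in auto)
  qed (use c u in auto)
  then show ?thesis using m(1,2) by blast
qed

lemma A_pure: "carrier A \<subseteq> add_span A {kt c u | c u. c \<in> carrier K \<and> u \<in> carrier L}"
proof -
  have "add_span A {kt c u | c u. c \<in> carrier K \<and> u \<in> carrier L} = add_span TK.T TK.pure"
    by (simp add: kt_eq) (rule add_span_cong_record[OF A_group], auto simp: A_simps)
  then show ?thesis using TK.pure_span by (simp add: A_simps)
qed

lemma kt_set: "{kt c u | c u. c \<in> carrier K \<and> u \<in> carrier L} \<subseteq> carrier A"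
  by auto

lemma A_mult:
  shows "x \<in> carrier A ==> additive_map A A (\<lambda>y. x \<otimes>\<^sub>A y)"
    and "y \<in> carrier A ==> additive_map A A (\<lambda>x. x \<otimes>\<^sub>A y)"
    and "c \<in> carrier K ==> c' \<in> carrier K ==> u \<in> carrier L ==> u' \<in> carrier L ==>
      kt c u \<otimes>\<^sub>A kt c' u' = kt (c \<otimes>\<^sub>K c') (u \<otimes>\<^sub>L u')"
proof -
  obtain m where m: "!!x. x \<in> carrier A ==> additive_map A A (m x)"
    "!!y. y \<in> carrier A ==> additive_map A A (\<lambda>x. m x y)"
    "!!c c' u u'. c \<in> carrier K ==> c' \<in> carrier K ==> u \<in> carrier L ==> u' \<in> carrier L ==>
       m (kt c u) (kt c' u') = kt (c \<otimes>\<^sub>K c') (u \<otimes>\<^sub>L u')"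
    using A_mult_ex by blast
  let ?r = "\<lambda>x y z. \<exists>c\<in>carrier K. \<exists>c'\<in>carrier K.
             \<exists>u\<in>carrier L. \<exists>u'\<in>carrier L. x = kt c u \<and> y = kt c' u' \<and> z = kt (c \<otimes>\<^sub>K c') (u \<otimes>\<^sub>L u')"
  have mm: "additive_map TK.T TK.T (m x)" "additive_map TK.T TK.T (\<lambda>y. m y x)" if "x \<in> carrier TK.T" for x
    using m(1,2)[of x] that by (simp_all add: A_simps additive_map_def)
  have eq: "x \<otimes>\<^sub>A y = m x y" if "x \<in> carrier A" "y \<in> carrier A" for x y
    unfolding A_simps(6)
  proof (rule biadditive_product[OF TK.T.M.ag TK.pure_closed TK.pure_span TK.pure_closed TK.pure_span])
    show "\<exists>z. ?r x y z" if "x \<in> TK.pure" "y \<in> TK.pure" for x y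
      using that by (auto simp: kt_eq) blast
    show "x \<in> carrier TK.T \<and> y \<in> carrier TK.T \<and> m x y = z" if "?r x y z" for x y z
      using that kt_closed by (auto simp: m(3) A_simps)
  qed (use that mm in \<open>auto simp: A_simps\<close>)
  have mc: "m x y \<in> carrier A" if "x \<in> carrier A" "y \<in> carrier A" for x y
    using additive_map_closed[OF m(1)] that by blast
  show "additive_map A A (\<lambda>y. x \<otimes>\<^sub>A y)" if "x \<in> carrier A"
    using m(1)[OF that] that A_group abelian_monoid.a_closed[OF abelian_group.axioms(1)[OF A_group]] by (auto simp: additive_map_def eq)
  show "additive_map A A (\<lambda>x. x \<otimes>\<^sub>A y)" if "y \<in> carrier A"
    using m(2)[OF that] that A_group abelian_monoid.a_closed[OF abelian_group.axioms(1)[OF A_group]] mc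
    by (auto simp: additive_map_def eq)
  show "kt c u \<otimes>\<^sub>A kt c' u' = kt (c \<otimes>\<^sub>K c') (u \<otimes>\<^sub>L u')"
    if "c \<in> carrier K" "c' \<in> carrier K" "u \<in> carrier L" "u' \<in> carrier L"
    using that by (simp add: eq m(3))
qed

lemma A_ring: "ring A"
proof (rule ring_from_span[OF A_group _ A_mult(1,2) _ kt_set A_pure])
  show "x \<otimes>\<^sub>A y \<in> carrier A" if "x \<in> carrier A" "y \<in> carrier A" for x y
    using additive_map_closed[OF A_mult(1)] that by blast
  show "\<one>\<^sub>A \<in> carrier A" unfolding A_simps(4) by (rule kt_closed) auto
qed (auto simp: A_simps(4) A_mult(3) L.m_assoc K.m_assoc)

sublocale A: ring A by (rule A_ring)

lemma A_lmod: "lmod K A"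
proof (intro lmod.intro lmod_axioms.intro)
  show "ring K" by (rule K.ring_axioms)
  show "abelian_group A" by (rule A_group)
qed (auto simp: A_simps(5) additive_map_add[OF kt_additive_l] A.l_distr A.r_distr A.m_assoc[symmetric] A_mult(3)
    A_simps(4)[symmetric])

sublocale A: lmod K A by (rule A_lmod)

lemma A_smult_mult:
  assumes "c \<in> carrier K" "x \<in> carrier A" "y \<in> carrier A"
  shows "(c \<odot>\<^sub>A x) \<otimes>\<^sub>A y = c \<odot>\<^sub>A (x \<otimes>\<^sub>A y)" "x \<otimes>\<^sub>A (c \<odot>\<^sub>A y) = c \<odot>\<^sub>A (x \<otimes>\<^sub>A y)"
proof -
  show "(c \<odot>\<^sub>A x) \<otimes>\<^sub>A y = c \<odot>\<^sub>A (x \<otimes>\<^sub>A y)"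
    using assms by (simp add: A_simps(5) A.m_assoc)
  have "x \<otimes>\<^sub>A kt c \<one>\<^sub>L = kt c \<one>\<^sub>L \<otimes>\<^sub>A x"
    by (rule A.additive_map_eq_span[OF A_mult(2) A_mult(1) A_group kt_set _ subsetD[OF A_pure assms(2)]])
      (use assms in \<open>auto simp: A_mult(3) K.m_comm\<close>)
  then show "x \<otimes>\<^sub>A (c \<odot>\<^sub>A y) = c \<odot>\<^sub>A (x \<otimes>\<^sub>A y)"
    using assms by (simp add: A_simps(5) A.m_assoc[symmetric])
qed

lemma kt_smult: "c \<in> carrier K ==> c' \<in> carrier K ==> u \<in> carrier L ==> c \<odot>\<^sub>A kt c' u = kt (c \<otimes>\<^sub>K c') u"
  by (simp add: A_simps(5) A_mult(3))

definition eA :: "(nat \<times> nat => nat) => 'k kos" where "eA k = kt \<one>\<^sub>K (E k)"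

lemma eA_closed [simp]: "k \<in> exps ==> eA k \<in> carrier A"
  by (simp add: eA_def E_in_L)

lemma A_basis: "mod_basis K A exps eA cK"
proof (intro mod_basis.intro mod_basis_axioms.intro A_lmod)
  fix k assume k: "k \<in> exps"
  show "additive_map A K (cK k)"
    using additive_map_cong[OF _ _ _ _ cK.gam_additive[OF k], of A K] by (simp add: A_simps)
  fix c x assume c: "c \<in> carrier K" and x: "x \<in> carrier A"
  have add: "additive_map A K (cK k)" by fact
  show "cK k (c \<odot>\<^sub>A x) = c \<otimes>\<^sub>K cK k x"
  proof (rule A.additive_map_eq_span[OF additive_map_comp[OF add A.smult_additive[OF c]]
        additive_map_comp[OF K.mult_additive_r[OF c] add] K.ag kt_set _ subsetD[OF A_pure x]])
    fix s assume "s \<in> {kt c u |c u. c \<in> carrier K \<and> u \<in> carrier L}"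
    then show "cK k (c \<odot>\<^sub>A s) = c \<otimes>\<^sub>K cK k s"
      using c k by (auto simp: kt_smult cK_kt K.add_pow_rdistr_int)
  qed
next
  fix k l assume "k \<in> exps" "l \<in> exps"
  then show "cK k (eA l) = (if k = l then \<one>\<^sub>K else \<zero>\<^sub>K)"
    using cK.gam_tau[of k l "\<one>\<^sub>K"] by (simp add: eA_def)
next
  fix x assume x: "x \<in> carrier A"
  show "finite {k \<in> exps. cK k x ~= \<zero>\<^sub>K}" using cK.gam_finite[of x] x by (simp add: A_simps)
  have xT: "x \<in> carrier TK.T" using x by (simp add: A_simps)
  have c: "cK k x \<in> carrier K" if "k \<in> exps" for k using cK.gam_closed[OF that xT] by simp
  have "x = fsum A (\<lambda>k. kt (cK k x) (E k)) exps"
    using cK.expand[OF xT] fsum_cong_record[of A TK.T "\<lambda>k. kt (cK k x) (E k)" exps] by (simp add: A_simps)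
  also have "\<dots> = fsum A (\<lambda>k. cK k x \<odot>\<^sub>A eA k) exps"
    by (rule A.fsum_cong) (use c in \<open>auto simp: eA_def kt_smult E_in_L\<close>)
  finally show "x = fsum A (\<lambda>k. cK k x \<odot>\<^sub>A eA k) exps" .
qed simp

end

subsection \<open>Weights of monomials\<close>

context kos
begin

definition dv :: "(nat \<times> nat => nat) => int vec" where "dv k = vec n (wt k)"

lemma dv_closed [simp]: "dv k \<in> carrier_vec n"
  by (simp add: dv_def)

lemma dv_index [simp]: "q < n ==> dv k $ q = wt k q"
  by (simp add: dv_def)

lemma monomial_degree_dv: "monomial_degree n M = dv (strict M)"
proof (rule eq_vecI)
  let ?D = "{(i, j). i < j \<and> j < n}"
  have fin: "finite ?D" by (rule finite_subset[of _ "{..<n} \<times> {..<n}"]) auto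
  let ?f = "\<lambda>(i, j). int (M $$ (i, j)) \<cdot>\<^sub>v (unit_vec n i - unit_vec n j) :: int vec"
  have f: "?f \<in> ?D \<rightarrow> carrier_vec n" by auto
  show "dim_vec (monomial_degree n M) = dim_vec (dv (strict M))"
    using finsum_vec_closed[OF f] by (simp add: monomial_degree_def dv_def)
  fix q assume "q < dim_vec (dv (strict M))"
  then have q: "q < n" by (simp add: dv_def)
  have row: "(\<Sum>x\<in>?D. int (M $$ x) * of_bool (fst x = q)) = irow q (strict M)"
  proof -
    have "(\<Sum>x\<in>?D. int (M $$ x) * of_bool (fst x = q)) = (\<Sum>x\<in>(\<lambda>b. (q, b)) ` {q<..<n}. int (M $$ x))"
      by (rule sum.mono_neutral_cong_right) (use fin in auto)
    also have "\<dots> = (\<Sum>b\<in>{q<..<n}. int (M $$ (q, b)))" by (subst sum.reindex) (auto simp: inj_on_def)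
    also have "\<dots> = irow q (strict M)"
      unfolding irow_def by (rule sum.mono_neutral_cong_left) (auto simp: strict_def)
    finally show ?thesis .
  qed
  have col: "(\<Sum>x\<in>?D. int (M $$ x) * of_bool (snd x = q)) = icol q (strict M)"
  proof -
    have "(\<Sum>x\<in>?D. int (M $$ x) * of_bool (snd x = q)) = (\<Sum>x\<in>(\<lambda>a. (a, q)) ` {..<q}. int (M $$ x))"
      by (rule sum.mono_neutral_cong_right) (use fin q in auto)
    also have "\<dots> = (\<Sum>a\<in>{..<q}. int (M $$ (a, q)))" by (subst sum.reindex) (auto simp: inj_on_def)
    also have "\<dots> = icol q (strict M)"
      unfolding icol_def by (rule sum.mono_neutral_cong_left) (use q in \<open>auto simp: strict_def\<close>)
    finally show ?thesis .
  qed
  have "monomial_degree n M $ q = (\<Sum>x\<in>?D. ?f x $ q)"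
    unfolding monomial_degree_def by (rule index_finsum_vec[OF fin q f])
  also have "\<dots> = (\<Sum>x\<in>?D. int (M $$ x) * of_bool (fst x = q) - int (M $$ x) * of_bool (snd x = q))"
    by (rule sum.cong) (use q in \<open>auto simp: unit_vec_def\<close>)
  also have "\<dots> = wt (strict M) q"
    by (simp add: sum_subtractf row col wt_def)
  finally show "monomial_degree n M $ q = dv (strict M) $ q" using q by simp
qed

lemma Psi_closed: "\<gamma> \<in> Psi n ==> \<gamma> \<in> carrier_vec n"
  by (induction rule: Psi.induct) auto

text \<open>The root telescopes into simple roots.\<close>

lemma Psi_root: "\<gamma> \<in> Psi n ==> i < j ==> j < n ==> \<gamma> + (unit_vec n i - unit_vec n j) \<in> Psi n"
proof (induction j)
  case (Suc j)
  show ?case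
  proof (cases "i = j")
    case True
    then show ?thesis using Psi_add[OF Suc.prems(1), of j] Suc.prems by simp
  next
    case False
    have "\<gamma> + (unit_vec n i - unit_vec n j) \<in> Psi n" using Suc False by simp
    from Psi_add[OF this, of j] Suc.prems(3)
    have "\<gamma> + (unit_vec n i - unit_vec n j) + (unit_vec n j - unit_vec n (Suc j)) \<in> Psi n" by simp
    moreover have "\<gamma> + (unit_vec n i - unit_vec n j) + (unit_vec n j - unit_vec n (Suc j)) = \<gamma> + (unit_vec n i - unit_vec n (Suc j))"
      by (rule eq_vecI) (use Psi_closed[OF Suc.prems(1)] in auto)
    ultimately show ?thesis by simp
  qed
qed simp

text \<open>The product rule of the skew algebra mentions only degrees in \<open>Psi n\<close>, so
  it has to be seen that monomials have such degrees. The roots are removed one at a time.\<close>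

lemma dv_Psi: "k \<in> exps ==> dv k \<in> Psi n"
proof (induction "\<Sum>x\<in>{..<n} \<times> {..<n}. k x" arbitrary: k)
  case 0
  have "k x = 0" for x
  proof (cases "x \<in> {..<n} \<times> {..<n}")
    case True
    then show ?thesis using 0(1) by (metis finite_SigmaI finite_lessThan sum_eq_0_iff)
  next
    case False
    obtain i j where ij: "x = (i, j)" by (cases x)
    have "\<not> (i < j \<and> j < n)" using False ij by auto
    then show ?thesis using 0(2) unfolding exps_def ij by blast
  qed
  then have "dv k = 0\<^sub>v n" by (intro eq_vecI) (simp_all add: dv_def wt_def irow_def icol_def)
  then show ?case by (simp add: Psi_zero)
next
  case (Suc N)
  have "\<exists>x\<in>{..<n} \<times> {..<n}. k x ~= 0"
    using Suc.hyps(2) by (metis Zero_not_Suc sum.neutral)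
  then obtain i j where x: "(i, j) \<in> {..<n} \<times> {..<n}" "k (i, j) ~= 0" by auto
  have ij: "i < j" "j < n" using x(2) Suc.prems by (auto simp: exps_def)
  let ?k = "k((i, j) := k (i, j) - 1)"
  have kx: "?k \<in> exps" using Suc.prems ij by (intro exps_upd) auto
  have "(\<Sum>x\<in>{..<n} \<times> {..<n}. k x) = k (i, j) + (\<Sum>x\<in>{..<n} \<times> {..<n} - {(i, j)}. k x)"
    using x by (subst sum.remove[of _ "(i, j)"]) auto
  moreover have "(\<Sum>x\<in>{..<n} \<times> {..<n}. ?k x) = (k (i, j) - 1) + (\<Sum>x\<in>{..<n} \<times> {..<n} - {(i, j)}. k x)"
    using x by (subst sum.remove[of _ "(i, j)"]) (auto intro!: sum.cong)
  ultimately have "N = (\<Sum>x\<in>{..<n} \<times> {..<n}. ?k x)" using Suc.hyps(2) x(2) by simp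
  from Psi_root[OF Suc.hyps(1)[OF this kx] ij]
  have "dv ?k + (unit_vec n i - unit_vec n j) \<in> Psi n" .
  moreover have "dv ?k + (unit_vec n i - unit_vec n j) = dv k"
    by (rule eq_vecI) (use ij x(2) in \<open>auto simp: wt_def icol_upd irow_upd unit_vec_def dv_def\<close>)
  ultimately show ?case by simp
qed

end

subsection \<open>The algebra of functions\<close>

context kosK
begin

abbreviation "B \<equiv> fun_alg K n"
abbreviation B_mult (infixl "\<otimes>\<^sub>B" 70) where "x \<otimes>\<^sub>B y \<equiv> x \<otimes>\<^bsub>B\<^esub> y"
abbreviation B_add (infixl "\<oplus>\<^sub>B" 65) where "x \<oplus>\<^sub>B y \<equiv> x \<oplus>\<^bsub>B\<^esub> y"
abbreviation B_smult (infixr "\<odot>\<^sub>B" 70) where "a \<odot>\<^sub>B x \<equiv> a \<odot>\<^bsub>B\<^esub> x"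
abbreviation B_zero ("\<zero>\<^sub>B") where "\<zero>\<^sub>B \<equiv> \<zero>\<^bsub>B\<^esub>"
abbreviation B_one ("\<one>\<^sub>B") where "\<one>\<^sub>B \<equiv> \<one>\<^bsub>B\<^esub>"
abbreviation "Z \<equiv> (carrier_vec n :: int vec set)"

lemma B_simps:
  "carrier B = Z \<rightarrow>\<^sub>E carrier K" "mult B = (\<lambda>f g. \<lambda>z\<in>Z. f z \<otimes>\<^sub>K g z)" "one B = (\<lambda>z\<in>Z. \<one>\<^sub>K)"
  "zero B = (\<lambda>z\<in>Z. \<zero>\<^sub>K)" "add B = (\<lambda>f g. \<lambda>z\<in>Z. f z \<oplus>\<^sub>K g z)" "smult B = (\<lambda>c f. \<lambda>z\<in>Z. c \<otimes>\<^sub>K f z)"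
  by (simp_all add: fun_alg_def)

lemma B_eqI: "f \<in> carrier B ==> g \<in> carrier B ==> (!!z. z \<in> Z ==> f z = g z) ==> f = g"
  unfolding B_simps by (rule PiE_ext)

lemma B_at: "f \<in> carrier B ==> z \<in> Z ==> f z \<in> carrier K"
  unfolding B_simps by auto

lemma B_closed [simp]:
  "f \<in> carrier B ==> g \<in> carrier B ==> f \<otimes>\<^sub>B g \<in> carrier B"
  "f \<in> carrier B ==> g \<in> carrier B ==> f \<oplus>\<^sub>B g \<in> carrier B"
  "c \<in> carrier K ==> f \<in> carrier B ==> c \<odot>\<^sub>B f \<in> carrier B"
  "\<one>\<^sub>B \<in> carrier B" "\<zero>\<^sub>B \<in> carrier B"
  by (auto simp: B_simps)

lemma B_app:
  "z \<in> Z ==> (f \<otimes>\<^sub>B g) z = f z \<otimes>\<^sub>K g z"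
  "z \<in> Z ==> (f \<oplus>\<^sub>B g) z = f z \<oplus>\<^sub>K g z"
  "z \<in> Z ==> (c \<odot>\<^sub>B f) z = c \<otimes>\<^sub>K f z"
  "z \<in> Z ==> \<one>\<^sub>B z = \<one>\<^sub>K"
  "z \<in> Z ==> \<zero>\<^sub>B z = \<zero>\<^sub>K"
  by (simp_all add: B_simps)

lemma B_group: "abelian_group B"
proof (rule abelian_groupI)
  fix f assume f: "f \<in> carrier B"
  have g: "(\<lambda>z\<in>Z. \<ominus>\<^bsub>K\<^esub> f z) \<in> carrier B" using f by (auto simp: B_simps)
  moreover have "(\<lambda>z\<in>Z. \<ominus>\<^bsub>K\<^esub> f z) \<oplus>\<^sub>B f = \<zero>\<^sub>B"
    by (rule B_eqI) (use f g in \<open>auto simp: B_app B_at K.l_neg\<close>)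
  ultimately show "\<exists>g\<in>carrier B. g \<oplus>\<^sub>B f = \<zero>\<^sub>B" by blast
  show "\<zero>\<^sub>B \<oplus>\<^sub>B f = f" by (rule B_eqI) (use f in \<open>auto simp: B_app B_at\<close>)
  fix g assume g: "g \<in> carrier B"
  show "f \<oplus>\<^sub>B g = g \<oplus>\<^sub>B f" by (rule B_eqI) (use f g in \<open>auto simp: B_app B_at K.a_comm\<close>)
  fix h assume h: "h \<in> carrier B"
  show "f \<oplus>\<^sub>B g \<oplus>\<^sub>B h = f \<oplus>\<^sub>B (g \<oplus>\<^sub>B h)" by (rule B_eqI) (use f g h in \<open>auto simp: B_app B_at K.a_assoc\<close>)
qed auto

lemma B_lmod: "lmod K B"
  by (intro lmod.intro lmod_axioms.intro B_group K.ring_axioms)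
    (auto intro!: B_eqI simp: B_app B_at K.l_distr K.r_distr K.m_assoc)

sublocale B: lmod K B by (rule B_lmod)

lemma B_mult_additive:
  "f \<in> carrier B ==> additive_map B B (\<lambda>g. f \<otimes>\<^sub>B g)" "g \<in> carrier B ==> additive_map B B (\<lambda>f. f \<otimes>\<^sub>B g)"
  by (auto intro!: additive_mapI B_eqI simp: B_app B_at K.l_distr K.r_distr)

abbreviation "sh \<equiv> shift n"

lemma sh_closed [simp]: "\<gamma> \<in> Z ==> f \<in> carrier B ==> sh \<gamma> f \<in> carrier B"
  by (auto simp: shift_def B_simps)

lemma sh_app: "z \<in> Z ==> sh \<gamma> f z = f (z + \<gamma>)"
  by (simp add: shift_def)

lemma sh_additive: "\<gamma> \<in> Z ==> additive_map B B (sh \<gamma>)"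
  by (auto intro!: additive_mapI B_eqI simp: B_app B_at sh_app)

lemma sh_mult: "\<gamma> \<in> Z ==> f \<in> carrier B ==> g \<in> carrier B ==> sh \<gamma> (f \<otimes>\<^sub>B g) = sh \<gamma> f \<otimes>\<^sub>B sh \<gamma> g"
  by (rule B_eqI) (auto simp: B_app B_at sh_app)

lemma sh_smult: "\<gamma> \<in> Z ==> f \<in> carrier B ==> c \<in> carrier K ==> sh \<gamma> (c \<odot>\<^sub>B f) = c \<odot>\<^sub>B sh \<gamma> f"
  by (rule B_eqI) (auto simp: B_app B_at sh_app)

lemma sh_one: "\<gamma> \<in> Z ==> sh \<gamma> \<one>\<^sub>B = \<one>\<^sub>B"
  by (rule B_eqI) (auto simp: B_app sh_app)

lemma sh_sh: "\<gamma> \<in> Z ==> \<gamma>' \<in> Z ==> f \<in> carrier B ==> sh \<gamma>' (sh \<gamma> f) = sh (\<gamma> + \<gamma>') f"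
proof (rule B_eqI)
  fix z assume "\<gamma> \<in> Z" "\<gamma>' \<in> Z" "f \<in> carrier B" "z \<in> Z"
  moreover have "z + \<gamma>' + \<gamma> = z + (\<gamma> + \<gamma>')" by (rule eq_vecI) (use calculation in auto)
  ultimately show "sh \<gamma>' (sh \<gamma> f) z = sh (\<gamma> + \<gamma>') f z" by (simp add: sh_app)
qed auto

lemma sh_zero: "f \<in> carrier B ==> sh (0\<^sub>v n) f = f"
  by (rule B_eqI) (auto simp: sh_app)

lemma B_mult_assoc: "f \<in> carrier B ==> g \<in> carrier B ==> h \<in> carrier B ==> f \<otimes>\<^sub>B g \<otimes>\<^sub>B h = f \<otimes>\<^sub>B (g \<otimes>\<^sub>B h)"
  by (rule B_eqI) (auto simp: B_app B_at K.m_assoc)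

lemma B_mult_one [simp]: "f \<in> carrier B ==> f \<otimes>\<^sub>B \<one>\<^sub>B = f" "f \<in> carrier B ==> \<one>\<^sub>B \<otimes>\<^sub>B f = f"
  by (rule B_eqI; auto simp: B_app B_at)+

lemma B_smult_mult:
  "c \<in> carrier K ==> f \<in> carrier B ==> g \<in> carrier B ==> (c \<odot>\<^sub>B f) \<otimes>\<^sub>B g = c \<odot>\<^sub>B (f \<otimes>\<^sub>B g)"
  "c \<in> carrier K ==> f \<in> carrier B ==> g \<in> carrier B ==> f \<otimes>\<^sub>B (c \<odot>\<^sub>B g) = c \<odot>\<^sub>B (f \<otimes>\<^sub>B g)"
  by (rule B_eqI; auto simp: B_app B_at K.m_ac)+

subsection \<open>Multiplication in the skew product\<close>

sublocale TS: tensor K A B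
  by (intro tensor.intro K.is_cring A_lmod B_lmod)

abbreviation "C \<equiv> skew_alg K n"
abbreviation C_mult (infixl "\<otimes>\<^sub>C" 70) where "x \<otimes>\<^sub>C y \<equiv> x \<otimes>\<^bsub>C\<^esub> y"
abbreviation C_add (infixl "\<oplus>\<^sub>C" 65) where "x \<oplus>\<^sub>C y \<equiv> x \<oplus>\<^bsub>C\<^esub> y"
abbreviation C_smult (infixr "\<odot>\<^sub>C" 70) where "a \<odot>\<^sub>C x \<equiv> a \<odot>\<^bsub>C\<^esub> x"
abbreviation C_diff (infixl "\<ominus>\<^sub>C" 65) where "x \<ominus>\<^sub>C y \<equiv> x \<ominus>\<^bsub>C\<^esub> y"
abbreviation C_zero ("\<zero>\<^sub>C") where "\<zero>\<^sub>C \<equiv> \<zero>\<^bsub>C\<^esub>"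
abbreviation C_one ("\<one>\<^sub>C") where "\<one>\<^sub>C \<equiv> \<one>\<^bsub>C\<^esub>"
abbreviation "st \<equiv> skew_tens K n"

lemma st_eq: "st = TS.t"
  by (simp add: skew_tens_def)

definition cS :: "(nat \<times> nat => nat) => 'k skew => int vec => 'k" where
  "cS = (SOME \<Gamma>. coords TS.T B exps (\<lambda>k y. TS.t (eA k) y) \<Gamma> \<and>
     (\<forall>k\<in>exps. \<forall>x\<in>carrier A. \<forall>y\<in>carrier B. \<Gamma> k (TS.t x y) = cK k x \<odot>\<^sub>B y))"

lemma cS: "coords TS.T B exps (\<lambda>k y. st (eA k) y) cS \<and>
     (\<forall>k\<in>exps. \<forall>x\<in>carrier A. \<forall>y\<in>carrier B. cS k (st x y) = cK k x \<odot>\<^sub>B y)"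
  using someI_ex[OF TS.coords_l[OF A_basis]] unfolding cS_def[symmetric] by (simp add: st_eq)

definition comp :: "int vec => 'k kos set" where "comp \<gamma> = kostant_component K n \<gamma>"

lemma comp_eq: "comp \<gamma> = add_span A {kt c (E k) | c k. c \<in> carrier K \<and> k \<in> exps \<and> dv k = \<gamma>}"
proof -
  have "{kt c (kostant_monomial n k) | c k. c \<in> carrier K \<and> k \<in> carrier_mat n n \<and> monomial_degree n k = \<gamma>}
      = {kt c (E k) | c k. c \<in> carrier K \<and> k \<in> exps \<and> dv k = \<gamma>}" (is "?L = ?R")
  proof (intro equalityI subsetI)
    fix x assume "x \<in> ?L"
    then obtain c M where "x = kt c (E (strict M))" "c \<in> carrier K" "dv (strict M) = \<gamma>"
      by (auto simp: kostant_monomial_E monomial_degree_dv)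
    then show "x \<in> ?R" using strict_exps by blast
  next
    fix x assume "x \<in> ?R"
    then obtain c k where x: "x = kt c (E k)" "c \<in> carrier K" "k \<in> exps" "dv k = \<gamma>" by auto
    have "x = kt c (kostant_monomial n (mat n n k))" "monomial_degree n (mat n n k) = \<gamma>"
      using x strict_mat[OF x(3)] by (simp_all add: kostant_monomial_E monomial_degree_dv)
    then show "x \<in> ?L" using x(2) by (intro CollectI exI[of _ c] exI[of _ "mat n n k"]) auto
  qed
  then show ?thesis by (simp add: comp_def kostant_component_def)
qed

lemma comp_set: "{kt c (E k) | c k. c \<in> carrier K \<and> k \<in> exps \<and> dv k = \<gamma>} \<subseteq> carrier A"
  by (auto simp: E_in_L)

lemma comp_subgroup: "additive_subgroup (comp \<gamma>) A"
  unfolding comp_eq by (rule A.add_span_subgroup[OF comp_set])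

lemma comp_closed: "a \<in> comp \<gamma> ==> a \<in> carrier A"
  using additive_subgroup.a_subset[OF comp_subgroup] by auto

lemma kt_comp: "c \<in> carrier K ==> k \<in> exps ==> kt c (E k) \<in> comp (dv k)"
  unfolding comp_eq by (rule A.add_span_incl) blast

lemma eA_comp: "k \<in> exps ==> eA k \<in> comp (dv k)"
  unfolding eA_def by (rule kt_comp) auto

text \<open>Homogeneity of products is read off from the degrees of the exponents in
  \<open>reach_prod\<close>.\<close>

lemma kt_E_mult_comp:
  assumes c: "c \<in> carrier K" and l: "l \<in> exps" and m: "m \<in> exps"
  shows "kt c (E l \<otimes>\<^sub>L E m) \<in> comp (dv l + dv m)"
proof -
  have S: "{E k | k. k \<in> reach_prod l m} \<subseteq> carrier U" by auto
  have exps: "reach_prod l m \<subseteq> exps" by (auto simp: reach_prod_def)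
  have L: "add_span U {E k | k. k \<in> reach_prod l m} \<subseteq> carrier L"
    unfolding L_simps(1) by (rule U.add_span_mono) (use exps in auto)
  have "kt c x \<in> comp (dv l + dv m) \<and> x \<in> carrier L" if "x \<in> add_span U {E k | k. k \<in> reach_prod l m}" for x
    using that S
  proof (induction rule: U.add_span_induct)
    case zero
    show ?case
      using additive_map_zero[OF kt_additive_r[OF c] L.ag A_group]
        subgroup_zero[OF comp_subgroup] subgroup_zero[OF L_subgroup] by (simp add: L_simps(4))
  next
    case (incl s)
    then obtain k where k: "s = E k" "k \<in> reach_prod l m" by auto
    have "dv k = dv l + dv m" by (rule eq_vecI) (use k(2) in \<open>auto simp: reach_prod_def dv_def\<close>)
    then show ?case using kt_comp[OF c, of k] k exps E_in_L by auto
  next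
    case (minus x)
    then show ?case
      using additive_map_minus[OF kt_additive_r[OF c] L.ag A_group, of x]
        subgroup_minus[OF comp_subgroup] subgroup_minus[OF L_subgroup] L_minus by auto
  next
    case (add x y)
    then show ?case
      using additive_map_add[OF kt_additive_r[OF c], of x y]
        subgroup_add[OF comp_subgroup] subgroup_add[OF L_subgroup] by (auto simp: L_simps(5))
  qed
  then show ?thesis using E_mult_span[OF l m] by (simp add: L_simps(2))
qed

lemma comp_mult:
  assumes "a \<in> comp \<gamma>" "a' \<in> comp \<gamma>'"
  shows "a \<otimes>\<^sub>A a' \<in> comp (\<gamma> + \<gamma>')"
proof -
  note sub = comp_subgroup[of "\<gamma> + \<gamma>'"]
  have ind: "h a \<in> comp \<delta>" if "a \<in> comp \<gamma>" "additive_map A A h"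
    "!!c k. c \<in> carrier K ==> k \<in> exps ==> dv k = \<gamma> ==> h (kt c (E k)) \<in> comp \<delta>" for h a \<gamma> \<delta>
    by (rule A.span_image[OF that(2) A_group comp_subgroup comp_set _ that(1)[unfolded comp_eq]]) (use that(3) in auto)
  show ?thesis
  proof (rule ind[OF assms(1) A_mult(2)[OF comp_closed[OF assms(2)]]])
    fix c k assume ck: "c \<in> carrier K" "k \<in> exps" "dv k = \<gamma>"
    show "kt c (E k) \<otimes>\<^sub>A a' \<in> comp (\<gamma> + \<gamma>')"
    proof (rule ind[OF assms(2) A_mult(1)])
      fix c' k' assume "c' \<in> carrier K" "k' \<in> exps" "dv k' = \<gamma>'"
      then show "kt c (E k) \<otimes>\<^sub>A kt c' (E k') \<in> comp (\<gamma> + \<gamma>')"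
        using ck kt_E_mult_comp[of "c \<otimes>\<^sub>K c'" k k'] by (simp add: A_mult(3) E_in_L)
    qed (use ck E_in_L in auto)
  qed
qed

lemma C_simps:
  "carrier C = carrier TS.T" "add C = add TS.T" "zero C = zero TS.T" "one C = st \<one>\<^sub>A \<one>\<^sub>B" "smult C = smult TS.T"
  "mult C = biadditive_product TS.T (\<lambda>x y z. \<exists>\<gamma>\<in>Psi n. \<exists>a\<in>carrier A. \<exists>a'\<in>comp \<gamma>.
             \<exists>b\<in>carrier B. \<exists>b'\<in>carrier B. x = st a b \<and> y = st a' b' \<and> z = st (a \<otimes>\<^sub>A a') (sh \<gamma> b \<otimes>\<^sub>B b'))"
  by (simp_all add: skew_alg_def Let_def comp_def st_eq)

lemma C_group: "abelian_group C"
  by (rule abelian_group_cong[OF TS.T.M.ag]) (simp_all add: C_simps)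

sublocale CG: abelian_group C by (rule C_group)

sublocale cS: coords C B exps "\<lambda>k y. st (eA k) y" cS
proof -
  interpret c: coords TS.T B exps "\<lambda>k y. st (eA k) y" cS using cS by blast
  show "coords C B exps (\<lambda>k y. st (eA k) y) cS"
  proof (intro coords.intro coords_axioms.intro C_group B_group)
    fix k assume k: "k \<in> exps"
    show "additive_map B C (st (eA k))"
      by (rule additive_map_cong[OF _ _ _ _ c.tau_additive[OF k]]) (simp_all add: C_simps)
    show "additive_map C B (cS k)"
      by (rule additive_map_cong[OF _ _ _ _ c.gam_additive[OF k]]) (simp_all add: C_simps)
    show "cS k (st (eA l) d) = (if k = l then d else \<zero>\<^sub>B)" if "l \<in> exps" "d \<in> carrier B" for l d
      using c.gam_tau k that by simp
  next
    fix x assume "x \<in> carrier C"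
    then have x: "x \<in> carrier TS.T" by (simp add: C_simps)
    show "finite {k \<in> exps. cS k x ~= \<zero>\<^sub>B}" by (rule c.gam_finite[OF x])
    show "x = fsum C (\<lambda>k. st (eA k) (cS k x)) exps"
      by (rule trans[OF c.expand[OF x] fsum_cong_record]) (simp_all add: C_simps)
  qed
qed

lemma cS_st: "k \<in> exps ==> x \<in> carrier A ==> y \<in> carrier B ==> cS k (st x y) = cK k x \<odot>\<^sub>B y"
  using cS by blast

lemma st_closed [simp]: "a \<in> carrier A ==> b \<in> carrier B ==> st a b \<in> carrier C"
  by (simp add: st_eq C_simps)

lemma st_additive_l: "b \<in> carrier B ==> additive_map A C (\<lambda>a. st a b)"
  using additive_map_cong[OF _ _ _ _ TS.tens_additive_l[of b], of A C] by (simp add: C_simps st_eq)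

lemma st_additive_r: "a \<in> carrier A ==> additive_map B C (st a)"
  using additive_map_cong[OF _ _ _ _ TS.tens_additive_r[of a], of B C] by (simp add: C_simps st_eq)

lemma st_smult: "c \<in> carrier K ==> a \<in> carrier A ==> b \<in> carrier B ==> st (c \<odot>\<^sub>A a) b = st a (c \<odot>\<^sub>B b)"
  by (simp add: st_eq TS.tens_smult_l TS.tens_smult_r)

lemma st_smult': "c \<in> carrier K ==> a \<in> carrier A ==> b \<in> carrier B ==> c \<odot>\<^sub>C st a b = st a (c \<odot>\<^sub>B b)"
  by (simp add: st_eq C_simps TS.tens_smult_r)

lemma kt_eA: "c \<in> carrier K ==> k \<in> exps ==> kt c (E k) = c \<odot>\<^sub>A eA k"
  by (simp add: eA_def kt_smult E_in_L)

lemma A_span: "carrier A \<subseteq> add_span A {kt c (E k) | c k. c \<in> carrier K \<and> k \<in> exps}"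
proof
  let ?X = "{kt c (E k) | c k. c \<in> carrier K \<and> k \<in> exps}"
  have X: "?X \<subseteq> carrier A" by (auto simp: E_in_L)
  have "add_span A ?X = add_span TK.T ?X"
    by (rule add_span_cong_record[OF A_group]) (use X in \<open>simp_all add: A_simps\<close>)
  moreover have "?X = {kt d (E k) | k d. k \<in> exps \<and> d \<in> carrier (int_module K)}" by auto
  ultimately show "x \<in> add_span A ?X" if "x \<in> carrier A" for x using cK.span that by (simp add: A_simps)
qed

text \<open>An element may lie in several components, as zero does, so consistency of the rule needs
  proof. The product is fixed on basis elements, for which the degree is unambiguous, and the rule
  is extended to all components by additivity.\<close>

lemma C_mult_ex:
  "\<exists>m. (\<forall>x\<in>carrier C. additive_map C C (m x)) \<and> (\<forall>y\<in>carrier C. additive_map C C (\<lambda>x. m x y)) \<and>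
    (\<forall>\<gamma>\<in>Psi n. \<forall>a\<in>carrier A. \<forall>a'\<in>comp \<gamma>. \<forall>b\<in>carrier B. \<forall>b'\<in>carrier B.
      m (st a b) (st a' b') = st (a \<otimes>\<^sub>A a') (sh \<gamma> b \<otimes>\<^sub>B b'))"
proof -
  have "\<exists>m. (\<forall>x\<in>carrier C. additive_map C C (m x)) \<and> (\<forall>y\<in>carrier C. additive_map C C (\<lambda>x. m x y)) \<and>
     (\<forall>k\<in>exps. \<forall>l\<in>exps. \<forall>d\<in>carrier B. \<forall>d'\<in>carrier B.
       m (st (eA k) d) (st (eA l) d') = st (eA k \<otimes>\<^sub>A eA l) (sh (dv l) d \<otimes>\<^sub>B d'))"
  proof (rule cS.bilinear_extension)
    fix k l d assume *: "k \<in> exps" "l \<in> exps" "d \<in> carrier B"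
    show "additive_map B C (\<lambda>d'. st (eA k \<otimes>\<^sub>A eA l) (sh (dv l) d \<otimes>\<^sub>B d'))"
      by (rule additive_map_comp[OF st_additive_r B_mult_additive(1)]) (use * in auto)
    show "additive_map B C (\<lambda>d'. st (eA k \<otimes>\<^sub>A eA l) (sh (dv l) d' \<otimes>\<^sub>B d))"
      by (rule additive_map_comp[OF st_additive_r additive_map_comp[OF B_mult_additive(2) sh_additive]]) (use * in auto)
  qed
  then obtain m where m: "!!x. x \<in> carrier C ==> additive_map C C (m x)"
    "!!y. y \<in> carrier C ==> additive_map C C (\<lambda>x. m x y)"
    "!!k l d d'. k \<in> exps ==> l \<in> exps ==> d \<in> carrier B ==> d' \<in> carrier B ==>
       m (st (eA k) d) (st (eA l) d') = st (eA k \<otimes>\<^sub>A eA l) (sh (dv l) d \<otimes>\<^sub>B d')"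
    by blast
  have "m (st a b) (st a' b') = st (a \<otimes>\<^sub>A a') (sh \<gamma> b \<otimes>\<^sub>B b')"
    if g: "\<gamma> \<in> Psi n" and a: "a \<in> carrier A" "a' \<in> comp \<gamma>" and b: "b \<in> carrier B" "b' \<in> carrier B" for \<gamma> a a' b b'
  proof -
    have gc: "\<gamma> \<in> Z" by (rule Psi_closed[OF g])
    have bb: "sh \<gamma> b \<otimes>\<^sub>B b' \<in> carrier B" using gc b by simp
    have step1: "m (st a b) (st a' b') = st (a \<otimes>\<^sub>A a') (sh \<gamma> b \<otimes>\<^sub>B b')"
      if a: "a = kt c (E k)" and c: "c \<in> carrier K" and k: "k \<in> exps" for a c k
    proof (rule A.additive_map_eq_span[OF additive_map_comp[OF m(1) st_additive_l]
          additive_map_comp[OF st_additive_l A_mult(1)] C_group comp_set[of \<gamma>] _ \<open>a' \<in> comp \<gamma>\<close>[unfolded comp_eq]])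
      fix s assume "s \<in> {kt c (E k) |c k. c \<in> carrier K \<and> k \<in> exps \<and> dv k = \<gamma>}"
      then obtain c' l where l: "s = kt c' (E l)" "c' \<in> carrier K" "l \<in> exps" "dv l = \<gamma>" by auto
      have "m (st a b) (st s b') = m (st (eA k) (c \<odot>\<^sub>B b)) (st (eA l) (c' \<odot>\<^sub>B b'))"
        using a c k l b by (simp add: kt_eA st_smult)
      also have "\<dots> = st (eA k \<otimes>\<^sub>A eA l) (c \<odot>\<^sub>B (c' \<odot>\<^sub>B (sh \<gamma> b \<otimes>\<^sub>B b')))"
        using c k l b gc by (simp add: m(3) sh_smult B_smult_mult B.smult_assoc[symmetric] K.m_comm)
      also have "\<dots> = st (a \<otimes>\<^sub>A s) (sh \<gamma> b \<otimes>\<^sub>B b')"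
        using a c k l bb by (simp add: kt_eA A_smult_mult st_smult)
      finally show "m (st a b) (st s b') = st (a \<otimes>\<^sub>A s) (sh \<gamma> b \<otimes>\<^sub>B b')" .
    qed (use a c k b bb E_in_L in auto)
    show ?thesis
      by (rule A.additive_map_eq_span[OF additive_map_comp[OF m(2) st_additive_l]
          additive_map_comp[OF st_additive_l A_mult(2)] C_group _ _ subsetD[OF A_span a(1)]])
        (use step1 a b bb comp_closed E_in_L in auto)
  qed
  then show ?thesis using m(1,2) by blast
qed

abbreviation "homog \<equiv> {st a b | a b \<gamma>. \<gamma> \<in> Psi n \<and> a \<in> comp \<gamma> \<and> b \<in> carrier B}"

lemma homog_closed: "homog \<subseteq> carrier C"
  using comp_closed by auto

lemma homog_span: "carrier C \<subseteq> add_span C homog"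
proof -
  have "{st (eA k) d | k d. k \<in> exps \<and> d \<in> carrier B} \<subseteq> homog" using eA_comp dv_Psi by blast
  then show ?thesis unfolding cS.span by (rule CG.add_span_mono) (rule homog_closed)
qed

lemma C_mult:
  shows "x \<in> carrier C ==> additive_map C C (\<lambda>y. x \<otimes>\<^sub>C y)"
    and "y \<in> carrier C ==> additive_map C C (\<lambda>x. x \<otimes>\<^sub>C y)"
    and "\<gamma> \<in> Psi n ==> a \<in> carrier A ==> a' \<in> comp \<gamma> ==> b \<in> carrier B ==> b' \<in> carrier B ==>
      st a b \<otimes>\<^sub>C st a' b' = st (a \<otimes>\<^sub>A a') (sh \<gamma> b \<otimes>\<^sub>B b')"
proof -
  obtain m where m: "!!x. x \<in> carrier C ==> additive_map C C (m x)"
    "!!y. y \<in> carrier C ==> additive_map C C (\<lambda>x. m x y)"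
    "!!\<gamma> a a' b b'. \<gamma> \<in> Psi n ==> a \<in> carrier A ==> a' \<in> comp \<gamma> ==> b \<in> carrier B ==> b' \<in> carrier B ==>
      m (st a b) (st a' b') = st (a \<otimes>\<^sub>A a') (sh \<gamma> b \<otimes>\<^sub>B b')"
    using C_mult_ex by blast
  let ?r = "\<lambda>x y z. \<exists>\<gamma>\<in>Psi n. \<exists>a\<in>carrier A. \<exists>a'\<in>comp \<gamma>.
             \<exists>b\<in>carrier B. \<exists>b'\<in>carrier B. x = st a b \<and> y = st a' b' \<and> z = st (a \<otimes>\<^sub>A a') (sh \<gamma> b \<otimes>\<^sub>B b')"
  have mm: "additive_map TS.T TS.T (m x)" "additive_map TS.T TS.T (\<lambda>y. m y x)" if "x \<in> carrier TS.T" for x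
    using m(1,2)[of x] that by (simp_all add: C_simps additive_map_def)
  have span: "carrier TS.T \<subseteq> add_span TS.T homog"
    using homog_span add_span_cong_record[OF C_group, of TS.T homog] homog_closed by (simp add: C_simps)
  have eq: "x \<otimes>\<^sub>C y = m x y" if "x \<in> carrier C" "y \<in> carrier C" for x y
    unfolding C_simps(6)
  proof (rule biadditive_product[OF TS.T.M.ag _ span _ span])
    show "homog \<subseteq> carrier TS.T" "homog \<subseteq> carrier TS.T" using homog_closed by (simp_all add: C_simps)
    show "\<exists>z. ?r x y z" if "x \<in> homog" "y \<in> homog" for x y
      using that comp_closed by blast
    show "x \<in> carrier TS.T \<and> y \<in> carrier TS.T \<and> m x y = z" if "?r x y z" for x y z
      using that st_closed comp_closed by (auto simp: m(3) C_simps)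
  qed (use that mm in \<open>auto simp: C_simps\<close>)
  have mc: "m x y \<in> carrier C" if "x \<in> carrier C" "y \<in> carrier C" for x y
    using additive_map_closed[OF m(1)] that by blast
  show "additive_map C C (\<lambda>y. x \<otimes>\<^sub>C y)" if "x \<in> carrier C"
    using m(1)[OF that] that CG.a_closed by (auto simp: additive_map_def eq)
  show "additive_map C C (\<lambda>x. x \<otimes>\<^sub>C y)" if "y \<in> carrier C"
    using m(2)[OF that] that CG.a_closed mc by (auto simp: additive_map_def eq)
  show "st a b \<otimes>\<^sub>C st a' b' = st (a \<otimes>\<^sub>A a') (sh \<gamma> b \<otimes>\<^sub>B b')"
    if "\<gamma> \<in> Psi n" "a \<in> carrier A" "a' \<in> comp \<gamma>" "b \<in> carrier B" "b' \<in> carrier B"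
    using that comp_closed by (simp add: eq m(3))
qed

lemma Psi_plus:
  assumes "\<gamma> \<in> Psi n" "\<gamma>' \<in> Psi n"
  shows "\<gamma> + \<gamma>' \<in> Psi n"
  using assms(2)
proof (induction \<gamma>' rule: Psi.induct)
  case Psi_zero
  then show ?case using Psi_closed[of \<gamma>] assms(1) by simp
next
  case (Psi_add \<gamma>' i)
  have "\<gamma> + (\<gamma>' + (unit_vec n i - unit_vec n (Suc i))) = \<gamma> + \<gamma>' + (unit_vec n i - unit_vec n (Suc i))"
    by (rule eq_vecI) (use Psi_closed[OF Psi_add(1)] Psi_closed[OF assms(1)] in auto)
  then show ?case using Psi.Psi_add[OF Psi_add(3,2)] by simp
qed

lemma zero_exps: "(\<lambda>_. 0) \<in> exps"
  by (simp add: exps_def)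

lemma eA_zero: "eA (\<lambda>_. 0) = \<one>\<^sub>A"
  by (simp add: eA_def A_simps E_zero L_simps)

lemma dv_zero: "dv (\<lambda>_. 0) = 0\<^sub>v n"
  by (rule eq_vecI) (simp_all add: dv_def wt_def irow_def icol_def)

lemma one_comp: "\<one>\<^sub>A \<in> comp (0\<^sub>v n)"
  using eA_comp[OF zero_exps] by (simp add: eA_zero dv_zero)

text \<open>On homogeneous elements associativity comes down to the cocycle-free identity that
  consecutive shifts add up and are multiplicative on functions.\<close>

lemma C_ring: "ring C"
proof (rule ring_from_span[OF C_group _ C_mult(1,2) _ homog_closed homog_span])
  show "x \<otimes>\<^sub>C y \<in> carrier C" if "x \<in> carrier C" "y \<in> carrier C" for x y
    using additive_map_closed[OF C_mult(1)] that by blast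
  show "\<one>\<^sub>C \<in> carrier C" unfolding C_simps(4) by simp
  fix x assume "x \<in> homog"
  then obtain a b \<gamma> where x: "x = st a b" "\<gamma> \<in> Psi n" "a \<in> comp \<gamma>" "b \<in> carrier B" by auto
  note gc = Psi_closed[OF x(2)] comp_closed[OF x(3)]
  show "\<one>\<^sub>C \<otimes>\<^sub>C x = x"
    unfolding C_simps(4) x(1) by (subst C_mult(3)[OF x(2) _ x(3)]) (use x gc in \<open>simp_all add: sh_one\<close>)
  show "x \<otimes>\<^sub>C \<one>\<^sub>C = x"
    unfolding C_simps(4) x(1) by (subst C_mult(3)[OF Psi_zero _ one_comp]) (use x gc in \<open>simp_all add: sh_zero\<close>)
  fix y z assume "y \<in> homog" "z \<in> homog"
  then obtain a' b' \<gamma>' a'' b'' \<gamma>'' where y: "y = st a' b'" "\<gamma>' \<in> Psi n" "a' \<in> comp \<gamma>'" "b' \<in> carrier B"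
    and z: "z = st a'' b''" "\<gamma>'' \<in> Psi n" "a'' \<in> comp \<gamma>''" "b'' \<in> carrier B" by blast
  note gc = gc Psi_closed[OF y(2)] comp_closed[OF y(3)] Psi_closed[OF z(2)] comp_closed[OF z(3)]
  have "x \<otimes>\<^sub>C y \<otimes>\<^sub>C z = st (a \<otimes>\<^sub>A a' \<otimes>\<^sub>A a'') (sh \<gamma>'' (sh \<gamma>' b \<otimes>\<^sub>B b') \<otimes>\<^sub>B b'')"
    unfolding x(1) y(1) z(1)
    by (subst C_mult(3)[OF y(2) _ y(3)], (use x y gc in simp_all)[3], subst C_mult(3)[OF z(2) _ z(3)], use x y z gc in simp_all)
  moreover have "x \<otimes>\<^sub>C (y \<otimes>\<^sub>C z) = st (a \<otimes>\<^sub>A (a' \<otimes>\<^sub>A a'')) (sh (\<gamma>' + \<gamma>'') b \<otimes>\<^sub>B (sh \<gamma>'' b' \<otimes>\<^sub>B b''))"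
    unfolding x(1) y(1) z(1)
    by (subst C_mult(3)[OF z(2) _ z(3)], (use x y z gc in simp_all)[3],
        subst C_mult(3)[OF Psi_plus[OF y(2) z(2)] _ comp_mult[OF y(3) z(3)]], use x y z gc in simp_all)
  ultimately show "x \<otimes>\<^sub>C y \<otimes>\<^sub>C z = x \<otimes>\<^sub>C (y \<otimes>\<^sub>C z)"
    using x y z gc by (simp add: A.m_assoc sh_mult sh_sh B_mult_assoc)
qed

sublocale C: ring C by (rule C_ring)

lemma C_lmod: "lmod K C"
  by (intro lmod.intro lmod_axioms.intro K.ring_axioms C_group)
    (simp_all add: C_simps TS.T.smult_l_distr TS.T.smult_r_distr TS.T.smult_assoc)

sublocale C: lmod K C by (rule C_lmod)

end

section \<open>How column sums and degrees behave under products of monomials\<close>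

subsection \<open>Row estimates\<close>

context kos
begin

lemma icol_nonneg: "icol q k \<ge> 0" and irow_nonneg: "irow q k \<ge> 0"
  by (simp_all add: icol_def irow_def sum_nonneg)

lemma exps_zero: "k \<in> exps ==> \<not> (i < j \<and> j < n) ==> k (i, j) = 0"
  unfolding exps_def by blast

lemma E_add_cols:
  assumes "!!x. a x ~= 0 ==> q < snd x" "!!x. b x ~= 0 ==> snd x \<le> q"
  shows "E a \<otimes>\<^sub>U E b = E (\<lambda>x. a x + b x)"
proof (rule E_add[of "\<lambda>x. q < snd x"])
  show "q < snd x" if "a x ~= 0" for x by (rule assms(1)[OF that])
  show "\<not> q < snd x" if "b x ~= 0" for x using assms(2)[OF that] by simp
qed auto

text \<open>If a factor (i, j) from a row before p precedes a factor (i', j') from a row from p on,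
  the order of the roots forces i < i' < j' < j, and such nested roots commute.\<close>

lemma E_add_rows:
  assumes "!!x. a x ~= 0 ==> p \<le> fst x" "!!x. b x ~= 0 ==> fst x < p"
  shows "E a \<otimes>\<^sub>U E b = E (\<lambda>x. a x + b x)"
proof (rule E_add[of "\<lambda>x. p \<le> fst x"])
  show "p \<le> fst x" if "a x ~= 0" for x by (rule assms(1)[OF that])
  show "\<not> p \<le> fst x" if "b x ~= 0" for x using assms(2)[OF that] by simp
  fix x y assume "root x" "root y" "\<not> p \<le> fst x" "p \<le> fst y" "snd y < snd x \<or> snd y = snd x \<and> fst y < fst x"
  then show "comm x y" by (auto simp: root_def comm_def)
qed

definition cols_gt :: "nat => (nat \<times> nat => nat) => nat \<times> nat => nat" where
  "cols_gt q k x = (if q < snd x then k x else 0)"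
definition cols_le :: "nat => (nat \<times> nat => nat) => nat \<times> nat => nat" where
  "cols_le q k x = (if snd x \<le> q then k x else 0)"

lemma cols_exps: "k \<in> exps ==> cols_gt q k \<in> exps" "k \<in> exps ==> cols_le q k \<in> exps"
  by (auto simp: exps_def cols_gt_def cols_le_def)

lemma E_cols: "E (cols_gt q k) \<otimes>\<^sub>U E (cols_le q k) = E k"
proof -
  have "(\<lambda>x. cols_gt q k x + cols_le q k x) = k" by (rule ext) (simp add: cols_gt_def cols_le_def)
  then show ?thesis
    using E_add_cols[of "cols_gt q k" q "cols_le q k"] by (simp add: cols_gt_def cols_le_def split: if_splits)
qed

text \<open>Entries of row q lie in columns after q, which have been removed.\<close>

lemma wt_cols_le:
  assumes "k \<in> exps"
  shows "wt (cols_le q k) q = - icol q k"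
proof -
  have "irow q (cols_le q k) = 0"
    unfolding irow_def by (rule sum.neutral) (simp add: cols_le_def exps_zero[OF assms])
  moreover have "icol q (cols_le q k) = icol q k" by (simp add: icol_def cols_le_def)
  ultimately show ?thesis by (simp add: wt_def)
qed

text \<open>Split \<open>E l\<close> after column q. The right part has degree
  \<open>- icol q l\<close> at q, so every term of its product with \<open>E m\<close> has degree
  \<open>wt m q - icol q l\<close> there; as row sums are nonnegative, its column sum is at least
  \<open>icol q l - wt m q\<close>. Multiplication by the left part does not lower column
  sums.\<close>

lemma gz_E_mult_col:
  assumes l: "l \<in> exps" and m: "m \<in> exps" and k: "k \<in> exps" and nz: "gz k (E l \<otimes>\<^sub>L E m) ~= 0"
  shows "icol q l - wt m q \<le> icol q k"
proof (rule ccontr)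
  assume c: "\<not> icol q l - wt m q \<le> icol q k"
  let ?a = "cols_gt q l" and ?b = "cols_le q l"
  let ?G = "{k \<in> exps. icol q l - wt m q \<le> icol q k}"
  have S: "{E k | k. P k} \<subseteq> carrier U" for P by auto
  note ab = cols_exps[OF l]
  have "E ?a \<otimes>\<^sub>U (E ?b \<otimes>\<^sub>U E m) \<in> add_span U {E k | k. k \<in> ?G}"
  proof (rule span_lmult[OF S E_mult_span[OF ab(2)[of q] m] _ U.add_span_subgroup[OF S]])
    fix t assume "t \<in> {E k | k. k \<in> reach_prod ?b m}"
    then obtain k' where k': "t = E k'" "k' \<in> reach_prod ?b m" by auto
    have "icol q l - wt m q = irow q k' - wt k' q - irow q k'"
      using k'(2) wt_cols_le[OF l, of q] by (simp add: reach_prod_def)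
    then have "icol q l - wt m q \<le> icol q k'" using irow_nonneg[of q k'] by (simp add: wt_def)
    have "reach_prod ?a k' \<subseteq> ?G"
    proof
      fix k'' assume k'': "k'' \<in> reach_prod ?a k'"
      then have "icol q k' \<le> icol q k''" "k'' \<in> exps" by (simp_all add: reach_prod_def)
      then show "k'' \<in> ?G" using \<open>icol q l - wt m q \<le> icol q k'\<close> by simp
    qed
    then have "add_span U {E k | k. k \<in> reach_prod ?a k'} \<subseteq> add_span U {E k | k. k \<in> ?G}"
      by (intro U.add_span_mono S) auto
    moreover have "k' \<in> exps" using k'(2) by (simp add: reach_prod_def)
    ultimately show "E ?a \<otimes>\<^sub>U t \<in> add_span U {E k | k. k \<in> ?G}"
      using E_mult_span[OF ab(1)] k'(1) by blast
  qed simp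
  then have "E l \<otimes>\<^sub>U E m \<in> add_span U {E k | k. k \<in> ?G}"
    using E_cols[of q l] by (simp add: U.m_assoc[symmetric])
  then have "gam k (E l \<otimes>\<^sub>U E m) = 0"
    by (rule gam_span_zero) (use k c in auto)
  then show False using nz by (simp add: gz_def L_simps)
qed

lemma sum_wt: "(\<Sum>q<n. wt k q) = 0"
  unfolding wt_def irow_def icol_def sum_subtractf by (subst sum.swap) simp

end

section \<open>The ideal in terms of supports, and the basis of the quotient\<close>

section \<open>Ideals of the skew product\<close>

locale kosKr = kosK n K for n :: nat and K :: "('k, 's) ring_scheme" + fixes r :: nat
begin

lemma tau_mult:
  assumes "l \<in> exps" "m \<in> exps" "b \<in> carrier B" "b' \<in> carrier B"
  shows "st (eA l) b \<otimes>\<^sub>C st (eA m) b' = st (eA l \<otimes>\<^sub>A eA m) (sh (dv m) b \<otimes>\<^sub>B b')"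
  by (rule C_mult(3)) (use assms dv_Psi eA_comp in auto)

lemma tau_mult_eq:
  assumes "l \<in> exps" "m \<in> exps" "b \<in> carrier B" "b' \<in> carrier B" "E l \<otimes>\<^sub>U E m = E k"
  shows "st (eA l) b \<otimes>\<^sub>C st (eA m) b' = st (eA k) (sh (dv m) b \<otimes>\<^sub>B b')"
proof -
  have "eA l \<otimes>\<^sub>A eA m = eA k" using assms by (simp add: eA_def A_mult(3) E_in_L L_simps(2))
  then show ?thesis using tau_mult[OF assms(1-4)] by simp
qed

text \<open>The coordinate is the product of an integer structure constant and two function values,
  so none of the three can vanish. There is no converse, as the integer may vanish in K.\<close>

lemma tau_mult_coord:
  assumes lm: "l \<in> exps" "m \<in> exps" and b: "b \<in> carrier B" "b' \<in> carrier B" and k: "k \<in> exps" and z: "z \<in> Z"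
    and nz: "cS k (st (eA l) b \<otimes>\<^sub>C st (eA m) b') z ~= \<zero>\<^sub>K"
  shows "gz k (E l \<otimes>\<^sub>L E m) ~= 0" "b (z + dv m) ~= \<zero>\<^sub>K" "b' z ~= \<zero>\<^sub>K"
proof -
  let ?N = "[gz k (E l \<otimes>\<^sub>L E m)] \<cdot>\<^bsub>K\<^esub> \<one>\<^sub>K"
  have "eA l \<otimes>\<^sub>A eA m = kt \<one>\<^sub>K (E l \<otimes>\<^sub>L E m)"
    using lm by (simp add: eA_def A_mult(3) E_in_L)
  then have "cK k (eA l \<otimes>\<^sub>A eA m) = ?N"
    using k lm by (simp add: cK_kt E_in_L)
  then have eq: "cS k (st (eA l) b \<otimes>\<^sub>C st (eA m) b') z = ?N \<otimes>\<^sub>K (b (z + dv m) \<otimes>\<^sub>K b' z)"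
    using tau_mult[OF lm b] lm k b z by (simp add: cS_st B_app sh_app)
  have N: "?N \<in> carrier K" by (simp add: K.add.int_pow_closed)
  have c: "b (z + dv m) \<in> carrier K" "b' z \<in> carrier K" using b z by (simp_all add: B_at)
  show "gz k (E l \<otimes>\<^sub>L E m) ~= 0"
  proof
    assume "gz k (E l \<otimes>\<^sub>L E m) = 0"
    then have "?N = \<zero>\<^sub>K" by (simp add: add_pow_def)
    then show False using nz eq c by simp
  qed
  show "b (z + dv m) ~= \<zero>\<^sub>K" "b' z ~= \<zero>\<^sub>K" using nz eq c N by auto
qed

definition tot :: "int vec => int" where "tot z = (\<Sum>i<n. z $ i)"

lemma tot_dv: "z \<in> Z ==> tot (z + dv m) = tot z"
proof -
  assume z: "z \<in> Z"
  have "tot (z + dv m) = (\<Sum>i<n. z $ i + wt m i)" unfolding tot_def by (rule sum.cong) (use z in \<open>auto simp: dv_def\<close>)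
  then show ?thesis using sum_wt[of m] by (simp add: tot_def sum.distrib)
qed

definition bad :: "nat set => (nat \<times> nat => nat) => int vec => bool" where
  "bad Q k z \<longleftrightarrow> tot z ~= int r \<or> (\<exists>q\<in>Q. q < n \<and> z $ q < icol q k)"

text \<open>\<open>J {p..<n}\<close> is the ideal \<open>J\<^sub>p\<close> of the overview and
  \<open>J {..<n}\<close> turns out to be the ideal generated by \<open>e_bar\<close>;
  \<open>J {}\<close> retains only the condition on the total.\<close>

definition J :: "nat set => 'k skew set" where
  "J Q = {x \<in> carrier C. \<forall>k\<in>exps. \<forall>z\<in>Z. cS k x z ~= \<zero>\<^sub>K --> bad Q k z}"

lemma cS_simps:
  "x \<in> carrier C ==> y \<in> carrier C ==> k \<in> exps ==> z \<in> Z ==> cS k (x \<oplus>\<^sub>C y) z = cS k x z \<oplus>\<^sub>K cS k y z"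
  "x \<in> carrier C ==> k \<in> exps ==> z \<in> Z ==> cS k (\<ominus>\<^bsub>C\<^esub> x) z = \<ominus>\<^bsub>K\<^esub> cS k x z"
  "k \<in> exps ==> z \<in> Z ==> cS k \<zero>\<^sub>C z = \<zero>\<^sub>K"
  "x \<in> carrier C ==> k \<in> exps ==> z \<in> Z ==> cS k x z \<in> carrier K"
proof -
  show add: "cS k (x \<oplus>\<^sub>C y) z = cS k x z \<oplus>\<^sub>K cS k y z"
    if "x \<in> carrier C" "y \<in> carrier C" "k \<in> exps" "z \<in> Z" for x y
    using that by (simp add: additive_map_add[OF cS.gam_additive] B_app)
  show "cS k x z \<in> carrier K" if "x \<in> carrier C" "k \<in> exps" "z \<in> Z"
    using cS.gam_closed[OF that(2,1)] that B_at by blast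
  show z: "cS k \<zero>\<^sub>C z = \<zero>\<^sub>K" if "k \<in> exps" "z \<in> Z"
    using that by (simp add: cS.gam_zero B_app)
  show "cS k (\<ominus>\<^bsub>C\<^esub> x) z = \<ominus>\<^bsub>K\<^esub> cS k x z" if "x \<in> carrier C" "k \<in> exps" "z \<in> Z"
  proof (rule K.minus_equality[symmetric])
    show "cS k (\<ominus>\<^bsub>C\<^esub> x) z \<oplus>\<^sub>K cS k x z = \<zero>\<^sub>K"
      using that add[of "\<ominus>\<^bsub>C\<^esub> x" x] z by (simp add: CG.l_neg)
    show "cS k x z \<in> carrier K" "cS k (\<ominus>\<^bsub>C\<^esub> x) z \<in> carrier K"
      using cS.gam_closed[OF that(2)] that B_at by simp_all
  qed
qed

lemma J_subgroup: "additive_subgroup (J Q) C"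
proof (rule CG.additive_subgroupI')
  fix x y assume x: "x \<in> J Q" and y: "y \<in> J Q"
  have "cS k x z ~= \<zero>\<^sub>K \<or> cS k y z ~= \<zero>\<^sub>K" if "k \<in> exps" "z \<in> Z" "cS k (x \<oplus>\<^sub>C y) z ~= \<zero>\<^sub>K" for k z
    using that x y by (auto simp: J_def cS_simps)
  then show "x \<oplus>\<^sub>C y \<in> J Q" using x y by (simp add: J_def) blast
next
  fix x assume x: "x \<in> J Q"
  then show "\<ominus>\<^bsub>C\<^esub> x \<in> J Q"
    using K.add.inv_eq_1_iff by (auto simp: J_def cS_simps)
qed (auto simp: J_def cS_simps)

lemma J_tau:
  assumes "k \<in> exps" "b \<in> carrier B" "!!z. z \<in> Z ==> b z ~= \<zero>\<^sub>K ==> bad Q k z"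
  shows "st (eA k) b \<in> J Q"
  using assms by (auto simp: J_def cS.gam_tau B_app split: if_splits)

lemma additive_map_in:
  assumes h: "additive_map C C h" and x: "x \<in> carrier C" and H: "additive_subgroup H C"
    and t: "!!k. k \<in> exps ==> h (st (eA k) (cS k x)) \<in> H"
  shows "h x \<in> H"
proof -
  have fin: "finite {k \<in> exps. st (eA k) (cS k x) ~= \<zero>\<^sub>C}"
    by (rule finite_subset[OF _ cS.gam_finite[OF x]]) (use cS.tau_zero in auto)
  have "h x = h (fsum C (\<lambda>k. st (eA k) (cS k x)) exps)"
    using cS.expand[OF x] by simp
  also have "\<dots> = fsum C (\<lambda>k. h (st (eA k) (cS k x))) exps"
    by (rule CG.fsum_additive[OF h C_group _ fin]) (use x in auto)
  also have "\<dots> \<in> H" by (rule CG.fsum_in_subgroup[OF H t])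
  finally show ?thesis .
qed

text \<open>A pair that is bad for the right factor stays bad since column sums do not drop. For the
  left factor the weight is read at \<open>z + dv m\<close>, and \<open>gz_E_mult_col\<close> says
  that the column sum grows enough to compensate the shift.\<close>

lemma J_mult:
  assumes x: "x \<in> carrier C" and y: "y \<in> carrier C"
    and xy: "x \<in> J Q \<or> y \<in> J Q"
  shows "x \<otimes>\<^sub>C y \<in> J Q"
proof (rule additive_map_in[OF C_mult(1)[OF x] y J_subgroup])
  fix m assume m: "m \<in> exps"
  show "x \<otimes>\<^sub>C st (eA m) (cS m y) \<in> J Q"
  proof (rule additive_map_in[OF C_mult(2) x J_subgroup])
    fix l assume l: "l \<in> exps"
    have c: "cS l x \<in> carrier B" "cS m y \<in> carrier B" using l m x y by simp_all
    have "bad Q k z" if k: "k \<in> exps" and z: "z \<in> Z"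
      and nz: "cS k (st (eA l) (cS l x) \<otimes>\<^sub>C st (eA m) (cS m y)) z ~= \<zero>\<^sub>K" for k z
    proof -
      note nz = tau_mult_coord[OF l m c k z nz]
      note rp = gz_E_mult[OF l m k nz(1)] and col = gz_E_mult_col[OF l m k nz(1)]
      have zd: "z + dv m \<in> Z" using z by simp
      show ?thesis
      proof (cases "x \<in> J Q")
        case True
        then have "bad Q l (z + dv m)" using nz(2) l zd by (simp add: J_def)
        then consider "tot z ~= int r" | q where "q \<in> Q" "q < n" "z $ q + wt m q < icol q l"
          unfolding bad_def tot_dv[OF z] by (auto simp: dv_def)
        then show ?thesis
        proof cases
          case (2 q)
          have "z $ q < icol q k" using col[of q] 2(3) by linarith
          then show ?thesis using 2(1,2) unfolding bad_def by blast
        qed (simp add: bad_def)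
      next
        case False
        then have "y \<in> J Q" using xy by simp
        then have "bad Q m z" using nz(3) m z by (simp add: J_def)
        moreover have "icol q m \<le> icol q k" for q using rp by (simp add: reach_prod_def)
        ultimately show ?thesis unfolding bad_def by (meson order_less_le_trans)
      qed
    qed
    then show "st (eA l) (cS l x) \<otimes>\<^sub>C st (eA m) (cS m y) \<in> J Q"
      using l m c by (simp add: J_def)
  qed (use m y in simp)
qed

lemma J_carrier: "x \<in> J Q ==> x \<in> carrier C"
  by (simp add: J_def)

lemma J_ideal: "ideal (J Q) C"
proof (rule idealI[OF C_ring])
  show "subgroup (J Q) (add_monoid C)" using J_subgroup by (simp add: additive_subgroup_def)
  fix a x assume "a \<in> J Q" "x \<in> carrier C"
  then show "x \<otimes>\<^sub>C a \<in> J Q" "a \<otimes>\<^sub>C x \<in> J Q" by (simp_all add: J_mult J_carrier)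
qed

definition ind :: "int vec set => int vec => 'k" where "ind = indicator_fun K n"

lemma ind_closed [simp]: "ind S \<in> carrier B"
  by (auto simp: ind_def indicator_fun_def B_simps)

lemma ind_app: "z \<in> Z ==> ind S z = (if z \<in> S then \<one>\<^sub>K else \<zero>\<^sub>K)"
  by (simp add: ind_def indicator_fun_def)

abbreviation "W0 \<equiv> weights n r"
abbreviation "ebar \<equiv> e_bar K n r"
abbreviation "I0 \<equiv> e_bar_ideal K n r"

lemma weights_iff: "z \<in> W0 \<longleftrightarrow> z \<in> Z \<and> tot z = int r \<and> (\<forall>q<n. 0 \<le> z $ q)"
  by (auto simp: weights_def tot_def)

lemma ebar_eq: "ebar = st (eA (\<lambda>_. 0)) (ind (- W0))"
proof -
  have "\<one>\<^sub>B = ind (- W0) \<oplus>\<^sub>B ind W0"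
    by (rule B_eqI) (auto simp: B_app ind_app)
  then have "\<one>\<^sub>C = st \<one>\<^sub>A (ind (- W0)) \<oplus>\<^sub>C st \<one>\<^sub>A (ind W0)"
    unfolding C_simps(4) by (metis A.one_closed additive_map_add ind_closed st_additive_r)
  then show ?thesis
    unfolding e_bar_def ind_def[symmetric] eA_zero by (simp add: CG.add_diff_cancel)
qed

lemma ebar_closed: "ebar \<in> carrier C"
  unfolding ebar_eq by (rule st_closed) (simp_all add: zero_exps)

lemma ebar_J: "ebar \<in> J {..<n}"
  unfolding ebar_eq
proof (rule J_tau[OF zero_exps ind_closed])
  fix z assume "z \<in> Z" "ind (- W0) z ~= \<zero>\<^sub>K"
  then have "z \<notin> W0" by (auto simp: ind_app split: if_splits)
  then show "bad {..<n} (\<lambda>_. 0) z" using \<open>z \<in> Z\<close> by (auto simp: bad_def weights_iff icol_def not_le)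
qed

lemma I0_gen: "{x \<otimes>\<^sub>C ebar \<otimes>\<^sub>C y | x y. x \<in> carrier C \<and> y \<in> carrier C} \<subseteq> carrier C"
  using ebar_closed by auto

lemma I0_subgroup: "additive_subgroup I0 C"
  unfolding e_bar_ideal_def by (rule CG.add_span_subgroup[OF I0_gen])

lemma I0_mem: "x \<in> carrier C ==> y \<in> carrier C ==> x \<otimes>\<^sub>C ebar \<otimes>\<^sub>C y \<in> I0"
  unfolding e_bar_ideal_def by (rule CG.add_span_incl) blast

text \<open>Insert \<open>ebar\<close> between \<open>E a\<close> and \<open>E b\<close>: the weight
  between the two factors is \<open>z + dv b\<close>, which lies outside the set of weights, so
  \<open>ebar\<close> acts there as the identity.\<close>

lemma I0_tau:
  assumes a: "a \<in> exps" and b: "b \<in> exps" and E: "E a \<otimes>\<^sub>U E b = E k" and g: "g \<in> carrier B"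
    and supp: "!!z. z \<in> Z ==> g z ~= \<zero>\<^sub>K ==> z + dv b \<notin> W0"
  shows "st (eA k) g \<in> I0"
proof -
  have "E a \<otimes>\<^sub>U E (\<lambda>_. 0) = E a" by (simp add: E_zero)
  then have 1: "st (eA a) \<one>\<^sub>B \<otimes>\<^sub>C ebar = st (eA a) (ind (- W0))"
    unfolding ebar_eq using a zero_exps by (subst tau_mult_eq[where k = a]) (simp_all add: dv_zero sh_zero)
  have 2: "sh (dv b) (ind (- W0)) \<otimes>\<^sub>B g = g"
  proof (rule B_eqI)
    fix z assume "z \<in> Z"
    then show "(sh (dv b) (ind (- W0)) \<otimes>\<^sub>B g) z = g z"
      using supp[of z] B_at[OF g, of z] by (cases "g z = \<zero>\<^sub>K") (auto simp: B_app sh_app ind_app)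
  qed (use g in auto)
  have "st (eA a) \<one>\<^sub>B \<otimes>\<^sub>C ebar \<otimes>\<^sub>C st (eA b) g = st (eA k) g"
    unfolding 1 tau_mult_eq[OF a b ind_closed g E] 2 ..
  then show ?thesis using I0_mem[of "st (eA a) \<one>\<^sub>B" "st (eA b) g"] a b g by simp
qed

text \<open>The function is cut into pieces, one for each possible bad column. If q is bad, the
  monomial is split after column q; between the two parts the entry of the weight at q is
  \<open>z $ q - icol q k\<close>, which is negative, and \<open>I0_tau\<close> applies. With no
  column left, the total itself is wrong.\<close>

lemma J_tau_I0:
  assumes k: "k \<in> exps"
  shows "finite Q ==> Q \<subseteq> {..<n} ==> g \<in> carrier B ==> (!!z. z \<in> Z ==> g z ~= \<zero>\<^sub>K ==> bad Q k z) ==> st (eA k) g \<in> I0"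
proof (induction Q arbitrary: g rule: finite_induct)
  case empty
  show ?case
  proof (rule I0_tau[OF k zero_exps])
    show "z + dv (\<lambda>_. 0) \<notin> W0" if "z \<in> Z" "g z ~= \<zero>\<^sub>K" for z
      using empty(3)[OF that] that by (simp add: bad_def weights_iff dv_zero)
  qed (use empty in \<open>simp_all add: E_zero\<close>)
next
  case (insert q Q)
  let ?S = "{z. z $ q < icol q k}"
  have q: "q < n" using insert.prems by simp
  have g: "g = ind ?S \<otimes>\<^sub>B g \<oplus>\<^sub>B ind (- ?S) \<otimes>\<^sub>B g"
    by (rule B_eqI) (use insert.prems(2) in \<open>auto simp: B_app ind_app B_at\<close>)
  have nz: "z \<in> S \<and> g z ~= \<zero>\<^sub>K" if "z \<in> Z" "(ind S \<otimes>\<^sub>B g) z ~= \<zero>\<^sub>K" for z S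
    using that insert.prems(2) by (auto simp: B_app ind_app B_at split: if_splits)
  have 1: "st (eA k) (ind ?S \<otimes>\<^sub>B g) \<in> I0"
  proof (rule I0_tau[OF cols_exps[OF k] E_cols])
    fix z assume z: "z \<in> Z" "(ind ?S \<otimes>\<^sub>B g) z ~= \<zero>\<^sub>K"
    have "(z + dv (cols_le q k)) $ q < 0"
      using nz[OF z] z(1) q wt_cols_le[OF k, of q] by (simp add: dv_def)
    then have "\<not> 0 \<le> (z + dv (cols_le q k)) $ q" by simp
    then show "z + dv (cols_le q k) \<notin> W0" using q unfolding weights_iff by blast
  qed (use insert.prems in simp)
  have 2: "st (eA k) (ind (- ?S) \<otimes>\<^sub>B g) \<in> I0"
  proof (rule insert.IH)
    fix z assume z: "z \<in> Z" "(ind (- ?S) \<otimes>\<^sub>B g) z ~= \<zero>\<^sub>K"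
    then show "bad Q k z" using nz[OF z] insert.prems(3)[OF z(1)] by (auto simp: bad_def)
  qed (use insert.prems in auto)
  have "st (eA k) g = st (eA k) (ind ?S \<otimes>\<^sub>B g) \<oplus>\<^sub>C st (eA k) (ind (- ?S) \<otimes>\<^sub>B g)"
    by (subst g, subst additive_map_add[OF st_additive_r]) (use k insert.prems(2) in simp_all)
  then show ?case using 1 2 subgroup_add[OF I0_subgroup] by simp
qed

lemma I0_eq: "I0 = J {..<n}"
proof
  show "I0 \<subseteq> J {..<n}"
    unfolding e_bar_ideal_def
    by (rule CG.add_span_least[OF J_subgroup]) (use J_mult ebar_J ebar_closed in auto)
  show "J {..<n} \<subseteq> I0"
  proof
    fix x assume x: "x \<in> J {..<n}"
    show "x \<in> I0"
    proof (rule cS.in_subgroupI[OF I0_subgroup J_carrier[OF x]])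
      fix k assume k: "k \<in> exps"
      show "st (eA k) (cS k x) \<in> I0"
      proof (rule J_tau_I0[OF k, of "{..<n}"])
        show "cS k x \<in> carrier B" using k J_carrier[OF x] by simp
        show "bad {..<n} k z" if "z \<in> Z" "cS k x z ~= \<zero>\<^sub>K" for z using x k that by (simp add: J_def)
      qed simp_all
    qed
  qed
qed

lemma C_smult_mult:
  assumes "c \<in> carrier K" "x \<in> carrier C"
  shows "c \<odot>\<^sub>C x = st \<one>\<^sub>A (c \<odot>\<^sub>B \<one>\<^sub>B) \<otimes>\<^sub>C x"
proof (rule CG.additive_map_eq_span[OF C.smult_additive[OF assms(1)] C_mult(1) C_group homog_closed _ subsetD[OF homog_span assms(2)]])
  show "st \<one>\<^sub>A (c \<odot>\<^sub>B \<one>\<^sub>B) \<in> carrier C" using assms by simp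
  fix s assume "s \<in> homog"
  then obtain a b \<gamma> where s: "s = st a b" "\<gamma> \<in> Psi n" "a \<in> comp \<gamma>" "b \<in> carrier B" by auto
  have "st \<one>\<^sub>A (c \<odot>\<^sub>B \<one>\<^sub>B) \<otimes>\<^sub>C s = st a (c \<odot>\<^sub>B b)"
    unfolding s(1) using assms s comp_closed[OF s(3)] Psi_closed[OF s(2)]
    by (subst C_mult(3)[OF s(2) _ s(3)]) (simp_all add: sh_smult sh_one B_smult_mult)
  then show "c \<odot>\<^sub>C s = st \<one>\<^sub>A (c \<odot>\<^sub>B \<one>\<^sub>B) \<otimes>\<^sub>C s"
    using assms s comp_closed by (simp add: st_smult')
qed

lemma cS_smult:
  assumes "c \<in> carrier K" "x \<in> carrier C" "k \<in> exps" "z \<in> Z"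
  shows "cS k (c \<odot>\<^sub>C x) z = c \<otimes>\<^sub>K cS k x z"
proof -
  have "cS k (c \<odot>\<^sub>C x) = c \<odot>\<^sub>B cS k x"
  proof (rule CG.additive_map_eq_span[OF additive_map_comp[OF cS.gam_additive[OF assms(3)] C.smult_additive[OF assms(1)]]
        additive_map_comp[OF B.smult_additive[OF assms(1)] cS.gam_additive[OF assms(3)]] B_group _ _ assms(2)[unfolded cS.span]])
    fix s assume "s \<in> {st (eA k) d |k d. k \<in> exps \<and> d \<in> carrier B}"
    then show "cS k (c \<odot>\<^sub>C s) = c \<odot>\<^sub>B cS k s"
      using assms by (auto simp: st_smult' cS.gam_tau)
  qed auto
  then show ?thesis using assms by (simp add: B_app)
qed

sublocale Cq: submod K C "J {..<n}"
proof (rule submodI[OF C_lmod J_subgroup])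
  fix c x assume "c \<in> carrier K" "x \<in> J {..<n}"
  then show "c \<odot>\<^sub>C x \<in> J {..<n}"
    using J_mult[of "st \<one>\<^sub>A (c \<odot>\<^sub>B \<one>\<^sub>B)" x "{..<n}"] J_carrier by (simp add: C_smult_mult)
qed

subsection \<open>The basis of the quotient\<close>

text \<open>The pairs that index the basis. The inequality says that k can be completed by
  nonnegative diagonal entries to a triangular matrix with column sums z.\<close>

definition good :: "((nat \<times> nat => nat) \<times> int vec) set" where
  "good = {(k, z). k \<in> exps \<and> z \<in> W0 \<and> (\<forall>q<n. icol q k \<le> z $ q)}"

lemma good_iff: "k \<in> exps ==> z \<in> Z ==> (k, z) \<in> good \<longleftrightarrow> \<not> bad {..<n} k z"
  using order_trans[OF icol_nonneg, of _ k] unfolding good_def bad_def weights_iff not_less[symmetric]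
  by (auto simp: not_less)

definition jj :: "(nat \<times> nat => nat) \<times> int vec => 'k skew" where "jj = (\<lambda>(k, z). st (eA k) (ind {z}))"

lemma tri_mats_strict:
  assumes M: "M \<in> tri_mats n \<nu> z" and z: "z \<in> W0"
  shows "(strict M, z) \<in> good"
proof -
  have "icol q (strict M) \<le> z $ q" if q: "q < n" for q
  proof -
    have "icol q (strict M) = (\<Sum>a<q. int (M $$ (a, q)))"
      unfolding icol_def by (rule sum.mono_neutral_cong_right) (use q in \<open>auto simp: strict_def\<close>)
    also have "\<dots> \<le> (\<Sum>a\<le>q. int (M $$ (a, q)))" by (rule sum_mono2) auto
    also have "\<dots> = z $ q" using M q by (simp add: tri_mats_def)
    finally show ?thesis .
  qed
  then show ?thesis using z strict_exps by (simp add: good_def)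
qed

lemma good_tri_mats:
  assumes "(k, z) \<in> good"
  shows "\<exists>M \<nu>. strict M = k \<and> \<nu> \<in> W0 \<and> dominates n \<nu> z \<and> M \<in> tri_mats n \<nu> z"
proof -
  have k: "k \<in> exps" and z: "z \<in> W0" and le: "!!q. q < n ==> icol q k \<le> z $ q"
    using assms by (auto simp: good_def)
  \<comment> \<open>The diagonal is forced by the column sums z; its entries are nonnegative because
    the pair is good, so \<open>nat\<close> loses nothing.\<close>
  define M where "M = mat n n (\<lambda>(a, b). if a < b then k (a, b) else if a = b then nat (z $ b - icol b k) else 0)"
  define \<nu> where "\<nu> = vec n (\<lambda>a. \<Sum>b<n. int (M $$ (a, b)))"
  have M0: "M $$ (a, b) = 0" if "b < a" "a < n" for a b using that by (simp add: M_def)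
  have strict: "strict M = k"
  proof (rule ext, clarify)
    fix a b show "strict M (a, b) = k (a, b)"
      using k by (cases "a < b \<and> b < n") (auto simp: strict_def M_def exps_def)
  qed
  have col: "(\<Sum>a<n. int (M $$ (a, b))) = z $ b" if b: "b < n" for b
  proof -
    have "(\<Sum>a<n. int (M $$ (a, b))) = (\<Sum>a<n. int (k (a, b)) + (if a = b then z $ b - icol b k else 0))"
    proof (rule sum.cong)
      fix a assume "a \<in> {..<n}"
      then show "int (M $$ (a, b)) = int (k (a, b)) + (if a = b then z $ b - icol b k else 0)"
        using le[OF b] b k by (auto simp: M_def exps_def)
    qed simp
    also have "\<dots> = z $ b" using b by (simp add: sum.distrib icol_def)
    finally show ?thesis .
  qed
  have "tot \<nu> = (\<Sum>b<n. \<Sum>a<n. int (M $$ (a, b)))"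
    unfolding tot_def by (subst sum.swap) (simp add: \<nu>_def)
  also have "\<dots> = int r" using z col by (simp add: weights_iff tot_def)
  finally have nu: "\<nu> \<in> W0" by (auto simp: weights_iff \<nu>_def sum_nonneg)
  have "M \<in> tri_mats n \<nu> z"
  proof -
    have "(\<Sum>b=a..<n. int (M $$ (a, b))) = \<nu> $ a" if "a < n" for a
      using that by (simp add: \<nu>_def) (rule sum.mono_neutral_left, auto simp: M0)
    moreover have "(\<Sum>a\<le>b. int (M $$ (a, b))) = z $ b" if "b < n" for b
      unfolding col[OF that, symmetric] by (rule sum.mono_neutral_left) (use that in \<open>auto simp: M0\<close>)
    ultimately show ?thesis by (auto simp: tri_mats_def M_def upper_triangular_def)
  qed
  moreover have "dominates n \<nu> z"
    unfolding dominates_def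
  proof (intro allI impI)
    fix j assume j: "j < n"
    \<comment> \<open>By triangularity the columns up to j have entries only in rows up to j.
      Extending these rows to all columns turns the sum into one of row sums, which can only
      increase it.\<close>
    have "(\<Sum>b\<le>j. z $ b) = (\<Sum>b\<le>j. \<Sum>a<n. int (M $$ (a, b)))"
      using j col by (intro sum.cong) auto
    also have "\<dots> = (\<Sum>b\<le>j. \<Sum>a\<le>j. int (M $$ (a, b)))"
      using j by (intro sum.cong refl sum.mono_neutral_right) (auto simp: M0)
    also have "\<dots> = (\<Sum>a\<le>j. \<Sum>b\<le>j. int (M $$ (a, b)))" by (rule sum.swap)
    also have "\<dots> \<le> (\<Sum>a\<le>j. \<Sum>b<n. int (M $$ (a, b)))"
      using j by (intro sum_mono sum_mono2) auto
    also have "\<dots> = (\<Sum>a\<le>j. \<nu> $ a)" using j by (intro sum.cong) (auto simp: \<nu>_def)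
    finally show "(\<Sum>i\<le>j. z $ i) \<le> (\<Sum>i\<le>j. \<nu> $ i)" .
  qed
  ultimately show ?thesis using strict nu by blast
qed

lemma JJ_eq: "JJ K n r = jj ` good"
proof (intro equalityI subsetI)
  fix x assume "x \<in> JJ K n r"
  then obtain M \<nu> z where "x = st (kt \<one>\<^sub>K (kostant_monomial n M)) (indicator_fun K n {z})" "z \<in> W0" "M \<in> tri_mats n \<nu> z"
    unfolding JJ_def by blast
  then show "x \<in> jj ` good"
    using tri_mats_strict by (intro image_eqI[of _ _ "(strict M, z)"]) (auto simp: jj_def ind_def eA_def kostant_monomial_E)
next
  fix x assume "x \<in> jj ` good"
  then obtain k z where x: "x = st (eA k) (ind {z})" "(k, z) \<in> good" by (auto simp: jj_def)
  from good_tri_mats[OF x(2)] obtain M \<nu> where "strict M = k" "\<nu> \<in> W0" "dominates n \<nu> z" "M \<in> tri_mats n \<nu> z" by blast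
  then show "x \<in> JJ K n r"
    unfolding JJ_def using x by (intro CollectI exI[of _ M] exI[of _ \<nu>] exI[of _ z])
      (auto simp: eA_def ind_def kostant_monomial_E good_def)
qed

text \<open>A function on all weights is not a finite combination of indicator functions. Modulo the
  ideal only these finitely many weights survive, which makes the coefficients finitely
  supported.\<close>

lemma finite_weights: "finite W0"
proof -
  have "W0 \<subseteq> vec_of_list ` {xs. set xs \<subseteq> {0..int r} \<and> length xs = n}"
  proof
    fix z assume z: "z \<in> W0"
    have "z $ i \<le> int r" if "i < n" for i
      using z that member_le_sum[of i "{..<n}" "\<lambda>i. z $ i"] by (auto simp: weights_iff tot_def)
    then have "set (list_of_vec z) \<subseteq> {0..int r}"
      using z by (auto simp: weights_iff set_list_of_vec vec_set_def)
    then show "z \<in> vec_of_list ` {xs. set xs \<subseteq> {0..int r} \<and> length xs = n}"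
      using z by (intro image_eqI[of _ _ "list_of_vec z"]) (auto simp: weights_iff vec_list)
  qed
  then show ?thesis by (rule finite_subset) (intro finite_imageI finite_lists_length_eq, simp)
qed

lemma cS_jj:
  assumes "(k, z) \<in> good" "(l, w) \<in> good"
  shows "cS k (jj (l, w)) z = (if (k, z) = (l, w) then \<one>\<^sub>K else \<zero>\<^sub>K)"
  using assms by (auto simp: good_def jj_def cS.gam_tau B_app ind_app weights_iff)

lemma jj_closed: "p \<in> good ==> jj p \<in> carrier C"
  by (auto simp: jj_def good_def)

lemma coset_eq_good:
  assumes "x \<in> carrier C" "y \<in> carrier C"
  shows "J {..<n} +>\<^bsub>C\<^esub> x = J {..<n} +>\<^bsub>C\<^esub> y \<longleftrightarrow> (\<forall>(k, z)\<in>good. cS k x z = cS k y z)"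
proof -
  have d: "cS k (x \<ominus>\<^sub>C y) z = cS k x z \<ominus>\<^bsub>K\<^esub> cS k y z" if "k \<in> exps" "z \<in> Z" for k z
    using assms that by (simp add: a_minus_def cS_simps)
  have "x \<ominus>\<^sub>C y \<in> J {..<n} \<longleftrightarrow> (\<forall>k\<in>exps. \<forall>z\<in>Z. \<not> bad {..<n} k z --> cS k x z = cS k y z)"
  proof -
    have "cS k (x \<ominus>\<^sub>C y) z = \<zero>\<^sub>K \<longleftrightarrow> cS k x z = cS k y z" if "k \<in> exps" "z \<in> Z" for k z
      using assms that by (simp add: d K.diff_eq_zero_iff cS_simps)
    moreover have "x \<ominus>\<^sub>C y \<in> carrier C" using assms by (rule CG.minus_closed)
    ultimately show ?thesis unfolding J_def by blast
  qed
  also have "\<dots> \<longleftrightarrow> (\<forall>(k, z)\<in>good. cS k x z = cS k y z)"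
  proof -
    have "k \<in> exps \<and> z \<in> Z" if "(k, z) \<in> good" for k z using that by (auto simp: good_def weights_iff)
    then show ?thesis using good_iff by blast
  qed
  finally show ?thesis using Cq.coset_eq_iff[OF assms] by simp
qed

text \<open>By \<open>coset_eq_good\<close> the values \<open>cS k x z\<close> at good pairs are
  coordinates of the coset of x, and \<open>cS_jj\<close> says that the classes of the
  \<open>jj (k, z)\<close> are dual to them.\<close>

theorem basis:
  assumes "\<one>\<^sub>K ~= \<zero>\<^sub>K"
  shows "is_basis K (quot_module C I0) (\<lambda>x. I0 +>\<^bsub>C\<^esub> x) (JJ K n r)"
proof -
  interpret Q: lmod K Cq.Q by (rule Cq.quot_lmod)
  let ?f = "\<lambda>x. J {..<n} +>\<^bsub>C\<^esub> x"
  have inj: "p = p'" if "p \<in> good" "p' \<in> good" "jj p = jj p'" for p p'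
    using cS_jj[of "fst p" "snd p" "fst p" "snd p"] cS_jj[of "fst p" "snd p" "fst p'" "snd p'"] that assms
    by (auto split: if_splits)
  have lin: "lincomb K Cq.Q ?f c = ?f (finsum C (\<lambda>b. c b \<odot>\<^sub>C b) {b. c b ~= \<zero>\<^sub>K})
      \<and> finsum C (\<lambda>b. c b \<odot>\<^sub>C b) {b. c b ~= \<zero>\<^sub>K} \<in> carrier C
      \<and> (\<forall>(k, z)\<in>good. cS k (finsum C (\<lambda>b. c b \<odot>\<^sub>C b) {b. c b ~= \<zero>\<^sub>K}) z = c (jj (k, z)))"
    if c: "c \<in> carrier (free_module K (JJ K n r))" for c
  proof (intro conjI ballI, goal_cases)
    case 1
    have b: "c b \<in> carrier K" "b \<in> carrier C" if "c b ~= \<zero>\<^sub>K" for b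
      using free_moduleD[OF c] that jj_closed unfolding JJ_eq by blast+
    have "lincomb K Cq.Q ?f c = finsum Cq.Q (\<lambda>b. ?f (c b \<odot>\<^sub>C b)) {b. c b ~= \<zero>\<^sub>K}"
      unfolding lincomb_def by (rule Q.M.finsum_cong') (use b in \<open>auto simp: Cq.coset_smult\<close>)
    also have "\<dots> = ?f (finsum C (\<lambda>b. c b \<odot>\<^sub>C b) {b. c b ~= \<zero>\<^sub>K})"
      by (rule CG.finsum_additive[OF Cq.coset_additive Q.M.ag, symmetric]) (use b in auto)
    finally show ?case .
  next
    case 2
    have b: "c b \<in> carrier K" "b \<in> carrier C" if "c b ~= \<zero>\<^sub>K" for b
      using free_moduleD[OF c] that jj_closed unfolding JJ_eq by blast+
    then show ?case by (intro CG.finsum_closed) auto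
  next
    case (3 p)
    obtain k z where p: "p = (k, z)" by (cases p)
    have kz: "(k, z) \<in> good" "k \<in> exps" "z \<in> Z" using 3 p by (auto simp: good_def weights_iff)
    have b: "c b \<in> carrier K" "b \<in> carrier C" "\<exists>p\<in>good. b = jj p" if "c b ~= \<zero>\<^sub>K" for b
      using free_moduleD[OF c] that jj_closed unfolding JJ_eq by blast+
    have add: "additive_map C K (\<lambda>x. cS k x z)"
      by (rule additive_mapI) (use kz in \<open>auto simp: cS_simps\<close>)
    have "cS k (finsum C (\<lambda>b. c b \<odot>\<^sub>C b) {b. c b ~= \<zero>\<^sub>K}) z = finsum K (\<lambda>b. cS k (c b \<odot>\<^sub>C b) z) {b. c b ~= \<zero>\<^sub>K}"
      by (rule CG.finsum_additive[OF add K.ag]) (use b in auto)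
    also have "\<dots> = finsum K (\<lambda>b. if jj (k, z) = b then c b else \<zero>\<^sub>K) {b. c b ~= \<zero>\<^sub>K}"
    proof (rule K.finsum_cong')
      fix x assume "x \<in> {b. c b ~= \<zero>\<^sub>K}"
      then obtain q where q: "q \<in> good" "x = jj q" "c x \<in> carrier K" "x \<in> carrier C" using b[of x] by auto
      obtain l w where lw: "q = (l, w)" by (cases q)
      have "cS k x z = (if jj (k, z) = x then \<one>\<^sub>K else \<zero>\<^sub>K)"
        using cS_jj[OF kz(1), of l w] inj[OF kz(1) q(1)] q lw by auto
      then show "cS k (c x \<odot>\<^sub>C x) z = (if jj (k, z) = x then c x else \<zero>\<^sub>K)"
        using q kz by (simp add: cS_smult)
    qed (use b in auto)
    also have "\<dots> = c (jj (k, z))"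
      using free_moduleD(2)[OF c] b
      by (cases "c (jj (k, z)) = \<zero>\<^sub>K")
        (auto simp: K.finsum_singleton intro!: K.add.finprod_one_eqI)
    finally show ?case by (simp add: p)
  qed
  have "\<exists>!c. c \<in> carrier (free_module K (JJ K n r)) \<and> lincomb K Cq.Q ?f c = X" if X: "X \<in> carrier Cq.Q" for X
  proof -
    obtain x where x: "x \<in> carrier C" "X = ?f x" using X by (rule Cq.quot_carrierE)
    \<comment> \<open>The elements of \<open>JJ\<close> serve as their own indices, so the
      coordinates are transported along the injection \<open>jj\<close>.\<close>
    define c where "c b = (if b \<in> jj ` good then (case the_inv_into good jj b of (k, z) => cS k x z) else \<zero>\<^sub>K)" for b
    have inj': "inj_on jj good" using inj by (auto simp: inj_on_def)
    have c_jj: "c (jj (k, z)) = cS k x z" if "(k, z) \<in> good" for k z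
      using that by (simp add: c_def the_inv_into_f_f[OF inj'])
    have c: "c \<in> carrier (free_module K (JJ K n r))"
    proof (rule free_moduleI)
      show "c b \<in> carrier K" for b
      proof (cases "b \<in> jj ` good")
        case True
        then obtain k z where "b = jj (k, z)" "(k, z) \<in> good" by auto
        then show ?thesis using c_jj x by (auto simp: good_def weights_iff cS_simps)
      qed (simp add: c_def)
      show "b \<in> JJ K n r" if "c b ~= \<zero>\<^sub>K" for b
        using that unfolding c_def JJ_eq by (auto split: if_splits)
      have "{b. c b ~= \<zero>\<^sub>K} \<subseteq> jj ` ({k \<in> exps. cS k x ~= \<zero>\<^sub>B} \<times> W0)"
      proof
        fix b assume b: "b \<in> {b. c b ~= \<zero>\<^sub>K}"
        then have "b \<in> jj ` good" by (auto simp: c_def split: if_splits)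
        then obtain k z where kz: "b = jj (k, z)" "(k, z) \<in> good" by auto
        then have "cS k x z ~= \<zero>\<^sub>K" using b c_jj by simp
        then have "cS k x ~= \<zero>\<^sub>B" using kz(2) by (auto simp: B_app good_def weights_iff)
        then show "b \<in> jj ` ({k \<in> exps. cS k x ~= \<zero>\<^sub>B} \<times> W0)" using kz by (auto simp: good_def)
      qed
      then show "finite {b. c b ~= \<zero>\<^sub>K}"
        by (rule finite_subset) (intro finite_imageI finite_cartesian_product cS.gam_finite[OF x(1)] finite_weights)
    qed
    have eq: "lincomb K Cq.Q ?f c' = X \<longleftrightarrow> (\<forall>(k, z)\<in>good. c' (jj (k, z)) = cS k x z)"
      if "c' \<in> carrier (free_module K (JJ K n r))" for c'
    proof -
      let ?y = "finsum C (\<lambda>b. c' b \<odot>\<^sub>C b) {b. c' b ~= \<zero>\<^sub>K}"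
      have "lincomb K Cq.Q ?f c' = ?f ?y" and yc: "?y \<in> carrier C"
        and y: "!!k z. (k, z) \<in> good ==> cS k ?y z = c' (jj (k, z))"
        using lin[OF that] by blast+
      then have "lincomb K Cq.Q ?f c' = X \<longleftrightarrow> (\<forall>(k, z)\<in>good. cS k ?y z = cS k x z)"
        using coset_eq_good[OF yc x(1)] x(2) by simp
      also have "\<dots> \<longleftrightarrow> (\<forall>(k, z)\<in>good. c' (jj (k, z)) = cS k x z)"
      proof (rule ball_cong[OF refl])
        fix p assume "p \<in> good"
        then show "(case p of (k, z) => cS k ?y z = cS k x z) \<longleftrightarrow> (case p of (k, z) => c' (jj (k, z)) = cS k x z)"
          using y by (cases p) simp
      qed
      finally show ?thesis .
    qed
    show ?thesis
    proof (rule ex1I[of _ c])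
      show "c \<in> carrier (free_module K (JJ K n r)) \<and> lincomb K Cq.Q ?f c = X"
        using c eq[OF c] c_jj by auto
      fix c' assume c': "c' \<in> carrier (free_module K (JJ K n r)) \<and> lincomb K Cq.Q ?f c' = X"
      show "c' = c"
      proof
        fix b
        show "c' b = c b"
        proof (cases "b \<in> jj ` good")
          case True
          then show ?thesis using eq[of c'] c' c_jj by auto
        next
          case False
          then show ?thesis using free_moduleD(3)[of c' K "JJ K n r" b] c' unfolding JJ_eq by (auto simp: c_def)
        qed
      qed
    qed
  qed
  moreover have "?f ` JJ K n r \<subseteq> carrier Cq.Q" using jj_closed unfolding JJ_eq by auto
  ultimately show ?thesis
    unfolding is_basis_def I0_eq left_module_iff using Cq.quot_lmod by blast
qed

end

section \<open>Exactness of the complexes I Q along a chain of ideals\<close>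

section \<open>The chain of ideals\<close>

context kos
begin

definition rows_ge :: "nat => (nat \<times> nat => nat) => nat \<times> nat => nat" where
  "rows_ge p k x = (if p \<le> fst x then k x else 0)"
definition rows_lt :: "nat => (nat \<times> nat => nat) => nat \<times> nat => nat" where
  "rows_lt p k x = (if fst x < p then k x else 0)"
definition exps_ge :: "nat => (nat \<times> nat => nat) set" where
  "exps_ge p = {k \<in> exps. \<forall>x. fst x < p --> k x = 0}"
definition exps_lt :: "nat => (nat \<times> nat => nat) set" where
  "exps_lt p = {k \<in> exps. \<forall>x. p \<le> fst x --> k x = 0}"

abbreviation plus_exp :: "(nat \<times> nat => nat) => (nat \<times> nat => nat) => nat \<times> nat => nat" (infixl "\<oplus>\<^sub>e" 65) where
  "k \<oplus>\<^sub>e m \<equiv> \<lambda>x. k x + m x"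

lemma rows_in: "k \<in> exps ==> rows_ge p k \<in> exps_ge p" "k \<in> exps ==> rows_lt p k \<in> exps_lt p"
proof -
  assume k: "k \<in> exps"
  have "rows_ge p k \<in> exps" "rows_lt p k \<in> exps"
    using k unfolding exps_def rows_ge_def rows_lt_def by (auto simp del: split_paired_All)
  then show "rows_ge p k \<in> exps_ge p" "rows_lt p k \<in> exps_lt p"
    unfolding exps_ge_def exps_lt_def by (simp_all del: split_paired_All add: rows_ge_def rows_lt_def)
qed

lemma exps_ge_lt_exps: "k \<in> exps_ge p ==> k \<in> exps" "k \<in> exps_lt p ==> k \<in> exps"
  unfolding exps_ge_def exps_lt_def by blast+

lemma exps_ge_zero: "k \<in> exps_ge p ==> fst x < p ==> k x = 0"
  and exps_lt_zero: "m \<in> exps_lt p ==> p \<le> fst x ==> m x = 0"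
  unfolding exps_ge_def exps_lt_def by blast+

lemma zero_exps_ge: "(\<lambda>_. 0) \<in> exps_ge p"
  by (simp add: exps_ge_def exps_def)

lemma expsI:
  assumes "!!i j. \<not> (i < j \<and> j < n) ==> k (i, j) = 0"
  shows "k \<in> exps"
  unfolding exps_def
proof (intro CollectI allI impI)
  fix i j assume nz: "k (i, j) ~= 0"
  show "i < j \<and> j < n"
  proof (rule ccontr)
    assume "\<not> (i < j \<and> j < n)"
    from nz assms[OF this] show False by (rule notE)
  qed
qed

lemma plus_exps:
  assumes "k \<in> exps" "m \<in> exps"
  shows "k \<oplus>\<^sub>e m \<in> exps"
proof (rule expsI)
  fix i j assume "\<not> (i < j \<and> j < n)"
  note exps_zero[OF assms(1) this] exps_zero[OF assms(2) this]
  then show "(k \<oplus>\<^sub>e m) (i, j) = 0" by (simp only: add_0)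
qed

lemma rows_plus: "rows_ge p k \<oplus>\<^sub>e rows_lt p k = k"
  by (rule ext) (simp add: rows_ge_def rows_lt_def)

lemma rows_of_plus:
  assumes "k \<in> exps_ge p" "m \<in> exps_lt p"
  shows "rows_ge p (k \<oplus>\<^sub>e m) = k" "rows_lt p (k \<oplus>\<^sub>e m) = m"
proof -
  note k = exps_ge_zero[OF assms(1)] and m = exps_lt_zero[OF assms(2)]
  show "rows_ge p (k \<oplus>\<^sub>e m) = k" by (rule ext) (simp add: rows_ge_def k m not_le)
  show "rows_lt p (k \<oplus>\<^sub>e m) = m" by (rule ext) (simp add: rows_lt_def k m not_less)
qed

lemma eq_plus_iff:
  assumes "k \<in> exps_ge p" "m \<in> exps_lt p"
  shows "l = k \<oplus>\<^sub>e m \<longleftrightarrow> rows_lt p l = m \<and> rows_ge p l = k"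
proof
  show "l = k \<oplus>\<^sub>e m ==> rows_lt p l = m \<and> rows_ge p l = k" using rows_of_plus[OF assms] by blast
  assume "rows_lt p l = m \<and> rows_ge p l = k"
  then show "l = k \<oplus>\<^sub>e m" using rows_plus[of p l] by metis
qed

lemma E_plus:
  assumes "k \<in> exps_ge p" "m \<in> exps_lt p"
  shows "E k \<otimes>\<^sub>U E m = E (k \<oplus>\<^sub>e m)"
proof (rule E_add_rows[of _ p])
  show "p \<le> fst x" if "k x ~= 0" for x using exps_ge_zero[OF assms(1), of x] that by (rule_tac ccontr) simp
  show "fst x < p" if "m x ~= 0" for x using exps_lt_zero[OF assms(2), of x] that by (rule_tac ccontr) simp
qed

lemma icol_plus: "icol q (k \<oplus>\<^sub>e m) = icol q k + icol q m"
  by (simp add: icol_def sum.distrib)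

text \<open>Entries of column p lie in rows before p. For such exponents the badness condition at
  column p therefore reads \<open>z $ p < 0\<close>.\<close>

lemma icol_exps_ge:
  assumes "k \<in> exps_ge p"
  shows "icol p k = 0"
  unfolding icol_def
proof (rule sum.neutral, rule ballI)
  fix a assume "a \<in> {..<n}"
  show "int (k (a, p)) = 0"
  proof (cases "a < p")
    case True
    then show ?thesis using exps_ge_zero[OF assms, of "(a, p)"] by simp
  next
    case False
    then show ?thesis using exps_zero[OF exps_ge_lt_exps(1)[OF assms], of a p] by simp
  qed
qed

lemma irow_exps_lt: "m \<in> exps_lt p ==> p \<le> q ==> irow q m = 0"
  unfolding irow_def by (rule sum.neutral) (simp add: exps_lt_zero)

end

context kosKr
begin

text \<open>The subalgebra \<open>A'\<close> of the overview, described by vanishing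
  coordinates.\<close>

definition sub_ge :: "nat => 'k skew set" where
  "sub_ge p = {x \<in> carrier C. \<forall>k\<in>exps. k \<notin> exps_ge p --> cS k x = \<zero>\<^sub>B}"

lemma sub_ge_closed: "x \<in> sub_ge p ==> x \<in> carrier C"
  by (simp add: sub_ge_def)

lemma sub_ge_zero: "x \<in> sub_ge p ==> k \<in> exps ==> k \<notin> exps_ge p ==> cS k x = \<zero>\<^sub>B"
  by (simp add: sub_ge_def)

lemma sub_ge_subgroup: "additive_subgroup (sub_ge p) C"
proof (rule CG.additive_subgroupI')
  note g = cS.gam_additive
  show "x \<oplus>\<^sub>C y \<in> sub_ge p" if "x \<in> sub_ge p" "y \<in> sub_ge p" for x y
    using that by (auto simp: sub_ge_def additive_map_add[OF g])
  show "\<ominus>\<^bsub>C\<^esub> x \<in> sub_ge p" if "x \<in> sub_ge p" for x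
    using that by (auto simp: sub_ge_def additive_map_minus[OF g C_group B_group])
qed (auto simp: sub_ge_def cS.gam_zero)

lemma sub_ge_tau: "k \<in> exps_ge p ==> b \<in> carrier B ==> st (eA k) b \<in> sub_ge p"
  using exps_ge_lt_exps(1)[of k p] by (auto simp: sub_ge_def cS.gam_tau)

lemma additive_map_in_rows:
  assumes h: "additive_map C C h" and x: "x \<in> sub_ge p" and H: "additive_subgroup H C"
    and t: "!!k. k \<in> exps_ge p ==> h (st (eA k) (cS k x)) \<in> H"
  shows "h x \<in> H"
proof (rule additive_map_in[OF h sub_ge_closed[OF x] H])
  fix k assume k: "k \<in> exps"
  show "h (st (eA k) (cS k x)) \<in> H"
  proof (cases "k \<in> exps_ge p")
    case False
    then show ?thesis
      using additive_map_zero[OF h C_group C_group] subgroup_zero[OF H]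
      by (simp add: sub_ge_zero[OF x k] cS.tau_zero[OF k])
  qed (rule t)
qed

lemma id_additive: "additive_map C C (\<lambda>x. x)"
  by (rule additive_mapI) auto

text \<open>Terms of \<open>E l E m\<close> inherit their rows before p from m when l has none, so
  they have none either.\<close>

lemma sub_ge_mult:
  assumes x: "x \<in> sub_ge p" and y: "y \<in> sub_ge p"
  shows "x \<otimes>\<^sub>C y \<in> sub_ge p"
proof (rule additive_map_in_rows[OF C_mult(1)[OF sub_ge_closed[OF x]] y sub_ge_subgroup])
  fix m assume m': "m \<in> exps_ge p"
  note m = exps_ge_lt_exps(1)[OF m']
  have mc: "st (eA m) (cS m y) \<in> carrier C" using m sub_ge_closed[OF y] by simp
  show "x \<otimes>\<^sub>C st (eA m) (cS m y) \<in> sub_ge p"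
  proof (rule additive_map_in_rows[OF C_mult(2)[OF mc] x sub_ge_subgroup])
    fix l assume l': "l \<in> exps_ge p"
    note l = exps_ge_lt_exps(1)[OF l']
    have b: "cS l x \<in> carrier B" "cS m y \<in> carrier B" using l m sub_ge_closed x y by simp_all
    have c: "st (eA l) (cS l x) \<otimes>\<^sub>C st (eA m) (cS m y) \<in> carrier C" using l m b by simp
    have "cS k (st (eA l) (cS l x) \<otimes>\<^sub>C st (eA m) (cS m y)) = \<zero>\<^sub>B"
      if k: "k \<in> exps" "k \<notin> exps_ge p" for k
    proof (rule B_eqI)
      fix z assume z: "z \<in> Z"
      show "cS k (st (eA l) (cS l x) \<otimes>\<^sub>C st (eA m) (cS m y)) z = \<zero>\<^sub>B z"
      proof (rule ccontr)
        assume "cS k (st (eA l) (cS l x) \<otimes>\<^sub>C st (eA m) (cS m y)) z ~= \<zero>\<^sub>B z"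
        then have "k \<in> reach_prod l m"
          using gz_E_mult[OF l m k(1)] tau_mult_coord(1)[OF l m b k(1) z] z by (simp add: B_app)
        then have "(\<forall>a b. a < p --> l (a, b) = 0) --> (\<forall>a b. a < p --> k (a, b) = m (a, b))"
          unfolding reach_prod_def by blast
        moreover have "l (a, b) = 0" if "a < p" for a b using exps_ge_zero[OF l', of "(a, b)"] that by simp
        ultimately have "\<forall>a b. a < p --> k (a, b) = m (a, b)" by blast
        then have "k x = 0" if "fst x < p" for x
          using exps_ge_zero[OF m' that] that by (metis prod.collapse)
        then show False using k unfolding exps_ge_def by blast
      qed
    qed (use k(1) c in auto)
    then show "st (eA l) (cS l x) \<otimes>\<^sub>C st (eA m) (cS m y) \<in> sub_ge p"
      using c by (simp add: sub_ge_def)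
  qed
qed

definition eM :: "(nat \<times> nat => nat) => 'k skew" where "eM m = st (eA m) \<one>\<^sub>B"

text \<open>The coefficient in \<open>sub_ge p\<close> of x at the monomial \<open>eM m\<close>.
  Since \<open>E k b E m\<close> equals \<open>E (k + m)\<close> times b shifted by the degree of m,
  the inverse shift has to be applied to the coordinate of x.\<close>

definition kap :: "nat => (nat \<times> nat => nat) => 'k skew => 'k skew" where
  "kap p m x = fsum C (\<lambda>k. st (eA k) (sh (- dv m) (cS (k \<oplus>\<^sub>e m) x))) (exps_ge p)"

lemma eM_closed: "m \<in> exps ==> eM m \<in> carrier C"
  by (simp add: eM_def)

lemma sh_zero_fun: "\<gamma> \<in> Z ==> sh \<gamma> \<zero>\<^sub>B = \<zero>\<^sub>B"
  by (rule additive_map_zero[OF sh_additive B_group B_group])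

context
  fixes p m assumes m: "m \<in> exps_lt p"
begin

lemma kap_terms: "k \<in> exps_ge p ==> x \<in> carrier C ==> st (eA k) (sh (- dv m) (cS (k \<oplus>\<^sub>e m) x)) \<in> carrier C"
  using plus_exps[OF exps_ge_lt_exps(1) exps_ge_lt_exps(2)[OF m]] by (simp add: exps_ge_lt_exps)

lemma kap_finite:
  assumes x: "x \<in> carrier C"
  shows "finite {k \<in> exps_ge p. st (eA k) (sh (- dv m) (cS (k \<oplus>\<^sub>e m) x)) ~= \<zero>\<^sub>C}"
proof (rule finite_subset)
  show "{k \<in> exps_ge p. st (eA k) (sh (- dv m) (cS (k \<oplus>\<^sub>e m) x)) ~= \<zero>\<^sub>C}
      \<subseteq> rows_ge p ` {k \<in> exps. cS k x ~= \<zero>\<^sub>B}"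
  proof
    fix k assume k: "k \<in> {k \<in> exps_ge p. st (eA k) (sh (- dv m) (cS (k \<oplus>\<^sub>e m) x)) ~= \<zero>\<^sub>C}"
    then have ke: "k \<in> exps_ge p" by simp
    have "cS (k \<oplus>\<^sub>e m) x ~= \<zero>\<^sub>B"
      using k by (auto simp: sh_zero_fun cS.tau_zero[OF exps_ge_lt_exps(1)[OF ke]])
    then show "k \<in> rows_ge p ` {k \<in> exps. cS k x ~= \<zero>\<^sub>B}"
      using plus_exps[OF exps_ge_lt_exps(1)[OF ke] exps_ge_lt_exps(2)[OF m]] rows_of_plus(1)[OF ke m]
      by (intro image_eqI[of _ _ "k \<oplus>\<^sub>e m"]) auto
  qed
  show "finite (rows_ge p ` {k \<in> exps. cS k x ~= \<zero>\<^sub>B})"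
    by (rule finite_imageI[OF cS.gam_finite[OF x]])
qed

lemma kap_closed: "x \<in> carrier C ==> kap p m x \<in> carrier C"
  unfolding kap_def by (rule CG.fsum_closed) (rule kap_terms)

lemma cS_kap:
  assumes x: "x \<in> carrier C" and l: "l \<in> exps"
  shows "cS l (kap p m x) = (if l \<in> exps_ge p then sh (- dv m) (cS (l \<oplus>\<^sub>e m) x) else \<zero>\<^sub>B)"
proof -
  have b: "sh (- dv m) (cS (k \<oplus>\<^sub>e m) x) \<in> carrier B" if "k \<in> exps_ge p" for k
    using plus_exps[OF exps_ge_lt_exps(1)[OF that] exps_ge_lt_exps(2)[OF m]] x by simp
  have "cS l (kap p m x) = fsum B (\<lambda>k. cS l (st (eA k) (sh (- dv m) (cS (k \<oplus>\<^sub>e m) x)))) (exps_ge p)"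
    unfolding kap_def
    by (rule CG.fsum_additive[OF cS.gam_additive[OF l] B_group kap_terms[OF _ x] kap_finite[OF x]])
  also have "\<dots> = (if l \<in> exps_ge p then sh (- dv m) (cS (l \<oplus>\<^sub>e m) x) else \<zero>\<^sub>B)"
  proof (cases "l \<in> exps_ge p")
    case True
    then show ?thesis
      using b by (simp, intro B.M.fsum_single[OF True]) (auto simp: cS.gam_tau[OF l] exps_ge_lt_exps)
  next
    case False
    then show ?thesis
      using b by (simp, intro B.M.fsum_zero) (auto simp: cS.gam_tau[OF l] exps_ge_lt_exps)
  qed
  finally show ?thesis .
qed

lemma kap_in: "x \<in> carrier C ==> kap p m x \<in> sub_ge p"
  by (auto simp: sub_ge_def kap_closed cS_kap)

lemma kap_additive: "additive_map C C (kap p m)"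
proof (rule additive_mapI[OF kap_closed])
  fix x y assume xy: "x \<in> carrier C" "y \<in> carrier C"
  show "kap p m (x \<oplus>\<^sub>C y) = kap p m x \<oplus>\<^sub>C kap p m y"
  proof (rule cS.coord_eqI)
    fix l assume l: "l \<in> exps"
    then have "l \<oplus>\<^sub>e m \<in> exps" by (rule plus_exps[OF _ exps_ge_lt_exps(2)[OF m]])
    then show "cS l (kap p m (x \<oplus>\<^sub>C y)) = cS l (kap p m x \<oplus>\<^sub>C kap p m y)"
      using xy l by (auto simp: cS_kap additive_map_add[OF cS.gam_additive] additive_map_add[OF sh_additive] kap_closed)
  qed (use xy kap_closed in auto)
qed

lemma cS_mult_eM:
  assumes c: "c \<in> sub_ge p" and l: "l \<in> exps"
  shows "cS l (c \<otimes>\<^sub>C eM m) = (if rows_lt p l = m then sh (dv m) (cS (rows_ge p l) c) else \<zero>\<^sub>B)"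
proof -
  note me = exps_ge_lt_exps(2)[OF m]
  note hl = rows_in(1)[OF l, of p]
  have h: "additive_map C B (\<lambda>c. if rows_lt p l = m then sh (dv m) (cS (rows_ge p l) c) else \<zero>\<^sub>B)"
    using exps_ge_lt_exps(1)[OF hl]
    by (cases "rows_lt p l = m")
      (auto intro!: additive_mapI simp: additive_map_add[OF cS.gam_additive] additive_map_add[OF sh_additive])
  have g: "additive_map C B (\<lambda>c. cS l (c \<otimes>\<^sub>C eM m))"
    by (rule additive_map_comp[OF cS.gam_additive[OF l] C_mult(2)[OF eM_closed[OF me]]])
  have "c \<in> {x \<in> carrier C. cS l (x \<otimes>\<^sub>C eM m) = (if rows_lt p l = m then sh (dv m) (cS (rows_ge p l) x) else \<zero>\<^sub>B)}"
  proof (rule additive_map_in_rows[OF id_additive c additive_subgroup_equalizer[OF C_group B_group g h]])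
    fix k assume k: "k \<in> exps_ge p"
    let ?b = "cS k c"
    have ke: "k \<in> exps" and b: "?b \<in> carrier B" using exps_ge_lt_exps(1)[OF k] sub_ge_closed[OF c] by simp_all
    have "st (eA k) ?b \<otimes>\<^sub>C eM m = st (eA (k \<oplus>\<^sub>e m)) (sh (dv m) ?b)"
      unfolding eM_def using tau_mult_eq[OF ke me b _ E_plus[OF k m], of "\<one>\<^sub>B"] b by simp
    then have "cS l (st (eA k) ?b \<otimes>\<^sub>C eM m) = (if l = k \<oplus>\<^sub>e m then sh (dv m) ?b else \<zero>\<^sub>B)"
      using l plus_exps[OF ke me] b by (simp add: cS.gam_tau)
    also have "\<dots> = (if rows_lt p l = m then sh (dv m) (cS (rows_ge p l) (st (eA k) ?b)) else \<zero>\<^sub>B)"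
      using ke b exps_ge_lt_exps(1)[OF hl] by (simp add: eq_plus_iff[OF k m] cS.gam_tau sh_zero_fun)
    finally show "st (eA k) ?b \<in> {x \<in> carrier C. cS l (x \<otimes>\<^sub>C eM m) = (if rows_lt p l = m then sh (dv m) (cS (rows_ge p l) x) else \<zero>\<^sub>B)}"
      using ke b by simp
  qed
  then show ?thesis by simp
qed

end

lemma sh_inverse: "b \<in> carrier B ==> sh (- dv m) (sh (dv m) b) = b" "b \<in> carrier B ==> sh (dv m) (sh (- dv m) b) = b"
  by (simp_all add: sh_sh sh_zero uminus_l_inv_vec[of _ n] uminus_r_inv_vec[of _ n])

text \<open>Here the splitting of exponents into rows from p on and rows before p is unique, and the
  two shifts cancel.\<close>

lemma kap_mult_eM:
  assumes m: "m \<in> exps_lt p" and m': "m' \<in> exps_lt p" and c: "c \<in> sub_ge p"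
  shows "kap p m (c \<otimes>\<^sub>C eM m') = (if m = m' then c else \<zero>\<^sub>C)"
proof (rule cS.coord_eqI)
  note cc = sub_ge_closed[OF c]
  have ce: "c \<otimes>\<^sub>C eM m' \<in> carrier C" using cc eM_closed[OF exps_ge_lt_exps(2)[OF m']] by simp
  show "kap p m (c \<otimes>\<^sub>C eM m') \<in> carrier C" by (rule kap_closed[OF m ce])
  show "(if m = m' then c else \<zero>\<^sub>C) \<in> carrier C" using cc by simp
  fix l assume l: "l \<in> exps"
  show "cS l (kap p m (c \<otimes>\<^sub>C eM m')) = cS l (if m = m' then c else \<zero>\<^sub>C)"
  proof (cases "l \<in> exps_ge p")
    case True
    note lm = plus_exps[OF l exps_ge_lt_exps(2)[OF m]]
    show ?thesis
      using True l cc cS.gam_closed[OF l cc]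
      by (auto simp: cS_kap[OF m ce l] cS_mult_eM[OF m' c lm] rows_of_plus[OF True m] rows_of_plus[OF True m'] sh_zero_fun cS.gam_zero sh_inverse)
  next
    case False
    then show ?thesis using sub_ge_zero[OF c l] by (simp add: cS_kap[OF m ce l] cS.gam_zero[OF l])
  qed
qed

lemma kap_support:
  assumes x: "x \<in> carrier C"
  shows "finite {m \<in> exps_lt p. kap p m x ~= \<zero>\<^sub>C}"
proof (rule finite_subset)
  show "finite (rows_lt p ` {k \<in> exps. cS k x ~= \<zero>\<^sub>B})" by (rule finite_imageI[OF cS.gam_finite[OF x]])
  show "{m \<in> exps_lt p. kap p m x ~= \<zero>\<^sub>C} \<subseteq> rows_lt p ` {k \<in> exps. cS k x ~= \<zero>\<^sub>B}"
  proof
    fix m assume "m \<in> {m \<in> exps_lt p. kap p m x ~= \<zero>\<^sub>C}"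
    then have m: "m \<in> exps_lt p" and nz: "kap p m x ~= \<zero>\<^sub>C" by auto
    have "\<exists>l\<in>exps. cS l (kap p m x) ~= \<zero>\<^sub>B"
      using cS.coord_eqI[OF kap_closed[OF m x], of "\<zero>\<^sub>C"] nz by (auto simp: cS.gam_zero)
    then obtain l where l: "l \<in> exps" "cS l (kap p m x) ~= \<zero>\<^sub>B" by blast
    then have "l \<in> exps_ge p" "cS (l \<oplus>\<^sub>e m) x ~= \<zero>\<^sub>B"
      by (auto simp: cS_kap[OF m x] sh_zero_fun split: if_splits)
    then show "m \<in> rows_lt p ` {k \<in> exps. cS k x ~= \<zero>\<^sub>B}"
      using plus_exps[OF l(1) exps_ge_lt_exps(2)[OF m]] rows_of_plus(2)[OF _ m, of l]
      by (intro image_eqI[of _ _ "l \<oplus>\<^sub>e m"]) auto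
  qed
qed

lemma kap_eM_finite:
  assumes x: "x \<in> carrier C"
  shows "finite {m \<in> exps_lt p. kap p m x \<otimes>\<^sub>C eM m ~= \<zero>\<^sub>C}"
proof (rule finite_subset[OF _ kap_support[OF x, of p]])
  have "\<zero>\<^sub>C \<otimes>\<^sub>C eM m = \<zero>\<^sub>C" if "m \<in> exps_lt p" for m
    using eM_closed[OF exps_ge_lt_exps(2)[OF that]] by simp
  then show "{m \<in> exps_lt p. kap p m x \<otimes>\<^sub>C eM m ~= \<zero>\<^sub>C} \<subseteq> {m \<in> exps_lt p. kap p m x ~= \<zero>\<^sub>C}" by force
qed

lemma kap_eM_closed: "x \<in> carrier C ==> m \<in> exps_lt p ==> kap p m x \<otimes>\<^sub>C eM m \<in> carrier C"
  by (simp add: kap_closed eM_closed exps_ge_lt_exps)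

lemma kap_expand:
  assumes x: "x \<in> carrier C"
  shows "x = fsum C (\<lambda>m. kap p m x \<otimes>\<^sub>C eM m) (exps_lt p)"
proof (rule cS.coord_eqI[OF x])
  show "fsum C (\<lambda>m. kap p m x \<otimes>\<^sub>C eM m) (exps_lt p) \<in> carrier C"
    by (rule CG.fsum_closed) (rule kap_eM_closed[OF x])
  fix l assume l: "l \<in> exps"
  note lr = rows_in[OF l, of p]
  have "cS l (fsum C (\<lambda>m. kap p m x \<otimes>\<^sub>C eM m) (exps_lt p)) = fsum B (\<lambda>m. cS l (kap p m x \<otimes>\<^sub>C eM m)) (exps_lt p)"
    by (rule CG.fsum_additive[OF cS.gam_additive[OF l] B_group kap_eM_closed[OF x] kap_eM_finite[OF x]])
  also have "\<dots> = cS l x"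
  proof (rule B.M.fsum_single[OF lr(2)])
    show "cS l x \<in> carrier B" using l x by simp
    fix m assume m: "m \<in> exps_lt p"
    have "sh (dv m) (cS (rows_ge p l) (kap p m x)) = cS l x" if "rows_lt p l = m"
    proof -
      have "rows_ge p l \<oplus>\<^sub>e m = l" using rows_plus[of p l] that by simp
      then have "cS (rows_ge p l) (kap p m x) = sh (- dv m) (cS l x)"
        using cS_kap[OF m x exps_ge_lt_exps(1)[OF lr(1)]] lr(1) by simp
      then show ?thesis using sh_inverse(2) l x by simp
    qed
    then show "cS l (kap p m x \<otimes>\<^sub>C eM m) = (if m = rows_lt p l then cS l x else \<zero>\<^sub>B)"
      by (auto simp: cS_mult_eM[OF m kap_in[OF m x] l])
  qed
  finally show "cS l x = cS l (fsum C (\<lambda>m. kap p m x \<otimes>\<^sub>C eM m) (exps_lt p))" ..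
qed

text \<open>Expand x in the \<open>eM m\<close>; a times a coefficient lies again in
  \<open>sub_ge p\<close>, so it is the coefficient of the product.\<close>

lemma kap_mult:
  assumes m: "m \<in> exps_lt p" and a: "a \<in> sub_ge p" and x: "x \<in> carrier C"
  shows "kap p m (a \<otimes>\<^sub>C x) = a \<otimes>\<^sub>C kap p m x"
proof -
  note ac = sub_ge_closed[OF a]
  note h = additive_map_comp[OF kap_additive[OF m] C_mult(1)[OF ac]]
  have "kap p m (a \<otimes>\<^sub>C x) = kap p m (a \<otimes>\<^sub>C fsum C (\<lambda>m. kap p m x \<otimes>\<^sub>C eM m) (exps_lt p))"
    using kap_expand[OF x, of p] by simp
  also have "\<dots> = fsum C (\<lambda>m'. kap p m (a \<otimes>\<^sub>C (kap p m' x \<otimes>\<^sub>C eM m'))) (exps_lt p)"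
    by (rule CG.fsum_additive[OF h C_group kap_eM_closed[OF x] kap_eM_finite[OF x]])
  also have "\<dots> = a \<otimes>\<^sub>C kap p m x"
  proof (rule CG.fsum_single[OF m])
    show "a \<otimes>\<^sub>C kap p m x \<in> carrier C" using ac kap_closed[OF m x] by simp
    fix m' assume m': "m' \<in> exps_lt p"
    have "a \<otimes>\<^sub>C (kap p m' x \<otimes>\<^sub>C eM m') = a \<otimes>\<^sub>C kap p m' x \<otimes>\<^sub>C eM m'"
      using ac kap_closed[OF m' x] eM_closed[OF exps_ge_lt_exps(2)[OF m']] by (simp add: C.m_assoc)
    then show "kap p m (a \<otimes>\<^sub>C (kap p m' x \<otimes>\<^sub>C eM m')) = (if m' = m then a \<otimes>\<^sub>C kap p m x else \<zero>\<^sub>C)"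
      using kap_mult_eM[OF m m' sub_ge_mult[OF a kap_in[OF m' x]]] by auto
  qed
  finally show ?thesis .
qed

lemma sub_ge_dual_basis: "ring_dual_basis C (sub_ge p) (exps_lt p) eM (kap p)"
  by (intro ring_dual_basis.intro ring_dual_basis_axioms.intro C_ring)
    (auto simp: sub_ge_closed eM_closed exps_ge_lt_exps kap_additive kap_in kap_mult kap_support kap_expand[symmetric])

lemma J_bad: "x \<in> J Q ==> k \<in> exps ==> z \<in> Z ==> cS k x z ~= \<zero>\<^sub>K ==> bad Q k z"
  unfolding J_def by blast

lemma JI: "x \<in> carrier C ==> (!!k z. k \<in> exps ==> z \<in> Z ==> cS k x z ~= \<zero>\<^sub>K ==> bad Q k z) ==> x \<in> J Q"
  unfolding J_def by blast

text \<open>For q >= p row q of m is empty, so passing \<open>E m\<close> changes the entry at q by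
  \<open>icol q m\<close>. This is exactly what m contributes to the column sum of
  \<open>l + m\<close>, and hence badness in the columns from p on is the same for x and for its
  coefficient.\<close>

lemma kap_J:
  assumes m: "m \<in> exps_lt p" and x: "x \<in> J {p..<n}"
  shows "kap p m x \<in> J {p..<n}" and "Q \<subseteq> {p..<n} ==> x \<in> J Q ==> kap p m x \<in> J Q"
proof -
  show *: "kap p m x \<in> J Q" if Q: "Q \<subseteq> {p..<n}" and x: "x \<in> J Q" for Q x
  proof -
    have "bad Q l z" if l: "l \<in> exps" and z: "z \<in> Z" and nz: "cS l (kap p m x) z ~= \<zero>\<^sub>K" for l z
    proof -
      let ?w = "z + - dv m"
      note lm = plus_exps[OF l exps_ge_lt_exps(2)[OF m]]
      have w: "?w \<in> Z" using z by simp
      have "cS (l \<oplus>\<^sub>e m) x ?w ~= \<zero>\<^sub>K"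
        using nz z by (auto simp: cS_kap[OF m J_carrier[OF x] l] sh_app B_app split: if_splits)
      then have "bad Q (l \<oplus>\<^sub>e m) ?w" by (rule J_bad[OF x lm w])
      then consider "tot ?w ~= int r" | q where "q \<in> Q" "q < n" "?w $ q < icol q (l \<oplus>\<^sub>e m)"
        unfolding bad_def by blast
      then show ?thesis
      proof cases
        case 1
        have "?w + dv m = z" using z by (intro eq_vecI) (auto simp: dv_def)
        then have "tot ?w = tot z" using tot_dv[OF w, of m] by simp
        then show ?thesis using 1 by (simp add: bad_def)
      next
        case (2 q)
        have "p \<le> q" using 2 Q by auto
        then have "z $ q < icol q l"
          using 2(2,3) z irow_exps_lt[OF m, of q] by (simp add: icol_plus wt_def dv_def)
        then show ?thesis using 2 unfolding bad_def by blast
      qed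
    qed
    then show ?thesis using kap_closed[OF m J_carrier[OF x]] by (intro JI)
  qed
  show "kap p m x \<in> J {p..<n}" by (rule *[OF subset_refl x])
qed

lemma cS_mult_zero:
  assumes x: "x \<in> carrier C" and b: "b \<in> carrier B" and l: "l \<in> exps"
  shows "cS l (x \<otimes>\<^sub>C st (eA (\<lambda>_. 0)) b) = cS l x \<otimes>\<^sub>B b"
proof -
  have c: "st (eA (\<lambda>_. 0)) b \<in> carrier C" using b zero_exps by simp
  have g: "additive_map C B (\<lambda>x. cS l (x \<otimes>\<^sub>C st (eA (\<lambda>_. 0)) b))"
    by (rule additive_map_comp[OF cS.gam_additive[OF l] C_mult(2)[OF c]])
  have "additive_map B B (\<lambda>y. y \<otimes>\<^sub>B b)"
    by (rule additive_mapI) (use b in \<open>auto intro!: B_eqI simp: B_app B_at K.l_distr\<close>)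
  then have h: "additive_map C B (\<lambda>x. cS l x \<otimes>\<^sub>B b)"
    by (rule additive_map_comp[OF _ cS.gam_additive[OF l]])
  have z: "\<zero>\<^sub>B \<otimes>\<^sub>B b = \<zero>\<^sub>B" by (rule B_eqI) (use b in \<open>auto simp: B_app B_at\<close>)
  have "x \<in> {x \<in> carrier C. cS l (x \<otimes>\<^sub>C st (eA (\<lambda>_. 0)) b) = cS l x \<otimes>\<^sub>B b}"
  proof (rule additive_map_in[OF id_additive x additive_subgroup_equalizer[OF C_group B_group g h]])
    fix k assume k: "k \<in> exps"
    have kc: "cS k x \<in> carrier B" using k x by simp
    have "st (eA k) (cS k x) \<otimes>\<^sub>C st (eA (\<lambda>_. 0)) b = st (eA k) (cS k x \<otimes>\<^sub>B b)"
      using tau_mult_eq[OF k zero_exps kc b, of k] kc k by (simp add: E_zero dv_zero sh_zero)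
    then show "st (eA k) (cS k x) \<in> {x \<in> carrier C. cS l (x \<otimes>\<^sub>C st (eA (\<lambda>_. 0)) b) = cS l x \<otimes>\<^sub>B b}"
      using k kc l b by (simp add: cS.gam_tau z)
  qed
  then show ?thesis by simp
qed

definition idem :: "int vec set => 'k skew" where "idem S = st (eA (\<lambda>_. 0)) (ind S)"

lemma idem_closed [simp]: "idem S \<in> carrier C"
  by (simp add: idem_def zero_exps)

lemma cS_mult_idem:
  assumes "x \<in> carrier C" "l \<in> exps" "z \<in> Z"
  shows "cS l (x \<otimes>\<^sub>C idem S) z = (if z \<in> S then cS l x z else \<zero>\<^sub>K)"
  using assms cS_simps(4)[OF assms] by (simp add: idem_def cS_mult_zero B_app ind_app)

lemma mult_idem_eqI:
  assumes x: "x \<in> carrier C" and S: "!!l z. l \<in> exps ==> z \<in> Z ==> cS l x z ~= \<zero>\<^sub>K ==> z \<in> S"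
  shows "x \<otimes>\<^sub>C idem S = x"
proof (rule cS.coord_eqI)
  fix l assume l: "l \<in> exps"
  show "cS l (x \<otimes>\<^sub>C idem S) = cS l x"
  proof (rule B_eqI)
    fix z assume z: "z \<in> Z"
    show "cS l (x \<otimes>\<^sub>C idem S) z = cS l x z"
    proof (cases "z \<in> S")
      case False
      then have "cS l x z = \<zero>\<^sub>K" using S[OF l z] by blast
      then show ?thesis using cS_mult_idem[OF x l z, of S] by simp
    qed (simp add: cS_mult_idem[OF x l z])
  qed (use x l in auto)
qed (use x in auto)

lemma idem_J: "(!!z. z \<in> Z ==> z \<in> S ==> bad Q (\<lambda>_. 0) z) ==> idem S \<in> J Q"
  unfolding idem_def by (rule J_tau[OF zero_exps ind_closed]) (auto simp: ind_app split: if_splits)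

lemma idem_in: "idem S \<in> sub_ge p"
  unfolding idem_def by (rule sub_ge_tau[OF zero_exps_ge ind_closed])

lemma idem_idem: "idem S \<otimes>\<^sub>C idem S = idem S"
  by (rule mult_idem_eqI) (auto simp: idem_def zero_exps cS.gam_tau B_app ind_app split: if_splits)

text \<open>A function to the left of \<open>E k\<close> is evaluated at \<open>z + dv k\<close> and
  one to the right at z. If S is reached from weights in S only, the idempotent on the right loses
  nothing.\<close>

lemma idem_mult_idem:
  assumes a: "a \<in> carrier C"
    and S: "!!k z. k \<in> exps ==> cS k a ~= \<zero>\<^sub>B ==> z \<in> Z ==> z + dv k \<in> S ==> z \<in> S"
  shows "idem S \<otimes>\<^sub>C a \<otimes>\<^sub>C idem S = idem S \<otimes>\<^sub>C a"
proof -
  have g: "additive_map C C (\<lambda>a. idem S \<otimes>\<^sub>C a \<otimes>\<^sub>C idem S)"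
    by (rule additive_map_comp[OF C_mult(2)[OF idem_closed] C_mult(1)[OF idem_closed]])
  have "a \<in> {a \<in> carrier C. idem S \<otimes>\<^sub>C a \<otimes>\<^sub>C idem S = idem S \<otimes>\<^sub>C a}"
  proof (rule additive_map_in[OF id_additive a additive_subgroup_equalizer[OF C_group C_group g C_mult(1)[OF idem_closed]]])
    fix k assume k: "k \<in> exps"
    let ?b = "cS k a"
    have b: "?b \<in> carrier B" using k a by simp
    have eq: "idem S \<otimes>\<^sub>C st (eA k) ?b = st (eA k) (sh (dv k) (ind S) \<otimes>\<^sub>B ?b)"
      unfolding idem_def by (rule tau_mult_eq[OF zero_exps k ind_closed b]) (use k in \<open>simp add: E_zero\<close>)
    have "idem S \<otimes>\<^sub>C st (eA k) ?b \<otimes>\<^sub>C idem S = idem S \<otimes>\<^sub>C st (eA k) ?b"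
    proof (rule mult_idem_eqI)
      fix l z assume l: "l \<in> exps" and z: "z \<in> Z" and nz: "cS l (idem S \<otimes>\<^sub>C st (eA k) ?b) z ~= \<zero>\<^sub>K"
      have "sh (dv k) (ind S) \<otimes>\<^sub>B ?b \<in> carrier B" using b by simp
      then have "ind S (z + dv k) \<otimes>\<^sub>K ?b z ~= \<zero>\<^sub>K"
        using nz l k z by (auto simp: eq cS.gam_tau B_app sh_app split: if_splits)
      moreover have "?b z \<in> carrier K" using b z by (rule B_at)
      ultimately have "z + dv k \<in> S" "?b z ~= \<zero>\<^sub>K" using z by (auto simp: ind_app split: if_splits)
      moreover from this z have "?b ~= \<zero>\<^sub>B" by (auto simp: B_app)
      ultimately show "z \<in> S" using S[OF k _ z] by blast
    qed (use k b in simp)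
    then show "st (eA k) ?b \<in> {a \<in> carrier C. idem S \<otimes>\<^sub>C a \<otimes>\<^sub>C idem S = idem S \<otimes>\<^sub>C a}"
      using k b by simp
  qed
  then show ?thesis by simp
qed

lemma J_mono: "Q \<subseteq> Q' ==> J Q \<subseteq> J Q'"
  unfolding J_def bad_def by blast

context
  fixes X :: "('k skew, 'x) module" and P d \<epsilon>
  assumes res: "resolution C X P d \<epsilon>"
    and kills: "!!f x. f \<in> I0 ==> x \<in> carrier X ==> f \<odot>\<^bsub>X\<^esub> x = \<zero>\<^bsub>X\<^esub>"
begin

interpretation R: resolution C X P d \<epsilon> by (rule res)

text \<open>The total of a weight is invariant under all monomials, so the subalgebra can be the
  whole algebra, with the single basis element 1. Right multiplication by f is the identity on
  \<open>J {}\<close>, so the zero ideal serves as the smaller one.\<close>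

lemma exact_J_empty: "R.exact_idl (J {})"
proof (rule R.exact_idl_step[where A' = "carrier C" and S = "{()}" and e = "\<lambda>_. \<one>\<^sub>C" and \<kappa> = "\<lambda>_ x. x"
        and f = "idem {z. tot z ~= int r}", OF _ _ _ _ _ _ _ _ _ _ _ _ R.exact_idl_zero])
  let ?f = "idem {z. tot z ~= int r}"
  show f: "?f \<in> J {}" by (rule idem_J) (simp add: bad_def)
  show "?f \<odot>\<^bsub>X\<^esub> x = \<zero>\<^bsub>X\<^esub>" if "x \<in> carrier X" for x
    by (rule kills[OF _ that]) (use f J_mono[of "{}" "{..<n}"] in \<open>auto simp: I0_eq\<close>)
  show "ring_dual_basis C (carrier C) {()} (\<lambda>_. \<one>\<^sub>C) (\<lambda>_ x. x)"
    by (intro ring_dual_basis.intro ring_dual_basis_axioms.intro C_ring)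
      (auto simp: id_additive CG.fsum_finite)
  show "?f \<otimes>\<^sub>C a \<otimes>\<^sub>C ?f = ?f \<otimes>\<^sub>C a" if "a \<in> carrier C" for a
    by (rule idem_mult_idem[OF that]) (simp add: tot_dv)
  show "\<exists>c\<in>carrier C. a \<ominus>\<^sub>C c \<otimes>\<^sub>C ?f \<in> {\<zero>\<^sub>C}" if a: "a \<in> J {}" for a
  proof -
    have "a \<otimes>\<^sub>C ?f = a" by (rule mult_idem_eqI[OF J_carrier[OF a]]) (use J_bad[OF a] in \<open>simp add: bad_def\<close>)
    then show ?thesis using J_carrier[OF a] CG.diff_self[OF J_carrier[OF a]] by (intro bexI[of _ a]) auto
  qed
  show "{\<zero>\<^sub>C} \<subseteq> J {}" using subgroup_zero[OF J_subgroup] by simp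
qed (auto simp: idem_idem J_carrier intro: J_mult)

lemma exact_J_step:
  assumes p: "p < n" and ex: "R.exact_idl (J {Suc p..<n})"
  shows "R.exact_idl (J {p..<n})"
proof (rule R.exact_idl_step[where f = "idem {z. z $ p < 0}", OF sub_ge_dual_basis[of p] _ _ _ _ _ _ _ _ _ _ _ ex])
  let ?S = "{z. z $ p < (0::int)}"
  let ?f = "idem ?S"
  show f: "?f \<in> J {p..<n}"
    by (rule idem_J) (use p in \<open>auto simp: bad_def icol_def\<close>)
  show "?f \<odot>\<^bsub>X\<^esub> x = \<zero>\<^bsub>X\<^esub>" if "x \<in> carrier X" for x
    by (rule kills[OF _ that]) (use subsetD[OF J_mono f, of "{..<n}"] in \<open>simp add: I0_eq lessThan_atLeast0\<close>)
  \<comment> \<open>A monomial in \<open>sub_ge p\<close> has an empty column p, so its degree at p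
    is nonnegative: a weight that it makes negative at p was negative there before.\<close>
  show "?f \<otimes>\<^sub>C a \<otimes>\<^sub>C ?f = ?f \<otimes>\<^sub>C a" if a: "a \<in> sub_ge p" for a
  proof (rule idem_mult_idem[OF sub_ge_closed[OF a]])
    fix k z assume k: "k \<in> exps" "cS k a ~= \<zero>\<^sub>B" and z: "z \<in> Z" "z + dv k \<in> ?S"
    then have "k \<in> exps_ge p" using sub_ge_zero[OF a] by blast
    then have "wt k p \<ge> 0" using irow_nonneg[of p k] by (simp add: wt_def icol_exps_ge)
    then show "z \<in> ?S" using z p by (simp add: dv_def)
  qed
  show "J {Suc p..<n} \<subseteq> J {p..<n}" by (rule J_mono) auto
  show "kap p m a \<in> J {Suc p..<n}" if "m \<in> exps_lt p" "a \<in> J {Suc p..<n}" for m a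
  proof (rule kap_J(2)[OF that(1) _ _ that(2)])
    show "a \<in> J {p..<n}" using J_mono[of "{Suc p..<n}" "{p..<n}"] that(2) by auto
  qed auto
  \<comment> \<open>The coefficient itself serves as c. Where f vanishes the entry at p is
    nonnegative, and column p of the exponents is empty; so p cannot be the bad column, and badness
    comes from a later column or from the total.\<close>
  show "\<exists>c\<in>sub_ge p. kap p m a \<ominus>\<^sub>C c \<otimes>\<^sub>C ?f \<in> J {Suc p..<n}" if m: "m \<in> exps_lt p" and a: "a \<in> J {p..<n}" for m a
  proof (rule bexI)
    let ?y = "kap p m a"
    show y: "?y \<in> sub_ge p" by (rule kap_in[OF m J_carrier[OF a]])
    note yc = sub_ge_closed[OF y]
    have yJ: "?y \<in> J {p..<n}" by (rule kap_J(1)[OF m a])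
    have "bad {Suc p..<n} l z" if l: "l \<in> exps" and z: "z \<in> Z" and nz: "cS l (?y \<ominus>\<^sub>C ?y \<otimes>\<^sub>C ?f) z ~= \<zero>\<^sub>K" for l z
    proof -
      have yz: "cS l ?y z \<in> carrier K" by (rule cS_simps(4)[OF yc l z])
      have "cS l (?y \<ominus>\<^sub>C ?y \<otimes>\<^sub>C ?f) z = cS l ?y z \<oplus>\<^sub>K \<ominus>\<^bsub>K\<^esub> (if z \<in> ?S then cS l ?y z else \<zero>\<^sub>K)"
        unfolding a_minus_def using yc l z by (simp add: cS_simps cS_mult_idem)
      then have zS: "z \<notin> ?S" and "cS l ?y z ~= \<zero>\<^sub>K" using nz yz by (auto simp: K.r_neg split: if_splits)
      then have "bad {p..<n} l z" by (intro J_bad[OF yJ l z])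
      moreover have "l \<in> exps_ge p"
      proof (rule ccontr)
        assume "l \<notin> exps_ge p"
        then have "cS l ?y = \<zero>\<^sub>B" by (rule sub_ge_zero[OF y l])
        then show False using \<open>cS l ?y z ~= \<zero>\<^sub>K\<close> z by (simp add: B_app)
      qed
      then have "\<not> z $ p < icol p l" using zS by (simp add: icol_exps_ge)
      ultimately show ?thesis unfolding bad_def using atLeastLessThan_iff le_neq_implies_less Suc_leI by metis
    qed
    then show "?y \<ominus>\<^sub>C ?y \<otimes>\<^sub>C ?f \<in> J {Suc p..<n}" using yc by (intro JI) auto
  qed
qed (auto simp: idem_idem idem_in J_carrier intro: J_mult)

theorem exact_I0: "R.exact_idl I0"
proof -
  have "R.exact_idl (J {p..<n})" if "p \<le> n" for p
    using that
  proof (induction rule: inc_induct)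
    case base
    show ?case using exact_J_empty by simp
  next
    case (step p)
    show ?case by (rule exact_J_step[OF step(2)]) (rule step(3))
  qed
  from this[of 0] show ?thesis by (simp add: I0_eq lessThan_atLeast0)
qed

end

end

context kosKr
begin

lemma I0_ideal: "ideal I0 C"
  unfolding I0_eq by (rule J_ideal)

lemma strong_idempotent_I0: "strong_idempotent TYPE('x \<times> 'y \<times> 'p \<times> 'q) C I0"
  unfolding strong_idempotent_def
proof (intro conjI I0_ideal allI impI)
  fix X :: "('k skew set, 'x) module" and Y :: "('k skew set, 'y) module"
    and P :: "nat => ('k skew set, 'p) module" and dP \<epsilon>P and Q :: "nat => ('k skew, 'q) module" and dQ \<epsilon>Q f i
  assume X: "left_module (C Quot I0) X" and Y: "left_module (C Quot I0) Y"
    and P: "proj_resolution (C Quot I0) X P dP \<epsilon>P"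
    and Q: "proj_resolution C (restrict_scalars C I0 X) Q dQ \<epsilon>Q"
    and f: "lifts_identity C Q dQ \<epsilon>Q (\<lambda>j. restrict_scalars C I0 (P j)) dP \<epsilon>P f" and i: "1 \<le> (i::nat)"
  interpret iq: ideal_quot I0 C using I0_ideal by (intro ideal_quot.intro) (auto simp: ideal_def)
  have "resolution.exact_idl Q dQ I0"
    by (rule exact_I0[OF resolution.intro[OF Q]])
      (use X iq.restrict_kills in \<open>simp add: left_module_iff\<close>)
  from ext_map_iso[OF I0_ideal X Y P Q f this i]
  show "ext_map C Q dQ (restrict_scalars C I0 Y) f i
      \<in> iso (ext_group (C Quot I0) P dP Y i) (ext_group C Q dQ (restrict_scalars C I0 Y) i)" .
qed

end

theorem theorem2p19:
  fixes K :: "('k, 's) ring_scheme" and n r :: nat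
  assumes "field K" and "n \<ge> 1" and "r \<ge> 1"
  shows "strong_idempotent TYPE('x \<times> 'y \<times> 'p \<times> 'q) (skew_alg K n) (e_bar_ideal K n r) \<and>
    is_basis K (quot_module (skew_alg K n) (e_bar_ideal K n r))
      (\<lambda>x. e_bar_ideal K n r +>\<^bsub>skew_alg K n\<^esub> x) (JJ K n r)"
proof -
  interpret K: field K by fact
  interpret kosKr n K r by (intro kosKr.intro kosK.intro K.is_cring)
  show ?thesis using strong_idempotent_I0 basis[OF K.one_not_zero] by blast
qed

end
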